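(* Assume that the transition rate function $q$ and the cost functions $f,g$ satisfy Assumptions (A), (B), (C) listed in the context. Then there exists a Nash equilibrium $(\alpha^*,p^*,\nu^* )$ for the weak formulation of the finite state mean field game, i.e. there exist measurable functions $p^*:[0,T]\to\mathcal{S}$ and $\nu^*:[0,T]\to\mathcal{P}(A)$ and a control $\alpha^*\in\mathbb{A}$ such that: (i) $\alpha^*$ minimizes $\alpha\mapsto J(\alpha,p^*,\nu^* )$ over $\mathbb{A}$; (ii) for every $t\in[0,T]$, $p^*_t=\big(\mathbb{Q}^{(\alpha^*,p^*,\nu^* )}[X_t=e_i]\big)_{i=1,\dots,m}$, and $\nu^*_t$ is the law of $\alpha^*_t$ under $\mathbb{Q}^{(\alpha^*,p^*,\nu^* )}$.
   Context: Fix $T>0$ and positive integers $m,l$. $E=\{e_1,\dots,e_m\}$ is the standard basis of $\mathbb{R}^m$ (the state space; the index $i$ is identified with $e_i$). $\Omega$ is the space of càdlàg functions $[0,T]\to E$ continuous at $T$, $X_t(\omega)=\omega_t$ is the canonical process, $\mathbb{F}=(\mathcal{F}_t)$ its natural filtration, $\mathcal{F}=\mathcal{F}_T$. A probability $p^\circ$ on $E$ is fixed. $\mathbb{P}$ (reference measure) is the probability on $(\Omega,\mathcal{F})$ under which $X$ is a continuous-time Markov chain with initial law $p^\circ$ and transition rate $1$ between any two different states. $Q^0$ is the $m\times m$ matrix with diagonal entries $-(m-1)$ and off-diagonal entries $1$; $\mathcal{M}_t:=X_t-X_0-\int_0^tQ^0X_{s-}\,ds$ is an $\mathbb{R}^m$-valued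 $\mathbb{P}$-martingale. $M^*$ denotes transpose and $M^+$ Moore–Penrose inverse. $\psi_t:=\mathrm{diag}(Q^0X_{t-})-Q^0\mathrm{diag}(X_{t-})-\mathrm{diag}(X_{t-})Q^0$. For $Z\in\mathbb{R}^m$, $\|Z\|_{e_i}^2:=\sum_{j\ne i}|Z_j-Z_i|^2$. $\mathcal{S}=\{p\in\mathbb{R}^m: p_i\ge0,\ \sum_ip_i=1\}$; $A\subset\mathbb{R}^l$ is compact; $\mathcal{P}(A)$ is the space of probability measures on $A$ with the 1-Wasserstein distance $\mathcal{W}_1$ (and its Borel $\sigma$-field). Data: $q:[0,T]\times\{1,\dots,m\}^2\times A\times\mathcal{S}\times\mathcal{P}(A)\to\mathbb{R}$, with matrix $Q(t,\alpha,p,\nu)=[q(t,i,j,\alpha,p,\nu)]_{i,j}$; running cost $f:[0,T]\times E\times A\times\mathcal{S}\times\mathcal{P}(A)\to\mathbb{R}$; terminal cost $g:E\times\mathcal{S}\to\mathbb{R}$. Assumption (A): (i) each $Q(t,\alpha,p,\nu)$ is a Q-matrix (nonnegative off-diagonal entries, rows summing to $0$); (ii) there are $C_1,C_2>0$ with $C_1<q(t,i,j,\alpha,p,\nu)<C_2$ for all arguments with $i\ne j$; (iii) there is $C>0$ with $|q(t,i,j,\alpha,p,\nu)-q(t,i,j,\alpha',p',\nu')|\le C(\|\alpha-\alpha'\|+\|p-p'\|+\mathcal{W}_1(\nu,\nu'))$ for all arguments. Assumption (B): there is $C>0$ with $|f(t,e_i,\alpha,p,\nu)-f(t,e_i,\alpha',p',\nu')|\le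 C(\|\alpha-\alpha'\|+\|p-p'\|+\mathcal{W}_1(\nu,\nu'))$ and $|g(e_i,p)-g(e_i,p')|\le C\|p-p'\|$ for all arguments. Hamiltonians: $H_i(t,z,\alpha,p,\nu):=f(t,e_i,\alpha,p,\nu)+\sum_{j\ne i}(z_j-z_i)(q(t,i,j,\alpha,p,\nu)-1)$, $z\in\mathbb{R}^m$. Assumption (C): (i) for all $t,i,z,p,\nu$ the map $\alpha\mapsto H_i(t,z,\alpha,p,\nu)$ on $A$ has a unique minimizer, which does not depend on $\nu$, denoted $\hat a_i(t,z,p)$; (ii) $\hat a_i$ is measurable on $[0,T]\times\mathbb{R}^m\times\mathcal{S}$ and there are constants $C_1>0$, $C_2\ge0$ with $\|\hat a_i(t,z,p)-\hat a_i(t,z',p')\|\le C_1\|z-z'\|_{e_i}+(C_1+C_2\|z\|_{e_i})\|p-p'\|$ for all $t,i,z,z',p,p'$. Controls: $\mathbb{A}$ is the set of $\mathbb{F}$-predictable $A$-valued processes on $[0,T]$. For $\alpha\in\mathbb{A}$ and measurable $p:[0,T]\to\mathcal{S}$, $\nu:[0,T]\to\mathcal{P}(A)$, let $L^{(\alpha,p,\nu)}_t:=\int_0^tX_{s-}^*(Q(s,\alpha_s,p_s,\nu_s)-Q^0)\psi_s^+\,d\mathcal{M}_s$ and define $\mathbb{Q}^{(\alpha,p,\nu)}$ by $d\mathbb{Q}^{(\alpha,p,\nu)}/d\mathbb{P}=\mathcal{E}(L^{(\alpha,p,\nu)})_T$, with $\mathcal{E}$ the Doléans-Dade exponential (under $\mathbb{Q}^{(\alpha,p,\nu)}$,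 $X$ has intensity $Q(t,\alpha_t,p_t,\nu_t)$). Cost: $J(\alpha,p,\nu):=\mathbb{E}^{\mathbb{Q}^{(\alpha,p,\nu)}}\big[\int_0^Tf(t,X_t,\alpha_t,p_t,\nu_t)\,dt+g(X_T,p_T)\big]$. *)

theory Defs
  imports "HOL-Probability.Probability"
begin

section \<open>State space, path space and filtration\<close>

text \<open>States are indexed by a finite type; the state of index \<open>i\<close> is the basis vector \<open>axis i 1\<close>.\<close>

abbreviation unit_state :: "'m::finite \<Rightarrow> real^'m" where
  "unit_state i \<equiv> axis i 1"

definition state_space :: "(real^'m::finite) set" where
  "state_space = range unit_state"

definition prob_simplex :: "(real^'m::finite) set" where
  "prob_simplex = {p. (\<forall>i. 0 \<le> p $ i) \<and> (\<Sum>i\<in>UNIV. p $ i) = 1}"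

definition cadlag_on :: "real \<Rightarrow> real \<Rightarrow> (real \<Rightarrow> 'a::topological_space) \<Rightarrow> bool" where
  "cadlag_on a b x \<longleftrightarrow>
     (\<forall>t\<in>{a..<b}. (x \<longlongrightarrow> x t) (at_right t)) \<and>
     (\<forall>t\<in>{a<..b}. \<exists>l. (x \<longlongrightarrow> l) (at_left t))"

text \<open>The left limit \<open>x\<^sub>t\<^sub>-\<close>, with the usual convention \<open>x\<^sub>0\<^sub>- = x\<^sub>0\<close>.\<close>

definition left_limit :: "(real \<Rightarrow> 'a::t2_space) \<Rightarrow> real \<Rightarrow> 'a" where
  "left_limit x t = (if t = 0 then x 0 else Lim (at_left t) x)"

text \<open>Functions on \<open>[0,T]\<close> are represented as extensional functions on the reals; the canonical
  process is \<open>X\<^sub>t \<omega> = \<omega> t\<close>.\<close>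

definition path_space :: "real \<Rightarrow> (real \<Rightarrow> real^'m::finite) set" where
  "path_space T = {\<omega> \<in> {0..T} \<rightarrow>\<^sub>E state_space. cadlag_on 0 T \<omega> \<and> (\<omega> \<longlongrightarrow> \<omega> T) (at_left T)}"

definition natural_filtration :: "real \<Rightarrow> real \<Rightarrow> (real \<Rightarrow> real^'m::finite) measure" where
  "natural_filtration T t =
     sigma (path_space T) {(\<lambda>\<omega>. \<omega> s) -` B \<inter> path_space T | s B. s \<in> {0..t} \<and> B \<in> sets borel}"

definition predictable_sigma :: "real \<Rightarrow> (real \<times> (real \<Rightarrow> real^'m::finite)) measure" where
  "predictable_sigma T =
     sigma ({0..T} \<times> path_space T)
       ({{0} \<times> B | B. B \<in> sets (natural_filtration T 0)} \<union>
        {{s<..t} \<times> B | s t B. 0 \<le> s \<and> s < t \<and> t \<le> T \<and> B \<in> sets (natural_filtration T s)})"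

definition controls ::
    "real \<Rightarrow> (real^'l::finite) set \<Rightarrow> (real \<Rightarrow> (real \<Rightarrow> real^'m::finite) \<Rightarrow> real^'l) set" where
  "controls T A =
     {\<alpha>. (\<lambda>(t, \<omega>). \<alpha> t \<omega>) \<in> predictable_sigma T \<rightarrow>\<^sub>M restrict_space borel A}"


section \<open>The reference measure\<close>

definition Q0 :: "real^'m::finite^'m" where
  "Q0 = (\<chi> i j. if i = j then - (real CARD('m) - 1) else 1)"

text \<open>The transition matrix \<open>exp (t Q)\<close>, as an entrywise power series.\<close>

definition transition_matrix :: "real^'m::finite^'m \<Rightarrow> real \<Rightarrow> real^'m^'m" where
  "transition_matrix Q t = (\<chi> i j. \<Sum>n. t ^ n / fact n * ((((**) Q) ^^ n) (mat 1)) $ i $ j)"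

text \<open>\<open>P\<close> is the law on path space of the chain with initial law \<open>p0\<close> and generator \<open>Q0\<close>.
  On \<open>{X\<^sub>s = e\<^sub>i}\<close> the right-hand side of the Markov property is the \<open>(i,j)\<close> entry of
  \<open>exp ((t - s) Q0)\<close>.\<close>

definition reference_measure ::
    "real \<Rightarrow> real^'m::finite \<Rightarrow> (real \<Rightarrow> real^'m) measure \<Rightarrow> bool" where
  "reference_measure T p0 P \<longleftrightarrow>
     prob_space P \<and> sets P = sets (natural_filtration T T) \<and>
     (\<forall>i. measure P {\<omega> \<in> space P. \<omega> 0 = unit_state i} = p0 $ i) \<and>
     (\<forall>s t j. 0 \<le> s \<and> s \<le> t \<and> t \<le> T \<longrightarrow>
        (AE \<omega> in P.
           real_cond_exp P (natural_filtration T s)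
             (indicat_real {\<omega> \<in> space P. \<omega> t = unit_state j}) \<omega>
           = (\<omega> s v* transition_matrix Q0 (t - s)) $ j))"


section \<open>Pathwise stochastic calculus for finite variation processes\<close>

text \<open>Lebesgue--Stieltjes integral of \<open>h\<close> over \<open>(a,b]\<close> against a right-continuous function \<open>G\<close> of
  finite variation on \<open>[a,b]\<close>. \<open>interval_measure\<close> requires monotone right-continuous integrators, so
  \<open>G\<close> is written as a difference of two such functions. The value does not depend on the
  decomposition as long as \<open>h\<close> is integrable against both of its parts.\<close>

definition has_stieltjes_integral ::
    "(real \<Rightarrow> real) \<Rightarrow> (real \<Rightarrow> real) \<Rightarrow> real \<Rightarrow> real \<Rightarrow> real \<Rightarrow> bool" where
  "has_stieltjes_integral h G a b I \<longleftrightarrow>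
     (\<exists>F1 F2. mono F1 \<and> mono F2 \<and>
        (\<forall>x. continuous (at_right x) F1) \<and> (\<forall>x. continuous (at_right x) F2) \<and>
        (\<forall>x\<in>{a..b}. G x = F1 x - F2 x) \<and>
        set_integrable (interval_measure F1) {a<..b} h \<and>
        set_integrable (interval_measure F2) {a<..b} h \<and>
        I = (LINT s:{a<..b}|interval_measure F1. h s) - (LINT s:{a<..b}|interval_measure F2. h s))"

definition stieltjes_integral ::
    "(real \<Rightarrow> real) \<Rightarrow> (real \<Rightarrow> real) \<Rightarrow> real \<Rightarrow> real \<Rightarrow> real" where
  "stieltjes_integral h G a b = (THE I. has_stieltjes_integral h G a b I)"

text \<open>The Doleans-Dade exponential of a process \<open>L\<close> with cadlag paths of finite variation: the value
  at \<open>t\<close> of the unique cadlag solution of \<open>Z\<^sub>u = 1 + \<integral>\<^sub>(\<^sub>0\<^sub>,\<^sub>u\<^sub>] Z\<^sub>s\<^sub>- dL\<^sub>s\<close>, solved path by path.\<close>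

definition doleans_dade :: "(real \<Rightarrow> real) \<Rightarrow> real \<Rightarrow> real" where
  "doleans_dade L t =
     (THE z. \<exists>Z. cadlag_on 0 t Z \<and>
        (\<forall>u\<in>{0..t}. has_stieltjes_integral (left_limit Z) L 0 u (Z u - 1)) \<and> z = Z t)"


section \<open>The martingale and its bracket density\<close>

definition diag_matrix :: "real^'m::finite \<Rightarrow> real^'m^'m" where
  "diag_matrix v = (\<chi> i j. if i = j then v $ i else 0)"

definition moore_penrose :: "real^'n::finite^'m::finite \<Rightarrow> real^'m^'n" where
  "moore_penrose M =
     (THE N. M ** N ** M = M \<and> N ** M ** N = N \<and>
        transpose (M ** N) = M ** N \<and> transpose (N ** M) = N ** M)"

definition mart :: "(real \<Rightarrow> real^'m::finite) \<Rightarrow> real \<Rightarrow> real^'m" where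
  "mart \<omega> t = \<omega> t - \<omega> 0 - (LINT s:{0..t}|lborel. Q0 *v left_limit \<omega> s)"

definition psi :: "(real \<Rightarrow> real^'m::finite) \<Rightarrow> real \<Rightarrow> real^'m^'m" where
  "psi \<omega> t =
     diag_matrix (Q0 *v left_limit \<omega> t) - Q0 ** diag_matrix (left_limit \<omega> t)
       - diag_matrix (left_limit \<omega> t) ** Q0"


section \<open>Probability measures on the action set\<close>

definition prob_measures :: "(real^'l::finite) set \<Rightarrow> (real^'l) measure set" where
  "prob_measures A = {\<nu>. sets \<nu> = sets (restrict_space borel A) \<and> prob_space \<nu>}"

definition couplings ::
    "(real^'l::finite) set \<Rightarrow> (real^'l) measure \<Rightarrow> (real^'l) measure \<Rightarrow> ((real^'l) \<times> (real^'l)) measure set"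
where
  "couplings A \<mu> \<nu> =
     {\<pi>. sets \<pi> = sets (restrict_space borel A \<Otimes>\<^sub>M restrict_space borel A) \<and> prob_space \<pi> \<and>
         distr \<pi> (restrict_space borel A) fst = \<mu> \<and> distr \<pi> (restrict_space borel A) snd = \<nu>}"

definition wasserstein1 ::
    "(real^'l::finite) set \<Rightarrow> (real^'l) measure \<Rightarrow> (real^'l) measure \<Rightarrow> real" where
  "wasserstein1 A \<mu> \<nu> = (INF \<pi>\<in>couplings A \<mu> \<nu>. LINT xy|\<pi>. dist (fst xy) (snd xy))"

definition wasserstein_open :: "(real^'l::finite) set \<Rightarrow> (real^'l) measure set \<Rightarrow> bool" where
  "wasserstein_open A U \<longleftrightarrow>
     U \<subseteq> prob_measures A \<and>
     (\<forall>\<mu>\<in>U. \<exists>r>0. \<forall>\<nu>\<in>prob_measures A. wasserstein1 A \<mu> \<nu> < r \<longrightarrow> \<nu> \<in> U)"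

definition wasserstein_borel :: "(real^'l::finite) set \<Rightarrow> (real^'l) measure measure" where
  "wasserstein_borel A = sigma (prob_measures A) {U. wasserstein_open A U}"


section \<open>Controlled dynamics and cost\<close>

type_synonym ('m, 'l) rate_function =
  "real \<Rightarrow> 'm \<Rightarrow> 'm \<Rightarrow> real^'l \<Rightarrow> real^'m \<Rightarrow> (real^'l) measure \<Rightarrow> real"

type_synonym ('m, 'l) running_cost =
  "real \<Rightarrow> real^'m \<Rightarrow> real^'l \<Rightarrow> real^'m \<Rightarrow> (real^'l) measure \<Rightarrow> real"

type_synonym 'm terminal_cost = "real^'m \<Rightarrow> real^'m \<Rightarrow> real"

type_synonym ('m, 'l) control = "real \<Rightarrow> (real \<Rightarrow> real^'m) \<Rightarrow> real^'l"

definition rate_matrix ::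
    "('m::finite, 'l::finite) rate_function \<Rightarrow> real \<Rightarrow> real^'l \<Rightarrow> real^'m \<Rightarrow> (real^'l) measure
      \<Rightarrow> real^'m^'m" where
  "rate_matrix q t a p \<nu> = (\<chi> i j. q t i j a p \<nu>)"

definition L_process ::
    "('m::finite, 'l::finite) rate_function \<Rightarrow> ('m, 'l) control \<Rightarrow> (real \<Rightarrow> real^'m)
      \<Rightarrow> (real \<Rightarrow> (real^'l) measure) \<Rightarrow> (real \<Rightarrow> real^'m) \<Rightarrow> real \<Rightarrow> real" where
  "L_process q \<alpha> p \<nu> \<omega> t =
     (\<Sum>k\<in>UNIV. stieltjes_integral
        (\<lambda>s. (left_limit \<omega> s v* ((rate_matrix q s (\<alpha> s \<omega>) (p s) (\<nu> s) - Q0)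
                 ** moore_penrose (psi \<omega> s))) $ k)
        (\<lambda>s. mart \<omega> s $ k) 0 t)"

definition controlled_measure ::
    "real \<Rightarrow> (real \<Rightarrow> real^'m::finite) measure \<Rightarrow> ('m, 'l::finite) rate_function \<Rightarrow> ('m, 'l) control
      \<Rightarrow> (real \<Rightarrow> real^'m) \<Rightarrow> (real \<Rightarrow> (real^'l) measure) \<Rightarrow> (real \<Rightarrow> real^'m) measure" where
  "controlled_measure T P q \<alpha> p \<nu> =
     density P (\<lambda>\<omega>. ennreal (doleans_dade (L_process q \<alpha> p \<nu> \<omega>) T))"

definition cost ::
    "real \<Rightarrow> (real \<Rightarrow> real^'m::finite) measure \<Rightarrow> ('m, 'l::finite) rate_function
      \<Rightarrow> ('m, 'l) running_cost \<Rightarrow> 'm terminal_cost \<Rightarrow> ('m, 'l) control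
      \<Rightarrow> (real \<Rightarrow> real^'m) \<Rightarrow> (real \<Rightarrow> (real^'l) measure) \<Rightarrow> real" where
  "cost T P q f g \<alpha> p \<nu> =
     (LINT \<omega>|controlled_measure T P q \<alpha> p \<nu>.
        (LINT t:{0..T}|lborel. f t (\<omega> t) (\<alpha> t \<omega>) (p t) (\<nu> t)) + g (\<omega> T) (p T))"


section \<open>Assumptions on the data\<close>

definition assumption_A ::
    "real \<Rightarrow> (real^'l::finite) set \<Rightarrow> ('m::finite, 'l) rate_function \<Rightarrow> bool" where
  "assumption_A T A q \<longleftrightarrow>
     (\<forall>t\<in>{0..T}. \<forall>a\<in>A. \<forall>p\<in>prob_simplex. \<forall>\<nu>\<in>prob_measures A.
        (\<forall>i j. i \<noteq> j \<longrightarrow> 0 \<le> q t i j a p \<nu>) \<and> (\<forall>i. (\<Sum>j\<in>UNIV. q t i j a p \<nu>) = 0)) \<and>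
     (\<exists>C1>0. \<exists>C2>0. \<forall>t\<in>{0..T}. \<forall>a\<in>A. \<forall>p\<in>prob_simplex. \<forall>\<nu>\<in>prob_measures A. \<forall>i j.
        i \<noteq> j \<longrightarrow> C1 < q t i j a p \<nu> \<and> q t i j a p \<nu> < C2) \<and>
     (\<exists>C>0. \<forall>t\<in>{0..T}. \<forall>i j. \<forall>a\<in>A. \<forall>a'\<in>A. \<forall>p\<in>prob_simplex. \<forall>p'\<in>prob_simplex.
        \<forall>\<nu>\<in>prob_measures A. \<forall>\<nu>'\<in>prob_measures A.
        \<bar>q t i j a p \<nu> - q t i j a' p' \<nu>'\<bar>
          \<le> C * (norm (a - a') + norm (p - p') + wasserstein1 A \<nu> \<nu>'))"

definition assumption_B ::
    "real \<Rightarrow> (real^'l::finite) set \<Rightarrow> ('m::finite, 'l) running_cost \<Rightarrow> 'm terminal_cost \<Rightarrow> bool" where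
  "assumption_B T A f g \<longleftrightarrow>
     (\<exists>C>0.
       (\<forall>t\<in>{0..T}. \<forall>i. \<forall>a\<in>A. \<forall>a'\<in>A. \<forall>p\<in>prob_simplex. \<forall>p'\<in>prob_simplex.
          \<forall>\<nu>\<in>prob_measures A. \<forall>\<nu>'\<in>prob_measures A.
          \<bar>f t (unit_state i) a p \<nu> - f t (unit_state i) a' p' \<nu>'\<bar>
            \<le> C * (norm (a - a') + norm (p - p') + wasserstein1 A \<nu> \<nu>')) \<and>
       (\<forall>i. \<forall>p\<in>prob_simplex. \<forall>p'\<in>prob_simplex.
          \<bar>g (unit_state i) p - g (unit_state i) p'\<bar> \<le> C * norm (p - p')))"

definition hamiltonian ::
    "('m::finite, 'l::finite) rate_function \<Rightarrow> ('m, 'l) running_cost \<Rightarrow> 'm \<Rightarrow> real \<Rightarrow> real^'m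
      \<Rightarrow> real^'l \<Rightarrow> real^'m \<Rightarrow> (real^'l) measure \<Rightarrow> real" where
  "hamiltonian q f i t z a p \<nu> =
     f t (unit_state i) a p \<nu> + (\<Sum>j\<in>UNIV - {i}. (z $ j - z $ i) * (q t i j a p \<nu> - 1))"

definition state_seminorm :: "'m::finite \<Rightarrow> real^'m \<Rightarrow> real" where
  "state_seminorm i z = sqrt (\<Sum>j\<in>UNIV - {i}. \<bar>z $ j - z $ i\<bar>\<^sup>2)"

definition assumption_C ::
    "real \<Rightarrow> (real^'l::finite) set \<Rightarrow> ('m::finite, 'l) rate_function \<Rightarrow> ('m, 'l) running_cost \<Rightarrow> bool"
where
  "assumption_C T A q f \<longleftrightarrow>
     (\<exists>ahat :: 'm \<Rightarrow> real \<Rightarrow> real^'m \<Rightarrow> real^'m \<Rightarrow> real^'l.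
       (\<forall>t\<in>{0..T}. \<forall>i z. \<forall>p\<in>prob_simplex. \<forall>\<nu>\<in>prob_measures A. \<forall>a.
          is_arg_min (\<lambda>b. hamiltonian q f i t z b p \<nu>) (\<lambda>b. b \<in> A) a \<longleftrightarrow> a = ahat i t z p) \<and>
       (\<forall>i. (\<lambda>(t, z, p). ahat i t z p)
              \<in> borel_measurable (restrict_space borel ({0..T} \<times> UNIV \<times> prob_simplex))) \<and>
       (\<exists>C1>0. \<exists>C2\<ge>0. \<forall>t\<in>{0..T}. \<forall>i z z'. \<forall>p\<in>prob_simplex. \<forall>p'\<in>prob_simplex.
          norm (ahat i t z p - ahat i t z' p')
            \<le> C1 * state_seminorm i (z - z') + (C1 + C2 * state_seminorm i z) * norm (p - p')))"

text \<open>The implicit regularity in time: \<open>q\<close> is Borel in \<open>t\<close> and \<open>f\<close> is Lebesgue integrable in \<open>t\<close> on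
  \<open>[0,T]\<close>. Without it neither the stochastic integral defining the change of measure nor the cost
  functional is meaningful.\<close>

definition well_posed_data ::
    "real \<Rightarrow> (real^'l::finite) set \<Rightarrow> ('m::finite, 'l) rate_function \<Rightarrow> ('m, 'l) running_cost \<Rightarrow> bool"
where
  "well_posed_data T A q f \<longleftrightarrow>
     (\<forall>a\<in>A. \<forall>p\<in>prob_simplex. \<forall>\<nu>\<in>prob_measures A.
        (\<forall>i j. (\<lambda>t. q t i j a p \<nu>) \<in> borel_measurable (restrict_space borel {0..T})) \<and>
        (\<forall>i. set_integrable lborel {0..T} (\<lambda>t. f t (unit_state i) a p \<nu>)))"

end

theory Submission
  imports Defs
begin

text \<open>
  Under the reference measure the path is a chain with finitely many jumps, and everything that the
  statement defines pathwise can be computed. The process \<open>L\<close> has a density with respect to Lebesgue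
  measure plus unit masses at the jumps, because the pseudo-inverse of the bracket density inverts the
  Laplacian of a star (\<open>moore_penrose_star\<close>); its Doleans-Dade exponential is therefore the explicit
  likelihood \<open>exp (\<integral> drift) * \<Prod> (rates at the jumps)\<close> (\<open>doleans_dade_L_process\<close>).

  Probability enters through one fact: a predictable integral against the compensated jumps has mean
  zero (\<open>comp_zero\<close>). It is checked on rectangles with the Markov property and extended by a monotone
  class argument; the unbounded likelihood is admitted because the number of jumps has exponential
  moments (\<open>exp_moment\<close>). The product rule for likelihood times value then gives a verification
  formula (\<open>verification\<close>): the controlled expectation of a finite variation functional of the chain is
  its initial value plus the expected integral of a drift. Its two instances are the forward equation
  for the law of the state (\<open>kolmogorov\<close>) and a representation of the cost (\<open>cost_identity\<close>) whose drift,
  for the value function \<open>u\<close>, is the gap between the Hamiltonian of the control and its minimum.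

  Since the minimizer does not depend on the law of the control, that law is a mixture of \<open>m\<close> point
  masses in a feedback equilibrium. A feedback equilibrium is thus a solution \<open>(p, u)\<close> of a
  finite-dimensional forward-backward system: \<open>p\<close> moves forward with the controlled rates, and \<open>u\<close> solves
  the Hamilton-Jacobi equation backward from \<open>g\<close>. The system is made Lipschitz and bounded by
  projecting \<open>p\<close> to the simplex and \<open>u\<close> to a ball whose radius comes from a Gronwall bound that holds for
  the projected system too. The projected system is solved by shooting: the initial value of \<open>u\<close> is a
  Brouwer fixed point (\<open>forward_backward_ode\<close>). Finally both projections turn out to be inactive: the
  bound keeps \<open>u\<close> in the ball, and \<open>p\<close> agrees with the law of the controlled chain because both solve
  the same Lipschitz equation.
\<close>

lemmas bochner_cong = Bochner_Integration.integral_cong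
 and bochner_bound = Bochner_Integration.integrable_bound
 and bochner_nonneg = Bochner_Integration.integral_nonneg

section \<open>Paths\<close>

lemma finite_state_space: "finite (state_space :: (real^'m::finite) set)"
 by (simp add: state_space_def)

lemma tendsto_finite_range_eventually:
 fixes l :: "'a::t1_space"
 assumes lim: "(x \<longlongrightarrow> l) F" and fin: "finite S" and ev: "eventually (%s. x s \<in> S) F"
 shows "eventually (%s. x s = l) F"
proof -
 have "open (- (S - {l}))" by (rule open_Compl, rule finite_imp_closed) (simp add: fin)
 then have "eventually (%s. x s \<in> - (S - {l})) F"
  by (rule topological_tendstoD[OF lim]) simp
 then show ?thesis using ev by eventually_elim auto
qed

lemma left_limit_eqI:
 fixes x :: "real => 'a::t2_space"
 assumes "t ~= 0" "(x \<longlongrightarrow> l) (at_left t)"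
 shows "left_limit x t = l"
 using assms tendsto_Lim[of "at_left t" x l] by (simp add: left_limit_def)

lemma left_limit_0 [simp]: "left_limit x 0 = x 0"
 by (simp add: left_limit_def)

definition jumps :: "real => (real => 'a::t2_space) => real set" where
 "jumps T w = {r \<in> {0<..T}. left_limit w r ~= w r}"

lemma jumps_subset: "jumps T w <= {0<..T}"
 by (auto simp: jumps_def)

lemma path_in_state_space: "w \<in> path_space T ==> t \<in> {0..T} ==> w t \<in> state_space"
 by (auto simp: path_space_def)

lemma path_left_eventually:
 assumes w: "w \<in> path_space T" and t: "t \<in> {0<..T}"
 shows "eventually (%s. w s = left_limit w t) (at_left t)" "left_limit w t \<in> state_space"
proof -
 have "\<forall>t\<in>{0<..T}. \<exists>l. (w \<longlongrightarrow> l) (at_left t)"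
  using w by (simp add: path_space_def cadlag_on_def)
 then obtain l where l: "(w \<longlongrightarrow> l) (at_left t)" using t by blast
 have eq: "left_limit w t = l" using l t by (intro left_limit_eqI) auto
 have "eventually (%s. s \<in> {0<..<t}) (at_left t)"
  using t by (intro eventually_at_left_real) auto
 then have ev: "eventually (%s. w s \<in> state_space) (at_left t)"
  by eventually_elim (use w t in \<open>auto intro!: path_in_state_space\<close>)
 have *: "eventually (%s. w s = l) (at_left t)"
  by (rule tendsto_finite_range_eventually[OF l finite_state_space ev])
 then show "eventually (%s. w s = left_limit w t) (at_left t)" using eq by simp
 have "eventually (%s. l \<in> state_space) (at_left t)" using * ev by eventually_elim auto
 then show "left_limit w t \<in> state_space" using eq by (simp add: eventually_const_iff)
qed

lemma path_left_limit_state: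
 "w \<in> path_space T ==> t \<in> {0..T} ==> left_limit w t \<in> state_space"
 using path_left_eventually(2)[of w T t] path_in_state_space[of w T t]
 by (cases "t = 0") auto

lemma path_right_eventually:
 assumes w: "w \<in> path_space T" and t: "t \<in> {0..<T}"
 shows "eventually (%s. w s = w t) (at_right t)"
proof -
 have l: "(w \<longlongrightarrow> w t) (at_right t)"
  using w t by (auto simp: path_space_def cadlag_on_def)
 have "eventually (%s. s \<in> {t<..<T}) (at_right t)"
  using t by (intro eventually_at_right_real) auto
 then have ev: "eventually (%s. w s \<in> state_space) (at_right t)"
  by eventually_elim (use w t in \<open>auto intro!: path_in_state_space\<close>)
 show ?thesis
  by (rule tendsto_finite_range_eventually[OF l finite_state_space ev])
qed

lemma left_limit_const_interval:
 assumes "!!s. s \<in> {a<..<r} ==> w s = c" "a < r" "r ~= 0"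
 shows "left_limit w r = c"
proof (rule left_limit_eqI[OF assms(3)])
 have "eventually (%s. s \<in> {a<..<r}) (at_left r)"
  by (rule eventually_at_left_real[OF assms(2)])
 then have "eventually (%s. w s = c) (at_left r)"
  by eventually_elim (use assms in auto)
 then show "(w \<longlongrightarrow> c) (at_left r)" by (rule tendsto_eventually)
qed

text \<open>Jump times do not accumulate: a cadlag path in a finite set is constant on both sides of any time.\<close>

lemma finite_jumps:
 assumes w: "w \<in> path_space T"
 shows "finite (jumps T w)"
proof -
 have "finite ({0..T} Int jumps T w)"
 proof (rule finite_not_islimpt_in_compact)
  fix z assume z: "z \<in> {0..T}"
  have "\<exists>a<z. \<forall>r\<in>{a<..<z}. r \<notin> jumps T w"
  proof (cases "z = 0")
   case True
   then show ?thesis by (intro exI[of _ "-1"]) (auto simp: jumps_def)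
  next
   case False
   then have "eventually (%s. w s = left_limit w z) (at_left z)"
    using path_left_eventually(1)[OF w, of z] z by auto
   then obtain a where a: "a < z" "!!s. s \<in> {a<..<z} ==> w s = left_limit w z"
    unfolding eventually_at_left_field by auto
   have "left_limit w r = w r" if "r \<in> {a<..<z}" "r ~= 0" for r
    using left_limit_const_interval[of a r w "left_limit w z"] a that by auto
   then show ?thesis using a(1) by (auto simp: jumps_def)
  qed
  then obtain a where a: "a < z" "!!r. r \<in> {a<..<z} ==> r \<notin> jumps T w" by auto
  have "\<exists>b>z. \<forall>r\<in>{z<..<b}. r \<notin> jumps T w"
  proof (cases "z = T")
   case True
   then show ?thesis by (intro exI[of _ "T+1"]) (auto simp: jumps_def)
  next
   case False
   then have "eventually (%s. w s = w z) (at_right z)"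
    using path_right_eventually[OF w, of z] z by auto
   then obtain b where b: "z < b" "!!s. s \<in> {z<..<b} ==> w s = w z"
    unfolding eventually_at_right_field by auto
   have "left_limit w r = w r" if "r \<in> {z<..<b}" "r ~= 0" for r
    using left_limit_const_interval[of z r w "w z"] b that by auto
   then show ?thesis using b(1) by (auto simp: jumps_def)
  qed
  then obtain b where b: "z < b" "!!r. r \<in> {z<..<b} ==> r \<notin> jumps T w" by auto
  show "\<not> z islimpt jumps T w"
   unfolding islimpt_approachable
  proof (intro notI)
   assume H: "\<forall>e>0. \<exists>x'\<in>jumps T w. x' ~= z & dist x' z < e"
   have "min (z - a) (b - z) > 0" using a b by auto
   then obtain r where "r \<in> jumps T w" "r ~= z" "dist r z < min (z - a) (b - z)"
    using H by blast
   then show False using a(2)[of r] b(2)[of r]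
    by (cases "r < z") (auto simp: dist_real_def)
  qed
 qed simp
 moreover have "{0..T} Int jumps T w = jumps T w" by (auto simp: jumps_def)
 ultimately show ?thesis by simp
qed

lemma path_const_between_jumps:
 assumes w: "w \<in> path_space T" and st: "0 <= s" "s <= t" "t <= T"
  and nj: "{s<..t} Int jumps T w = {}"
 shows "w t = w s"
proof (cases "s = t")
 case False
 then have lt: "s < t" using st by simp
 have "continuous_on {s..t} w"
  unfolding continuous_on_def
 proof
  fix r assume r: "r \<in> {s..t}"
  have L: "eventually (%u. w u = w r) (at_left r)" if "s < r"
  proof -
   have "r \<in> {0<..T}" using r st that by auto
   moreover have "left_limit w r = w r" using nj r st that by (auto simp: jumps_def)
   ultimately show ?thesis using path_left_eventually(1)[OF w, of r] by simp
  qed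
  have R: "eventually (%u. w u = w r) (at_right r)" if "r < t"
   using path_right_eventually[OF w, of r] r st that by auto
  have "eventually (%u. w u = w r) (at r within {s..t})"
  proof (cases "r = s \<or> r = t")
   case True
   then show ?thesis using L R lt
    by (auto simp: at_within_Icc_at_right at_within_Icc_at_left)
  next
   case False
   then have "at r within {s..t} = at r" using r by (intro at_within_Icc_at) auto
   then show ?thesis using L R False r by (auto simp: eventually_at_split)
  qed
  then show "(w \<longlongrightarrow> w r) (at r within {s..t})" by (rule tendsto_eventually)
 qed
 moreover have "finite (w ` {s..t})"
  by (rule finite_subset[OF _ finite_state_space])
    (use w st in \<open>auto intro!: path_in_state_space\<close>)
 moreover have "connected (w ` {s..t})"
  by (rule connected_continuous_image) (use calculation in auto)
 ultimately have "w ` {s..t} = {} \<or> (\<exists>x. w ` {s..t} = {x})"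
  by (simp add: connected_finite_iff_sing)
 then obtain x where "w ` {s..t} = {x}" using lt by auto
 moreover have "w s \<in> w ` {s..t}" "w t \<in> w ` {s..t}" using lt by auto
 ultimately show ?thesis by simp
qed simp

lemma path_left_limit_between_jumps:
 assumes w: "w \<in> path_space T" and st: "0 <= s" "s < t" "t <= T"
  and nj: "{s<..<t} Int jumps T w = {}"
 shows "left_limit w t = w s"
proof (rule left_limit_const_interval[of s])
 fix u assume "u \<in> {s<..<t}"
 then have "{s<..u} <= {s<..<t}" "0 <= s" "s <= u" "u <= T" using st by auto
 then show "w u = w s"
  using nj by (intro path_const_between_jumps[OF w]) blast+
qed (use st in auto)

text \<open>A path moves only at its jumps, so any function of the state telescopes over them.\<close>

lemma path_telescope:
 fixes \<phi> :: "real^'m::finite => real"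
 assumes w: "w \<in> path_space T" and ab: "0 <= a" "a <= b" "b <= T"
 shows "\<phi> (w b) - \<phi> (w a) = (\<Sum>r\<in>jumps T w Int {a<..b}. \<phi> (w r) - \<phi> (left_limit w r))"
 using ab(2,3)
proof (induction "card (jumps T w Int {a<..b})" arbitrary: b)
 case 0
 then have e: "jumps T w Int {a<..b} = {}" using finite_jumps[OF w] by simp
 then have "w b = w a" using 0 ab(1) by (intro path_const_between_jumps[OF w]) auto
 then show ?case using e by simp
next
 case (Suc n)
 let ?J = "jumps T w Int {a<..b}"
 have fin: "finite ?J" using finite_jumps[OF w] by simp
 have ne: "?J ~= {}" using Suc(2) by auto
 define r where "r = Max ?J"
 have r: "r \<in> ?J" using Max_in[OF fin ne] by (simp add: r_def)
 define K where "K = insert a (?J - {r})"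
 define s0 where "s0 = Max K"
 have finK: "finite K" using fin by (simp add: K_def)
 have s0: "s0 \<in> K" unfolding s0_def using finK by (intro Max_in) (auto simp: K_def)
 have s0_max: "x <= s0" if "x \<in> K" for x using finK that by (simp add: s0_def)
 have less_r: "x < r" if "x \<in> ?J - {r}" for x
  using Max_ge[OF fin, of x] that unfolding r_def[symmetric] by (simp add: less_le)
 have s0r: "s0 < r"
 proof (cases "s0 = a")
  case False
  then show ?thesis using s0 less_r[of s0] unfolding K_def by blast
 qed (use r in simp)
 have as0: "a <= s0" using s0_max[of a] by (simp add: K_def)
 have J': "jumps T w Int {a<..s0} = ?J - {r}"
 proof (intro equalityI subsetI)
  fix x assume "x \<in> jumps T w Int {a<..s0}"
  then show "x \<in> ?J - {r}" using s0r r by simp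
 next
  fix x assume "x \<in> ?J - {r}"
  then show "x \<in> jumps T w Int {a<..s0}" using s0_max[of x] by (simp add: K_def)
 qed
 have wr: "w b = w r"
 proof (rule path_const_between_jumps[OF w])
  show "{r<..b} Int jumps T w = {}"
  proof (rule ccontr)
   assume "{r<..b} Int jumps T w ~= {}"
   then obtain x where x: "x \<in> jumps T w" "r < x" "x <= b" by auto
   then show False using Max_ge[OF fin, of x] r by (simp add: r_def[symmetric])
  qed
 qed (use r ab Suc in auto)
 have wl: "left_limit w r = w s0"
 proof (rule path_left_limit_between_jumps[OF w])
  show "{s0<..<r} Int jumps T w = {}"
  proof (rule ccontr)
   assume "{s0<..<r} Int jumps T w ~= {}"
   then obtain x where x: "x \<in> jumps T w" "s0 < x" "x < r" by auto
   then have "x \<in> K" using as0 r by (auto simp: K_def)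
   then show False using s0_max[of x] x by simp
  qed
 qed (use r as0 ab Suc s0r in auto)
 have "n = card (jumps T w Int {a<..s0})"
  unfolding J' using Suc(2) r fin by simp
 then have "\<phi> (w s0) - \<phi> (w a) = (\<Sum>r\<in>?J - {r}. \<phi> (w r) - \<phi> (left_limit w r))"
  using Suc(1)[of s0] as0 s0r r Suc(4) unfolding J' by auto
 moreover have "(\<Sum>r\<in>?J. \<phi> (w r) - \<phi> (left_limit w r))
   = (\<phi> (w r) - \<phi> (left_limit w r)) + (\<Sum>r\<in>?J - {r}. \<phi> (w r) - \<phi> (left_limit w r))"
  by (rule sum.remove[OF fin r])
 ultimately show ?case using wr wl by simp
qed

text \<open>On a fine enough grid every jump sits alone in its cell and is seen by the two end points.\<close>

lemma jumps_le_grid_changes: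
 assumes w: "w \<in> path_space T" and T: "0 < T"
 shows "eventually (%n. card (jumps T w) <=
  card {k. k < n & w (real k * T / real n) ~= w (real (Suc k) * T / real n)}) sequentially"
proof -
 let ?J = "jumps T w"
 have fin: "finite ?J" by (rule finite_jumps[OF w])
 have "\<exists>d>0. \<forall>x\<in>?J. \<forall>y\<in>?J. x ~= y \<longrightarrow> d <= \<bar>x - y\<bar>"
 proof -
  let ?D = "insert 1 ((%(x,y). \<bar>x - y\<bar>) ` {(x,y) \<in> ?J \<times> ?J. x ~= y})"
  have "finite {(x,y) \<in> ?J \<times> ?J. x ~= y}"
   by (rule finite_subset[of _ "?J \<times> ?J"]) (use fin in auto)
  then have fD: "finite ?D" by simp
  have "Min ?D > 0" using fD by (subst Min_gr_iff) auto
  moreover have "Min ?D <= \<bar>x - y\<bar>" if "x \<in> ?J" "y \<in> ?J" "x ~= y" for x y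
   using that fD by (intro Min_le) (auto intro!: image_eqI[of _ _ "(x,y)"])
  ultimately show ?thesis by blast
 qed
 then obtain d where d: "d > 0" "!!x y. x \<in> ?J ==> y \<in> ?J ==> x ~= y ==> d <= \<bar>x - y\<bar>" by blast
 obtain n0 :: nat where n0: "T / d < real n0" using reals_Archimedean2 by blast
 have "card ?J <= card {k. k < n & w (real k * T / real n) ~= w (real (Suc k) * T / real n)}"
  if n: "n \<ge> max 1 n0" for n
 proof -
  have n1: "n > 0" using n by simp
  have "T / d < real n" using n0 n by linarith
  then have mesh: "T / n < d" using d n1 by (simp add: field_simps)
  define t where "t k = real k * T / real n" for k :: nat
  have tS: "t (Suc k) = t k + T / n" for k by (simp add: t_def field_simps add_divide_distrib)
  have cell: "\<exists>k<n. r \<in> {t k<..t (Suc k)}" if r: "r \<in> {0<..T}" for r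
  proof -
   define k where "k = nat (\<lceil>r * n / T\<rceil> - 1)"
   have pos: "r * n / T > 0" using r T n1 by auto
   then have c1: "\<lceil>r * n / T\<rceil> \<ge> 1" by (simp add: one_le_ceiling)
   have "r * n / T <= real n" using r T n1 by (simp add: field_simps)
   then have c2: "\<lceil>r * n / T\<rceil> <= int n" by (simp add: ceiling_le_iff)
   have rk: "real k = of_int \<lceil>r * n / T\<rceil> - 1" using c1 by (simp add: k_def)
   have "real k < r * n / T" "r * n / T <= real k + 1" unfolding rk by linarith+
   then have "r \<in> {t k<..t (Suc k)}" using T n1 by (simp add: t_def field_simps)
   moreover have "k < n" using c1 c2 by (simp add: k_def) linarith
   ultimately show ?thesis by blast
  qed
  then obtain \<kappa> where \<kappa>: "!!r. r \<in> {0<..T} ==> \<kappa> r < n & r \<in> {t (\<kappa> r)<..t (Suc (\<kappa> r))}"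
   by metis
  have tle: "t k <= T" if "k <= n" for k
   using that T n1 by (simp add: t_def field_simps)
  have t0: "0 <= t k" for k using T by (simp add: t_def)
  have single: "x = r" if "x \<in> ?J" "r \<in> ?J" "x \<in> {t k<..t (Suc k)}" "r \<in> {t k<..t (Suc k)}" for x r k
  proof (rule ccontr)
   assume "x ~= r"
   then have "d <= \<bar>x - r\<bar>" using that d by blast
   then show False using that mesh tS[of k] by auto
  qed
  have inj: "inj_on \<kappa> ?J"
  proof (rule inj_onI)
   fix x y assume "x \<in> ?J" "y \<in> ?J" "\<kappa> x = \<kappa> y"
   then show "x = y" using single[of x y "\<kappa> x"] \<kappa>[of x] \<kappa>[of y] subsetD[OF jumps_subset, of x T w]
     subsetD[OF jumps_subset, of y T w] by simp
  qed
  have sub: "\<kappa> ` ?J <= {k. k < n & w (t k) ~= w (t (Suc k))}"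
  proof (rule image_subsetI)
   fix r assume r: "r \<in> ?J"
   let ?k = "\<kappa> r"
   have rT: "r \<in> {0<..T}" by (rule subsetD[OF jumps_subset r])
   note kr = \<kappa>[OF rT]
   have ktop: "t (Suc ?k) <= T" using kr tle[of "Suc ?k"] by simp
   have "left_limit w r = w (t ?k)"
   proof (rule path_left_limit_between_jumps[OF w t0])
    show "{t ?k<..<r} Int ?J = {}"
    proof (rule ccontr)
     assume "{t ?k<..<r} Int ?J ~= {}"
     then obtain x where "x \<in> ?J" "t ?k < x" "x < r" by auto
     then show False using single[of x r ?k] r kr by simp
    qed
   qed (use kr rT in auto)
   moreover have "w (t (Suc ?k)) = w r"
   proof (rule path_const_between_jumps[OF w])
    show "{r<..t (Suc ?k)} Int ?J = {}"
    proof (rule ccontr)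
     assume "{r<..t (Suc ?k)} Int ?J ~= {}"
     then obtain x where "x \<in> ?J" "r < x" "x <= t (Suc ?k)" by auto
     then show False using single[of x r ?k] r kr by simp
    qed
   next
    show "0 <= r" "r <= t (Suc ?k)" "t (Suc ?k) <= T" using kr rT ktop by simp_all
   qed
   ultimately show "?k \<in> {k. k < n & w (t k) ~= w (t (Suc k))}"
    using conjunct1[OF kr] r unfolding jumps_def by simp
  qed
  show ?thesis
   unfolding t_def[symmetric] by (rule card_inj_on_le[OF inj sub]) simp
 qed
 then show ?thesis unfolding eventually_sequentially by blast
qed

section \<open>Sums of measures, and Lebesgue measure with unit masses\<close>

definition add_measure :: "'a measure => 'a measure => 'a measure" where
 "add_measure M N = measure_of (space M) (sets M) (%A. emeasure M A + emeasure N A)"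

lemma sets_add_measure [simp, measurable_cong]: "sets (add_measure M N) = sets M"
 by (simp add: add_measure_def)

lemma space_add_measure [simp]: "space (add_measure M N) = space M"
 by (simp add: add_measure_def)

lemma emeasure_add_measure:
 assumes N: "sets N = sets M" and A: "A \<in> sets M"
 shows "emeasure (add_measure M N) A = emeasure M A + emeasure N A"
proof (rule emeasure_measure_of[OF add_measure_def])
 show "countably_additive (sets (add_measure M N)) (%A. emeasure M A + emeasure N A)"
 proof (rule countably_additiveI)
  fix B :: "nat => 'a set"
  assume B: "range B <= sets (add_measure M N)" "disjoint_family B"
  have "(\<Sum>i. emeasure M (B i) + emeasure N (B i)) = (\<Sum>i. emeasure M (B i)) + (\<Sum>i. emeasure N (B i))"
   by (rule suminf_add[symmetric]) auto
  also have "... = emeasure M (\<Union> (range B)) + emeasure N (\<Union> (range B))"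
   using B N by (simp add: suminf_emeasure)
  finally show "(\<Sum>i. emeasure M (B i) + emeasure N (B i))
   = emeasure M (\<Union> (range B)) + emeasure N (\<Union> (range B))" .
 qed
qed (use A sets.sets_into_space in \<open>auto simp: positive_def\<close>)

lemma nn_integral_add_measure:
 assumes N: "sets N = sets M" and f: "f \<in> borel_measurable M"
 shows "(\<integral>\<^sup>+x. f x \<partial>add_measure M N) = (\<integral>\<^sup>+x. f x \<partial>M) + (\<integral>\<^sup>+x. f x \<partial>N)"
 using f
proof (induction rule: borel_measurable_induct)
 case (cong f g)
 have "(\<integral>\<^sup>+x. f x \<partial>K) = (\<integral>\<^sup>+x. g x \<partial>K)" if "space K = space M" for K
  using cong(3) that by (intro nn_integral_cong) auto
 then show ?case using cong(4) sets_eq_imp_space_eq[OF N] by simp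
next
 case (set A)
 then show ?case using N by (simp add: emeasure_add_measure)
next
 case (mult u c)
 have "u \<in> borel_measurable N" "u \<in> borel_measurable (add_measure M N)"
  using mult N by (auto cong: measurable_cong_sets)
 then show ?case using mult by (simp add: nn_integral_cmult distrib_left)
next
 case (add u v)
 have "u \<in> borel_measurable N" "u \<in> borel_measurable (add_measure M N)"
  "v \<in> borel_measurable N" "v \<in> borel_measurable (add_measure M N)"
  using add N by (auto cong: measurable_cong_sets)
 then show ?case using add by (simp add: nn_integral_add algebra_simps)
next
 case (seq U)
 have m: "U i \<in> borel_measurable N" "U i \<in> borel_measurable (add_measure M N)" for i
  using seq N by (auto cong: measurable_cong_sets)
 have inc: "incseq (%i. integral\<^sup>N K (U i))" for K
  using seq(3) by (auto simp: incseq_def le_fun_def intro!: nn_integral_mono)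
 have conv: "(\<integral>\<^sup>+x. (SUP i. U i) x \<partial>K) = (SUP i. integral\<^sup>N K (U i))"
  if "!!i. U i \<in> borel_measurable K" for K
  using nn_integral_monotone_convergence_SUP[OF seq(3) that] by (simp add: image_comp)
 show ?case
  unfolding conv[OF seq(1)] conv[OF m(1)] conv[OF m(2)] seq.IH
  by (rule ennreal_SUP_add[OF inc inc])
qed

lemma integrable_add_measure:
 fixes f :: "'a => real"
 assumes N: "sets N = sets M"
 shows "integrable (add_measure M N) f \<longleftrightarrow> integrable M f & integrable N f"
proof (cases "f \<in> borel_measurable M")
 case True
 moreover have "f \<in> borel_measurable N" "f \<in> borel_measurable (add_measure M N)"
  using True N by (auto cong: measurable_cong_sets)
 ultimately show ?thesis
  by (auto simp: integrable_iff_bounded nn_integral_add_measure[OF N] ennreal_add_eq_top less_top)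
next
 case False
 moreover have "f \<notin> borel_measurable (add_measure M N)"
  using False by (simp cong: measurable_cong_sets)
 ultimately show ?thesis by (auto dest: borel_measurable_integrable)
qed

lemma integral_add_measure:
 fixes f :: "'a => real"
 assumes N: "sets N = sets M" and i: "integrable M f" "integrable N f"
 shows "(LINT x|add_measure M N. f x) = (LINT x|M. f x) + (LINT x|N. f x)"
proof -
 have [measurable]: "f \<in> borel_measurable M" using i by auto
 have "integrable (add_measure M N) f" using i integrable_add_measure[OF N] by simp
 then show ?thesis using i
  by (simp add: real_lebesgue_integral_def nn_integral_add_measure[OF N] enn2real_plus
    real_integrable_def less_top)
qed

definition clock :: "real set => real measure" where
 "clock J = add_measure lborel (distr (count_space J) borel (%x. x))"

lemma sets_clock [simp, measurable_cong]: "sets (clock J) = sets borel"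
 by (simp add: clock_def)

lemma space_clock [simp]: "space (clock J) = UNIV"
 by (simp add: clock_def)

lemma emeasure_clock:
 assumes "finite J" "A \<in> sets borel"
 shows "emeasure (clock J) A = emeasure lborel A + of_nat (card (A Int J))"
 using assms
 by (simp add: clock_def emeasure_add_measure emeasure_distr emeasure_count_space_finite Int_commute)

lemma sigma_finite_clock:
 assumes "finite J" shows "sigma_finite_measure (clock J)"
proof
 let ?A = "range (%n::nat. {- real n..real n})"
 have "\<Union> ?A = UNIV"
 proof (intro equalityI subsetI)
  fix x :: real
  obtain n :: nat where "\<bar>x\<bar> <= real n" using real_arch_simple by blast
  then have "x \<in> {- real n..real n}" by auto
  then show "x \<in> \<Union> ?A" by blast
 qed simp
 moreover have "emeasure (clock J) a ~= \<infinity>" if "a \<in> ?A" for a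
  using that assms by (auto simp: emeasure_clock)
 ultimately show "\<exists>A. countable A & A <= sets (clock J) & \<Union> A = space (clock J) &
   (\<forall>a\<in>A. emeasure (clock J) a ~= \<infinity>)"
  by (intro exI[of _ ?A]) auto
qed

lemma set_integrable_clock:
 fixes f :: "real => real"
 assumes J: "finite J" and A: "A \<in> sets borel"
 shows "set_integrable (clock J) A f \<longleftrightarrow> set_integrable lborel A f"
proof -
 have "integrable (distr (count_space J) borel (%x. x)) (%x. indicator A x *\<^sub>R f x)"
  if "integrable lborel (%x. indicator A x *\<^sub>R f x)"
 proof -
  have "(%x. indicator A x *\<^sub>R f x) \<in> borel_measurable borel"
   using borel_measurable_integrable[OF that] by simp
  then show ?thesis using J by (subst integrable_distr_eq) (auto simp: integrable_count_space)
 qed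
 then show ?thesis unfolding set_integrable_def clock_def by (auto simp: integrable_add_measure)
qed

lemma set_integral_clock:
 fixes f :: "real => real"
 assumes J: "finite J" and A: "A \<in> sets borel" and f: "set_integrable lborel A f"
 shows "(LINT x:A|clock J. f x) = (LINT x:A|lborel. f x) + (\<Sum>r\<in>J Int A. f r)"
proof -
 let ?h = "%x. indicator A x *\<^sub>R f x"
 have h: "?h \<in> borel_measurable borel" "integrable lborel ?h"
  using f borel_measurable_integrable[of lborel ?h] by (auto simp: set_integrable_def)
 have "integrable (distr (count_space J) borel (%x. x)) ?h"
  using h J by (subst integrable_distr_eq) (auto simp: integrable_count_space)
 then have "(LINT x:A|clock J. f x) = (LINT x:A|lborel. f x)
   + (LINT x|distr (count_space J) borel (%x. x). ?h x)"
  using h unfolding set_lebesgue_integral_def clock_def by (subst integral_add_measure) auto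
 also have "(LINT x|distr (count_space J) borel (%x. x). ?h x) = (\<Sum>r\<in>J. ?h r)"
  using h J by (subst integral_distr) (auto simp: lebesgue_integral_count_space_finite)
 also have "... = (\<Sum>r\<in>J Int A. f r)"
  using J by (simp add: sum.inter_restrict indicator_def if_distrib[of "%c. c * _"] cong: if_cong)
 finally show ?thesis .
qed

section \<open>Functions with a density\<close>

text \<open>The pathwise calculus is the calculus of functions of the form
 \<open>Y 0 + \<integral>\<^bsub>(0,t]\<^esub> \<eta> d\<mu>\<close>. With \<open>\<mu>\<close> the clock of a path, the density \<open>\<eta>\<close> is the time derivative
 off the jumps and the jump size on them.\<close>

definition has_density :: "real measure => real => (real => real) => (real => real) => bool" where
 "has_density M T \<eta> Y \<longleftrightarrow>
   set_integrable M {0<..T} \<eta> & (\<forall>t\<in>{0..T}. Y t = Y 0 + (LINT s:{0<..t}|M. \<eta> s))"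

lemma has_densityD:
 assumes "has_density M T \<eta> Y"
 shows "set_integrable M {0<..T} \<eta>"
  and "t \<in> {0..T} ==> Y t = Y 0 + (LINT s:{0<..t}|M. \<eta> s)"
 using assms unfolding has_density_def by blast+

lemma has_density_subset:
 assumes "has_density M T \<eta> Y" "sets M = sets borel" "A <= {0<..T}" "A \<in> sets borel"
 shows "set_integrable M A \<eta>"
 using assms by (auto simp: has_density_def intro: set_integrable_subset)

lemma has_density_at_left:
 assumes d: "has_density M T \<eta> Y" and M: "sets M = sets borel" and t: "t \<in> {0<..T}"
 shows "(Y \<longlongrightarrow> Y 0 + (LINT s:{0<..<t}|M. \<eta> s)) (at_left t)"
proof (rule tendsto_at_left_sequentially[of 0])
 fix S :: "nat => real"
 assume S: "!!n. S n < t" "!!n. 0 < S n" "incseq S" "S \<longlonglongrightarrow> t"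
 have eq: "(\<Union>n. {0<..S n}) = {0<..<t}"
 proof (intro equalityI subsetI)
  fix x assume "x \<in> {0<..<t}"
  with order_tendstoD(1)[OF S(4), of x] show "x \<in> (\<Union>n. {0<..S n})"
   by (force simp: eventually_at_top_linorder dest: less_imp_le)
 next
  fix x assume "x \<in> (\<Union>n. {0<..S n})"
  then obtain n where "0 < x" "x <= S n" by auto
  then show "x \<in> {0<..<t}" using S(1)[of n] by simp
 qed
 have "(%n. LINT s:{0<..S n}|M. \<eta> s) \<longlonglongrightarrow> (LINT s:(\<Union>n. {0<..S n})|M. \<eta> s)"
 proof (rule set_integral_cont_up)
  show "set_integrable M (\<Union>n. {0<..S n}) \<eta>"
   unfolding eq using t by (intro has_density_subset[OF d M]) auto
  show "incseq (%n. {0<..S n})" by (intro incseq_SucI subsetI) (auto intro: order_trans[OF _ incseq_SucD[OF S(3)]])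
  show "{0<..S i} \<in> sets M" for i using M by simp
 qed
 then have "(%n. Y 0 + (LINT s:{0<..S n}|M. \<eta> s)) \<longlonglongrightarrow> Y 0 + (LINT s:{0<..<t}|M. \<eta> s)"
  unfolding eq by (intro tendsto_intros)
 moreover have "Y (S n) = Y 0 + (LINT s:{0<..S n}|M. \<eta> s)" for n
  by (rule has_densityD(2)[OF d]) (use S(1,2)[of n] t in auto)
 ultimately show "(%n. Y (S n)) \<longlonglongrightarrow> Y 0 + (LINT s:{0<..<t}|M. \<eta> s)" by (simp only:)
qed (use t in simp)

lemma has_density_left_limit:
 assumes "has_density M T \<eta> Y" "sets M = sets borel" "t \<in> {0<..T}"
 shows "left_limit Y t = Y 0 + (LINT s:{0<..<t}|M. \<eta> s)"
 using has_density_at_left[OF assms] assms(3) by (intro left_limit_eqI) auto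

lemma has_density_at_right:
 assumes d: "has_density M T \<eta> Y" and M: "sets M = sets borel" and t: "t \<in> {0..<T}"
 shows "(Y \<longlongrightarrow> Y t) (at_right t)"
proof (rule tendsto_at_right_sequentially[of _ T])
 fix S :: "nat => real"
 assume S: "!!n. t < S n" "!!n. S n < T" "decseq S" "S \<longlonglongrightarrow> t"
 have eq: "(\<Inter>n. {0<..S n}) = {0<..t}"
 proof (intro equalityI subsetI)
  fix x assume "x \<in> {0<..t}"
  then show "x \<in> (\<Inter>n. {0<..S n})" using S(1) by (auto intro: less_imp_le order_trans)
 next
  fix x assume x: "x \<in> (\<Inter>n. {0<..S n})"
  then have "x <= S n" for n by simp
  then have "x <= t" by (intro LIMSEQ_le_const[OF S(4)]) auto
  then show "x \<in> {0<..t}" using x by simp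
 qed
 have "(%n. LINT s:{0<..S n}|M. \<eta> s) \<longlonglongrightarrow> (LINT s:(\<Inter>n. {0<..S n})|M. \<eta> s)"
 proof (rule set_integral_cont_down)
  show "set_integrable M {0<..S 0} \<eta>"
   using S(2)[of 0] by (intro has_density_subset[OF d M]) auto
  show "decseq (%n. {0<..S n})" by (intro decseq_SucI subsetI) (auto intro: order_trans[OF _ decseq_SucD[OF S(3)]])
  show "{0<..S i} \<in> sets M" for i using M by simp
 qed
 then have "(%n. Y 0 + (LINT s:{0<..S n}|M. \<eta> s)) \<longlonglongrightarrow> Y 0 + (LINT s:{0<..t}|M. \<eta> s)"
  unfolding eq by (intro tendsto_intros)
 moreover have "Y (S n) = Y 0 + (LINT s:{0<..S n}|M. \<eta> s)" for n
  by (rule has_densityD(2)[OF d]) (use S(1,2)[of n] t in auto)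
 moreover have "Y t = Y 0 + (LINT s:{0<..t}|M. \<eta> s)" by (rule has_densityD(2)[OF d]) (use t in auto)
 ultimately show "(%n. Y (S n)) \<longlonglongrightarrow> Y t" by (simp only:)
qed (use t in simp)

lemma has_density_cadlag:
 assumes "has_density M T \<eta> Y" "sets M = sets borel"
 shows "cadlag_on 0 T Y"
 using has_density_at_left[OF assms] has_density_at_right[OF assms]
 unfolding cadlag_on_def by blast

text \<open>Fubini on the square \<open>(0,t]\<^sup>2\<close>, cut along the diagonal; the diagonal itself, which may carry
 mass, goes to the first of the two triangles, whence the left limit in the second term.\<close>

lemma integral_product_triangles:
 fixes \<eta> \<zeta> :: "real => real"
 assumes sf: "sigma_finite_measure M" and M: "sets M = sets borel"
  and i: "set_integrable M {0<..t} \<eta>" "set_integrable M {0<..t} \<zeta>"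
 shows "set_integrable M {0<..t} (%r. \<eta> r * (LINT s:{0<..r}|M. \<zeta> s) + (LINT s:{0<..<r}|M. \<eta> s) * \<zeta> r)"
  and "(LINT s:{0<..t}|M. \<eta> s) * (LINT s:{0<..t}|M. \<zeta> s)
   = (LINT r:{0<..t}|M. \<eta> r * (LINT s:{0<..r}|M. \<zeta> s) + (LINT s:{0<..<r}|M. \<eta> s) * \<zeta> r)"
proof -
 interpret pair_sigma_finite M M using sf by (simp add: pair_sigma_finite_def)
 let ?I = "{0<..t}"
 define e where "e = (%r. indicator ?I r *\<^sub>R \<eta> r)"
 define z where "z = (%r. indicator ?I r *\<^sub>R \<zeta> r)"
 have ez: "integrable M e" "integrable M z" using i by (auto simp: set_integrable_def e_def z_def)
 have [measurable]: "e \<in> borel_measurable M" "z \<in> borel_measurable M" using ez by auto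
 have MM: "sets (M \<Otimes>\<^sub>M M) = sets (borel :: (real \<times> real) measure)"
  using sets_pair_measure_cong[OF M M] by (simp add: borel_prod[symmetric])
 define k where "k = (%(r, s). e r * z s)"
 have k: "integrable (M \<Otimes>\<^sub>M M) k"
 proof (rule Fubini_integrable)
  show "k \<in> borel_measurable (M \<Otimes>\<^sub>M M)" unfolding k_def by measurable
  show "integrable M (%x. LINT y|M. norm (k (x, y)))"
   using ez by (simp add: k_def norm_mult abs_mult integrable_abs)
  show "AE x in M. integrable M (%y. k (x, y))" using ez by (simp add: k_def)
 qed
 define D where "D = {p :: real \<times> real. snd p <= fst p}"
 have "closed D" unfolding D_def by (intro closed_Collect_le continuous_intros)
 then have D: "D \<in> sets (M \<Otimes>\<^sub>M M)" by (simp add: MM borel_closed)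
 define k1 where "k1 = (%r s. k (r, s) * indicator D (r, s))"
 define k2 where "k2 = (%r s. k (r, s) * indicator (- D) (r, s))"
 have sp: "space (M \<Otimes>\<^sub>M M) = UNIV"
  using sets_eq_imp_space_eq[OF MM] by simp
 have D': "- D \<in> sets (M \<Otimes>\<^sub>M M)"
  using sets.compl_sets[OF D] by (simp add: sp Compl_eq_Diff_UNIV)
 have k1: "integrable (M \<Otimes>\<^sub>M M) (case_prod k1)" and k2: "integrable (M \<Otimes>\<^sub>M M) (case_prod k2)"
  using integrable_real_mult_indicator[OF D k] integrable_real_mult_indicator[OF D' k]
  by (simp_all add: k1_def k2_def case_prod_unfold)
 have in1: "(LINT s|M. k1 r s) = indicator ?I r *\<^sub>R (\<eta> r * (LINT s:{0<..r}|M. \<zeta> s))" for r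
 proof -
  have "(LINT s|M. k1 r s) = (LINT s|M. e r * (indicator {0<..r} s *\<^sub>R \<zeta> s))"
   by (intro bochner_cong)
     (auto simp: k1_def k_def e_def z_def D_def indicator_def)
  then show ?thesis by (simp add: e_def set_lebesgue_integral_def)
 qed
 have in2: "(LINT r|M. k2 r s) = indicator ?I s *\<^sub>R ((LINT r:{0<..<s}|M. \<eta> r) * \<zeta> s)" for s
 proof -
  have "(LINT r|M. k2 r s) = (LINT r|M. (indicator {0<..<s} r *\<^sub>R \<eta> r) * z s)"
   by (intro bochner_cong)
     (auto simp: k2_def k_def e_def z_def D_def indicator_def)
  then show ?thesis by (simp add: z_def set_lebesgue_integral_def)
 qed
 have s1: "set_integrable M ?I (%r. \<eta> r * (LINT s:{0<..r}|M. \<zeta> s))"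
  using integrable_fst[OF k1] by (simp add: in1 set_integrable_def)
 have s2: "set_integrable M ?I (%r. (LINT s:{0<..<r}|M. \<eta> s) * \<zeta> r)"
  using integrable_snd[OF k2] by (simp add: in2 set_integrable_def)
 show "set_integrable M ?I (%r. \<eta> r * (LINT s:{0<..r}|M. \<zeta> s) + (LINT s:{0<..<r}|M. \<eta> s) * \<zeta> r)"
  using s1 s2 by (rule set_integral_add)
 have "(LINT s:?I|M. \<eta> s) * (LINT s:?I|M. \<zeta> s) = (LINT r|M. LINT s|M. k (r, s))"
  by (simp add: k_def e_def z_def set_lebesgue_integral_def)
 also have "... = (LINT p|(M \<Otimes>\<^sub>M M). k p)" by (rule integral_fst'[OF k])
 also have "... = (LINT p|(M \<Otimes>\<^sub>M M). case_prod k1 p + case_prod k2 p)"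
  by (intro bochner_cong) (auto simp: k1_def k2_def indicator_def)
 also have "... = (LINT p|(M \<Otimes>\<^sub>M M). case_prod k1 p) + (LINT p|(M \<Otimes>\<^sub>M M). case_prod k2 p)"
  by (rule Bochner_Integration.integral_add[OF k1 k2])
 also have "... = (LINT r|M. LINT s|M. k1 r s) + (LINT s|M. LINT r|M. k2 r s)"
  by (simp add: integral_fst[OF k1] integral_snd[OF k2])
 also have "... = (LINT r:?I|M. \<eta> r * (LINT s:{0<..r}|M. \<zeta> s)) + (LINT r:?I|M. (LINT s:{0<..<r}|M. \<eta> s) * \<zeta> r)"
  by (simp add: in1 in2 set_lebesgue_integral_def)
 also have "... = (LINT r:?I|M. \<eta> r * (LINT s:{0<..r}|M. \<zeta> s) + (LINT s:{0<..<r}|M. \<eta> s) * \<zeta> r)"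
  by (rule set_integral_add(2)[OF s1 s2, symmetric])
 finally show "(LINT s:?I|M. \<eta> s) * (LINT s:?I|M. \<zeta> s)
  = (LINT r:?I|M. \<eta> r * (LINT s:{0<..r}|M. \<zeta> s) + (LINT s:{0<..<r}|M. \<eta> s) * \<zeta> r)" .
qed

lemma has_density_cong:
 assumes "has_density M T \<eta> Y" "sets M = sets borel" "!!s. s \<in> {0<..T} ==> \<eta> s = \<eta>' s" "!!t. t \<in> {0..T} ==> Y t = Y' t"
  "0 <= T"
 shows "has_density M T \<eta>' Y'"
proof -
 have "set_integrable M {0<..T} \<eta>'"
  using has_densityD(1)[OF assms(1)] set_integrable_cong[of M M "{0<..T}" "{0<..T}" \<eta> \<eta>']
   assms(3) by blast
 moreover have "Y' t = Y' 0 + (LINT s:{0<..t}|M. \<eta>' s)" if "t \<in> {0..T}" for t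
 proof -
  have "(LINT s:{0<..t}|M. \<eta> s) = (LINT s:{0<..t}|M. \<eta>' s)"
   using that assms by (intro set_lebesgue_integral_cong) auto
  then show ?thesis
   using has_densityD(2)[OF assms(1) that] assms(4)[OF that] assms(4)[of 0] assms(5) by simp
 qed
 ultimately show ?thesis unfolding has_density_def by blast
qed

text \<open>At a common unit mass of the clock \<open>Z\<close> enters with its value after the jump and \<open>Y\<close> with its value before,
 so the product of the two jumps is counted once.\<close>

lemma has_density_mult:
 assumes sf: "sigma_finite_measure M" and M: "sets M = sets borel" and T: "0 <= T"
  and Y: "has_density M T \<eta> Y" and Z: "has_density M T \<zeta> Z"
 shows "has_density M T (%s. \<eta> s * Z s + left_limit Y s * \<zeta> s) (%t. Y t * Z t)"
proof -
 define F where "F t = (LINT s:{0<..t}|M. \<eta> s)" for t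
 define G where "G t = (LINT s:{0<..t}|M. \<zeta> s)" for t
 define F' where "F' t = (LINT s:{0<..<t}|M. \<eta> s)" for t
 have YF: "Y t = Y 0 + F t" "Z t = Z 0 + G t" if "t \<in> {0..T}" for t
  unfolding F_def G_def by (rule has_densityD(2)[OF Y that], rule has_densityD(2)[OF Z that])
 have lY: "left_limit Y t = Y 0 + F' t" if "t \<in> {0<..T}" for t
  unfolding F'_def by (rule has_density_left_limit[OF Y M that])
 let ?d = "%s. (\<eta> s * G s + F' s * \<zeta> s) + (Z 0 * \<eta> s + Y 0 * \<zeta> s)"
 have iY: "set_integrable M {0<..t} \<eta>" "set_integrable M {0<..t} \<zeta>" if "t <= T" for t
  using that by (auto intro: has_density_subset[OF Y M] has_density_subset[OF Z M])
 note tri = integral_product_triangles[OF sf M iY, folded F_def G_def F'_def]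
 have lin: "set_integrable M {0<..t} (%s. Z 0 * \<eta> s + Y 0 * \<zeta> s)" if "t <= T" for t
  using iY[OF that] by (intro set_integral_add(1) set_integrable_mult_right) auto
 have "has_density M T ?d (%t. Y t * Z t)"
  unfolding has_density_def
 proof (intro conjI ballI)
  show "set_integrable M {0<..T} ?d"
   by (rule set_integral_add(1)[OF tri(1) lin]) auto
  fix t assume t: "t \<in> {0..T}"
  have "(LINT s:{0<..t}|M. ?d s) = (LINT s:{0<..t}|M. \<eta> s * G s + F' s * \<zeta> s)
    + (LINT s:{0<..t}|M. Z 0 * \<eta> s + Y 0 * \<zeta> s)"
   by (rule set_integral_add(2)[OF tri(1) lin]) (use t in auto)
  also have "(LINT s:{0<..t}|M. Z 0 * \<eta> s + Y 0 * \<zeta> s) = Z 0 * F t + Y 0 * G t"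
   using iY[of t] t by (subst set_integral_add(2)) (auto simp: F_def G_def)
  also have "(LINT s:{0<..t}|M. \<eta> s * G s + F' s * \<zeta> s) = F t * G t"
   using tri(2)[of t] t by simp
  finally show "Y t * Z t = Y 0 * Z 0 + (LINT s:{0<..t}|M. ?d s)"
   using YF[OF t] by (simp add: algebra_simps)
 qed
 then show ?thesis
 proof (rule has_density_cong[OF _ M])
  fix s assume s: "s \<in> {0<..T}"
  then have "Z s = Z 0 + G s" using YF(2)[of s] by simp
  then show "?d s = \<eta> s * Z s + left_limit Y s * \<zeta> s" using lY[OF s] by (simp add: algebra_simps)
 qed (use T in auto)
qed

lemma has_density_restrict:
 assumes "has_density M T \<eta> Y" "sets M = sets borel" "T' <= T"
 shows "has_density M T' \<eta> Y"
 unfolding has_density_def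
proof (intro conjI ballI)
 show "set_integrable M {0<..T'} \<eta>" using assms by (intro has_density_subset[OF assms(1,2)]) auto
 show "Y t = Y 0 + (LINT s:{0<..t}|M. \<eta> s)" if "t \<in> {0..T'}" for t
  by (rule has_densityD(2)[OF assms(1)]) (use that assms in auto)
qed

section \<open>Densities against a clock\<close>

lemma set_integral_finite_difference:
 fixes f g :: "real => real"
 assumes J: "finite J" and eq: "!!x. x \<in> A ==> x \<notin> J ==> f x = g x"
 shows "set_integrable lborel A f \<longleftrightarrow> set_integrable lborel A g"
  and "(LINT x:A|lborel. f x) = (LINT x:A|lborel. g x)"
proof -
 have eq': "indicator A x *\<^sub>R f x = indicator A x *\<^sub>R g x" if "x \<notin> J" for x
  using eq[of x] that by (simp add: indicator_def)
 show "set_integrable lborel A f \<longleftrightarrow> set_integrable lborel A g"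
  unfolding set_integrable_def
  by (rule integrable_discrete_difference[OF countable_finite[OF J]]) (use eq' in auto)
 show "(LINT x:A|lborel. f x) = (LINT x:A|lborel. g x)"
  unfolding set_lebesgue_integral_def
  by (rule integral_discrete_difference[OF countable_finite[OF J]]) (use eq' in auto)
qed

lemma has_density_clockI:
 assumes J: "finite J" and y: "set_integrable lborel {0<..T} y"
  and eq: "!!t. t \<in> {0..T} ==> Y t = Y 0 + (LINT s:{0<..t}|lborel. y s) + (\<Sum>r\<in>J Int {0<..t}. \<delta> r)"
 shows "has_density (clock J) T (%s. if s \<in> J then \<delta> s else y s) Y"
 unfolding has_density_def
proof (intro conjI ballI)
 let ?y = "%s. if s \<in> J then \<delta> s else y s"
 have dl: "set_integrable lborel A ?y \<longleftrightarrow> set_integrable lborel A y"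
  "(LINT x:A|lborel. ?y x) = (LINT x:A|lborel. y x)" for A
  by (rule set_integral_finite_difference(1)[OF J], simp)
   (rule set_integral_finite_difference(2)[OF J], simp)
 then show "set_integrable (clock J) {0<..T} ?y" using y J by (simp add: set_integrable_clock)
 fix t assume t: "t \<in> {0..T}"
 have "set_integrable lborel {0<..t} ?y"
  unfolding dl using t by (intro set_integrable_subset[OF y]) auto
 then have "(LINT s:{0<..t}|clock J. ?y s) = (LINT s:{0<..t}|lborel. y s) + (\<Sum>r\<in>J Int {0<..t}. ?y r)"
  using J by (subst set_integral_clock) (simp_all add: dl)
 also have "(\<Sum>r\<in>J Int {0<..t}. ?y r) = (\<Sum>r\<in>J Int {0<..t}. \<delta> r)"
  by (intro sum.cong) auto
 finally show "Y t = Y 0 + (LINT s:{0<..t}|clock J. ?y s)" using eq[OF t] by linarith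
qed

lemma has_density_clockD:
 assumes J: "finite J" and d: "has_density (clock J) T \<eta> Y" and t: "t \<in> {0..T}"
 shows "Y t = Y 0 + (LINT s:{0<..t}|lborel. \<eta> s) + (\<Sum>r\<in>J Int {0<..t}. \<eta> r)"
  and "set_integrable lborel {0<..T} \<eta>"
proof -
 show i: "set_integrable lborel {0<..T} \<eta>"
  using has_densityD(1)[OF d] J by (simp add: set_integrable_clock)
 have "set_integrable lborel {0<..t} \<eta>"
  using t by (intro set_integrable_subset[OF i]) auto
 then show "Y t = Y 0 + (LINT s:{0<..t}|lborel. \<eta> s) + (\<Sum>r\<in>J Int {0<..t}. \<eta> r)"
  using has_densityD(2)[OF d t] J by (simp add: set_integral_clock)
qed

lemma left_limit_mult:
 assumes M: "sets M = sets borel" and Y: "has_density M T \<eta> Y" and Z: "has_density M T \<zeta> Z"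
  and t: "t \<in> {0<..T}"
 shows "left_limit (%t. Y t * Z t) t = left_limit Y t * left_limit Z t"
 unfolding has_density_left_limit[OF Y M t] has_density_left_limit[OF Z M t]
 by (rule left_limit_eqI)
   (use t tendsto_mult[OF has_density_at_left[OF Y M t] has_density_at_left[OF Z M t]] in auto)

lemma left_limit_lborel:
 assumes Y: "has_density lborel T \<eta> Y" and t: "t \<in> {0<..T}"
 shows "left_limit Y t = Y t"
proof -
 have "(LINT s:{0<..<t}|lborel. \<eta> s) = (LINT s:{0<..t}|lborel. \<eta> s)"
  unfolding set_lebesgue_integral_def
  by (intro integral_discrete_difference[of "{t}"]) (auto simp: indicator_def)
 then show ?thesis
  using has_density_left_limit[OF Y _ t] has_densityD(2)[OF Y, of t] t by simp
qed

section \<open>The exponential of a path with jumps\<close>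

text \<open>For an integrable \<open>g\<close> the chain rule for \<open>exp (\<integral> g)\<close> comes from the product rule, which gives
 the powers, and from summing the exponential series.\<close>

lemma has_density_power:
 assumes G: "has_density lborel T g G" and T: "0 <= T"
 shows "has_density lborel T (%s. real k * G s ^ (k - 1) * g s) (%t. G t ^ k)"
proof (induction k)
 case 0
 show ?case by (simp add: has_density_def set_integrable_def set_lebesgue_integral_def)
next
 case (Suc k)
 have "has_density lborel T (%s. g s * G s ^ k + left_limit G s * (real k * G s ^ (k - 1) * g s))
   (%t. G t * G t ^ k)"
  by (rule has_density_mult[OF _ _ T G Suc]) (auto intro: lborel.sigma_finite_measure_axioms)
 then show ?case
 proof (rule has_density_cong)
  fix s assume s: "s \<in> {0<..T}"
  show "g s * G s ^ k + left_limit G s * (real k * G s ^ (k - 1) * g s)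
   = real (Suc k) * G s ^ (Suc k - 1) * g s"
   using left_limit_lborel[OF G s] by (cases k) (auto simp: algebra_simps)
 qed (use T in auto)
qed

lemma has_density_exp:
 assumes g: "set_integrable lborel {0<..T} g" and T: "0 <= T"
 defines "E \<equiv> %t. exp (LINT s:{0<..t}|lborel. g s)"
 shows "has_density lborel T (%s. g s * E s) E"
proof -
 define G where "G = (%t. LINT s:{0<..t}|lborel. g s)"
 have G0: "G 0 = 0" by (simp add: G_def set_lebesgue_integral_def)
 have G: "has_density lborel T g G"
  using g G0 by (simp add: has_density_def G_def[symmetric]) (simp add: G_def)
 define B where "B = (LINT s:{0<..T}|lborel. \<bar>g s\<bar>)"
 have ig: "set_integrable lborel {0<..t} g" if "t <= T" for t
  using that by (intro set_integrable_subset[OF g]) auto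
 have GB: "\<bar>G t\<bar> <= B" if "t <= T" for t
 proof -
  have "\<bar>G t\<bar> <= (LINT s:{0<..t}|lborel. \<bar>g s\<bar>)"
   unfolding G_def using set_integral_norm_bound[OF ig[OF that]] by simp
  also have "... <= B" unfolding B_def
   unfolding set_lebesgue_integral_def
   using set_integrable_abs[OF ig[OF that]] set_integrable_abs[OF g] that
   by (intro integral_mono) (auto simp: set_integrable_def indicator_def)
  finally show ?thesis .
 qed
 define P where "P n s = (\<Sum>k<n. G s ^ k / fact k)" for n s
 have E: "E = (%t. exp (G t))" by (simp add: E_def G_def)
 have PE: "(%n. P n s) \<longlonglongrightarrow> E s" for s
  using exp_converges[of "G s"] by (simp add: sums_def P_def E divide_inverse mult.commute)
 have Pbound: "\<bar>P n s\<bar> <= exp B" if "s <= T" for n s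
 proof -
  have "\<bar>P n s\<bar> <= (\<Sum>k<n. \<bar>G s\<bar> ^ k / fact k)"
   unfolding P_def by (rule order_trans[OF sum_abs]) (simp add: power_abs)
  also have "... <= (\<Sum>k. \<bar>G s\<bar> ^ k / fact k)"
   using exp_converges[of "\<bar>G s\<bar>"]
   by (intro sum_le_suminf) (auto simp: sums_iff divide_inverse mult.commute)
  also have "... = exp \<bar>G s\<bar>"
   using exp_converges[of "\<bar>G s\<bar>"] by (auto simp: sums_iff divide_inverse mult.commute)
  finally show ?thesis using GB[OF that] order_trans[of "\<bar>P n s\<bar>" "exp \<bar>G s\<bar>" "exp B"] by simp
 qed
 have pw: "has_density lborel T (%s. real k * G s ^ (k - 1) * g s) (%t. G t ^ k)" for k
  by (rule has_density_power[OF G T])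
 have gP: "set_integrable lborel {0<..t} (%s. g s * (G s ^ k / fact k))"
  "(LINT s:{0<..t}|lborel. g s * (G s ^ k / fact k)) = G t ^ Suc k / fact (Suc k)"
  if t: "t \<in> {0..T}" for t k
 proof -
  have eq: "real (Suc k) * G s ^ (Suc k - 1) * g s / fact (Suc k) = g s * (G s ^ k / fact k)" for s
   by (simp add: field_simps del: of_nat_Suc)
  have "set_integrable lborel {0<..t} (%s. real (Suc k) * G s ^ (Suc k - 1) * g s)"
   using t by (intro has_density_subset[OF pw]) auto
  from set_integrable_divide[OF this, of "fact (Suc k)"]
  show "set_integrable lborel {0<..t} (%s. g s * (G s ^ k / fact k))"
   by (simp only: eq)
  have "G t ^ Suc k = G 0 ^ Suc k + (LINT s:{0<..t}|lborel. real (Suc k) * G s ^ (Suc k - 1) * g s)"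
   by (rule has_densityD(2)[OF pw t])
  then have "G t ^ Suc k / fact (Suc k) = (LINT s:{0<..t}|lborel. real (Suc k) * G s ^ (Suc k - 1) * g s) / fact (Suc k)"
   by (simp add: G0)
  also have "... = (LINT s:{0<..t}|lborel. real (Suc k) * G s ^ (Suc k - 1) * g s / fact (Suc k))"
   by (simp only: set_integral_divide_zero)
  finally show "(LINT s:{0<..t}|lborel. g s * (G s ^ k / fact k)) = G t ^ Suc k / fact (Suc k)"
   by (simp only: eq)
 qed
 have PT: "set_integrable lborel {0<..t} (%s. g s * P n s)"
  "(LINT s:{0<..t}|lborel. g s * P n s) = P (Suc n) t - 1"
  if t: "t \<in> {0..T}" for t n
 proof -
  show "set_integrable lborel {0<..t} (%s. g s * P n s)"
   unfolding P_def sum_distrib_left set_integrable_def scaleR_sum_right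
   using gP(1)[OF t] by (intro Bochner_Integration.integrable_sum) (simp add: set_integrable_def)
  have "(LINT s:{0<..t}|lborel. g s * P n s) = (\<Sum>k<n. LINT s:{0<..t}|lborel. g s * (G s ^ k / fact k))"
   unfolding P_def sum_distrib_left set_lebesgue_integral_def scaleR_sum_right
   using gP(1)[OF t]
   by (intro Bochner_Integration.integral_sum) (simp add: set_integrable_def)
  also have "... = P (Suc n) t - 1"
   unfolding gP(2)[OF t] P_def by (subst sum.lessThan_Suc_shift) simp
  finally show "(LINT s:{0<..t}|lborel. g s * P n s) = P (Suc n) t - 1" .
 qed
 have lim: "(%n. LINT s:{0<..t}|lborel. g s * P n s) \<longlonglongrightarrow> (LINT s:{0<..t}|lborel. g s * E s)"
  and int: "set_integrable lborel {0<..t} (%s. g s * E s)"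
  if t: "t \<in> {0..T}" for t
 proof -
  let ?w = "%s. indicator {0<..t} s *\<^sub>R (exp B * \<bar>g s\<bar>)"
  have w: "integrable lborel ?w"
   using set_integrable_abs[OF ig[of t]] t
   by (auto simp: set_integrable_def mult.left_commute intro!: integrable_mult_right)
  have conv: "AE s in lborel. (%n. indicator {0<..t} s *\<^sub>R (g s * P n s)) \<longlonglongrightarrow> indicator {0<..t} s *\<^sub>R (g s * E s)"
   using PE by (intro AE_I2 tendsto_intros)
  have meas: "(%s. indicator {0<..t} s *\<^sub>R (g s * P n s)) \<in> borel_measurable lborel" for n
   using PT(1)[OF t, of n] unfolding set_integrable_def by (rule borel_measurable_integrable)
  have measE: "(%s. indicator {0<..t} s *\<^sub>R (g s * E s)) \<in> borel_measurable lborel"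
   by (rule borel_measurable_LIMSEQ_real[where u="%n s. indicator {0<..t} s *\<^sub>R (g s * P n s)", OF _ meas])
     (intro tendsto_intros PE)
  have bd: "AE s in lborel. norm (indicator {0<..t} s *\<^sub>R (g s * P n s)) <= ?w s" for n
  proof (rule AE_I2)
   fix s
   show "norm (indicator {0<..t} s *\<^sub>R (g s * P n s)) <= ?w s"
   proof (cases "s \<in> {0<..t}")
    case True
    then have "\<bar>g s\<bar> * \<bar>P n s\<bar> <= \<bar>g s\<bar> * exp B"
     using t by (intro mult_left_mono Pbound) auto
    then show ?thesis using True by (simp add: abs_mult mult.commute)
   qed simp
  qed
  show "(%n. LINT s:{0<..t}|lborel. g s * P n s) \<longlonglongrightarrow> (LINT s:{0<..t}|lborel. g s * E s)"
   unfolding set_lebesgue_integral_def by (rule integral_dominated_convergence[OF measE meas w conv bd])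
  show "set_integrable lborel {0<..t} (%s. g s * E s)"
   unfolding set_integrable_def by (rule integrable_dominated_convergence[OF measE meas w conv bd])
 qed
 show ?thesis
  unfolding has_density_def
 proof (intro conjI ballI)
  show "set_integrable lborel {0<..T} (%s. g s * E s)" using int T by simp
  fix t assume t: "t \<in> {0..T}"
  have "(%n. P (Suc n) t - 1) \<longlonglongrightarrow> E t - 1"
   using LIMSEQ_Suc[OF PE[of t]] by (intro tendsto_intros)
  then have "E t - 1 = (LINT s:{0<..t}|lborel. g s * E s)"
   using lim[OF t] unfolding PT(2)[OF t] by (rule LIMSEQ_unique)
  moreover have "E 0 = 1" using G0 by (simp add: E)
  ultimately show "E t = E 0 + (LINT s:{0<..t}|lborel. g s * E s)" by linarith
 qed
qed

lemma prod_telescope: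
 fixes c :: "real => real"
 assumes "finite A"
 shows "prod c A = 1 + (\<Sum>r\<in>A. prod c (A Int {..<r}) * (c r - 1))"
 using assms
proof (induction rule: finite_linorder_max_induct)
 case (insert b A)
 have "(\<Sum>r\<in>A. prod c (insert b A Int {..<r}) * (c r - 1)) = (\<Sum>r\<in>A. prod c (A Int {..<r}) * (c r - 1))"
  by (intro sum.cong refl arg_cong2[where f="(*)"] arg_cong[where f="prod c"]) (use insert(2) in force)
 moreover have "insert b A Int {..<b} = A" using insert(2) by auto
 moreover have "b \<notin> A" using insert(2) by auto
 ultimately show ?case using insert by (simp add: algebra_simps)
qed simp

definition jump_exp :: "real set => (real => real) => (real => real) => real => real" where
 "jump_exp J g c t = exp (LINT s:{0<..t}|lborel. g s) * prod c (J Int {0<..t})"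

lemma jump_exp_0 [simp]: "jump_exp J g c 0 = 1"
 by (simp add: jump_exp_def set_lebesgue_integral_def)

lemma jump_exp_pos: "(!!r. r \<in> J ==> 0 < c r) ==> 0 < jump_exp J g c t"
 by (auto simp: jump_exp_def intro!: mult_pos_pos prod_pos)

text \<open>\<open>jump_exp\<close> is the Doleans-Dade exponential: it solves \<open>dD = D\<^sub>- dL\<close> where \<open>L\<close> has drift \<open>g\<close> and
 jumps \<open>c - 1\<close>.\<close>

lemma
 assumes J: "finite J" and g: "set_integrable lborel {0<..T} g" and T: "0 <= T"
  and c: "!!r. r \<in> J ==> c r ~= 0"
 defines "D \<equiv> jump_exp J g c"
 shows has_density_jump_exp:
   "has_density (clock J) T (%s. left_limit D s * (if s \<in> J then c s - 1 else g s)) D"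
  and left_limit_jump_exp:
   "!!s. s \<in> {0<..T} ==> left_limit D s = (if s \<in> J then D s / c s else D s)"
proof -
 define E where "E = (%t. exp (LINT s:{0<..t}|lborel. g s))"
 define Q where "Q = (%t. prod c (J Int {0<..t}))"
 define Q' where "Q' = (%t. prod c (J Int {0<..<t}))"
 have D: "D = (%t. E t * Q t)" by (simp add: D_def E_def Q_def jump_exp_def fun_eq_iff)
 have E1: "has_density lborel T (%s. g s * E s) E"
  unfolding E_def by (rule has_density_exp[OF g T])
 have E2: "has_density (clock J) T (%s. if s \<in> J then 0 else g s * E s) E"
 proof (rule has_density_clockI[OF J has_densityD(1)[OF E1]])
  fix t assume "t \<in> {0..T}"
  from has_densityD(2)[OF E1 this]
  show "E t = E 0 + (LINT s:{0<..t}|lborel. g s * E s) + (\<Sum>r\<in>J Int {0<..t}. 0)"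
   by (simp only: sum.neutral_const add.right_neutral)
 qed
 have Qsum: "Q t = 1 + (\<Sum>r\<in>J Int {0<..t}. Q' r * (c r - 1))" for t
 proof -
  have "Q t = 1 + (\<Sum>r\<in>J Int {0<..t}. prod c (J Int {0<..t} Int {..<r}) * (c r - 1))"
   unfolding Q_def using J by (intro prod_telescope) auto
  also have "(\<Sum>r\<in>J Int {0<..t}. prod c (J Int {0<..t} Int {..<r}) * (c r - 1))
    = (\<Sum>r\<in>J Int {0<..t}. Q' r * (c r - 1))"
   unfolding Q'_def
   by (intro sum.cong refl arg_cong2[where f="(*)"] arg_cong[where f="prod c"]) auto
  finally show ?thesis .
 qed
 have Q'sum: "Q' t = 1 + (\<Sum>r\<in>J Int {0<..<t}. Q' r * (c r - 1))" for t
 proof -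
  have "Q' t = 1 + (\<Sum>r\<in>J Int {0<..<t}. prod c (J Int {0<..<t} Int {..<r}) * (c r - 1))"
   unfolding Q'_def using J by (intro prod_telescope) auto
  also have "(\<Sum>r\<in>J Int {0<..<t}. prod c (J Int {0<..<t} Int {..<r}) * (c r - 1))
    = (\<Sum>r\<in>J Int {0<..<t}. Q' r * (c r - 1))"
   unfolding Q'_def
   by (intro sum.cong refl arg_cong2[where f="(*)"] arg_cong[where f="prod c"]) auto
  finally show ?thesis .
 qed
 have Q0: "Q 0 = 1" by (simp add: Q_def)
 have Qd: "has_density (clock J) T (%s. if s \<in> J then Q' s * (c s - 1) else 0) Q"
  by (rule has_density_clockI[OF J])
    (use Qsum Q0 in \<open>simp_all add: set_integrable_def set_lebesgue_integral_def\<close>)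
 have lE: "left_limit E s = E s" if "s \<in> {0<..T}" for s
  by (rule left_limit_lborel[OF E1 that])
 have lQ: "left_limit Q s = Q' s" if s: "s \<in> {0<..T}" for s
 proof -
  have "left_limit Q s = Q 0 + (LINT r:{0<..<s}|clock J. if r \<in> J then Q' r * (c r - 1) else 0)"
   by (rule has_density_left_limit[OF Qd _ s]) simp
  also have "(LINT r:{0<..<s}|clock J. if r \<in> J then Q' r * (c r - 1) else 0)
    = (LINT r:{0<..<s}|lborel. if r \<in> J then Q' r * (c r - 1) else 0)
     + (\<Sum>r\<in>J Int {0<..<s}. if r \<in> J then Q' r * (c r - 1) else 0)"
   using has_density_clockD(2)[OF J Qd, of 0] T s
   by (intro set_integral_clock[OF J]) (auto intro: set_integrable_subset)
  also have "(LINT r:{0<..<s}|lborel. if r \<in> J then Q' r * (c r - 1) else 0) = (LINT r:{0<..<s}|lborel. 0)"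
   by (rule set_integral_finite_difference(2)[OF J]) simp
  also have "(\<Sum>r\<in>J Int {0<..<s}. if r \<in> J then Q' r * (c r - 1) else 0) = (\<Sum>r\<in>J Int {0<..<s}. Q' r * (c r - 1))"
   by (intro sum.cong) auto
  finally show ?thesis using Q'sum[of s] Q0 by (simp add: set_lebesgue_integral_def)
 qed
 have QJ: "Q s = c s * Q' s" if "s \<in> J" "0 < s" for s
 proof -
  have "J Int {0<..s} = insert s (J Int {0<..<s})" using that by auto
  then show ?thesis using J by (simp add: Q_def Q'_def)
 qed
 have Qn: "Q s = Q' s" if "s \<notin> J" for s
 proof -
  have "J Int {0<..s} = J Int {0<..<s}" using that by (auto simp: less_le)
  then show ?thesis by (simp add: Q_def Q'_def)
 qed
 have lD: "left_limit D s = E s * Q' s" if "s \<in> {0<..T}" for s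
  unfolding D using left_limit_mult[OF _ E2 Qd that] lE[OF that] lQ[OF that] by simp
 show "left_limit D s = (if s \<in> J then D s / c s else D s)" if "s \<in> {0<..T}" for s
  unfolding lD[OF that] using QJ[of s] Qn[of s] c[of s] that by (auto simp: D)
 have "has_density (clock J) T (%s. (if s \<in> J then 0 else g s * E s) * Q s
   + left_limit E s * (if s \<in> J then Q' s * (c s - 1) else 0)) D"
  unfolding D by (rule has_density_mult[OF sigma_finite_clock[OF J] _ T E2 Qd]) simp
 then show "has_density (clock J) T (%s. left_limit D s * (if s \<in> J then c s - 1 else g s)) D"
 proof (rule has_density_cong)
  fix s assume s: "s \<in> {0<..T}"
  show "(if s \<in> J then 0 else g s * E s) * Q s + left_limit E s * (if s \<in> J then Q' s * (c s - 1) else 0)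
   = left_limit D s * (if s \<in> J then c s - 1 else g s)"
   unfolding lD[OF s] lE[OF s] using Qn[of s] by (simp add: algebra_simps)
 qed (use T in auto)
qed

text \<open>Uniqueness for the linear equation: \<open>1/D\<close> solves an equation of the same kind, and the
 product rule makes \<open>Z / D\<close> constant.\<close>

lemma jump_exp_unique:
 assumes J: "finite J" and g: "set_integrable lborel {0<..T} g" and T: "0 <= T"
  and c: "!!r. r \<in> J ==> c r ~= 0"
  and Z: "has_density (clock J) T (%s. left_limit Z s * (if s \<in> J then c s - 1 else g s)) Z"
  and Z0: "Z 0 = 1" and t: "t \<in> {0..T}"
 shows "Z t = jump_exp J g c t"
proof -
 define R where "R = jump_exp J (%s. - g s) (%r. 1 / c r)"
 have g': "set_integrable lborel {0<..T} (%s. - g s)" using set_integrable_mult_right[of "-1" lborel "{0<..T}" g] g by simp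
 have c': "1 / c r ~= 0" if "r \<in> J" for r using c[OF that] by simp
 have R: "has_density (clock J) T (%s. left_limit R s * (if s \<in> J then 1 / c s - 1 else - g s)) R"
  unfolding R_def by (rule has_density_jump_exp[OF J g' T c'])
 have lR: "left_limit R s = (if s \<in> J then R s / (1 / c s) else R s)" if "s \<in> {0<..T}" for s
  unfolding R_def by (rule left_limit_jump_exp[OF J g' T c' that])
 have "has_density (clock J) T (%s. left_limit Z s * (if s \<in> J then c s - 1 else g s) * R s +
   left_limit Z s * (left_limit R s * (if s \<in> J then 1 / c s - 1 else - g s))) (%t. Z t * R t)"
  by (rule has_density_mult[OF sigma_finite_clock[OF J] _ T Z R]) simp
 then have "has_density (clock J) T (%s. 0) (%t. Z t * R t)"
 proof (rule has_density_cong)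
  fix s assume s: "s \<in> {0<..T}"
  show "left_limit Z s * (if s \<in> J then c s - 1 else g s) * R s +
   left_limit Z s * (left_limit R s * (if s \<in> J then 1 / c s - 1 else - g s)) = 0"
   using lR[OF s] c[of s] by (auto simp: field_simps)
 qed (use T in auto)
 from has_densityD(2)[OF this t] have ZR: "Z t * R t = 1"
  by (simp add: Z0 R_def set_lebesgue_integral_def)
 have "jump_exp J g c t * R t = (exp (LINT s:{0<..t}|lborel. g s) * exp (- (LINT s:{0<..t}|lborel. g s)))
   * prod (%r. c r * (1 / c r)) (J Int {0<..t})"
  unfolding jump_exp_def R_def prod.distrib by (simp add: set_lebesgue_integral_def)
 also have "... = 1"
  using c by (simp add: exp_minus)
 finally have "jump_exp J g c t * R t = 1" .
 with ZR have "R t ~= 0" "(Z t - jump_exp J g c t) * R t = 0" by (auto simp: algebra_simps)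
 then show ?thesis by simp
qed

section \<open>Stieltjes integrals and the Doleans-Dade exponential\<close>

lemma interval_measure_shift: "interval_measure (%x. c + F x) = interval_measure F"
 unfolding interval_measure_def by simp

lemma interval_measure_cdf:
 assumes "finite_borel_measure M"
 shows "interval_measure (cdf M) = M"
proof (rule cdf_unique')
 interpret finite_borel_measure M by fact
 have top: "(cdf M \<longlongrightarrow> measure M (space M)) at_top" by (rule cdf_lim_at_top)
 show "finite_borel_measure (interval_measure (cdf M))"
  by (rule finite_borel_measure_interval_measure[OF _ _ cdf_lim_at_bot top])
    (auto intro: cdf_nondecreasing cdf_is_right_cont)
 show "cdf (interval_measure (cdf M)) = cdf M"
  by (rule cdf_interval_measure) (auto intro: cdf_nondecreasing cdf_is_right_cont cdf_lim_at_bot)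
qed (fact assms)

lemma measure_density_real:
 assumes p: "integrable M p" "!!x. 0 <= p x" and A: "A \<in> sets M"
 shows "emeasure (density M (%x. ennreal (p x))) A = ennreal (LINT x:A|M. p x)"
proof -
 have [measurable]: "p \<in> borel_measurable M" using p by auto
 have "emeasure (density M (%x. ennreal (p x))) A = (\<integral>\<^sup>+x. ennreal (indicator A x *\<^sub>R p x) \<partial>M)"
  using A by (subst emeasure_density) (auto intro!: nn_integral_cong simp: indicator_def)
 also have "... = ennreal (LINT x|M. indicator A x *\<^sub>R p x)"
  using p A by (intro nn_integral_eq_integral integrable_mult_indicator) auto
 finally show ?thesis by (simp add: set_lebesgue_integral_def)
qed

lemma emeasure_interval_measure_cut:
 assumes F: "mono F" "!!x. continuous (at_right x) F" and t: "0 <= t"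
 shows "emeasure (density (interval_measure F) (%x. ennreal (indicator {0<..t} x))) {..x}
   = ennreal (F (max 0 (min x t)) - F 0)"
  and "emeasure (density (interval_measure F) (%x. ennreal (indicator {0<..t} x))) UNIV
   = ennreal (F t - F 0)"
proof -
 have em: "emeasure (density (interval_measure F) (%x. ennreal (indicator {0<..t} x))) A
   = emeasure (interval_measure F) {0<..s}" if "A \<in> sets borel" "A Int {0<..t} = {0<..s}" for A s
 proof -
  have "emeasure (density (interval_measure F) (%x. ennreal (indicator {0<..t} x))) A
   = emeasure (interval_measure F) ({0<..t} Int A)"
   unfolding ennreal_indicator using that(1) by (intro emeasure_restricted) auto
  then show ?thesis using that(2) by (simp add: Int_commute)
 qed
 have I: "emeasure (interval_measure F) {0<..s} = ennreal (F s - F 0)" if "0 <= s" for s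
  by (rule emeasure_interval_measure_Ioc[OF that monoD[OF F(1)] F(2)])
 have "{..x} Int {0<..t} = {0<..max 0 (min x t)}" using t by auto
 from em[OF _ this]
 show "emeasure (density (interval_measure F) (%x. ennreal (indicator {0<..t} x))) {..x}
   = ennreal (F (max 0 (min x t)) - F 0)" by (simp add: I)
 show "emeasure (density (interval_measure F) (%x. ennreal (indicator {0<..t} x))) UNIV
   = ennreal (F t - F 0)" using em[of UNIV t] t by (simp add: I)
qed

text \<open>Two decompositions of \<open>G\<close> into monotone functions give, crosswise, equal sums of interval
 measures; so the Stieltjes integral can be computed with the positive and negative parts of the
 density of \<open>G\<close>.\<close>

lemma has_stieltjes_integral_iff:
 fixes \<gamma> h :: "real => real"
 assumes M: "sets M = sets borel" and G: "has_density M t \<gamma> G" and t: "0 <= t"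
  and h: "(%s. indicator {0<..t} s * h s) \<in> borel_measurable borel"
  and hg: "set_integrable M {0<..t} (%s. h s * \<gamma> s)"
 shows "has_stieltjes_integral h G 0 t I \<longleftrightarrow> I = (LINT s:{0<..t}|M. h s * \<gamma> s)"
proof -
 define c where "c s = indicator {0<..t} s * \<gamma> s" for s
 define k where "k s = indicator {0<..t} s * h s" for s
 define p where "p s = max 0 (c s)" for s
 define n where "n s = max 0 (- c s)" for s
 have ci: "integrable M c" using has_densityD(1)[OF G] by (simp add: set_integrable_def c_def[abs_def])
 have pi: "integrable M p" "integrable M n"
  unfolding p_def[abs_def] n_def[abs_def]
  by (rule integrable_max[OF integrable_zero ci],
    rule integrable_max[OF integrable_zero Bochner_Integration.integrable_minus[OF ci]])
 have pn0: "0 <= p s" "0 <= n s" for s by (auto simp: p_def n_def)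
 have pn: "p s - n s = c s" for s by (auto simp: p_def n_def)
 have spM: "space M = UNIV" using sets_eq_imp_space_eq[OF M] by simp
 have mb: "f \<in> borel_measurable M \<longleftrightarrow> f \<in> borel_measurable borel" for f :: "real => real"
  by (subst measurable_cong_sets[OF M refl]) (rule refl)
 have km: "k \<in> borel_measurable borel" using h by (simp add: k_def[abs_def])
 have cm: "c \<in> borel_measurable M" "p \<in> borel_measurable M" "n \<in> borel_measurable M"
  using ci pi by auto
 define MP where "MP = density M (%x. ennreal (p x))"
 define MN where "MN = density M (%x. ennreal (n x))"
 have sP: "sets MP = sets borel" "sets MN = sets borel" using M by (auto simp: MP_def MN_def)
 have spP: "space MP = UNIV" "space MN = UNIV" using spM by (auto simp: MP_def MN_def)
 have emP: "emeasure MP A = ennreal (LINT x:A|M. p x)" "emeasure MN A = ennreal (LINT x:A|M. n x)"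
  if "A \<in> sets borel" for A
  unfolding MP_def MN_def using that M pi pn0 by (auto intro!: measure_density_real)
 have fb: "finite_borel_measure MP" "finite_borel_measure MN"
  using sP spP emP[of UNIV]
  by (auto simp: finite_borel_measure_def finite_borel_measure_axioms_def intro!: finite_measureI)
 have cdfP: "cdf MP x = (LINT s:{..x}|M. p s)" "cdf MN x = (LINT s:{..x}|M. n s)" for x
  using pn0 by (auto simp: cdf_def measure_def emP set_lebesgue_integral_def intro!: integral_nonneg)
 have iA: "set_integrable M A p" "set_integrable M A n" if "A \<in> sets borel" for A
  unfolding set_integrable_def by (rule integrable_mult_indicator; use that M pi in simp)+
 have cut: "indicator {..x} s * p s = indicator {..max 0 (min x t)} s * p s"
  "indicator {..x} s * n s = indicator {..max 0 (min x t)} s * n s" for x s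
  by (auto simp: p_def n_def c_def indicator_def)
 have diff: "cdf MP x - cdf MN x = G x - G 0" if x: "x \<in> {0..t}" for x
 proof -
  have "cdf MP x - cdf MN x = (LINT s:{..x}|M. p s - n s)"
   unfolding cdfP by (rule set_integral_diff(2)[symmetric]) (auto intro: iA)
  also have "... = (LINT s:{0<..x}|M. \<gamma> s)"
   unfolding pn set_lebesgue_integral_def
   using x by (intro bochner_cong) (auto simp: c_def indicator_def)
  finally show ?thesis using has_densityD(2)[OF G x] by linarith
 qed
 have kp: "integrable M (%x. p x * k x)" "integrable M (%x. n x * k x)"
 proof -
  have i: "integrable M (%x. c x * k x)"
  proof -
   have "(%x. c x * k x) = (%x. indicator {0<..t} x *\<^sub>R (h x * \<gamma> x))"
    by (auto simp: c_def k_def indicator_def fun_eq_iff)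
   then show ?thesis using hg by (simp add: set_integrable_def)
  qed
  have [measurable]: "k \<in> borel_measurable M" using km mb by simp
  note cm[measurable]
  have bd: "\<bar>p x\<bar> <= \<bar>c x\<bar>" "\<bar>n x\<bar> <= \<bar>c x\<bar>" for x by (simp_all add: p_def n_def)
  show "integrable M (%x. p x * k x)"
   by (rule bochner_bound[OF i], measurable)
     (simp add: abs_mult mult_right_mono bd)
  show "integrable M (%x. n x * k x)"
   by (rule bochner_bound[OF i], measurable)
     (simp add: abs_mult mult_right_mono bd)
 qed
 have ki: "integrable MP k" "integrable MN k"
  and kI: "integral\<^sup>L MP k = (LINT x|M. p x * k x)" "integral\<^sup>L MN k = (LINT x|M. n x * k x)"
  unfolding MP_def MN_def using kp km cm pn0 mb
  by (auto simp: integrable_density integral_density)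
 have sk: "set_lebesgue_integral N {0<..t} h = integral\<^sup>L N k" "set_integrable N {0<..t} h = integrable N k" for N
  by (auto simp: set_lebesgue_integral_def set_integrable_def k_def[abs_def])
 have val: "integral\<^sup>L MP k - integral\<^sup>L MN k = (LINT s:{0<..t}|M. h s * \<gamma> s)"
 proof -
  have "integral\<^sup>L MP k - integral\<^sup>L MN k = (LINT x|M. p x * k x - n x * k x)"
   unfolding kI by (rule Bochner_Integration.integral_diff[OF kp, symmetric])
  also have "... = (LINT s:{0<..t}|M. h s * \<gamma> s)"
   unfolding left_diff_distrib[symmetric] pn set_lebesgue_integral_def
   by (intro bochner_cong) (auto simp: c_def k_def indicator_def)
  finally show ?thesis .
 qed
 show ?thesis
 proof
  assume "I = (LINT s:{0<..t}|M. h s * \<gamma> s)"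
  moreover have "interval_measure (%x. G 0 + cdf MP x) = MP" "interval_measure (cdf MN) = MN"
   by (simp_all add: interval_measure_shift interval_measure_cdf fb)
  moreover have "mono (%x. G 0 + cdf MP x)" "mono (cdf MN)"
   using fb[THEN finite_borel_measure.cdf_nondecreasing] by (auto simp: mono_def)
  moreover have "continuous (at_right x) (%x. G 0 + cdf MP x)" "continuous (at_right x) (cdf MN)" for x
   using fb[THEN finite_borel_measure.cdf_is_right_cont] by (auto intro!: continuous_intros)
  ultimately show "has_stieltjes_integral h G 0 t I"
   unfolding has_stieltjes_integral_def
   using diff ki val
   by (intro exI[of _ "%x. G 0 + cdf MP x"] exI[of _ "cdf MN"]) (simp add: sk algebra_simps)
 next
  assume "has_stieltjes_integral h G 0 t I"
  then have "\<exists>F1 F2. mono F1 & mono F2 & (\<forall>x. continuous (at_right x) F1) &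
    (\<forall>x. continuous (at_right x) F2) & (\<forall>x\<in>{0..t}. G x = F1 x - F2 x) &
    integrable (interval_measure F1) k & integrable (interval_measure F2) k &
    I = integral\<^sup>L (interval_measure F1) k - integral\<^sup>L (interval_measure F2) k"
   unfolding has_stieltjes_integral_def sk .
  then obtain F1 F2 where *: "mono F1 & mono F2 & (\<forall>x. continuous (at_right x) F1) &
    (\<forall>x. continuous (at_right x) F2) & (\<forall>x\<in>{0..t}. G x = F1 x - F2 x) &
    integrable (interval_measure F1) k & integrable (interval_measure F2) k &
    I = integral\<^sup>L (interval_measure F1) k - integral\<^sup>L (interval_measure F2) k"
   by (elim exE) (rule that)
  have F: "mono F1" "mono F2" "continuous (at_right x) F1" "continuous (at_right x) F2" for x
   using * by blast+
  have GF: "G x = F1 x - F2 x" if "x \<in> {0..t}" for x using * that by blast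
  have kF: "integrable (interval_measure F1) k" "integrable (interval_measure F2) k"
   and I: "I = integral\<^sup>L (interval_measure F1) k - integral\<^sup>L (interval_measure F2) k"
   using * by blast+
  define K where "K F = density (interval_measure F) (%x. ennreal (indicator {0<..t} x))" for F
  note emK = emeasure_interval_measure_cut[OF _ _ t, folded K_def]
  have sK: "sets (K F) = sets borel" "space (K F) = UNIV" for F by (auto simp: K_def)
  have eq: "add_measure (K F1) MN = add_measure (K F2) MP"
  proof (rule cdf_unique')
   have fin: "finite_borel_measure (add_measure (K F) N)"
    if "mono F" "!!x. continuous (at_right x) F" "finite_borel_measure N" for F N
   proof -
    interpret N: finite_borel_measure N by fact
    have "emeasure (add_measure (K F) N) UNIV ~= \<infinity>"
     using emK(2)[OF that(1,2)] N.emeasure_finite[of UNIV]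
     by (subst emeasure_add_measure) (simp_all add: sK N.M_is_borel)
    then show ?thesis
     by (auto simp: finite_borel_measure_def finite_borel_measure_axioms_def sK intro!: finite_measureI)
   qed
   show "finite_borel_measure (add_measure (K F1) MN)" "finite_borel_measure (add_measure (K F2) MP)"
    using F fb by (auto intro: fin)
   show "cdf (add_measure (K F1) MN) = cdf (add_measure (K F2) MP)"
   proof
    fix x
    define y where "y = max 0 (min x t)"
    have y: "y \<in> {0..t}" "0 <= y" using t by (auto simp: y_def)
    have mono: "F1 0 <= F1 y" "F2 0 <= F2 y" using F y by (auto dest: monoD)
    have cdfy: "cdf MP x = cdf MP y" "cdf MN x = cdf MN y"
     unfolding cdfP y_def set_lebesgue_integral_def real_scaleR_def by (simp_all only: cut[of x])
    have em: "emeasure MP {..x} = ennreal (cdf MP y)" "emeasure MN {..x} = ennreal (cdf MN y)"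
     unfolding cdfy[symmetric] unfolding cdfP by (simp_all add: emP)
    have nn: "0 <= cdf MP y" "0 <= cdf MN y" by (simp_all add: cdf_def)
    have "emeasure (add_measure (K F1) MN) {..x} = ennreal (F1 y - F1 0) + ennreal (cdf MN y)"
     using F by (subst emeasure_add_measure) (auto simp: sK sP emK em y_def)
    also have "... = ennreal ((F1 y - F1 0) + cdf MN y)"
     using mono nn by (subst ennreal_plus) auto
    also have "(F1 y - F1 0) + cdf MN y = (F2 y - F2 0) + cdf MP y"
     using diff[OF y(1)] GF[OF y(1)] GF[of 0] t by simp
    also have "ennreal ... = ennreal (F2 y - F2 0) + ennreal (cdf MP y)"
     using mono nn by (subst ennreal_plus) auto
    also have "... = emeasure (add_measure (K F2) MP) {..x}"
     using F by (subst emeasure_add_measure) (auto simp: sK sP emK em y_def)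
    finally show "cdf (add_measure (K F1) MN) x = cdf (add_measure (K F2) MP) x"
     by (simp add: cdf_def measure_def)
   qed
  qed
  have kk: "indicator {0<..t} x * k x = k x" for x by (simp add: k_def indicator_def)
  have KI: "integrable (K F) k" "integral\<^sup>L (K F) k = integral\<^sup>L (interval_measure F) k"
   if "integrable (interval_measure F) k" for F
   unfolding K_def using that km by (auto simp: integrable_density integral_density kk)
  have "integral\<^sup>L (add_measure (K F1) MN) k = integral\<^sup>L (add_measure (K F2) MP) k" using eq by simp
  then have "integral\<^sup>L (interval_measure F1) k + integral\<^sup>L MN k = integral\<^sup>L (interval_measure F2) k + integral\<^sup>L MP k"
   using KI[OF kF(1)] KI[OF kF(2)] ki by (simp add: integral_add_measure sK sP)
  then show "I = (LINT s:{0<..t}|M. h s * \<gamma> s)" using I val by linarith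
 qed
qed

lemma cadlag_on_left: "cadlag_on a b x ==> t \<in> {a<..b} ==> \<exists>l. (x \<longlongrightarrow> l) (at_left t)"
 unfolding cadlag_on_def by blast

lemma cadlag_bounded:
 fixes Z :: "real => real"
 assumes Z: "cadlag_on 0 t Z" and t: "0 <= t"
 obtains K where "!!s. s \<in> {0..t} ==> \<bar>Z s\<bar> <= K"
proof -
 define P where "P a b \<longleftrightarrow> (\<exists>K. \<forall>s\<in>{a..b} Int {0..t}. \<bar>Z s\<bar> <= K)" for a b
 have "P 0 t"
  using t
 proof (induction rule: Bolzano)
  case (trans a b c)
  then obtain K1 K2 where K: "\<forall>s\<in>{a..b} Int {0..t}. \<bar>Z s\<bar> <= K1" "\<forall>s\<in>{b..c} Int {0..t}. \<bar>Z s\<bar> <= K2"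
   unfolding P_def by blast
  show ?case unfolding P_def
  proof (intro exI[of _ "max K1 K2"] ballI)
   fix s assume "s \<in> {a..c} Int {0..t}"
   then show "\<bar>Z s\<bar> <= max K1 K2" using K by (cases "s <= b") (auto simp: le_max_iff_disj)
  qed
 next
  case (local x)
  have "\<exists>a<x. \<exists>K. \<forall>s\<in>{a<..<x} Int {0..t}. \<bar>Z s\<bar> <= K"
  proof (cases "x = 0")
   case True
   then show ?thesis by (intro exI[of _ "-1"]) auto
  next
   case False
   then obtain l where "(Z \<longlongrightarrow> l) (at_left x)" using cadlag_on_left[OF Z, of x] local by auto
   from tendstoD[OF this zero_less_one] obtain a where "a < x" "!!s. a < s ==> s < x ==> dist (Z s) l < 1"
    unfolding eventually_at_left_field by blast
   then show ?thesis by (intro exI[of _ a] conjI exI[of _ "\<bar>l\<bar> + 1"] ballI) (auto simp: dist_real_def, fastforce)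
  qed
  then obtain a K1 where a: "a < x" "\<forall>s\<in>{a<..<x} Int {0..t}. \<bar>Z s\<bar> <= K1" by blast
  have "\<exists>b>x. \<exists>K. \<forall>s\<in>{x<..<b} Int {0..t}. \<bar>Z s\<bar> <= K"
  proof (cases "x = t")
   case True
   then show ?thesis by (intro exI[of _ "t+1"]) auto
  next
   case False
   then have "(Z \<longlongrightarrow> Z x) (at_right x)" using Z local by (auto simp: cadlag_on_def)
   from tendstoD[OF this zero_less_one] obtain b where "x < b" "!!s. x < s ==> s < b ==> dist (Z s) (Z x) < 1"
    unfolding eventually_at_right_field by blast
   then show ?thesis by (intro exI[of _ b] conjI exI[of _ "\<bar>Z x\<bar> + 1"] ballI) (auto simp: dist_real_def, fastforce)
  qed
  then obtain b K2 where b: "x < b" "\<forall>s\<in>{x<..<b} Int {0..t}. \<bar>Z s\<bar> <= K2" by blast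
  show ?case
  proof (intro exI[of _ "min (x - a) (b - x)"] conjI allI impI)
   fix a' b' assume *: "a' <= x & x <= b' & b' - a' < min (x - a) (b - x)"
   show "P a' b'" unfolding P_def
   proof (intro exI[of _ "max (\<bar>Z x\<bar>) (max K1 K2)"] ballI)
    fix s assume s: "s \<in> {a'..b'} Int {0..t}"
    consider "s < x" | "s = x" | "s > x" by linarith
    then show "\<bar>Z s\<bar> <= max (\<bar>Z x\<bar>) (max K1 K2)"
    proof cases
     case 1
     then have "\<bar>Z s\<bar> <= K1" using a(2) s * by auto
     then show ?thesis by simp
    next
     case 3
     then have "\<bar>Z s\<bar> <= K2" using b(2) s * by auto
     then show ?thesis by simp
    qed simp
   qed
  qed (use a b in auto)
 qed
 then obtain K where "\<forall>s\<in>{0..t} Int {0..t}. \<bar>Z s\<bar> <= K" unfolding P_def by blast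
 then show ?thesis by (intro that[of K]) simp
qed

lemma left_limit_bounded:
 fixes Z :: "real => real"
 assumes Z: "cadlag_on 0 t Z" and K: "!!s. s \<in> {0..t} ==> \<bar>Z s\<bar> <= K" and s: "s \<in> {0..t}"
 shows "\<bar>left_limit Z s\<bar> <= K"
proof (cases "s = 0")
 case False
 then obtain l where l: "(Z \<longlongrightarrow> l) (at_left s)" using cadlag_on_left[OF Z, of s] s by auto
 have "eventually (%u. u \<in> {0<..<s}) (at_left s)"
  using False s by (intro eventually_at_left_real) auto
 then have "eventually (%u. \<bar>Z u\<bar> <= K) (at_left s)"
  by eventually_elim (use K s in auto)
 then have "\<bar>l\<bar> <= K" by (intro tendsto_upperbound[OF tendsto_rabs[OF l]]) auto
 then show ?thesis using left_limit_eqI[OF False l] by simp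
qed (use K s in auto)

lemma has_density_left_limit_measurable:
 assumes sf: "sigma_finite_measure M" and M: "sets M = sets borel" and Y: "has_density M T \<eta> Y"
 shows "(%s. indicator {0<..T} s * left_limit Y s) \<in> borel_measurable borel"
proof -
 interpret sigma_finite_measure M by fact
 define e where "e r = indicator {0<..T} r *\<^sub>R \<eta> r" for r
 have "e \<in> borel_measurable M"
  using has_densityD(1)[OF Y] unfolding set_integrable_def e_def by (rule borel_measurable_integrable)
 then have [measurable]: "e \<in> borel_measurable borel" using M by (auto cong: measurable_cong_sets)
 have "(%s::real. LINT r|M. (if 0 < r & r < s then e r else 0)) \<in> borel_measurable borel"
 proof (rule borel_measurable_lebesgue_integral)
  have "(%(s::real, r). if 0 < r & r < s then e r else 0) \<in> borel_measurable (borel \<Otimes>\<^sub>M borel)"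
   by measurable
  then show "(%(s::real, r). if 0 < r & r < s then e r else 0) \<in> borel_measurable (borel \<Otimes>\<^sub>M M)"
   by (subst measurable_cong_sets[OF sets_pair_measure_cong[OF refl M] refl])
 qed
 then have "(%s. indicator {0<..T} s * (Y 0 + (LINT r|M. (if 0 < r & r < s then e r else 0)))) \<in> borel_measurable borel"
  by measurable
 moreover have "indicator {0<..T} s * (Y 0 + (LINT r|M. (if 0 < r & r < s then e r else 0))) = indicator {0<..T} s * left_limit Y s" for s
 proof (cases "s \<in> {0<..T}")
  case True
  have "(LINT r|M. (if 0 < r & r < s then e r else 0)) = (LINT r:{0<..<s}|M. \<eta> r)"
   unfolding set_lebesgue_integral_def
   using True by (intro bochner_cong) (auto simp: e_def indicator_def)
  then show ?thesis using has_density_left_limit[OF Y M True] by simp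
 qed simp
 ultimately show ?thesis by simp
qed

lemma set_integrable_bounded_mult:
 fixes h \<gamma> :: "real => real"
 assumes M: "sets M = sets borel" and g: "set_integrable M A \<gamma>"
  and h: "(%s. indicator A s * h s) \<in> borel_measurable borel" and K: "!!s. s \<in> A ==> \<bar>h s\<bar> <= K"
 shows "set_integrable M A (%s. h s * \<gamma> s)"
 unfolding set_integrable_def
proof (rule bochner_bound)
 have i: "integrable M (%s. indicator A s *\<^sub>R \<gamma> s)" using g by (simp add: set_integrable_def)
 then show "integrable M (%s. K * (indicator A s *\<^sub>R \<gamma> s))" by (rule integrable_mult_right)
 have "(%s. indicator A s * h s) \<in> borel_measurable M" using h M by (auto cong: measurable_cong_sets)
 from borel_measurable_times[OF this borel_measurable_integrable[OF i]]
 have "(%s. (indicator A s * h s) * (indicator A s *\<^sub>R \<gamma> s)) \<in> borel_measurable M" .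
 also have "(%s. (indicator A s * h s) * (indicator A s *\<^sub>R \<gamma> s)) = (%s. indicator A s *\<^sub>R (h s * \<gamma> s))"
  by (auto simp: indicator_def)
 finally show "(%s. indicator A s *\<^sub>R (h s * \<gamma> s)) \<in> borel_measurable M" .
 show "AE s in M. norm (indicator A s *\<^sub>R (h s * \<gamma> s)) <= norm (K * (indicator A s *\<^sub>R \<gamma> s))"
 proof (rule AE_I2)
  fix s
  show "norm (indicator A s *\<^sub>R (h s * \<gamma> s)) <= norm (K * (indicator A s *\<^sub>R \<gamma> s))"
  proof (cases "s \<in> A")
   case True
   then have "\<bar>h s\<bar> * \<bar>\<gamma> s\<bar> <= \<bar>K\<bar> * \<bar>\<gamma> s\<bar>" using K[OF True] by (intro mult_right_mono) auto
   then show ?thesis using True by (simp add: abs_mult)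
  qed simp
 qed
qed

text \<open>Existence and uniqueness for the linear equation together justify the definite description.\<close>

lemma doleans_dade_jump_exp:
 assumes J: "finite J" and g: "set_integrable lborel {0<..t} g" and t: "0 <= t"
  and c: "!!r. r \<in> J ==> c r ~= 0"
  and L: "has_density (clock J) t (%s. if s \<in> J then c s - 1 else g s) L"
 shows "doleans_dade L t = jump_exp J g c t"
proof -
 let ?l = "%s. if s \<in> J then c s - 1 else g s"
 let ?D = "jump_exp J g c"
 have Lu: "has_density (clock J) u ?l L" if "u <= t" for u
  by (rule has_density_restrict[OF L _ that]) simp
 have iff: "has_stieltjes_integral h L 0 u I \<longleftrightarrow> I = (LINT s:{0<..u}|clock J. h s * ?l s)"
  "set_integrable (clock J) {0<..u} (%s. h s * ?l s)"
  if u: "u \<in> {0..t}" and h: "(%s. indicator {0<..u} s * h s) \<in> borel_measurable borel"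
   and K: "!!s. s \<in> {0<..u} ==> \<bar>h s\<bar> <= K" for h u I K
 proof -
  have ut: "u <= t" "0 <= u" using u by auto
  show i: "set_integrable (clock J) {0<..u} (%s. h s * ?l s)"
   by (rule set_integrable_bounded_mult[OF _ has_densityD(1)[OF Lu[OF ut(1)]] h K]) auto
  show "has_stieltjes_integral h L 0 u I \<longleftrightarrow> I = (LINT s:{0<..u}|clock J. h s * ?l s)"
   by (rule has_stieltjes_integral_iff[OF _ Lu[OF ut(1)] ut(2) h i]) simp
 qed
 show ?thesis
  unfolding doleans_dade_def
 proof (rule the_equality)
  have D: "has_density (clock J) t (%s. left_limit ?D s * ?l s) ?D"
   by (rule has_density_jump_exp[OF J g t c])
  have cad: "cadlag_on 0 t ?D" by (rule has_density_cadlag[OF D]) simp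
  obtain K where K: "!!s. s \<in> {0..t} ==> \<bar>?D s\<bar> <= K" using cadlag_bounded[OF cad t] by blast
  have "has_stieltjes_integral (left_limit ?D) L 0 u (?D u - 1)" if u: "u \<in> {0..t}" for u
  proof (rule iff(1)[OF u, THEN iffD2])
   have "has_density (clock J) u (%s. left_limit ?D s * ?l s) ?D"
    by (rule has_density_restrict[OF D]) (use u in auto)
   then show "(%s. indicator {0<..u} s * left_limit ?D s) \<in> borel_measurable borel"
    by (intro has_density_left_limit_measurable[OF sigma_finite_clock[OF J]]) auto
   show "?D u - 1 = (LINT s:{0<..u}|clock J. left_limit ?D s * ?l s)"
    using has_densityD(2)[OF D u] by simp
   show "\<bar>left_limit ?D s\<bar> <= K" if "s \<in> {0<..u}" for s
    by (rule left_limit_bounded[OF cad K]) (use that u in auto)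
  qed
  with cad show "\<exists>Z. cadlag_on 0 t Z & (\<forall>u\<in>{0..t}. has_stieltjes_integral (left_limit Z) L 0 u (Z u - 1)) & ?D t = Z t"
   by blast
 next
  fix z assume "\<exists>Z. cadlag_on 0 t Z & (\<forall>u\<in>{0..t}. has_stieltjes_integral (left_limit Z) L 0 u (Z u - 1)) & z = Z t"
  then obtain Z where cad: "cadlag_on 0 t Z"
   and Z: "!!u. u \<in> {0..t} ==> has_stieltjes_integral (left_limit Z) L 0 u (Z u - 1)" and z: "z = Z t" by blast
  obtain K where K: "!!s. s \<in> {0..t} ==> \<bar>Z s\<bar> <= K" using cadlag_bounded[OF cad t] by blast
  have meas: "(%s. indicator {0<..u} s * left_limit Z s) \<in> borel_measurable borel" if u: "u \<in> {0..t}" for u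
  proof -
   obtain F where "set_integrable (interval_measure F) {0<..u} (left_limit Z)"
    using Z[OF u] unfolding has_stieltjes_integral_def by blast
   then have "(%s. indicator {0<..u} s *\<^sub>R left_limit Z s) \<in> borel_measurable (interval_measure F)"
    unfolding set_integrable_def by (rule borel_measurable_integrable)
   then show ?thesis by simp
  qed
  have bd: "\<bar>left_limit Z s\<bar> <= K" if "s \<in> {0<..u}" "u \<in> {0..t}" for s u
   by (rule left_limit_bounded[OF cad K]) (use that in auto)
  have Zu: "Z u - 1 = (LINT s:{0<..u}|clock J. left_limit Z s * ?l s)" if u: "u \<in> {0..t}" for u
   by (rule iff(1)[OF u meas[OF u] bd[OF _ u], THEN iffD1, OF _ Z[OF u]])
  have Z0: "Z 0 = 1" using Zu[of 0] t by (simp add: set_lebesgue_integral_def)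
  have "has_density (clock J) t (%s. left_limit Z s * ?l s) Z"
   unfolding has_density_def
  proof (intro conjI ballI)
   show "set_integrable (clock J) {0<..t} (%s. left_limit Z s * ?l s)"
    by (rule iff(2)[OF _ meas bd]) (use t in auto)
   show "Z u = Z 0 + (LINT s:{0<..u}|clock J. left_limit Z s * ?l s)" if "u \<in> {0..t}" for u
    using Zu[OF that] Z0 by linarith
  qed
  then have "Z t = ?D t" using Z0 t by (intro jump_exp_unique[OF J g t c]) auto
  then show "z = ?D t" using z by simp
 qed
qed

section \<open>The pseudo-inverse of the bracket density\<close>

lemma moore_penrose_unique:
 fixes M :: "real^'n::finite^'m::finite"
 assumes A: "M ** A ** M = M" "A ** M ** A = A" "transpose (M ** A) = M ** A" "transpose (A ** M) = A ** M"
  and B: "M ** B ** M = M" "B ** M ** B = B" "transpose (M ** B) = M ** B" "transpose (B ** M) = B ** M"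
 shows "A = B"
proof -
 have "M ** A = transpose ((M ** B) ** (M ** A))"
  using A(3) B(1) by (simp add: matrix_mul_assoc)
 also have "... = (M ** A ** M) ** B"
  by (subst matrix_transpose_mul) (simp add: A(3) B(3) matrix_mul_assoc)
 finally have 1: "M ** A = M ** B" using A(1) by simp
 have "A ** M = transpose ((A ** M) ** (B ** M))"
  using A(4) B(1) by (simp add: matrix_mul_assoc[symmetric])
 also have "... = B ** (M ** A ** M)"
  by (subst matrix_transpose_mul) (simp add: A(4) B(4) matrix_mul_assoc)
 finally have 2: "A ** M = B ** M" using A(1) by simp
 have "A = A ** (M ** A)" using A(2) by (simp add: matrix_mul_assoc)
 also have "... = (A ** M) ** B" using 1 by (simp add: matrix_mul_assoc)
 also have "... = B" using 2 B(2) by simp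
 finally show ?thesis .
qed

lemma moore_penrose_eqI:
 fixes M :: "real^'n::finite^'m::finite"
 assumes "M ** A ** M = M" "A ** M ** A = A" "transpose (M ** A) = M ** A" "transpose (A ** M) = A ** M"
 shows "moore_penrose M = A"
 unfolding moore_penrose_def
proof (rule the_equality)
 show "B = A" if "M ** B ** M = M & B ** M ** B = B & transpose (M ** B) = M ** B & transpose (B ** M) = B ** M" for B
  by (rule moore_penrose_unique) (use that assms in auto)
qed (use assms in auto)

text \<open>In state \<open>i\<close> the bracket density is the Laplacian of the star with centre \<open>i\<close>.\<close>

definition star_matrix :: "'m::finite => real^'m^'m" where
 "star_matrix i = diag_matrix (Q0 *v axis i 1) - Q0 ** diag_matrix (axis i 1) - diag_matrix (axis i 1) ** Q0"

definition centering :: "real^'m::finite^'m" where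
 "centering = (\<chi> a b. (if a = b then 1 else 0) - 1 / real CARD('m))"

text \<open>For \<open>v\<close> of total mass zero, \<open>v\<close> with its \<open>i\<close>-th entry replaced by zero is a preimage of \<open>v\<close> under the Laplacian;
 centering selects the preimage of total mass zero.\<close>

definition star_inverse :: "'m::finite => real^'m^'m" where
 "star_inverse i = centering ** diag_matrix (\<chi> k. if k = i then 0 else 1) ** centering"

lemma diag_mult_right: "(M ** diag_matrix v) $ a $ b = M $ a $ b * v $ b"
 by (simp add: matrix_matrix_mult_def diag_matrix_def if_distrib[of "%x. _ * x"] cong: if_cong)

lemma diag_mult_left: "(diag_matrix v ** M) $ a $ b = v $ a * M $ a $ b"
 by (simp add: matrix_matrix_mult_def diag_matrix_def if_distrib[of "%x. x * _"] cong: if_cong)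

lemma axis_nth: "axis i (1::real) $ k = (if k = i then 1 else 0)"
 by (simp add: axis_def)

lemma if_mult_zero:
 "(if c then x else 0) * y = (if c then x * y else (0::real))"
 "y * (if c then x else 0) = (if c then y * x else (0::real))"
 by auto

lemma axis_vec_matrix: "(axis i 1 v* M) $ k = (M $ i $ k :: real)"
 by (simp add: vector_matrix_mult_def axis_nth if_mult_zero)

lemma Q0_vec_axis: "(Q0 *v axis i 1) $ a = Q0 $ a $ i"
 by (simp add: matrix_vector_mult_def axis_nth if_distrib[of "%x. _ * x"] cong: if_cong)

lemma star_matrix_nth:
 "star_matrix i $ a $ b = (if a = b then Q0 $ a $ i else 0)
   - (if b = i then Q0 $ a $ b else 0) - (if a = i then Q0 $ a $ b else 0)"
 unfolding star_matrix_def
 by (simp add: diag_mult_left diag_mult_right Q0_vec_axis axis_nth) (simp add: diag_matrix_def Q0_vec_axis)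

lemma sum_Q0: "(\<Sum>b\<in>UNIV. Q0 $ (a::'m::finite) $ b) = 0"
proof -
 have "(\<Sum>b\<in>UNIV. Q0 $ a $ b) = (\<Sum>b\<in>(UNIV::'m set). 1 - (if b = a then real CARD('m) else 0))"
  by (intro sum.cong) (auto simp: Q0_def)
 then show ?thesis by (simp add: sum_subtractf)
qed

lemma sum_Q0_off: "(\<Sum>k\<in>UNIV. wt $ k * Q0 $ k $ i) = (\<Sum>k\<in>UNIV. (if k = i then 0 else wt $ k - wt $ (i::'m::finite)))"
proof -
 have "(\<Sum>k\<in>UNIV. wt $ k * Q0 $ k $ i) = (\<Sum>k\<in>(UNIV::'m set). wt $ k - (if k = i then real CARD('m) * wt $ i else 0))"
  by (intro sum.cong) (auto simp: Q0_def algebra_simps)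
 also have "... = (\<Sum>k\<in>UNIV. wt $ k - wt $ i)" by (simp add: sum_subtractf)
 also have "... = (\<Sum>k\<in>UNIV. (if k = i then 0 else wt $ k - wt $ i))" by (intro sum.cong) auto
 finally show ?thesis .
qed

lemma star_matrix_sum: "(\<Sum>b\<in>UNIV. star_matrix i $ a $ b) = 0"
proof -
 have "(\<Sum>b\<in>UNIV. star_matrix i $ a $ b) = Q0 $ a $ i - Q0 $ a $ i - (if a = i then (\<Sum>b\<in>UNIV. Q0 $ a $ b) else 0)"
  unfolding star_matrix_nth by (simp add: sum_subtractf)
 then show ?thesis by (simp add: sum_Q0)
qed

lemma transpose_nth: "transpose M $ a $ b = M $ b $ a"
 by (simp add: transpose_def)

lemma Q0_sym: "Q0 $ a $ b = Q0 $ b $ a"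
 by (simp add: Q0_def)

lemma centering_sum: "(\<Sum>b\<in>UNIV. centering $ (b::'m::finite) $ a) = 0"
 by (simp add: centering_def sum_subtractf)

lemma matrix_centering: "(M ** centering) $ a $ b = M $ a $ b - (\<Sum>k\<in>UNIV. M $ a $ k) / real CARD('m)"
 for M :: "real^'m::finite^'n::finite"
proof -
 have "(M ** centering) $ a $ b = (\<Sum>k\<in>UNIV. (if k = b then M $ a $ k else 0) - M $ a $ k / real CARD('m))"
  by (simp add: matrix_matrix_mult_def centering_def) (intro sum.cong, auto simp: algebra_simps)
 then show ?thesis by (simp add: sum_subtractf sum_divide_distrib)
qed

lemma moore_penrose_star: "moore_penrose (star_matrix i) = star_inverse (i::'m::finite)"
proof -
 let ?S = "star_matrix i" and ?P = "centering :: real^'m^'m" and ?N = "star_inverse i"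
 define G where "G = diag_matrix (\<chi> k. if k = i then 0 else (1::real))"
 have N: "?N = ?P ** G ** ?P" by (simp add: star_inverse_def G_def)
 have sym: "transpose ?S = ?S" "transpose ?P = ?P" "transpose G = G"
  by (auto simp: vec_eq_iff transpose_nth star_matrix_nth centering_def Q0_sym G_def diag_matrix_def)
 have SP: "?S ** ?P = ?S" by (simp add: vec_eq_iff matrix_centering star_matrix_sum)
 have PP: "?P ** ?P = ?P"
  using centering_sum[where 'm='m] sym(2)
  by (simp add: vec_eq_iff matrix_centering transpose_nth)
 define B :: "real^'m^'m" where "B = (\<chi> a b. (if a = b then 1 else 0) - (if a = i then 1 else 0))"
 have SG: "?S ** G = B"
  by (simp add: vec_eq_iff G_def diag_mult_right star_matrix_nth B_def) (simp add: Q0_def)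
 have "(B ** ?P) $ a $ b = ?P $ a $ b" for a b
 proof -
  have "(B ** ?P) $ a $ b = (\<Sum>k\<in>UNIV. (if k = a then ?P $ k $ b else 0) - (if a = i then ?P $ k $ b else 0))"
  proof -
   have "(B ** ?P) $ a $ b = (\<Sum>k\<in>UNIV. B $ a $ k * ?P $ k $ b)" by (simp add: matrix_matrix_mult_def)
   also have "... = (\<Sum>k\<in>UNIV. (if k = a then ?P $ k $ b else 0) - (if a = i then ?P $ k $ b else 0))"
    by (intro sum.cong) (auto simp: B_def)
   finally show ?thesis .
  qed
  then show ?thesis using centering_sum[of b] by (cases "a = i") (simp_all add: sum_subtractf)
 qed
 then have BP: "B ** ?P = ?P" by (simp add: vec_eq_iff)
 have SN: "?S ** ?N = ?P"
  unfolding N matrix_mul_assoc SP SG BP ..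
 have symN: "transpose ?N = ?N" unfolding N matrix_transpose_mul sym by (simp add: matrix_mul_assoc)
 have NS: "?N ** ?S = ?P"
  using arg_cong[OF SN, of transpose] unfolding matrix_transpose_mul[of ?S ?N] sym symN .
 have NP: "?N ** ?P = ?N" unfolding N by (simp add: matrix_mul_assoc[symmetric] PP)
 have PN: "?P ** ?N = ?N" unfolding N by (simp add: matrix_mul_assoc PP)
 have PS: "?P ** ?S = ?S"
  using arg_cong[OF SP, of transpose] unfolding matrix_transpose_mul[of ?S ?P] sym .
 show ?thesis
  by (rule moore_penrose_eqI) (simp_all add: SN NS PN PS sym)
qed

text \<open>Applied to a vector of total mass zero, the pseudo-inverse recovers the vector up to a constant,
 which jumps \<open>e\<^sub>j - e\<^sub>i\<close> do not see.\<close>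

lemma vec_moore_penrose_star:
 fixes v :: "real^'m::finite"
 assumes v: "(\<Sum>k\<in>UNIV. v $ k) = 0"
 shows "\<exists>c. \<forall>b. (v v* moore_penrose (star_matrix i)) $ b = (if b = i then 0 else v $ b) - c"
proof -
 have cent: "(u v* centering) $ b = u $ b - (\<Sum>k\<in>UNIV. u $ k) / real CARD('m)" for u :: "real^'m" and b
 proof -
  have "(u v* centering) $ b = (\<Sum>k\<in>UNIV. (if k = b then u $ k else 0) - u $ k / real CARD('m))"
   by (simp add: vector_matrix_mult_def centering_def) (intro sum.cong, auto simp: algebra_simps)
  then show ?thesis by (simp add: sum_subtractf sum_divide_distrib)
 qed
 let ?G = "diag_matrix (\<chi> k. if k = i then 0 else (1::real))"
 have G: "(u v* ?G) $ b = (if b = i then 0 else u $ b)" for u :: "real^'m" and b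
  by (simp add: vector_matrix_mult_def diag_matrix_def if_mult_zero)
 have "v v* moore_penrose (star_matrix i) = ((v v* centering) v* ?G) v* centering"
  by (simp add: moore_penrose_star star_inverse_def vector_matrix_mul_assoc)
 moreover have "v v* centering = v" using v by (simp add: vec_eq_iff cent)
 ultimately have "v v* moore_penrose (star_matrix i) = (v v* ?G) v* centering" by simp
 then show ?thesis
  by (intro exI[of _ "(\<Sum>k\<in>UNIV. (v v* ?G) $ k) / real CARD('m)"]) (simp add: cent G)
qed

section \<open>Paths as functions with a density, and the process \<open>L\<close>\<close>

lemma left_limit_nth:
 assumes w: "w \<in> path_space T" and t: "t \<in> {0..T}"
 shows "left_limit (%s. w s $ j) t = left_limit w t $ j"
proof (cases "t = 0")
 case False
 then have "eventually (%s. w s = left_limit w t) (at_left t)"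
  using path_left_eventually(1)[OF w, of t] t by auto
 then have "eventually (%s. w s $ j = left_limit w t $ j) (at_left t)"
  by eventually_elim simp
 then show ?thesis using False by (intro left_limit_eqI tendsto_eventually)
qed simp

lemma has_density_path:
 assumes w: "w \<in> path_space T"
 shows "has_density (clock (jumps T w)) T
   (%s. if s \<in> jumps T w then (w s - left_limit w s) $ j else 0) (%s. w s $ j)"
proof (rule has_density_clockI[OF finite_jumps[OF w]])
 fix t assume "t \<in> {0..T}"
 then show "w t $ j = w 0 $ j + (LINT s:{0<..t}|lborel. 0) + (\<Sum>r\<in>jumps T w Int {0<..t}. (w r - left_limit w r) $ j)"
  using path_telescope[OF w, of 0 t "%x. x $ j"] by (simp add: set_lebesgue_integral_def)
qed (simp add: set_integrable_def)

lemma left_limit_path_measurable: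
 assumes w: "w \<in> path_space T"
 shows "(%s. indicator {0<..T} s * left_limit w s $ j) \<in> borel_measurable borel"
proof -
 have "(%s. indicator {0<..T} s * left_limit (%s. w s $ j) s) \<in> borel_measurable borel"
  by (rule has_density_left_limit_measurable[OF sigma_finite_clock[OF finite_jumps[OF w]] _ has_density_path[OF w]]) simp
 also have "(%s. indicator {0<..T} s * left_limit (%s. w s $ j) s) = (%s. indicator {0<..T} s * left_limit w s $ j)"
  using left_limit_nth[OF w] by (auto simp: indicator_def fun_eq_iff)
 finally show ?thesis .
qed

lemma state_nth: "x \<in> state_space ==> x $ j = 0 \<or> x $ j = 1"
 by (auto simp: state_space_def axis_nth)

lemma state_cases:
 assumes "x \<in> state_space" obtains i where "x = axis i 1"
 using assms by (auto simp: state_space_def)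

lemma set_integrable_bounded_lborel:
 fixes f :: "real => real"
 assumes "(%s. indicator {a<..b} s * f s) \<in> borel_measurable borel" "!!s. s \<in> {a<..b} ==> \<bar>f s\<bar> <= K"
 shows "set_integrable lborel {a<..b} f"
proof -
 have "set_integrable lborel {a<..b} (%s. 1 :: real)"
  by (cases "a <= b") (auto simp: set_integrable_def intro!: integrable_real_indicator)
 from set_integrable_bounded_mult[OF _ this assms] show ?thesis by simp
qed

text \<open>The intensity towards \<open>j\<close> at time \<open>s\<close>, given the transition rates \<open>r s\<close>, and the two
 characteristics of \<open>L\<close>: its drift and the factor by which its exponential jumps.\<close>

definition intensity :: "(real => 'm => 'm => real) => (real => real^'m::finite) => real => 'm => real" where
 "intensity r w s j = (\<Sum>i\<in>UNIV. left_limit w s $ i * r s i j)"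

definition exit_drift :: "(real => 'm => real) => (real => real^'m::finite) => real => real" where
 "exit_drift l w s = - (\<Sum>j\<in>UNIV. (1 - left_limit w s $ j) * (l s j - 1))"

definition jump_factor :: "(real => 'm => real) => (real => real^'m::finite) => real => real" where
 "jump_factor l w s = (\<Sum>j\<in>UNIV. w s $ j * l s j)"

lemma intensity_axis: "left_limit w s = axis i 1 ==> intensity r w s j = r s i j"
 by (simp add: intensity_def axis_nth if_mult_zero)

text \<open>The martingale has jumps \<open>e\<^sub>j - e\<^sub>i\<close> and drift \<open>- e\<^sub>i Q0\<close>. Both have total mass zero, so the undetermined constant
 in the pseudo-inverse drops out, and a jump to \<open>j\<close> moves \<open>L\<close> by \<open>q\<^sub>i\<^sub>j - 1\<close>.\<close>

lemma L_process_density: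
 fixes q :: "('m::finite, 'l::finite) rate_function"
 assumes w: "w \<in> path_space T" and T: "0 < T"
  and meas: "!!i j. (%s. indicator {0<..T} s * q s i j (\<alpha> s w) (p s) (\<nu> s)) \<in> borel_measurable borel"
  and bd: "!!i j s. s \<in> {0<..T} ==> \<bar>q s i j (\<alpha> s w) (p s) (\<nu> s)\<bar> <= K"
  and sum0: "!!i s. s \<in> {0<..T} ==> (\<Sum>j\<in>UNIV. q s i j (\<alpha> s w) (p s) (\<nu> s)) = 0"
 defines "J \<equiv> jumps T w"
  and "l \<equiv> intensity (%s i j. q s i j (\<alpha> s w) (p s) (\<nu> s)) w"
 shows "has_density (clock J) T (%s. if s \<in> J then jump_factor l w s - 1 else exit_drift l w s)
      (L_process q \<alpha> p \<nu> w)"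
proof -
 let ?X = "left_limit w"
 define r where "r s i j = q s i j (\<alpha> s w) (p s) (\<nu> s)" for s i j
 define h where "h k s = (?X s v* ((rate_matrix q s (\<alpha> s w) (p s) (\<nu> s) - Q0) ** moore_penrose (psi w s))) $ k" for k s
 define c where "c k s = (if s \<in> J then (w s - ?X s) $ k else - (Q0 *v ?X s) $ k)" for k s
 have J: "finite J" unfolding J_def by (rule finite_jumps[OF w])
 have psi: "psi w s = star_matrix i" if "?X s = axis i 1" for s i
  by (simp add: psi_def star_matrix_def that)
 have h_eq: "h k s = (\<Sum>i\<in>UNIV. \<Sum>j\<in>UNIV. ?X s $ i * ((r s i j - Q0 $ i $ j) * star_inverse i $ j $ k))"
  if s: "s \<in> {0..T}" for k s
 proof -
  obtain i where i: "?X s = axis i 1" using path_left_limit_state[OF w s] by (rule state_cases)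
  have "h k s = ((rate_matrix q s (\<alpha> s w) (p s) (\<nu> s) - Q0) ** star_inverse i) $ i $ k"
   by (simp only: h_def psi[OF i] moore_penrose_star i axis_vec_matrix)
  also have "... = (\<Sum>j\<in>UNIV. (r s i j - Q0 $ i $ j) * star_inverse i $ j $ k)"
   by (simp add: matrix_matrix_mult_def rate_matrix_def r_def)
  also have "... = (\<Sum>i'\<in>UNIV. if i' = i then (\<Sum>j\<in>UNIV. (r s i' j - Q0 $ i' $ j) * star_inverse i' $ j $ k) else 0)"
   by simp
  also have "... = (\<Sum>i\<in>UNIV. \<Sum>j\<in>UNIV. ?X s $ i * ((r s i j - Q0 $ i $ j) * star_inverse i $ j $ k))"
   by (intro sum.cong) (auto simp: i axis_nth)
  finally show ?thesis .
 qed
 have X01: "\<bar>?X s $ i\<bar> <= 1" if "s \<in> {0..T}" for s i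
  using state_nth[OF path_left_limit_state[OF w that], of i] by auto
 have h_meas: "(%s. indicator {0<..T} s * h k s) \<in> borel_measurable borel" for k
 proof -
  note meas[folded r_def, measurable] left_limit_path_measurable[OF w, measurable]
  have "(%s. \<Sum>i\<in>UNIV. \<Sum>j\<in>UNIV. (indicator {0<..T} s * ?X s $ i) *
    ((indicator {0<..T} s * r s i j - Q0 $ i $ j) * star_inverse i $ j $ k)) \<in> borel_measurable borel"
   by measurable
  also have "(%s. \<Sum>i\<in>UNIV. \<Sum>j\<in>UNIV. (indicator {0<..T} s * ?X s $ i) *
    ((indicator {0<..T} s * r s i j - Q0 $ i $ j) * star_inverse i $ j $ k)) = (%s. indicator {0<..T} s * h k s)"
   by (rule ext) (auto simp: h_eq indicator_def)
  finally show ?thesis .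
 qed
 define B where "B k = (\<Sum>i\<in>UNIV. \<Sum>j\<in>UNIV. (K + \<bar>Q0 $ i $ j\<bar>) * \<bar>star_inverse (i::'m) $ j $ k\<bar>)" for k
 have h_bd: "\<bar>h k s\<bar> <= B k" if s: "s \<in> {0<..T}" for k s
 proof -
  have s': "s \<in> {0..T}" using s by auto
  have "\<bar>?X s $ i * ((r s i j - Q0 $ i $ j) * star_inverse i $ j $ k)\<bar> <= (K + \<bar>Q0 $ i $ j\<bar>) * \<bar>star_inverse i $ j $ k\<bar>" for i j
  proof -
   have "\<bar>r s i j - Q0 $ i $ j\<bar> <= K + \<bar>Q0 $ i $ j\<bar>" using bd[OF s, of i j] by (simp add: r_def)
   then have "\<bar>?X s $ i\<bar> * (\<bar>r s i j - Q0 $ i $ j\<bar> * \<bar>star_inverse i $ j $ k\<bar>) <= 1 * ((K + \<bar>Q0 $ i $ j\<bar>) * \<bar>star_inverse i $ j $ k\<bar>)"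
    using X01[OF s', of i] by (intro mult_mono mult_right_mono) auto
   then show ?thesis by (simp add: abs_mult)
  qed
  then show ?thesis unfolding h_eq[OF s'] B_def
   by (intro order_trans[OF sum_abs] sum_mono order_trans[OF sum_abs]) auto
 qed
 have y_meas: "(%s. indicator {0<..T} s * (Q0 *v ?X s) $ k) \<in> borel_measurable borel" for k
 proof -
  note left_limit_path_measurable[OF w, measurable]
  have "(%s. \<Sum>j\<in>UNIV. Q0 $ k $ j * (indicator {0<..T} s * ?X s $ j)) \<in> borel_measurable borel" by measurable
  also have "(%s. \<Sum>j\<in>UNIV. Q0 $ k $ j * (indicator {0<..T} s * ?X s $ j)) = (%s. indicator {0<..T} s * (Q0 *v ?X s) $ k)"
   by (auto simp: matrix_vector_mult_def sum_distrib_left mult.left_commute)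
  finally show ?thesis .
 qed
 have y_bd: "\<bar>(Q0 *v ?X s) $ k\<bar> <= (\<Sum>j\<in>UNIV. \<bar>Q0 $ k $ j\<bar>)" if "s \<in> {0<..T}" for s k
 proof -
  have "\<bar>Q0 $ k $ j * ?X s $ j\<bar> <= \<bar>Q0 $ k $ j\<bar>" for j
   using X01[of s j] that mult_left_mono[of "\<bar>?X s $ j\<bar>" 1 "\<bar>Q0 $ k $ j\<bar>"] by (auto simp: abs_mult)
  then show ?thesis by (auto simp: matrix_vector_mult_def intro!: order_trans[OF sum_abs] sum_mono)
 qed
 have y_int: "set_integrable lborel {0<..T} (%s. (Q0 *v ?X s) $ k)" for k
  by (rule set_integrable_bounded_lborel[OF y_meas y_bd])
 have mart_nth: "mart w t $ k = w t $ k - w 0 $ k - (LINT s:{0<..t}|lborel. (Q0 *v ?X s) $ k)"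
  if t: "t \<in> {0..T}" for t k
 proof -
  have yi: "integrable lborel (%s. indicator {0..t} s *\<^sub>R (Q0 *v ?X s) $ k)" for k
  proof -
   have "set_integrable lborel {0<..t} (%s. (Q0 *v ?X s) $ k)"
    using t by (intro set_integrable_subset[OF y_int]) auto
   then show ?thesis unfolding set_integrable_def
    by (subst integrable_discrete_difference[of "{0}" _ _ "%s. indicator {0<..t} s *\<^sub>R (Q0 *v ?X s) $ k"])
      (auto simp: indicator_def)
  qed
  have "integrable lborel (%s. \<Sum>j\<in>UNIV. (indicator {0..t} s *\<^sub>R (Q0 *v ?X s) $ j) *\<^sub>R axis j (1::real))"
   using yi by (intro Bochner_Integration.integrable_sum integrable_scaleR_left) auto
  also have "(%s. \<Sum>j\<in>UNIV. (indicator {0..t} s *\<^sub>R (Q0 *v ?X s) $ j) *\<^sub>R axis j (1::real)) = (%s. indicator {0..t} s *\<^sub>R (Q0 *v ?X s))"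
   by (auto simp: vec_eq_iff axis_nth if_mult_zero fun_eq_iff)
  finally have vi: "integrable lborel (%s. indicator {0..t} s *\<^sub>R (Q0 *v ?X s))" .
  have "(LINT s:{0..t}|lborel. Q0 *v ?X s) $ k = (LINT s|lborel. (indicator {0..t} s *\<^sub>R (Q0 *v ?X s)) $ k)"
   unfolding set_lebesgue_integral_def
   by (rule integral_bounded_linear[OF bounded_linear_vec_nth vi, symmetric])
  also have "... = (LINT s|lborel. indicator {0<..t} s *\<^sub>R (Q0 *v ?X s) $ k)"
   by (rule integral_discrete_difference[of "{0}"]) (auto simp: indicator_def)
  finally show ?thesis by (simp add: mart_def set_lebesgue_integral_def)
 qed
 have mart_d: "has_density (clock J) T (c k) (%s. mart w s $ k)" for k
 proof -
  have "has_density (clock J) T (%s. if s \<in> J then (w s - ?X s) $ k else - (Q0 *v ?X s) $ k) (%s. mart w s $ k)"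
  proof (rule has_density_clockI[OF J])
   show "set_integrable lborel {0<..T} (%s. - (Q0 *v ?X s) $ k)"
    using set_integrable_mult_right[of "-1", OF y_int[of k]] by simp
   fix t assume t: "t \<in> {0..T}"
   have "w t $ k - w 0 $ k = (\<Sum>r\<in>J Int {0<..t}. (w r - ?X r) $ k)"
    using path_telescope[OF w, of 0 t "%x. x $ k"] t by (simp add: J_def)
   moreover have "mart w 0 $ k = 0" using mart_nth[of 0 k] T by (simp add: set_lebesgue_integral_def)
   moreover have "(LINT s:{0<..t}|lborel. - (Q0 *v ?X s) $ k) = - (LINT s:{0<..t}|lborel. (Q0 *v ?X s) $ k)"
    by (simp add: set_lebesgue_integral_def)
   ultimately show "mart w t $ k = mart w 0 $ k + (LINT s:{0<..t}|lborel. - (Q0 *v ?X s) $ k)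
     + (\<Sum>r\<in>J Int {0<..t}. (w r - ?X r) $ k)"
    unfolding mart_nth[OF t] by linarith
  qed
  then show ?thesis by (simp add: c_def[abs_def])
 qed
 have hc_int: "set_integrable (clock J) {0<..T} (%s. h k s * c k s)" for k
  by (rule set_integrable_bounded_mult[OF _ has_densityD(1)[OF mart_d] h_meas h_bd]) simp
 have st: "stieltjes_integral (h k) (%s. mart w s $ k) 0 t = (LINT s:{0<..t}|clock J. h k s * c k s)"
  if t: "t \<in> {0..T}" for k t
 proof -
  have d: "has_density (clock J) t (c k) (%s. mart w s $ k)"
   by (rule has_density_restrict[OF mart_d]) (use t in auto)
  have "(%s. indicator {0<..t} s * (indicator {0<..T} s * h k s)) \<in> borel_measurable borel"
   by (rule borel_measurable_times[OF _ h_meas]) simp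
  also have "(%s. indicator {0<..t} s * (indicator {0<..T} s * h k s)) = (%s. indicator {0<..t} s * h k s)"
   using t by (auto simp: indicator_def fun_eq_iff)
  finally have m: "(%s. indicator {0<..t} s * h k s) \<in> borel_measurable borel" .
  have i: "set_integrable (clock J) {0<..t} (%s. h k s * c k s)"
   using t by (intro set_integrable_subset[OF hc_int]) auto
  show ?thesis
   unfolding stieltjes_integral_def
   using has_stieltjes_integral_iff[OF _ d _ m i] t by (intro the_equality) auto
 qed
 have Lt: "L_process q \<alpha> p \<nu> w t = (LINT s:{0<..t}|clock J. \<Sum>k\<in>UNIV. h k s * c k s)"
  if t: "t \<in> {0..T}" for t
 proof -
  have i: "set_integrable (clock J) {0<..t} (%s. h k s * c k s)" for k
   using t by (intro set_integrable_subset[OF hc_int]) auto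
  have "L_process q \<alpha> p \<nu> w t = (\<Sum>k\<in>UNIV. LINT s:{0<..t}|clock J. h k s * c k s)"
   unfolding L_process_def h_def[symmetric] st[OF t] ..
  also have "... = (LINT s:{0<..t}|clock J. \<Sum>k\<in>UNIV. h k s * c k s)"
   unfolding set_lebesgue_integral_def scaleR_sum_right using i
   by (intro Bochner_Integration.integral_sum[symmetric]) (simp add: set_integrable_def)
  finally show ?thesis .
 qed
 have sum_int: "set_integrable (clock J) {0<..T} (%s. \<Sum>k\<in>UNIV. h k s * c k s)"
  unfolding set_integrable_def scaleR_sum_right using hc_int
  by (intro Bochner_Integration.integrable_sum) (simp add: set_integrable_def)
 have "has_density (clock J) T (%s. \<Sum>k\<in>UNIV. h k s * c k s) (L_process q \<alpha> p \<nu> w)"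
  unfolding has_density_def
 proof (intro conjI ballI sum_int)
  fix t assume t: "t \<in> {0..T}"
  have "L_process q \<alpha> p \<nu> w 0 = 0" using Lt[of 0] T by (simp add: set_lebesgue_integral_def)
  then show "L_process q \<alpha> p \<nu> w t = L_process q \<alpha> p \<nu> w 0 + (LINT s:{0<..t}|clock J. \<Sum>k\<in>UNIV. h k s * c k s)"
   using Lt[OF t] by linarith
 qed
 then show ?thesis
 proof (rule has_density_cong)
  fix s assume s: "s \<in> {0<..T}"
  then have s': "s \<in> {0..T}" by auto
  obtain i where i: "?X s = axis i 1" using path_left_limit_state[OF w s'] by (rule state_cases)
  obtain j where j: "w s = axis j 1" using path_in_state_space[OF w s'] by (rule state_cases)
  define v where "v = ?X s v* (rate_matrix q s (\<alpha> s w) (p s) (\<nu> s) - Q0)"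
  have v: "v $ k = r s i k - Q0 $ i $ k" for k
   by (simp add: v_def i axis_vec_matrix rate_matrix_def r_def)
  have "(\<Sum>k\<in>UNIV. v $ k) = 0"
   unfolding v using sum0[OF s, of i] by (simp add: sum_subtractf sum_Q0 r_def)
  then obtain a where "\<forall>b. (v v* moore_penrose (star_matrix i)) $ b = (if b = i then 0 else v $ b) - a"
   using vec_moore_penrose_star by blast
  moreover have "h k s = (v v* moore_penrose (star_matrix i)) $ k" for k
   unfolding h_def v_def psi[OF i] vector_matrix_mul_assoc ..
  ultimately have h: "h k s = (if k = i then 0 else v $ k) - a" for k by simp
  have l: "l s k = r s i k" for k unfolding l_def r_def by (rule intensity_axis[OF i])
  have vk: "v $ k = l s k - 1" if "k ~= i" for k using that by (simp add: v l Q0_def)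
  show "(\<Sum>k\<in>UNIV. h k s * c k s) = (if s \<in> J then jump_factor l w s - 1 else exit_drift l w s)"
  proof (cases "s \<in> J")
   case True
   then have ij: "i ~= j" using i j by (auto simp: J_def jumps_def)
   have "(\<Sum>k\<in>UNIV. h k s * c k s) = (\<Sum>k\<in>UNIV. (if k = j then h k s else 0) - (if k = i then h k s else 0))"
    by (intro sum.cong) (auto simp: c_def True i j axis_nth)
   also have "... = h j s - h i s" by (simp add: sum_subtractf)
   also have "... = l s j - 1" using vk[of j] ij by (simp add: h)
   also have "l s j = jump_factor l w s"
    by (simp add: jump_factor_def j axis_nth if_mult_zero)
   finally show ?thesis using True by simp
  next
   case False
   have "(\<Sum>k\<in>UNIV. h k s * c k s) = - (\<Sum>k\<in>UNIV. (\<chi> k. h k s) $ k * Q0 $ k $ i)"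
    by (simp add: c_def False i Q0_vec_axis sum_negf)
   also have "... = - (\<Sum>k\<in>UNIV. (if k = i then 0 else h k s - h i s))"
    unfolding sum_Q0_off by (intro arg_cong[where f=uminus] sum.cong) auto
   also have "... = exit_drift l w s"
    unfolding exit_drift_def
    by (intro arg_cong[where f=uminus] sum.cong) (auto simp: i axis_nth h vk)
   finally show ?thesis using False by simp
  qed
 qed (use T in auto)
qed

text \<open>Hence the controlled measure has an explicit density.\<close>

lemma doleans_dade_L_process:
 fixes q :: "('m::finite, 'l::finite) rate_function"
 assumes w: "w \<in> path_space T" and T: "0 < T"
  and meas: "!!i j. (%s. indicator {0<..T} s * q s i j (\<alpha> s w) (p s) (\<nu> s)) \<in> borel_measurable borel"
  and bd: "!!i j s. s \<in> {0<..T} ==> \<bar>q s i j (\<alpha> s w) (p s) (\<nu> s)\<bar> <= K"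
  and sum0: "!!i s. s \<in> {0<..T} ==> (\<Sum>j\<in>UNIV. q s i j (\<alpha> s w) (p s) (\<nu> s)) = 0"
  and pos: "!!i j s. s \<in> {0<..T} ==> i ~= j ==> 0 < q s i j (\<alpha> s w) (p s) (\<nu> s)"
 defines "J \<equiv> jumps T w"
  and "l \<equiv> intensity (%s i j. q s i j (\<alpha> s w) (p s) (\<nu> s)) w"
 shows "doleans_dade (L_process q \<alpha> p \<nu> w) T = jump_exp J (exit_drift l w) (jump_factor l w) T"
proof (rule doleans_dade_jump_exp)
 have L: "has_density (clock J) T (%s. if s \<in> J then jump_factor l w s - 1 else exit_drift l w s)
   (L_process q \<alpha> p \<nu> w)"
  unfolding J_def l_def
  by (rule L_process_density[OF w T, where q=q and \<alpha>=\<alpha> and p=p and \<nu>=\<nu> and K=K])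
    (fact meas bd sum0)+
 show J: "finite J" unfolding J_def by (rule finite_jumps[OF w])
 show "has_density (clock J) T (%s. if s \<in> J then jump_factor l w s - 1 else exit_drift l w s)
   (L_process q \<alpha> p \<nu> w)" by (rule L)
 have "set_integrable lborel {0<..T} (%s. if s \<in> J then jump_factor l w s - 1 else exit_drift l w s)"
  using has_density_clockD(2)[OF J L, of 0] T by simp
 then show "set_integrable lborel {0<..T} (exit_drift l w)"
  by (subst set_integral_finite_difference(1)[OF J, symmetric]) auto
 fix s assume s: "s \<in> J"
 then have s': "s \<in> {0<..T}" "s \<in> {0..T}" using jumps_subset[of T w] by (auto simp: J_def)
 obtain i where i: "left_limit w s = axis i 1" using path_left_limit_state[OF w s'(2)] by (rule state_cases)
 obtain j where j: "w s = axis j 1" using path_in_state_space[OF w s'(2)] by (rule state_cases)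
 have "i ~= j" using i j s by (auto simp: J_def jumps_def)
 moreover have "jump_factor l w s = l s j"
  by (simp add: jump_factor_def j axis_nth if_mult_zero)
 ultimately show "jump_factor l w s ~= 0" using pos[OF s'(1), of i j] by (simp add: l_def intensity_axis[OF i])
qed (use T in simp)

section \<open>Predictable processes\<close>

lemma natural_filtration_gen:
 "{(%w. w s) -` B Int path_space T | s B. s \<in> {0..t} & B \<in> sets borel} <= Pow (path_space T)"
 by auto

lemma space_natural_filtration [simp]: "space (natural_filtration T t) = path_space T"
 unfolding natural_filtration_def by (rule space_measure_of[OF natural_filtration_gen])

lemma sets_natural_filtration_mono:
 assumes "s <= t" shows "sets (natural_filtration T s) <= sets (natural_filtration T t)"
 unfolding natural_filtration_def sets_measure_of[OF natural_filtration_gen]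
 by (rule sigma_sets_mono') (use assms in fastforce)

lemma measurable_natural_filtration_mono:
 assumes "f \<in> measurable (natural_filtration T s) N" "s <= t"
 shows "f \<in> measurable (natural_filtration T t) N"
 using assms sets_natural_filtration_mono[OF assms(2)] by (auto simp: measurable_def)

lemma measurable_coordinate:
 assumes "s \<in> {0..t}"
 shows "(%w. w s) \<in> borel_measurable (natural_filtration T t)"
proof (rule measurableI)
 fix B :: "(real^'m) set" assume B: "B \<in> sets borel"
 show "(%w. w s) -` B Int space (natural_filtration T t) \<in> sets (natural_filtration T t)"
  unfolding space_natural_filtration
  unfolding natural_filtration_def sets_measure_of[OF natural_filtration_gen]
  by (rule sigma_sets.Basic) (use assms B in blast)
qed simp

lemma measurable_coordinate_nth:
 assumes "s \<in> {0..t}"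
 shows "(%w. w s $ j) \<in> borel_measurable (natural_filtration T t)"
 using measurable_compose[OF measurable_coordinate[OF assms] borel_measurable_nth] .

abbreviation predictable_gen :: "real => (real \<times> (real => real^'m::finite)) set set" where
 "predictable_gen T \<equiv> {{0} \<times> B | B. B \<in> sets (natural_filtration T 0)} Un
    {{s<..t} \<times> B | s t B. 0 <= s & s < t & t <= T & B \<in> sets (natural_filtration T s)}"

lemma natural_filtration_subset: "B \<in> sets (natural_filtration T s) ==> B <= path_space T"
 using sets.sets_into_space[of B "natural_filtration T s"] by simp

lemma predictable_gen_subset: "0 <= T ==> predictable_gen T <= Pow ({0..T} \<times> path_space T)"
proof
 fix A :: "(real \<times> (real => real^'a)) set"
 assume T: "0 <= T" and "A \<in> predictable_gen T"
 then consider B where "A = {0} \<times> B" "B \<in> sets (natural_filtration T 0)"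
  | s t B where "A = {s<..t} \<times> B" "0 <= s" "s < t" "t <= T" "B \<in> sets (natural_filtration T s)"
  by blast
 then show "A \<in> Pow ({0..T} \<times> path_space T)"
 proof cases
  case 1
  then show ?thesis using natural_filtration_subset[OF 1(2)] T by auto
 next
  case 2
  then show ?thesis using natural_filtration_subset[OF 2(5)] by auto
 qed
qed

lemma space_predictable [simp]: "0 <= T ==> space (predictable_sigma T) = {0..T} \<times> path_space T"
 unfolding predictable_sigma_def by (rule space_measure_of[OF predictable_gen_subset])

lemma sets_predictable:
 "0 <= T ==> sets (predictable_sigma T) = sigma_sets ({0..T} \<times> path_space T) (predictable_gen T)"
 unfolding predictable_sigma_def by (rule sets_measure_of[OF predictable_gen_subset])

lemma predictable_Ioc:
 assumes "0 <= s" "s <= t" "t <= T" "B \<in> sets (natural_filtration T s)"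
 shows "{s<..t} \<times> B \<in> sets (predictable_sigma T)"
proof (cases "s = t")
 case False
 then show ?thesis using assms by (subst sets_predictable) (auto intro!: sigma_sets.Basic)
qed simp

lemma predictable_zero:
 assumes "0 <= T" "B \<in> sets (natural_filtration T 0)"
 shows "{0} \<times> B \<in> sets (predictable_sigma T)"
 using assms by (subst sets_predictable) (auto intro!: sigma_sets.Basic)

lemma path_space_sets: "path_space T \<in> sets (natural_filtration T t)"
 using sets.top[of "natural_filtration T t"] by simp

lemma predictable_gen_Int_stable:
 "Int_stable (predictable_gen T :: (real \<times> (real => real^'m::finite)) set set)"
proof (rule Int_stableI)
 let ?Z = "{{0} \<times> B | B. B \<in> sets (natural_filtration T 0)} :: (real \<times> (real => real^'m)) set set"
 have e: "{} \<in> ?Z" by (auto intro!: exI[of _ "{}"])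
 fix a b :: "(real \<times> (real => real^'m)) set"
 assume a: "a \<in> predictable_gen T" and b: "b \<in> predictable_gen T"
 have zz: "a Int b \<in> ?Z" if "a \<in> ?Z" "b \<in> ?Z" for a b
 proof -
  obtain B C where "a = {0} \<times> B" "b = {0} \<times> C" "B \<in> sets (natural_filtration T 0)" "C \<in> sets (natural_filtration T 0)"
   using \<open>a \<in> ?Z\<close> \<open>b \<in> ?Z\<close> by auto
  then show ?thesis by (auto intro!: exI[of _ "B Int C"])
 qed
 show "a Int b \<in> predictable_gen T"
 proof (cases "a \<in> ?Z \<or> b \<in> ?Z")
  case True
  show ?thesis
  proof (cases "a \<in> ?Z & b \<in> ?Z")
   case True
   then show ?thesis using zz[of a b] by blast
  next
   case False
   then have "a Int b = {}" using True a b by auto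
   then show ?thesis using e by simp
  qed
 next
  case False
  then obtain s t B s' t' C where
   a': "a = {s<..t} \<times> B" "0 <= s" "s < t" "t <= T" "B \<in> sets (natural_filtration T s)" and
   b': "b = {s'<..t'} \<times> C" "0 <= s'" "s' < t'" "t' <= T" "C \<in> sets (natural_filtration T s')"
   using a b by auto
  have ab: "a Int b = {max s s'<..min t t'} \<times> (B Int C)" by (auto simp: a'(1) b'(1))
  have BC: "B Int C \<in> sets (natural_filtration T (max s s'))"
   using a'(5) b'(5) sets_natural_filtration_mono[of s "max s s'" T] sets_natural_filtration_mono[of s' "max s s'" T]
   by auto
  show ?thesis
  proof (cases "max s s' < min t t'")
   case True
   then show ?thesis unfolding ab using BC a' b'
    by (intro UnI2 CollectI exI[of _ "max s s'"] exI[of _ "min t t'"] exI[of _ "B Int C"]) auto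
  next
   case False
   then have "a Int b = {}" unfolding ab by auto
   then show ?thesis using e by simp
  qed
 qed
qed

text \<open>A Dynkin argument specialised to predictable sets.\<close>

lemma predictable_induct [consumes 2, case_names zero Ioc compl union]:
 assumes T: "0 <= T" and A: "A \<in> sets (predictable_sigma T)"
  and zero: "!!B. B \<in> sets (natural_filtration T 0) ==> P ({0} \<times> B)"
  and Ioc: "!!s t B. 0 <= s ==> s < t ==> t <= T ==> B \<in> sets (natural_filtration T s) ==> P ({s<..t} \<times> B)"
  and compl: "!!A. A \<in> sets (predictable_sigma T) ==> P A ==> P ({0..T} \<times> path_space T - A)"
  and union: "!!A. disjoint_family A ==> range A <= sets (predictable_sigma T) ==> (!!i::nat. P (A i)) ==> P (\<Union>i. A i)"
 shows "P A"
 using predictable_gen_Int_stable predictable_gen_subset[OF T] A[unfolded sets_predictable[OF T]]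
proof (induction rule: sigma_sets_induct_disjoint)
 case (basic A)
 then show ?case using zero Ioc by auto
next
 case empty
 show ?case using zero[of "{}"] by simp
next
 case (compl A)
 then show ?case using assms(5)[of A] by (simp add: sets_predictable[OF T])
next
 case (union A)
 then show ?case using assms(6)[of A] by (simp add: sets_predictable[OF T])
qed

lemma predictable_rect:
 fixes Z :: "(real => real^'m::finite) => real"
 assumes T: "0 <= T" and S: "S \<times> (path_space T :: (real => real^'m) set) \<in> sets (predictable_sigma T)"
  and Z: "!!C. C \<in> sets borel ==> S \<times> (Z -` C Int path_space T) \<in> sets (predictable_sigma T)"
 shows "(%(t, w). indicator S t * Z w) \<in> borel_measurable (predictable_sigma T)"
proof (rule measurableI)
 fix C :: "real set" assume C: "C \<in> sets borel"
 let ?sp = "{0..T} \<times> path_space T :: (real \<times> (real => real^'m)) set"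
 have sub: "S \<times> path_space T <= ?sp" using sets.sets_into_space[OF S] T by simp
 have "(%(t, w). indicator S t * Z w) -` C Int ?sp
   = (S \<times> (Z -` C Int path_space T)) Un (if 0 \<in> C then ?sp - S \<times> path_space T else {})"
 proof (rule set_eqI)
  fix x :: "real \<times> (real => real^'m)"
  obtain t w where x: "x = (t, w)" by (cases x)
  show "x \<in> (%(t, w). indicator S t * Z w) -` C Int ?sp \<longleftrightarrow>
    x \<in> (S \<times> (Z -` C Int path_space T)) Un (if 0 \<in> C then ?sp - S \<times> path_space T else {})"
  proof (cases "t \<in> S")
   case True
   then show ?thesis using subsetD[OF sub, of x] by (auto simp: x)
  next
   case False
   then show ?thesis by (auto simp: x)
  qed
 qed
 also have "... \<in> sets (predictable_sigma T)"
  using Z[OF C] S sets.top[of "predictable_sigma T :: (real \<times> (real => real^'m)) measure"] T by auto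
 finally show "(%(t, w). indicator S t * Z w) -` C Int space (predictable_sigma T) \<in> sets (predictable_sigma T)"
  using T by simp
qed simp

lemma predictable_rect_Ioc:
 fixes Z :: "(real => real^'m::finite) => real"
 assumes T: "0 <= T" and a: "0 <= a" and Z: "a <= T ==> Z \<in> borel_measurable (natural_filtration T a)"
 shows "(%(t, w). indicator {a<..b} t * Z w) \<in> borel_measurable (predictable_sigma T)"
proof (cases "a <= min b T")
 case True
 have Zs: "Z -` C Int path_space T \<in> sets (natural_filtration T a)" if "C \<in> sets borel" for C
  using measurable_sets[OF Z that] True by simp
 have "(%(t, w). indicator {a<..min b T} t * Z w) \<in> borel_measurable (predictable_sigma T)"
  using True a T Zs by (intro predictable_rect predictable_Ioc path_space_sets) auto
 also have "?this \<longleftrightarrow> ?thesis"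
  using T by (intro measurable_cong) (auto simp: indicator_def)
 finally show ?thesis .
next
 case False
 then show ?thesis
  using T by (subst measurable_cong[where g="%_. 0"]) (auto simp: indicator_def)
qed

lemma predictable_rect_zero:
 fixes Z :: "(real => real^'m::finite) => real"
 assumes T: "0 <= T" and Z: "Z \<in> borel_measurable (natural_filtration T 0)"
 shows "(%(t, w). indicator {0} t * Z w) \<in> borel_measurable (predictable_sigma T)"
 using T measurable_sets[OF Z] by (intro predictable_rect predictable_zero path_space_sets) auto

text \<open>The left limits of an adapted process form a predictable process: freeze the process at the left
 end of each cell of a grid and refine the grid.\<close>

lemma predictable_left_limit:
 fixes Y :: "real => (real => real^'m::finite) => real"
 assumes T: "0 <= T" and ad: "!!t. t \<in> {0..T} ==> Y t \<in> borel_measurable (natural_filtration T t)"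
  and lim: "!!w t. w \<in> path_space T ==> t \<in> {0<..T} ==> \<exists>l. ((%s. Y s w) \<longlongrightarrow> l) (at_left t)"
 shows "(%(t, w). left_limit (%s. Y s w) t) \<in> borel_measurable (predictable_sigma T)"
proof -
 define N where "N n = real (Suc n)" for n
 have N: "N n > 0" for n by (simp add: N_def)
 define k where "k n t = nat (\<lceil>t * N n\<rceil> - 1)" for n t
 define Yn where "Yn n = (%(t, w). indicator {0} t * Y 0 w +
   (\<Sum>i<nat \<lceil>T * N n\<rceil>. indicator {real i / N n<..real (Suc i) / N n} t * Y (real i / N n) w))" for n
 have Yn_meas: "Yn n \<in> borel_measurable (predictable_sigma T)" for n
 proof -
  have "(%x. (case x of (t, w) => indicator {0} t * Y 0 w) +
   (\<Sum>i<nat \<lceil>T * N n\<rceil>. (case x of (t, w) => indicator {real i / N n<..real (Suc i) / N n} t * Y (real i / N n) w)))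
   \<in> borel_measurable (predictable_sigma T)"
   using T N[of n]
   by (intro borel_measurable_add borel_measurable_sum predictable_rect_zero predictable_rect_Ioc ad) auto
  then show ?thesis unfolding Yn_def case_prod_unfold .
 qed
 have cell: "(t \<in> {real i / N n<..real (Suc i) / N n}) \<longleftrightarrow> i = k n t" if t: "t > 0" for t i n
 proof -
  have "t * N n > 0" using t N[of n] by simp
  then have c1: "\<lceil>t * N n\<rceil> \<ge> 1" by simp
  have "t \<in> {real i / N n<..real (Suc i) / N n} \<longleftrightarrow> real i < t * N n & t * N n <= real i + 1"
   using N[of n] by (auto simp: field_simps)
  also have "... \<longleftrightarrow> \<lceil>t * N n\<rceil> = int i + 1"
   by (auto simp: ceiling_eq_iff)
  also have "... \<longleftrightarrow> i = k n t" using c1 by (auto simp: k_def)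
  finally show ?thesis .
 qed
 have Yn_eq: "Yn n (t, w) = Y (real (k n t) / N n) w" if t: "t \<in> {0<..T}" for n t w
 proof -
  have "t * N n <= T * N n" "0 < t * N n" using t N[of n] by auto
  then have "\<lceil>t * N n\<rceil> <= \<lceil>T * N n\<rceil>" "1 <= \<lceil>t * N n\<rceil>" by (auto intro: ceiling_mono)
  then have kl: "k n t < nat \<lceil>T * N n\<rceil>" unfolding k_def by linarith
  have "Yn n (t, w) = (\<Sum>i<nat \<lceil>T * N n\<rceil>. if i = k n t then Y (real i / N n) w else 0)"
   using t cell[of t] by (auto simp: Yn_def indicator_def intro!: sum.cong)
  then show ?thesis using kl by simp
 qed
 have conv: "(%n. Yn n x) \<longlonglongrightarrow> (case x of (t, w) => left_limit (%s. Y s w) t)"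
  if x: "x \<in> space (predictable_sigma T)" for x
 proof -
  obtain t w where xe: "x = (t, w)" by (cases x)
  have t: "t \<in> {0..T}" and w: "w \<in> path_space T" using x T by (auto simp: xe)
  show ?thesis
  proof (cases "t = 0")
   case True
   have "indicator {real i / N n<..real (Suc i) / N n} t = (0::real)" for i n
    using True divide_nonneg_pos[OF _ N[of n], of "real i"] by (simp add: indicator_def not_less)
   then have "Yn n (t, w) = Y 0 w" for n
    by (simp only: Yn_def prod.case mult_zero_left sum.neutral_const) (simp add: True)
   then show ?thesis using True by (simp add: xe)
  next
   case False
   then have t0: "t \<in> {0<..T}" using t by auto
   obtain l where l: "((%s. Y s w) \<longlongrightarrow> l) (at_left t)" using lim[OF w t0] by blast
   have kn: "real (k n t) / N n < t" "t - 1 / N n <= real (k n t) / N n" for n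
   proof -
    have "real (Suc (k n t)) / N n = real (k n t) / N n + 1 / N n" by (simp add: add_divide_distrib)
    then show "real (k n t) / N n < t" "t - 1 / N n <= real (k n t) / N n"
     using cell[of t "k n t" n] t0 by auto
   qed
   have "(%n. t - 1 / N n) \<longlonglongrightarrow> t - 0"
    unfolding N_def by (intro tendsto_intros LIMSEQ_Suc[OF lim_1_over_n])
   then have "(%n. t - 1 / N n) \<longlonglongrightarrow> t" by simp
   then have "(%n. real (k n t) / N n) \<longlonglongrightarrow> t"
   proof (rule tendsto_sandwich[of "%n. t - 1 / N n" _ _ "%_. t", rotated 2])
    show "eventually (%n. t - 1 / N n <= real (k n t) / N n) sequentially"
     by (intro always_eventually allI kn(2))
    show "eventually (%n. real (k n t) / N n <= t) sequentially"
     by (intro always_eventually allI less_imp_le kn(1))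
   qed (simp_all)
   then have "filterlim (%n. real (k n t) / N n) (at_left t) sequentially"
    unfolding filterlim_at by (simp add: kn(1) less_imp_neq)
   from filterlim_compose[OF l this] have "(%n. Y (real (k n t) / N n) w) \<longlonglongrightarrow> l" .
   moreover have "left_limit (%s. Y s w) t = l" by (rule left_limit_eqI[OF False l])
   ultimately show ?thesis using Yn_eq[OF t0] by (simp add: xe)
  qed
 qed
 show ?thesis by (rule borel_measurable_LIMSEQ_real[OF conv Yn_meas])
qed

lemma predictable_left_limit_path:
 assumes T: "0 <= T"
 shows "(%(t, w). left_limit w t $ (j::'m::finite)) \<in> borel_measurable (predictable_sigma T)"
proof -
 have "(%(t, w). left_limit (%s. w s $ j) t) \<in> borel_measurable (predictable_sigma T)"
 proof (rule predictable_left_limit[OF T])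
  show "(%w. w t $ j) \<in> borel_measurable (natural_filtration T t)" if "t \<in> {0..T}" for t
   using that by (intro measurable_coordinate_nth) auto
  fix w :: "real => real^'m" and t assume "w \<in> path_space T" "t \<in> {0<..T}"
  then have "eventually (%s. w s = left_limit w t) (at_left t)" by (rule path_left_eventually(1))
  then have "eventually (%s. w s $ j = left_limit w t $ j) (at_left t)" by eventually_elim simp
  then show "\<exists>l. ((%s. w s $ j) \<longlongrightarrow> l) (at_left t)" by (intro exI tendsto_eventually)
 qed
 also have "?this \<longleftrightarrow> ?thesis"
  using T by (intro measurable_cong) (auto simp: left_limit_nth)
 finally show ?thesis .
qed

text \<open>Up to time \<open>t\<close> a predictable process only sees \<open>\<F>\<^sub>t\<close>.\<close>

lemma predictable_progressive:
 fixes H :: "real \<times> (real => real^'m::finite) => 'b"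
 assumes T: "0 <= T" and t: "t \<in> {0..T}" and H: "H \<in> measurable (predictable_sigma T) N"
 shows "H \<in> measurable (restrict_space borel {0..t} \<Otimes>\<^sub>M natural_filtration T t) N"
proof -
 let ?R = "restrict_space borel {0..t} :: real measure"
 let ?F = "natural_filtration T t :: (real => real^'m) measure"
 have sp: "space (?R \<Otimes>\<^sub>M ?F) = {0..t} \<times> (path_space T :: (real => real^'m) set)"
  by (simp add: space_pair_measure space_restrict_space)
 have "(%x. x) \<in> measurable (?R \<Otimes>\<^sub>M ?F) (predictable_sigma T :: (real \<times> (real => real^'m)) measure)"
  unfolding predictable_sigma_def
 proof (rule measurable_measure_of[OF predictable_gen_subset[OF T]])
  show "(%x. x) \<in> space (?R \<Otimes>\<^sub>M ?F) \<rightarrow> {0..T} \<times> path_space T"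
  proof
   fix x assume "x \<in> space (?R \<Otimes>\<^sub>M ?F)"
   then have "x \<in> {0..t} \<times> path_space T" unfolding sp .
   then show "x \<in> {0..T} \<times> path_space T" using t by auto
  qed
  fix y :: "(real \<times> (real => real^'m)) set" assume y: "y \<in> predictable_gen T"
  have rs: "S \<times> B \<in> sets (?R \<Otimes>\<^sub>M ?F)" if "S \<in> sets borel" "S <= {0..t}" "B \<in> sets (?F)"
   for S and B :: "(real => real^'m) set"
   using that by (intro pair_measureI) (auto simp: sets_restrict_space_iff)
  from y show "(%x. x) -` y Int space (?R \<Otimes>\<^sub>M ?F) \<in> sets (?R \<Otimes>\<^sub>M ?F)"
  proof
   assume "y \<in> {{0} \<times> B | B. B \<in> sets (natural_filtration T 0)}"
   then obtain B where B: "y = {0} \<times> B" "B \<in> sets (natural_filtration T 0)" by blast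
   have "(%x. x) -` y Int space (?R \<Otimes>\<^sub>M ?F) = {0} \<times> B"
    unfolding sp B(1) using t natural_filtration_subset[OF B(2)] by auto
   then show ?thesis using B(2) t sets_natural_filtration_mono[of 0 t T] by (auto intro!: rs)
  next
   assume "y \<in> {{a<..b} \<times> B | a b B. 0 <= a & a < b & b <= T & B \<in> sets (natural_filtration T a)}"
   then obtain a b B where B: "y = {a<..b} \<times> B" "0 <= a" "a < b" "b <= T" "B \<in> sets (natural_filtration T a)" by blast
   have eq: "(%x. x) -` y Int space (?R \<Otimes>\<^sub>M ?F) = ({a<..b} Int {0..t}) \<times> B"
    unfolding sp B(1) using natural_filtration_subset[OF B(5)] by auto
   show ?thesis
   proof (cases "a < t")
    case True
    then have "B \<in> sets (?F)" using B(5) sets_natural_filtration_mono[of a t T] by auto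
    then show ?thesis unfolding eq by (intro rs) auto
   next
    case False
    then have "{a<..b} Int {0..t} = {}" by auto
    then show ?thesis unfolding eq by simp
   qed
  qed
 qed
 from measurable_compose[OF this H] show ?thesis .
qed

lemma predictable_section:
 fixes H :: "real => (real => real^'m::finite) => 'b"
 assumes T: "0 <= T" and w: "w \<in> path_space T" and H: "(%(s, w). H s w) \<in> measurable (predictable_sigma T) N"
 shows "(%s. H s w) \<in> measurable (restrict_space borel {0..T}) N"
proof -
 have "(%(s, w). H s w) \<in> measurable (restrict_space borel {0..T} \<Otimes>\<^sub>M natural_filtration T T) N"
  using T by (intro predictable_progressive[OF T _ H]) auto
 from measurable_compose[OF measurable_Pair2'[OF _, of w] this] w show ?thesis by simp
qed

lemma predictable_section_borel:
 fixes H :: "real => (real => real^'m::finite) => real"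
 assumes T: "0 <= T" and w: "w \<in> path_space T" and H: "(%(s, w). H s w) \<in> borel_measurable (predictable_sigma T)"
 shows "(%s. indicator {0<..T} s * H s w) \<in> borel_measurable borel"
proof -
 have "(%s. indicator {0..T} s *\<^sub>R H s w) \<in> borel_measurable borel"
  using predictable_section[OF T w H] by (subst (asm) borel_measurable_restrict_space_iff) auto
 from borel_measurable_times[OF _ this, of "indicator {0<..T}"]
 have "(%s. indicator {0<..T} s * (indicator {0..T} s *\<^sub>R H s w)) \<in> borel_measurable borel" by simp
 also have "(%s. indicator {0<..T} s * (indicator {0..T} s *\<^sub>R H s w)) = (%s. indicator {0<..T} s * H s w)"
  by (auto simp: indicator_def fun_eq_iff)
 finally show ?thesis .
qed

lemma predictable_integral_adapted:
 fixes H :: "real => (real => real^'m::finite) => real"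
 assumes T: "0 <= T" and t: "t \<in> {0..T}" and H: "(%(s, w). H s w) \<in> borel_measurable (predictable_sigma T)"
 shows "(%w. LINT s:{0<..t}|lborel. H s w) \<in> borel_measurable (natural_filtration T t)"
proof -
 let ?R = "restrict_space lborel {0..t} :: real measure"
 have "finite_measure ?R"
  by (rule finite_measureI) (simp add: emeasure_restrict_space space_restrict_space emeasure_lborel_Icc_eq)
 then interpret sigma_finite_measure ?R by (rule finite_measure.sigma_finite_measure)
 have sR: "sets ?R = sets (restrict_space borel {0..t})" by (rule sets_restrict_space_cong) simp
 have m: "(%(s, w). H s w) \<in> borel_measurable (?R \<Otimes>\<^sub>M natural_filtration T t)"
  using predictable_progressive[OF T t H]
  by (subst measurable_cong_sets[OF sets_pair_measure_cong[OF sR refl] refl])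
 have "(%(s, w). indicator {0<..t} s * H s w) \<in> borel_measurable (?R \<Otimes>\<^sub>M natural_filtration T t)"
 proof -
  have [measurable]: "{0<..t} \<in> sets ?R" by (auto simp: sR sets_restrict_space_iff)
  have "(%x. indicator {0<..t} (fst x)) \<in> borel_measurable (?R \<Otimes>\<^sub>M natural_filtration T t)" by measurable
  from borel_measurable_times[OF this m] show ?thesis by (simp add: case_prod_unfold)
 qed
 from measurable_compose[OF measurable_pair_swap' this]
 have "(%(w, s). indicator {0<..t} s * H s w) \<in> borel_measurable (natural_filtration T t \<Otimes>\<^sub>M ?R)"
  by (simp add: case_prod_unfold)
 then have "(%w. LINT s|?R. indicator {0<..t} s * H s w) \<in> borel_measurable (natural_filtration T t)"
  by (rule borel_measurable_lebesgue_integral)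
 also have "(%w. LINT s|?R. indicator {0<..t} s * H s w) = (%w. LINT s:{0<..t}|lborel. H s w)"
  by (subst integral_restrict_space)
    (auto simp: set_lebesgue_integral_def fun_eq_iff indicator_def intro!: bochner_cong)
 finally show ?thesis .
qed

text \<open>Integrals against the jumps of the indicator of state \<open>j\<close>. On a generating rectangle they
 telescope to increments of the path, which are visibly measurable.\<close>

definition jump_integral ::
  "real => 'm => (real \<times> (real => real^'m::finite) => real) => real => (real => real^'m) => real" where
 "jump_integral T j H t w = (\<Sum>r\<in>jumps T w Int {0<..t}. H (r, w) * (w r - left_limit w r) $ j)"

lemma jump_integral_rect:
 assumes w: "w \<in> path_space T" and t: "t \<in> {0..T}" and ab: "0 <= a" "a <= b"
 shows "jump_integral T j (indicator ({a<..b} \<times> B)) t w = indicator B w * (w (min t b) $ j - w (min t a) $ j)"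
proof -
 have fin: "finite (jumps T w)" by (rule finite_jumps[OF w])
 have "jump_integral T j (indicator ({a<..b} \<times> B)) t w
   = (\<Sum>r\<in>jumps T w Int {0<..t}. if r \<in> {a<..b} then indicator B w * (w r - left_limit w r) $ j else 0)"
  unfolding jump_integral_def by (intro sum.cong) (auto simp: indicator_def)
 also have "... = (\<Sum>r\<in>(jumps T w Int {0<..t}) Int {a<..b}. indicator B w * (w r - left_limit w r) $ j)"
  using fin by (intro sum.inter_restrict[symmetric]) auto
 also have "(jumps T w Int {0<..t}) Int {a<..b} = jumps T w Int {min t a<..min t b}"
  using ab by auto
 also have "(\<Sum>r\<in>jumps T w Int {min t a<..min t b}. indicator B w * (w r - left_limit w r) $ j)
   = indicator B w * (w (min t b) $ j - w (min t a) $ j)"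
 proof -
  have "min t a <= min t b" "0 <= min t a" "min t b <= T" using t ab by auto
  from path_telescope[OF w this(2,1,3), of "%x. x $ j"] show ?thesis
   by (simp only: sum_distrib_left[symmetric] vector_minus_component)
 qed
 finally show ?thesis .
qed

lemma jump_integral_UN:
 assumes "disjoint_family A"
 shows "(%n. \<Sum>i<n. jump_integral T j (indicator (A i)) t w) \<longlonglongrightarrow> jump_integral T j (indicator (\<Union>i. A i)) t w"
proof -
 have eq: "(\<Sum>i<n. jump_integral T j (indicator (A i)) t w) = jump_integral T j (indicator (\<Union>i<n. A i)) t w" for n
 proof -
  have "indicator (\<Union>i<n. A i) x = (\<Sum>i<n. indicator (A i) x :: real)" for x
   using assms by (intro indicator_UN_disjoint) (auto simp: disjoint_family_on_def)
  then show ?thesis unfolding jump_integral_def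
   by (subst sum.swap) (simp only: sum_distrib_right[symmetric])
 qed
 show ?thesis unfolding eq unfolding jump_integral_def
  by (intro tendsto_intros LIMSEQ_indicator_UN)
qed

lemma jump_integral_compl:
 assumes w: "w \<in> path_space T" and t: "t \<in> {0..T}"
 shows "jump_integral T j (indicator ({0..T} \<times> path_space T - A)) t w
  = (w t $ j - w 0 $ j) - jump_integral T j (indicator A) t w"
proof -
 have "jump_integral T j (indicator ({0..T} \<times> path_space T - A)) t w
  = (\<Sum>r\<in>jumps T w Int {0<..t}. (w r - left_limit w r) $ j - indicator A (r, w) * (w r - left_limit w r) $ j)"
  unfolding jump_integral_def using w t by (intro sum.cong) (auto simp: indicator_def)
 also have "... = (\<Sum>r\<in>jumps T w Int {0<..t}. (w r - left_limit w r) $ j) - jump_integral T j (indicator A) t w"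
  unfolding jump_integral_def by (rule sum_subtractf)
 finally show ?thesis using path_telescope[OF w, of 0 t "%x. x $ j"] t by simp
qed

lemma jump_integral_adapted_set:
 assumes T: "0 <= T" and A: "A \<in> sets (predictable_sigma T)" and t: "t \<in> {0..T}"
 shows "jump_integral T j (indicator A) t \<in> borel_measurable (natural_filtration T t)"
 using T A
proof (induction rule: predictable_induct)
 case (zero B)
 have "jump_integral T j (indicator ({0} \<times> B)) t = (%w. 0)"
  unfolding jump_integral_def using jumps_subset by (intro ext sum.neutral) (auto simp: indicator_def)
 then show ?case by simp
next
 case (Ioc a b B)
 have "(%w. indicator B w * (w (min t b) $ j - w (min t a) $ j)) \<in> borel_measurable (natural_filtration T t)"
 proof (cases "a < t")
  case True
  then have [measurable]: "B \<in> sets (natural_filtration T t)"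
   using Ioc(4) sets_natural_filtration_mono[of a t T] by auto
  have [measurable]: "(%w. w (min t b) $ j) \<in> borel_measurable (natural_filtration T t)"
   "(%w. w (min t a) $ j) \<in> borel_measurable (natural_filtration T t)"
   using t Ioc by (auto intro!: measurable_coordinate_nth)
  show ?thesis by measurable
 next
  case False
  then show ?thesis using Ioc by (simp add: min_def)
 qed
 also have "?this \<longleftrightarrow> ?case"
  using Ioc t by (intro measurable_cong) (simp add: jump_integral_rect)
 finally show ?case .
next
 case (compl A)
 have "(%w. (w t $ j - w 0 $ j) - jump_integral T j (indicator A) t w) \<in> borel_measurable (natural_filtration T t)"
  using compl(2) t by (intro borel_measurable_diff measurable_coordinate_nth) auto
 also have "?this \<longleftrightarrow> ?case"
  using t by (intro measurable_cong) (simp add: jump_integral_compl)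
 finally show ?case .
next
 case (union A)
 show ?case
  by (rule borel_measurable_LIMSEQ_real[OF jump_integral_UN[OF union(1)]])
    (use union in \<open>auto intro!: borel_measurable_sum\<close>)
qed

lemma jump_integral_adapted_nonneg:
 fixes H :: "real \<times> (real => real^'m::finite) => real"
 assumes T: "0 <= T" and t: "t \<in> {0..T}" and H: "H \<in> borel_measurable (predictable_sigma T)" "!!x. 0 <= H x"
 shows "jump_integral T j H t \<in> borel_measurable (natural_filtration T t)"
 using H
proof (induction rule: borel_measurable_induct_real)
 case (set A)
 then show ?case by (rule jump_integral_adapted_set[OF T _ t])
next
 case (mult u c)
 have "jump_integral T j (%x. c * u x) t = (%w. c * jump_integral T j u t w)"
  by (simp add: jump_integral_def fun_eq_iff sum_distrib_left mult.assoc)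
 then show ?case using mult.IH by simp
next
 case (add u v)
 have "jump_integral T j (%x. v x + u x) t = (%w. jump_integral T j v t w + jump_integral T j u t w)"
  by (simp add: jump_integral_def fun_eq_iff sum.distrib distrib_right)
 then show ?case using add.IH by simp
next
 case (seq U)
 show ?case
 proof (rule borel_measurable_LIMSEQ_real)
  fix w :: "real => real^'m" assume w: "w \<in> space (natural_filtration T t)"
  show "(%i. jump_integral T j (U i) t w) \<longlonglongrightarrow> jump_integral T j H t w"
   unfolding jump_integral_def
  proof (intro tendsto_sum tendsto_mult tendsto_const)
   fix r assume "r \<in> jumps T w Int {0<..t}"
   then have "(r, w) \<in> space (predictable_sigma T)" using w T t by auto
   then show "(%i. U i (r, w)) \<longlonglongrightarrow> H (r, w)" by (rule seq.hyps)
  qed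
 qed (rule seq.IH)
qed

lemma jump_integral_adapted:
 fixes H :: "real \<times> (real => real^'m::finite) => real"
 assumes T: "0 <= T" and t: "t \<in> {0..T}" and H: "H \<in> borel_measurable (predictable_sigma T)"
 shows "jump_integral T j H t \<in> borel_measurable (natural_filtration T t)"
proof -
 have "jump_integral T j H t = (%w. jump_integral T j (%x. max 0 (H x)) t w - jump_integral T j (%x. max 0 (- H x)) t w)"
  unfolding jump_integral_def sum_subtractf[symmetric] left_diff_distrib[symmetric]
  by (intro ext sum.cong) auto
 moreover have "jump_integral T j (%x. max 0 (H x)) t \<in> borel_measurable (natural_filtration T t)"
  "jump_integral T j (%x. max 0 (- H x)) t \<in> borel_measurable (natural_filtration T t)"
  using H by (auto intro!: jump_integral_adapted_nonneg[OF T t])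
 ultimately show ?thesis by simp
qed

section \<open>The reference chain\<close>

text \<open>\<open>Q0\<close> is the all-ones matrix minus \<open>m\<close> times the identity, so its powers are those of \<open>-m\<close> times a projection.\<close>

lemma transition_matrix_Q0:
 fixes i j :: "'m::finite"
 shows "transition_matrix Q0 h $ i $ j
  = (if i = j then exp (- real CARD('m) * h) else 0) + (1 - exp (- real CARD('m) * h)) / real CARD('m)"
proof -
 let ?m = "real CARD('m)"
 define d where "d i j = (if i = j then 1 else 0) - 1 / ?m" for i j :: 'm
 have pw: "((((**) Q0) ^^ n) (mat 1)) $ i $ j = (- ?m) ^ n * d i j + (if n = 0 then 1 / ?m else 0)" for n and i j :: 'm
 proof (induction n arbitrary: i)
  case 0
  then show ?case by (simp add: mat_def d_def)
 next
  case (Suc n)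
  define A where "A = (((**) Q0) ^^ n) (mat 1 :: real^'m^'m)"
  have "(Q0 ** A) $ i $ j = (\<Sum>k\<in>UNIV. A $ k $ j - (if k = i then ?m * A $ k $ j else 0))"
   unfolding matrix_matrix_mult_def by (simp, intro sum.cong, auto simp: Q0_def algebra_simps)
  also have "... = (\<Sum>k\<in>UNIV. A $ k $ j) - ?m * A $ i $ j" by (simp add: sum_subtractf)
  also have "(\<Sum>k\<in>UNIV. A $ k $ j) = (if n = 0 then 1 else 0)"
   using Suc.IH by (simp add: A_def sum.distrib sum_distrib_left[symmetric] d_def sum_subtractf)
  also have "A $ i $ j = (- ?m) ^ n * d i j + (if n = 0 then 1 / ?m else 0)"
   unfolding A_def by (rule Suc.IH)
  finally show ?case by (cases "n = 0") (simp_all add: A_def distrib_left)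
 qed
 have e: "(%n. (- ?m * h) ^ n / fact n) sums exp (- ?m * h)"
  using exp_converges[of "- ?m * h"] by (simp add: divide_inverse mult.commute)
 have z: "(%n. if n = 0 then 1 / ?m else 0) sums (1 / ?m)"
  using sums_single[of 0 "%_. 1 / ?m"] by simp
 have "(%n. d i j * ((- ?m * h) ^ n / fact n) + (if n = 0 then 1 / ?m else 0)) sums (d i j * exp (- ?m * h) + 1 / ?m)"
  by (intro sums_add sums_mult e z)
 also have "(%n. d i j * ((- ?m * h) ^ n / fact n) + (if n = 0 then 1 / ?m else 0))
   = (%n. h ^ n / fact n * ((((**) Q0) ^^ n) (mat 1)) $ i $ j)"
 proof (rule ext)
  fix n
  show "d i j * ((- ?m * h) ^ n / fact n) + (if n = 0 then 1 / ?m else 0)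
    = h ^ n / fact n * ((((**) Q0) ^^ n) (mat 1)) $ i $ j"
   unfolding pw power_mult_distrib[of "- ?m" h]
   by (cases "n = 0") (simp_all add: algebra_simps add_divide_distrib)
 qed
 finally have "transition_matrix Q0 h $ i $ j = d i j * exp (- ?m * h) + 1 / ?m"
  by (simp add: transition_matrix_def sums_iff)
 then show ?thesis by (simp add: d_def algebra_simps diff_divide_distrib)
qed

text \<open>The off-diagonal entries of \<open>exp (h Q0)\<close>, for \<open>m\<close> states.\<close>

definition enter_prob :: "real => real => real" where
 "enter_prob m h = (1 - exp (- m * h)) / m"

locale reference_chain =
 fixes T :: real and p0 :: "real^'m::finite" and P :: "(real => real^'m) measure"
 assumes T: "0 < T" and ref: "reference_measure T p0 P"
begin

abbreviation "F \<equiv> (natural_filtration T :: real => (real => real^'m) measure)"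

abbreviation N :: "(real => real^'m) => nat" where "N w \<equiv> card (jumps T w)"

lemma sets_P: "sets P = sets (F T)"
 using ref by (simp add: reference_measure_def)

lemma space_P [simp]: "space P = path_space T"
 using sets_eq_imp_space_eq[OF sets_P] by simp

sublocale prob_space P
 using ref by (simp add: reference_measure_def)

lemma prob_path: "prob (path_space T) = 1"
 using prob_space by simp

lemma F_measurable:
 assumes "f \<in> measurable (F s) M" "s <= T" shows "f \<in> measurable P M"
 using measurable_natural_filtration_mono[OF assms] by (simp add: measurable_cong_sets[OF sets_P refl])

lemma X_measurable: "s \<in> {0..T} ==> (%w. w s $ j) \<in> borel_measurable P"
 by (rule F_measurable[OF measurable_coordinate_nth, of s T]) auto

lemma X_bounds: "w \<in> path_space T ==> s \<in> {0..T} ==> w s $ j \<in> {0, 1}"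
 using state_nth[OF path_in_state_space] by blast

lemma Xm_bounds: "w \<in> path_space T ==> s \<in> {0..T} ==> left_limit w s $ j \<in> {0, 1}"
 using state_nth[OF path_left_limit_state] by blast

lemma integrable_bounded:
 fixes f :: "(real => real^'m) => real"
 assumes "f \<in> borel_measurable P" "!!w. w \<in> path_space T ==> \<bar>f w\<bar> <= K"
 shows "integrable P f"
 using assms by (intro integrable_const_bound[of _ K]) auto

text \<open>The Markov property, tested against bounded functions of the past.\<close>

lemma markov:
 assumes st: "0 <= s" "s <= t" "t <= T" and Z: "Z \<in> borel_measurable (F s)"
  and K: "!!w. w \<in> path_space T ==> \<bar>Z w\<bar> <= K"
 shows "expectation (%w. Z w * w t $ j)
  = exp (- real CARD('m) * (t - s)) * expectation (%w. Z w * w s $ j) + enter_prob (real CARD('m)) (t - s) * expectation Z"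
proof -
 have sub: "subalgebra P (F s)"
  unfolding subalgebra_def using sets_natural_filtration_mono[of s T T] st sets_P by auto
 interpret C: finite_measure_subalgebra P "F s" by unfold_locales (rule sub)
 let ?g = "indicat_real {w \<in> space P. w t = unit_state j}"
 have g: "?g w = w t $ j" if "w \<in> path_space T" for w
  using that path_in_state_space[OF that, of t] st by (auto simp: indicator_def state_space_def axis_nth axis_eq_axis)
 note g' = g[unfolded space_P]
 have gm: "?g \<in> borel_measurable P"
  using X_measurable[of t j] st by (subst measurable_cong[where g="%w. w t $ j"]) (auto simp: g')
 have ZP: "Z \<in> borel_measurable P" using F_measurable[OF Z] st by simp
 have Zi: "integrable P Z" by (rule integrable_bounded[OF ZP K])
 have Xb: "\<bar>Z w * w u $ j\<bar> <= K" if "w \<in> path_space T" "u \<in> {0..T}" for w u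
  using K[OF that(1)] X_bounds[OF that, of j] order_trans[OF abs_ge_zero K[OF that(1)]] by (auto simp: abs_mult)
 have ZX: "integrable P (%w. Z w * w u $ j)" if "u \<in> {0..T}" for u
  by (rule integrable_bounded[of _ K]) (use ZP X_measurable[OF that] Xb that in auto)
 have Zg: "integrable P (%w. Z w * ?g w)"
  using ZX[of t] st by (subst Bochner_Integration.integrable_cong[where g="%w. Z w * w t $ j"]) (auto simp: g')
 have "expectation (%w. Z w * w t $ j) = expectation (%w. Z w * ?g w)"
  by (intro bochner_cong) (auto simp: g')
 also have "... = expectation (%w. Z w * real_cond_exp P (F s) ?g w)"
  by (rule C.real_cond_exp_intg(2)[OF Zg Z gm, symmetric])
 also have "... = expectation (%w. exp (- real CARD('m) * (t - s)) * (Z w * w s $ j) + enter_prob (real CARD('m)) (t - s) * Z w)"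
 proof (rule integral_cong_AE)
  have "AE w in P. real_cond_exp P (F s) ?g w = (w s v* transition_matrix Q0 (t - s)) $ j"
   using ref st by (simp add: reference_measure_def)
  then show "AE w in P. Z w * real_cond_exp P (F s) ?g w
    = exp (- real CARD('m) * (t - s)) * (Z w * w s $ j) + enter_prob (real CARD('m)) (t - s) * Z w"
  proof (rule AE_mp, intro AE_I2 impI)
   fix w assume w: "w \<in> space P" and e: "real_cond_exp P (F s) ?g w = (w s v* transition_matrix Q0 (t - s)) $ j"
   obtain i where i: "w s = axis i 1" using path_in_state_space[of w T s] w st by (auto elim: state_cases)
   have "(w s v* transition_matrix Q0 (t - s)) $ j = exp (- real CARD('m) * (t - s)) * w s $ j + enter_prob (real CARD('m)) (t - s)"
    by (simp add: i axis_vec_matrix transition_matrix_Q0 axis_nth enter_prob_def)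
   then show "Z w * real_cond_exp P (F s) ?g w = exp (- real CARD('m) * (t - s)) * (Z w * w s $ j) + enter_prob (real CARD('m)) (t - s) * Z w"
    unfolding e by (simp add: algebra_simps)
  qed
  show "(%w. Z w * real_cond_exp P (F s) ?g w) \<in> borel_measurable P"
   using ZP borel_measurable_cond_exp2 by (intro borel_measurable_times) auto
  show "(%w. exp (- real CARD('m) * (t - s)) * (Z w * w s $ j) + enter_prob (real CARD('m)) (t - s) * Z w) \<in> borel_measurable P"
   using ZP X_measurable[of s j] st by auto
 qed
 also have "... = exp (- real CARD('m) * (t - s)) * expectation (%w. Z w * w s $ j) + enter_prob (real CARD('m)) (t - s) * expectation Z"
  using Zi ZX[of s] st by simp
 finally show ?thesis .
qed

lemma changes_eq:
 assumes w: "w \<in> path_space T" and "s \<in> {0..T}" "t \<in> {0..T}"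
 shows "(\<Sum>j\<in>UNIV. (1 - w s $ j) * w t $ j) = (if w s = w t then 0 else 1)"
proof -
 obtain i where i: "w s = axis i 1" using path_in_state_space[OF assms(1,2)] by (rule state_cases)
 obtain k where k: "w t = axis k 1" using path_in_state_space[OF assms(1,3)] by (rule state_cases)
 show ?thesis by (simp add: i k axis_nth if_mult_zero axis_eq_axis)
qed

lemma markov_change:
 assumes st: "0 <= s" "s <= t" "t <= T" and Z: "Z \<in> borel_measurable (F s)"
  and K: "!!w. w \<in> path_space T ==> \<bar>Z w\<bar> <= K"
 shows "expectation (%w. Z w * (1 - w s $ j) * w t $ j) = enter_prob (real CARD('m)) (t - s) * expectation (%w. Z w * (1 - w s $ j))"
proof -
 have "expectation (%w. (Z w * (1 - w s $ j)) * w t $ j)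
  = exp (- real CARD('m) * (t - s)) * expectation (%w. (Z w * (1 - w s $ j)) * w s $ j) + enter_prob (real CARD('m)) (t - s) * expectation (%w. Z w * (1 - w s $ j))"
 proof (rule markov[OF st])
  show "(%w. Z w * (1 - w s $ j)) \<in> borel_measurable (F s)"
   using Z measurable_coordinate_nth[where s=s and t=s and T=T and j=j] st by auto
  show "\<bar>Z w * (1 - w s $ j)\<bar> <= K" if "w \<in> path_space T" for w
   using K[OF that] X_bounds[OF that, of s j] st order_trans[OF abs_ge_zero K[OF that]] by auto
 qed
 also have "expectation (%w. (Z w * (1 - w s $ j)) * w s $ j) = expectation (%w. 0)"
  using X_bounds[of _ s j] st by (intro bochner_cong) fastforce+
 finally show ?thesis by simp
qed

lemma enter_prob_bounds: "0 <= h ==> 0 <= enter_prob (real CARD('m)) h" "0 <= h ==> real CARD('m) * enter_prob (real CARD('m)) h <= real CARD('m) * h" "0 <= h ==> enter_prob (real CARD('m)) h <= h"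
proof -
 assume h: "0 <= h"
 have mpos: "real CARD('m) > 0" by simp
 have "1 + (- real CARD('m) * h) <= exp (- real CARD('m) * h)" by (rule exp_ge_add_one_self)
 then have "real CARD('m) * enter_prob (real CARD('m)) h <= real CARD('m) * h" by (simp add: enter_prob_def)
 then show "real CARD('m) * enter_prob (real CARD('m)) h <= real CARD('m) * h" "enter_prob (real CARD('m)) h <= h" using mpos by auto
 show "0 <= enter_prob (real CARD('m)) h" using h mpos by (simp add: enter_prob_def)
qed

text \<open>Exponential moments of the number of jumps. The expectation of \<open>C\<close> to the number of changes along
 a grid is controlled by conditioning from the right; Fatou passes to the jumps.\<close>

lemma grid_moment:
 fixes C :: real
 assumes C: "1 <= C" and n: "0 < n" and k: "k <= n"
 defines "t \<equiv> %k. real k * T / real n"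
  and "z \<equiv> %k w. \<Prod>l<k. (if w (real l * T / real n) = w (real (Suc l) * T / real n) then 1 else C)"
 shows "z k \<in> borel_measurable (F (t k)) & expectation (z k) <= (1 + (C - 1) * real CARD('m) * T / n) ^ k
  & (\<forall>w\<in>path_space T. 0 <= z k w & z k w <= C ^ k)"
 using k
proof (induction k)
 case 0
 show ?case by (simp add: z_def prob_space)
next
 case (Suc k)
 then have IH: "z k \<in> borel_measurable (F (t k))" "expectation (z k) <= (1 + (C - 1) * real CARD('m) * T / n) ^ k"
  "!!w. w \<in> path_space T ==> 0 <= z k w & z k w <= C ^ k" by auto
 have "real (Suc k) <= real n" using Suc.prems by simp
 then have "real (Suc k) * T / real n <= real n * T / real n"
  using T by (intro divide_right_mono mult_right_mono) auto
 then have tS: "t (Suc k) <= T" using n by (simp add: t_def)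
 have tk: "0 <= t k" "t k <= t (Suc k)" "t (Suc k) <= T" "t (Suc k) - t k = T / n"
  using T n tS by (auto simp: t_def field_simps)
 then have tI: "t k \<in> {0..T}" "t (Suc k) \<in> {0..T}" by auto
 define ch where "ch w = (\<Sum>j\<in>UNIV. (1 - w (t k) $ j) * w (t (Suc k)) $ j)" for w :: "real => real^'m"
 have zS: "z (Suc k) w = z k w * (1 + (C - 1) * ch w)" if "w \<in> path_space T" for w
  using changes_eq[OF that tI] by (simp add: z_def ch_def t_def)
 have meas: "(%w. z k w * (1 + (C - 1) * ch w)) \<in> borel_measurable (F (t (Suc k)))"
 proof -
  have [measurable]: "z k \<in> borel_measurable (F (t (Suc k)))"
   by (rule measurable_natural_filtration_mono[OF IH(1) tk(2)])
  have [measurable]: "(%w. w (t k) $ j) \<in> borel_measurable (F (t (Suc k)))"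
   "(%w. w (t (Suc k)) $ j) \<in> borel_measurable (F (t (Suc k)))" for j
   using tk by (auto intro!: measurable_coordinate_nth)
  show ?thesis unfolding ch_def by measurable
 qed
 have r1: "z (Suc k) \<in> borel_measurable (F (t (Suc k)))"
  using meas by (subst measurable_cong[OF zS]) auto
 have r3: "0 <= z (Suc k) w & z (Suc k) w <= C ^ Suc k" if w: "w \<in> path_space T" for w
 proof -
  have "ch w \<in> {0, 1}" using changes_eq[OF w tI] by (simp add: ch_def)
  then have "0 <= 1 + (C - 1) * ch w" "1 + (C - 1) * ch w <= C" using C by auto
  then show ?thesis using IH(3)[OF w] C zS[OF w]
   by (auto simp: mult.commute[of C] intro!: mult_nonneg_nonneg mult_mono)
 qed
 have r2: "expectation (z (Suc k)) <= (1 + (C - 1) * real CARD('m) * T / n) ^ Suc k"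
 proof -
  have zP: "z k \<in> borel_measurable P" using F_measurable[OF IH(1)] tI by simp
  have zi: "integrable P (z k)"
   by (rule integrable_bounded[OF zP, of "C ^ k"]) (use IH(3) in auto)
  have bd: "\<bar>z k w\<bar> <= C ^ k" if "w \<in> path_space T" for w using IH(3)[OF that] by auto
  have b1: "\<bar>z k w * (1 - w (t k) $ j)\<bar> <= C ^ k" if w: "w \<in> path_space T" for w j
   using bd[OF w] X_bounds[OF w tI(1), of j] order_trans[OF abs_ge_zero bd[OF w]] by auto
  have b2: "\<bar>z k w * (1 - w (t k) $ j) * w (t (Suc k)) $ j\<bar> <= C ^ k" if w: "w \<in> path_space T" for w j
   using b1[OF w, of j] X_bounds[OF w tI(2), of j] order_trans[OF abs_ge_zero bd[OF w]] by auto
  note [measurable] = zP X_measurable[OF tI(1)] X_measurable[OF tI(2)]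
  have i1: "integrable P (%w. z k w * (1 - w (t k) $ j))" for j
   by (rule integrable_bounded[OF _ b1]) measurable
  have i2: "integrable P (%w. z k w * (1 - w (t k) $ j) * w (t (Suc k)) $ j)" for j
   by (rule integrable_bounded[OF _ b2]) measurable
  have sm: "(\<Sum>j\<in>UNIV. 1 - w (t k) $ j) = real CARD('m) - 1" if w: "w \<in> path_space T" for w :: "real => real^'m"
  proof -
   obtain i where "w (t k) = axis i 1" using path_in_state_space[OF w tI(1)] by (rule state_cases)
   then show ?thesis by (simp add: sum_subtractf axis_nth)
  qed
  have "expectation (z (Suc k)) = expectation (%w. z k w + (C - 1) * (\<Sum>j\<in>UNIV. z k w * (1 - w (t k) $ j) * w (t (Suc k)) $ j))"
   by (intro bochner_cong refl)
     (simp add: zS ch_def sum_distrib_left algebra_simps)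
  also have "... = expectation (z k) + (C - 1) * (\<Sum>j\<in>UNIV. enter_prob (real CARD('m)) (T / n) * expectation (%w. z k w * (1 - w (t k) $ j)))"
   using zi i2 markov_change[OF tk(1,2,3) IH(1) bd] by (simp add: tk(4))
  also have "(\<Sum>j\<in>UNIV. enter_prob (real CARD('m)) (T / n) * expectation (%w. z k w * (1 - w (t k) $ j)))
    = enter_prob (real CARD('m)) (T / n) * expectation (%w. \<Sum>j\<in>UNIV. z k w * (1 - w (t k) $ j))"
   using i1 by (simp add: sum_distrib_left)
  also have "expectation (%w. \<Sum>j\<in>UNIV. z k w * (1 - w (t k) $ j)) = expectation (%w. (real CARD('m) - 1) * z k w)"
   by (intro bochner_cong refl) (simp add: sum_distrib_left[symmetric] sm)
  also have "... = (real CARD('m) - 1) * expectation (z k)" by simp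
  finally have e: "expectation (z (Suc k)) = (1 + (C - 1) * (enter_prob (real CARD('m)) (T / n) * (real CARD('m) - 1))) * expectation (z k)"
   by (simp add: algebra_simps)
  have Tn: "0 <= T / n" using T by simp
  have ep: "0 <= enter_prob (real CARD('m)) (T / n)" by (rule enter_prob_bounds(1)[OF Tn])
  have m1: "1 <= real CARD('m)" by (simp add: Suc_le_eq)
  have "enter_prob (real CARD('m)) (T / n) * (real CARD('m) - 1) <= real CARD('m) * enter_prob (real CARD('m)) (T / n)"
   unfolding mult.commute[of "real CARD('m)"] by (intro mult_left_mono) (auto simp: ep)
  then have mk1: "enter_prob (real CARD('m)) (T / n) * (real CARD('m) - 1) <= real CARD('m) * (T / n)"
   using enter_prob_bounds(2)[OF Tn] by linarith
  have mk2: "0 <= enter_prob (real CARD('m)) (T / n) * (real CARD('m) - 1)"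
   using ep m1 by (intro mult_nonneg_nonneg) auto
  note mk = mk1 mk2
  have "expectation (z (Suc k)) <= (1 + (C - 1) * real CARD('m) * T / n) * (1 + (C - 1) * real CARD('m) * T / n) ^ k"
   unfolding e
  proof (rule mult_mono)
   have "(C - 1) * (enter_prob (real CARD('m)) (T / n) * (real CARD('m) - 1)) <= (C - 1) * (real CARD('m) * (T / n))"
    using mk C by (intro mult_left_mono) auto
   then show "1 + (C - 1) * (enter_prob (real CARD('m)) (T / n) * (real CARD('m) - 1)) <= 1 + (C - 1) * real CARD('m) * T / n" by simp
   show "0 <= expectation (z k)" by (rule bochner_nonneg) (use IH(3) in auto)
   show "0 <= 1 + (C - 1) * real CARD('m) * T / n" using C T by auto
  qed (rule IH(2))
  then show ?thesis by (simp only: power_Suc)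
 qed
 show ?case by (intro conjI ballI r1 r2 r3)
qed

lemma entering_eq:
 assumes w: "w \<in> path_space T" and r: "r \<in> {0..T}"
 shows "(1 - left_limit w r $ j) * (w r - left_limit w r) $ j = (1 - left_limit w r $ j) * w r $ j"
 using Xm_bounds[OF w r, of j] by auto

lemma entering_sum:
 assumes w: "w \<in> path_space T" and r: "r \<in> jumps T w"
 shows "(\<Sum>j\<in>UNIV. f j * ((1 - left_limit w r $ j) * w r $ j)) = (\<Sum>j\<in>UNIV. f j * w r $ j)"
proof -
 have r': "r \<in> {0..T}" using r jumps_subset[of T w] by auto
 obtain i where i: "left_limit w r = axis i 1" using path_left_limit_state[OF w r'] by (rule state_cases)
 obtain k where k: "w r = axis k 1" using path_in_state_space[OF w r'] by (rule state_cases)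
 have "i ~= k" using r i k by (auto simp: jumps_def)
 then show ?thesis by (intro sum.cong) (auto simp: i k axis_nth)
qed

lemma Xm_predictable: "(%(t, w). left_limit w t $ (j::'m)) \<in> borel_measurable (predictable_sigma T)"
 using T by (intro predictable_left_limit_path) auto

lemma N_measurable: "(%w. real (N w)) \<in> borel_measurable P"
proof -
 have H: "(%(t, w). 1 - left_limit w t $ (j::'m)) \<in> borel_measurable (predictable_sigma T)" for j
  using borel_measurable_diff[OF borel_measurable_const Xm_predictable[of j], of 1]
  by (simp add: case_prod_unfold)
 have "(%w. \<Sum>j\<in>UNIV. jump_integral T j (%(t, w). 1 - left_limit w t $ j) T w) \<in> borel_measurable P"
  using T by (intro borel_measurable_sum F_measurable[OF jump_integral_adapted[OF _ _ H]]) auto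
 also have "?this \<longleftrightarrow> ?thesis"
 proof (rule measurable_cong)
  fix w assume "w \<in> space P"
  then have w: "w \<in> path_space T" by simp
  have J: "jumps T w Int {0<..T} = jumps T w" using jumps_subset by blast
  have "(\<Sum>j\<in>UNIV. jump_integral T j (%(t, w). 1 - left_limit w t $ j) T w)
   = (\<Sum>r\<in>jumps T w. \<Sum>j\<in>UNIV. (1 - left_limit w r $ j) * (w r - left_limit w r) $ j)"
   unfolding jump_integral_def J by (subst sum.swap) simp
  also have "... = (\<Sum>r\<in>jumps T w. 1)"
  proof (intro sum.cong refl)
   fix r assume r: "r \<in> jumps T w"
   then have r': "r \<in> {0..T}" using jumps_subset[of T w] by auto
   obtain k where k: "w r = axis k 1" using path_in_state_space[OF w r'] by (rule state_cases)
   show "(\<Sum>j\<in>UNIV. (1 - left_limit w r $ j) * (w r - left_limit w r) $ j) = 1"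
    unfolding entering_eq[OF w r'] using entering_sum[OF w r, of "%_. 1"] by (simp add: k axis_nth)
  qed
  finally show "(\<Sum>j\<in>UNIV. jump_integral T j (%(t, w). 1 - left_limit w t $ j) T w) = real (N w)" by simp
 qed
 finally show ?thesis .
qed

lemma exp_moment:
 fixes C :: real
 assumes C: "1 <= C"
 shows "integrable P (%w. C ^ N w)"
proof -
 define z where "z n w = (\<Prod>l<n. (if w (real l * T / real n) = w (real (Suc l) * T / real n) then 1 else C))"
  for n and w :: "real => real^'m"
 define B where "B = exp ((C - 1) * real CARD('m) * T)"
 have g: "z n \<in> borel_measurable P" "expectation (z n) <= B" "!!w. w \<in> path_space T ==> 0 <= z n w & z n w <= C ^ n"
  if n: "0 < n" for n
 proof -
  note gm = grid_moment[OF C n order_refl, folded z_def]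
  have "real n * T / real n = T" using n by simp
  then have "z n \<in> borel_measurable (F T)" using gm[THEN conjunct1] by (simp only:)
  then show "z n \<in> borel_measurable P" by (rule F_measurable) simp
  have "expectation (z n) <= (1 + ((C - 1) * real CARD('m) * T) / n) ^ n" using gm by blast
  also have "... <= B"
   unfolding B_def
  proof (rule exp_ge_one_plus_x_over_n_power_n[OF _ n])
   have "0 <= (C - 1) * real CARD('m) * T" using C T by simp
   then show "- real n <= (C - 1) * real CARD('m) * T" by linarith
  qed
  finally show "expectation (z n) <= B" .
  show "!!w. w \<in> path_space T ==> 0 <= z n w & z n w <= C ^ n" using gm by blast
 qed
 have meas: "(%w. C ^ N w) \<in> borel_measurable P"
 proof -
  have "(%w. real (N w) * ln C) \<in> borel_measurable P"
   by (intro borel_measurable_times N_measurable borel_measurable_const)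
  then have "(%w. exp (real (N w) * ln C)) \<in> borel_measurable P"
   by (rule measurable_compose[OF _ borel_measurable_exp])
  moreover have "exp (real n * ln C) = C ^ n" for n using C by (simp add: exp_of_nat_mult)
  ultimately show ?thesis by simp
 qed
 have le: "ennreal (C ^ N w) <= liminf (%n. ennreal (z (Suc n) w))" if w: "w \<in> path_space T" for w
 proof (rule Liminf_bounded)
  have "eventually (%n. N w <= card {k. k < n & w (real k * T / real n) ~= w (real (Suc k) * T / real n)}) sequentially"
   by (rule jumps_le_grid_changes[OF w T])
  then have "eventually (%n. N w <= card {k. k < Suc n & w (real k * T / real (Suc n)) ~= w (real (Suc k) * T / real (Suc n))}) sequentially"
   by (rule eventually_compose_filterlim[OF _ filterlim_Suc])
  then show "eventually (%n. ennreal (C ^ N w) <= ennreal (z (Suc n) w)) sequentially"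
  proof eventually_elim
   fix n
   let ?S = "{k. k < Suc n & w (real k * T / real (Suc n)) ~= w (real (Suc k) * T / real (Suc n))}"
   assume "N w <= card ?S"
   then have "C ^ N w <= C ^ card ?S" using C by (rule power_increasing)
   also have "C ^ card ?S = z (Suc n) w"
   proof -
    have pr: "(\<Prod>l<n. if E l then 1 else C) = C ^ card {k. k < n & \<not> E k}" for E :: "nat => bool" and n
    proof -
     have "{..<n} Int - {x. E x} = {k. k < n & \<not> E k}" by auto
     then show ?thesis by (simp add: prod.If_cases)
    qed
    show ?thesis unfolding z_def by (rule pr[symmetric])
   qed
   finally show "ennreal (C ^ N w) <= ennreal (z (Suc n) w)" by (rule ennreal_leI)
  qed
 qed
 have "(\<integral>\<^sup>+w. ennreal (C ^ N w) \<partial>P) <= (\<integral>\<^sup>+w. liminf (%n. ennreal (z (Suc n) w)) \<partial>P)"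
  using le by (intro nn_integral_mono) auto
 also have "... <= liminf (%n. \<integral>\<^sup>+w. ennreal (z (Suc n) w) \<partial>P)"
  using g(1) by (intro nn_integral_liminf) auto
 also have "... <= ennreal B"
 proof (rule Liminf_le)
  have "(\<integral>\<^sup>+w. ennreal (z (Suc n) w) \<partial>P) <= ennreal B" for n
  proof -
   have "integrable P (z (Suc n))"
    by (rule integrable_bounded[OF g(1), of _ "C ^ Suc n"]) (use g(3)[of "Suc n"] in auto)
   then have "(\<integral>\<^sup>+w. ennreal (z (Suc n) w) \<partial>P) = ennreal (expectation (z (Suc n)))"
    using g(3)[of "Suc n"] by (intro nn_integral_eq_integral) auto
   then show ?thesis using g(2)[of "Suc n"] by (simp add: ennreal_leI)
  qed
  then show "eventually (%n. (\<integral>\<^sup>+w. ennreal (z (Suc n) w) \<partial>P) <= ennreal B) sequentially" by simp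
 qed simp
 finally have "(\<integral>\<^sup>+w. ennreal (C ^ N w) \<partial>P) < \<infinity>" by (rule order_le_less_trans) simp
 then show ?thesis using meas C by (intro integrableI_nonneg) auto
qed

text \<open>A jump at a fixed time has probability zero, because the probability of a change over a short
 interval vanishes with its length; the left limit is reached along a sequence.\<close>

lemma left_approx:
 assumes w: "w \<in> path_space T" and u: "u \<in> {0<..T}" and v: "!!n. v n < u" "v \<longlonglongrightarrow> u"
 shows "(%n. w (v n) $ j) \<longlonglongrightarrow> left_limit w u $ j"
proof -
 have "eventually (%s. w s = left_limit w u) (at_left u)" by (rule path_left_eventually(1)[OF w u])
 then have "((%s. w s $ j) \<longlongrightarrow> left_limit w u $ j) (at_left u)"
  by (intro tendsto_eventually) (auto elim: eventually_mono)
 moreover have "filterlim v (at_left u) sequentially"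
  unfolding filterlim_at using v by (simp add: less_imp_neq)
 ultimately show ?thesis by (rule filterlim_compose)
qed

lemma AE_left_limit:
 assumes u: "u \<in> {0..T}"
 shows "AE w in P. left_limit w u = w u"
proof (cases "u = 0")
 case False
 then have u': "u \<in> {0<..T}" using u by auto
 define v where "v n = u - u / real (n + 2)" for n :: nat
 have v: "v n < u" "0 <= v n" for n using u' by (auto simp: v_def field_simps)
 have "(%n. u - u / real (n + 2)) \<longlonglongrightarrow> u - 0"
  by (intro tendsto_intros LIMSEQ_ignore_initial_segment[OF lim_const_over_n])
 then have vl: "v \<longlonglongrightarrow> u" by (simp add: v_def[abs_def])
 have vT: "v n \<in> {0..T}" for n using v[of n] u' by auto
 have lm: "(%w. left_limit w u $ j) \<in> borel_measurable P" for j
  by (rule borel_measurable_LIMSEQ_real[where u="%n w. w (v n) $ j"])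
    (use left_approx[OF _ u' v(1) vl] X_measurable[OF vT] in auto)
 have "expectation (%w. (1 - left_limit w u $ j) * w u $ j) = 0" for j
 proof -
  have "(%n. expectation (%w. (1 - w (v n) $ j) * w u $ j)) \<longlonglongrightarrow> expectation (%w. (1 - left_limit w u $ j) * w u $ j)"
  proof (rule integral_dominated_convergence[where w="%_. 1"])
   show "(%w. (1 - left_limit w u $ j) * w u $ j) \<in> borel_measurable P"
    using lm X_measurable[OF u] by auto
   show "(%w. (1 - w (v n) $ j) * w u $ j) \<in> borel_measurable P" for n
    using X_measurable[OF vT] X_measurable[OF u] by auto
   show "AE w in P. (%n. (1 - w (v n) $ j) * w u $ j) \<longlonglongrightarrow> (1 - left_limit w u $ j) * w u $ j"
    by (intro AE_I2 tendsto_mult tendsto_diff tendsto_const left_approx[OF _ u' v(1) vl]) auto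
   show "AE w in P. norm ((1 - w (v n) $ j) * w u $ j) <= 1" for n
   proof (rule AE_I2)
    fix w assume "w \<in> space P"
    then show "norm ((1 - w (v n) $ j) * w u $ j) <= 1"
     using X_bounds[OF _ vT, of w n j] X_bounds[OF _ u, of w j] by auto
   qed
  qed auto
  moreover have "(%n. expectation (%w. (1 - w (v n) $ j) * w u $ j)) \<longlonglongrightarrow> 0"
  proof (rule tendsto_sandwich)
   have e: "expectation (%w. (1 - w (v n) $ j) * w u $ j) = enter_prob (real CARD('m)) (u - v n) * expectation (%w. 1 - w (v n) $ j)" for n
    using markov_change[of "v n" u "%_. 1" 1 j] v[of n] u' by simp
   have b: "0 <= expectation (%w. 1 - w (v n) $ j)" "expectation (%w. 1 - w (v n) $ j) <= 1" for n
   proof -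
    have x: "0 <= 1 - w (v n) $ j & 1 - w (v n) $ j <= 1" if "w \<in> path_space T" for w
     using X_bounds[OF that vT, of n j] by auto
    have i: "integrable P (%w. 1 - w (v n) $ j)"
     by (rule integrable_bounded[of _ 1]) (use X_measurable[OF vT] x in \<open>auto simp: abs_le_iff\<close>)
    show "0 <= expectation (%w. 1 - w (v n) $ j)"
     by (rule bochner_nonneg) (use x in auto)
    have "expectation (%w. 1 - w (v n) $ j) <= expectation (%w. 1)"
     by (rule integral_mono[OF i]) (use x in auto)
    then show "expectation (%w. 1 - w (v n) $ j) <= 1" by (simp add: prob_path)
   qed
   have k: "0 <= enter_prob (real CARD('m)) (u - v n)" "enter_prob (real CARD('m)) (u - v n) <= u - v n" for n using enter_prob_bounds[of "u - v n"] v[of n] by auto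
   show "eventually (%n. 0 <= expectation (%w. (1 - w (v n) $ j) * w u $ j)) sequentially"
    unfolding e using k b by simp
   show "eventually (%n. expectation (%w. (1 - w (v n) $ j) * w u $ j) <= u - v n) sequentially"
    unfolding e using mult_mono[OF k(2) b(2) _ b(1)] v(1) by (auto simp: less_imp_le)
   have "(%n. u - v n) \<longlonglongrightarrow> u - u" by (intro tendsto_intros vl)
   then show "(%n. u - v n) \<longlonglongrightarrow> 0" by simp
  qed simp
  ultimately show ?thesis by (rule LIMSEQ_unique)
 qed
 moreover have i: "integrable P (%w. (1 - left_limit w u $ j) * w u $ j)" for j
 proof (rule integrable_bounded[of _ 1])
  show "(%w. (1 - left_limit w u $ j) * w u $ j) \<in> borel_measurable P"
   using lm X_measurable[OF u] by auto
  fix w :: "real => real^'m" assume w: "w \<in> path_space T"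
  then show "\<bar>(1 - left_limit w u $ j) * w u $ j\<bar> <= 1"
   using X_bounds[OF w u, of j] Xm_bounds[OF w u, of j] by auto
 qed
 moreover have nn: "AE w in P. 0 <= (1 - left_limit w u $ j) * w u $ j" for j
 proof (rule AE_I2)
  fix w :: "real => real^'m" assume "w \<in> space P"
  then have w: "w \<in> path_space T" by simp
  show "0 <= (1 - left_limit w u $ j) * w u $ j"
   using X_bounds[OF w u, of j] Xm_bounds[OF w u, of j] by auto
 qed
 ultimately have "AE w in P. (1 - left_limit w u $ j) * w u $ j = 0" for j
  using integral_nonneg_eq_0_iff_AE[OF i nn] by blast
 then have "AE w in P. \<forall>j. (1 - left_limit w u $ j) * w u $ j = 0"
  by (subst AE_all_countable) auto
 then show ?thesis
 proof (rule AE_mp, intro AE_I2 impI)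
  fix w assume w: "w \<in> space P" and z: "\<forall>j. (1 - left_limit w u $ j) * w u $ j = 0"
  obtain i where i: "left_limit w u = axis i 1" using path_left_limit_state[of w T u] w u by (auto elim: state_cases)
  obtain k where k: "w u = axis k 1" using path_in_state_space[of w T u] w u by (auto elim: state_cases)
  show "left_limit w u = w u" using z[rule_format, of k] by (simp add: i k axis_nth split: if_splits)
 qed
qed simp

end

lemma clamp_measurable:
 assumes "0 <= (t::real)"
 shows "(%s. max 0 (min t s)) \<in> measurable borel (restrict_space borel {0..t})"
 by (rule measurable_restrict_space2) (use assms in auto)

lemma set_integral_exp_decay:
 fixes m :: real assumes m: "0 < m" and ab: "a <= b"
 shows "(LINT u:{a<..b}|lborel. exp (- m * (u - a))) = enter_prob m (b - a)"
proof -
 have "(\<integral>x. exp (- m * (x - a)) * indicator {a..b} x \<partial>lborel) = - exp (- m * (b - a)) / m - (- exp (- m * (a - a)) / m)"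
 proof (rule integral_FTC_Icc_real[OF ab])
  fix x
  show "((%x. - exp (- m * (x - a)) / m) has_real_derivative exp (- m * (x - a))) (at x)"
   using m by (auto intro!: derivative_eq_intros)
 qed (auto intro!: continuous_intros)
 also have "(\<integral>x. exp (- m * (x - a)) * indicator {a..b} x \<partial>lborel) = (LINT u:{a<..b}|lborel. exp (- m * (u - a)))"
  unfolding set_lebesgue_integral_def
  by (rule integral_cong_AE, simp, simp, rule AE_mp[OF AE_lborel_singleton[of a]]) (auto simp: indicator_def)
 finally show ?thesis by (simp add: enter_prob_def diff_divide_distrib)
qed

context reference_chain begin

lemma T0: "0 <= T" using T by simp

subsection \<open>Fubini for predictable processes\<close>

text \<open>Clamping the time to \<open>[0,T]\<close> turns progressive measurability into measurability on the whole line.\<close>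

lemma predictable_pair:
 assumes H: "(%(s, w). H s w) \<in> borel_measurable (predictable_sigma T)" and t: "t \<in> {0..T}"
 shows "(%(s, w). indicator {0<..t} s * H s w :: real) \<in> borel_measurable (lborel \<Otimes>\<^sub>M P)"
proof -
 have "(%x. (max 0 (min T (fst x)), snd x)) \<in> measurable (lborel \<Otimes>\<^sub>M P) (restrict_space borel {0..T} \<Otimes>\<^sub>M F T)"
 proof (rule measurable_Pair)
  have "fst \<in> measurable (lborel \<Otimes>\<^sub>M P) (borel :: real measure)"
   using measurable_fst[of "lborel :: real measure" P] by simp
  from measurable_compose[OF this clamp_measurable[OF T0]]
  show "(%x. max 0 (min T (fst x))) \<in> measurable (lborel \<Otimes>\<^sub>M P) (restrict_space borel {0..T})" .
  show "snd \<in> measurable ((lborel :: real measure) \<Otimes>\<^sub>M P) (F T)"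
   using measurable_snd[of "lborel :: real measure" P] by (simp add: measurable_cong_sets[OF refl sets_P])
 qed
 from measurable_compose[OF this predictable_progressive[OF T0 _ H]] T0
 have "(%x. H (max 0 (min T (fst x))) (snd x)) \<in> borel_measurable (lborel \<Otimes>\<^sub>M P)" by simp
 moreover have "(%x. indicator {0<..t} (fst x) :: real) \<in> borel_measurable (lborel \<Otimes>\<^sub>M P)" by measurable
 ultimately have "(%x. indicator {0<..t} (fst x) * H (max 0 (min T (fst x))) (snd x)) \<in> borel_measurable (lborel \<Otimes>\<^sub>M P)"
  by (rule borel_measurable_times[rotated])
 also have "(%x. indicator {0<..t} (fst x) * H (max 0 (min T (fst x))) (snd x)) = (%(s, w). indicator {0<..t} s * H s w)"
  using t by (auto simp: indicator_def fun_eq_iff)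
 finally show ?thesis .
qed

lemma predictable_at:
 assumes H: "(%(s, w). H s w) \<in> borel_measurable (predictable_sigma T)" and s: "s \<in> {0<..T}"
 shows "(%w. H s w :: real) \<in> borel_measurable P"
proof -
 have "(%(s, w). indicator {0<..T} s * H s w) \<in> borel_measurable (lborel \<Otimes>\<^sub>M P)"
  using T0 by (intro predictable_pair[OF H]) auto
 from measurable_compose[OF measurable_Pair1'[of s] this] s show ?thesis by simp
qed

lemma
 fixes H :: "real => (real => real^'m) => real"
 assumes H: "(%(s, w). H s w) \<in> borel_measurable (predictable_sigma T)"
  and W: "integrable P W" and \<phi>: "set_integrable lborel {0<..T} \<phi>" and t: "t \<in> {0..T}"
  and bd: "!!s w. s \<in> {0<..T} ==> w \<in> path_space T ==> \<bar>H s w\<bar> <= \<phi> s * W w"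
 shows predictable_integrable_time: "integrable P (%w. LINT s:{0<..t}|lborel. H s w)"
  and predictable_fubini_integrable: "set_integrable lborel {0<..t} (%s. expectation (H s))"
  and predictable_fubini: "expectation (%w. LINT s:{0<..t}|lborel. H s w) = (LINT s:{0<..t}|lborel. expectation (H s))"
proof -
 interpret pair_sigma_finite lborel P
  by (intro pair_sigma_finite.intro lborel.sigma_finite_measure_axioms sigma_finite_measure_axioms)
 let ?f = "%(s, w). indicator {0<..t} s * H s w"
 have at: "integrable P (H s)" if s: "s \<in> {0<..T}" for s
 proof (rule bochner_bound)
  show "integrable P (%w. \<phi> s * W w)" using W by simp
  show "H s \<in> borel_measurable P" by (rule predictable_at[OF H s])
  show "AE w in P. norm (H s w) <= norm (\<phi> s * W w)"
  proof (rule AE_I2)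
   fix w assume "w \<in> space P"
   then show "norm (H s w) <= norm (\<phi> s * W w)" using bd[OF s, of w] by simp
  qed
 qed
 have fm: "?f \<in> borel_measurable (lborel \<Otimes>\<^sub>M P)" by (rule predictable_pair[OF H t])
 have \<phi>t: "set_integrable lborel {0<..t} \<phi>" by (rule set_integrable_subset[OF \<phi>]) (use t in auto)
 have f: "integrable (lborel \<Otimes>\<^sub>M P) ?f"
 proof (rule Fubini_integrable[OF fm])
  show "integrable lborel (%s. \<integral>w. norm (case (s, w) of (s, w) => indicator {0<..t} s * H s w) \<partial>P)"
  proof (rule bochner_bound)
   show "integrable lborel (%s. indicator {0<..t} s *\<^sub>R \<phi> s * expectation W)"
    using \<phi>t unfolding set_integrable_def by (rule integrable_mult_left)
   have "(%x. norm (?f x)) \<in> borel_measurable (lborel \<Otimes>\<^sub>M P)" by (rule measurable_compose[OF fm borel_measurable_norm])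
   then show "(%s. \<integral>w. norm (case (s, w) of (s, w) => indicator {0<..t} s * H s w) \<partial>P) \<in> borel_measurable lborel"
    using sigma_finite_measure.borel_measurable_lebesgue_integral[OF prob_space_imp_sigma_finite[OF prob_space_axioms], of "%s w. norm (indicator {0<..t} s * H s w)" lborel]
    by (simp add: case_prod_unfold)
   show "AE s in lborel. norm (\<integral>w. norm (case (s, w) of (s, w) => indicator {0<..t} s * H s w) \<partial>P)
     <= norm (indicator {0<..t} s *\<^sub>R \<phi> s * expectation W)"
   proof (rule AE_I2)
    fix s :: real
    show "norm (\<integral>w. norm (case (s, w) of (s, w) => indicator {0<..t} s * H s w) \<partial>P)
     <= norm (indicator {0<..t} s *\<^sub>R \<phi> s * expectation W)"
    proof (cases "s \<in> {0<..t}")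
     case True
     then have s: "s \<in> {0<..T}" using t by auto
     have "(\<integral>w. \<bar>H s w\<bar> \<partial>P) <= (\<integral>w. \<phi> s * W w \<partial>P)"
      using at[OF s] W bd[OF s] by (intro integral_mono) auto
     moreover have "0 <= (\<integral>w. \<bar>H s w\<bar> \<partial>P)" by (rule bochner_nonneg) simp
     ultimately have "\<bar>\<integral>w. \<bar>H s w\<bar> \<partial>P\<bar> <= \<bar>\<phi> s * expectation W\<bar>" by simp
     then show ?thesis using True by simp
    qed simp
   qed
  qed
  show "AE s in lborel. integrable P (%w. case (s, w) of (s, w) => indicator {0<..t} s * H s w)"
  proof (rule AE_I2)
   fix s show "integrable P (%w. case (s, w) of (s, w) => indicator {0<..t} s * H s w)"
    using at[of s] t by (cases "s \<in> {0<..t}") auto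
  qed
 qed
 show "integrable P (%w. LINT s:{0<..t}|lborel. H s w)"
  using integrable_snd[OF f] by (simp add: set_lebesgue_integral_def)
 show "set_integrable lborel {0<..t} (%s. expectation (H s))"
  using integrable_fst[OF f] by (simp add: set_integrable_def)
 show "expectation (%w. LINT s:{0<..t}|lborel. H s w) = (LINT s:{0<..t}|lborel. expectation (H s))"
  using integral_fst[OF f] integral_snd[OF f] by (simp add: set_lebesgue_integral_def)
qed

lemma predictable_time:
 fixes g :: "real => 'c::topological_space"
 assumes g: "g \<in> measurable (restrict_space borel {0..T}) M"
 shows "(%(s, w). g s) \<in> measurable (predictable_sigma T :: (real \<times> (real => real^'m)) measure) M"
proof -
 have id: "left_limit (%s::real. s) t = t" for t
  by (cases "t = 0") (auto intro!: left_limit_eqI tendsto_ident_at)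
 have "(%(t, w). left_limit (%s. s) t) \<in> borel_measurable (predictable_sigma T :: (real \<times> (real => real^'m)) measure)"
  by (rule predictable_left_limit[OF T0]) (auto intro!: tendsto_ident_at exI)
 then have "fst \<in> borel_measurable (predictable_sigma T :: (real \<times> (real => real^'m)) measure)"
  by (simp add: id case_prod_unfold)
 then have "fst \<in> measurable (predictable_sigma T :: (real \<times> (real => real^'m)) measure) (restrict_space borel {0..T})"
  using T0 by (intro measurable_restrict_space2) auto
 from measurable_compose[OF this g] show ?thesis by (simp add: case_prod_unfold)
qed

subsection \<open>The compensated jump integrals have mean zero\<close>

text \<open>The density, with respect to the clock of the path, of the martingale \<open>X\<^sub>j - \<integral> (1 - m X\<^sub>j\<^sub>-) ds\<close>: on a jump it is
 the jump of \<open>X\<^sub>j\<close>, elsewhere minus the drift \<open>(X Q0)\<^sub>j\<close>. One integral against the clock makes the compensated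
 integral linear and lets dominated convergence act on jumps and drift at once.\<close>

definition kappa :: "'m => (real => real^'m) => real => real" where
 "kappa j w s = (if s \<in> jumps T w then (w s - left_limit w s) $ j else real CARD('m) * left_limit w s $ j - 1)"

definition compensated :: "'m => (real \<times> (real => real^'m) => real) => (real => real^'m) => real" where
 "compensated j H w = (LINT s:{0<..T}|clock (jumps T w). H (s, w) * kappa j w s)"

lemma kappa_bound:
 assumes w: "w \<in> path_space T" and s: "s \<in> {0<..T}"
 shows "\<bar>kappa j w s\<bar> <= real CARD('m)"
proof -
 have s': "s \<in> {0..T}" using s by auto
 have m: "1 <= real CARD('m)" by (simp add: Suc_le_eq)
 show ?thesis using X_bounds[OF w s', of j] Xm_bounds[OF w s', of j] m by (auto simp: kappa_def)
qed

lemma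
 assumes w: "w \<in> path_space T" and H: "H \<in> borel_measurable (predictable_sigma T)"
  and K: "!!s. s \<in> {0<..T} ==> \<bar>H (s, w)\<bar> <= K"
 shows comp_integrable: "set_integrable (clock (jumps T w)) {0<..T} (%s. H (s, w) * kappa j w s)"
  and comp_eq: "compensated j H w = jump_integral T j H T w + (LINT s:{0<..T}|lborel. H (s, w) * (real CARD('m) * left_limit w s $ j - 1))"
  and comp_bound: "\<bar>compensated j H w\<bar> <= K * real CARD('m) * (T + N w)"
proof -
 let ?J = "jumps T w"
 let ?k = "%s. real CARD('m) * left_limit w s $ j - 1"
 note J = finite_jumps[OF w]
 have I: "{0<..T} \<in> sets borel" by simp
 have m: "1 <= real CARD('m)" by (simp add: Suc_le_eq)
 have K0: "0 <= K" using order_trans[OF abs_ge_zero K[of T]] T by simp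
 have Hb: "(%s. indicator {0<..T} s * H (s, w)) \<in> borel_measurable borel"
  by (rule predictable_section_borel[OF T0 w]) (use H in \<open>simp add: case_prod_unfold\<close>)
 have kb: "(%s. indicator {0<..T} s * ?k s) \<in> borel_measurable borel"
 proof -
  have "(%s. real CARD('m) * (indicator {0<..T} s * left_limit w s $ j) - indicator {0<..T} s) \<in> borel_measurable borel"
   using left_limit_path_measurable[OF w, of j] by measurable
  then show ?thesis by (simp add: algebra_simps)
 qed
 have kk: "\<bar>?k s\<bar> <= real CARD('m)" if "s \<in> {0<..T}" for s
  using Xm_bounds[OF w, of s j] that m by auto
 have i0: "set_integrable lborel {0<..T} (%s. H (s, w) * ?k s)"
 proof (rule set_integrable_bounded_lborel)
  have "(%s. (indicator {0<..T} s * H (s, w)) * (indicator {0<..T} s * ?k s)) \<in> borel_measurable borel"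
   by (rule borel_measurable_times[OF Hb kb])
  also have "(%s. (indicator {0<..T} s * H (s, w)) * (indicator {0<..T} s * ?k s)) = (%s. indicator {0<..T} s * (H (s, w) * ?k s))"
   by (auto simp: indicator_def fun_eq_iff)
  finally show "(%s. indicator {0<..T} s * (H (s, w) * ?k s)) \<in> borel_measurable borel" .
  show "\<bar>H (s, w) * ?k s\<bar> <= K * real CARD('m)" if "s \<in> {0<..T}" for s
   unfolding abs_mult using K[OF that] kk[OF that] K0 by (intro mult_mono) auto
 qed
 have ne: "H (s, w) * kappa j w s = H (s, w) * ?k s" if "s \<notin> ?J" for s
  using that by (simp add: kappa_def)
 have il: "set_integrable lborel {0<..T} (%s. H (s, w) * kappa j w s)"
  by (rule set_integral_finite_difference(1)[OF J, THEN iffD2, OF _ i0]) (rule ne)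
 have el: "(LINT s:{0<..T}|lborel. H (s, w) * kappa j w s) = (LINT s:{0<..T}|lborel. H (s, w) * ?k s)"
  by (rule set_integral_finite_difference(2)[OF J]) (rule ne)
 show "set_integrable (clock ?J) {0<..T} (%s. H (s, w) * kappa j w s)"
  using il by (simp add: set_integrable_clock[OF J I])
 have c: "compensated j H w = (LINT s:{0<..T}|lborel. H (s, w) * ?k s) + (\<Sum>r\<in>?J Int {0<..T}. H (r, w) * kappa j w r)"
  unfolding compensated_def set_integral_clock[OF J I il] el ..
 also have "(\<Sum>r\<in>?J Int {0<..T}. H (r, w) * kappa j w r) = jump_integral T j H T w"
  unfolding jump_integral_def by (intro sum.cong) (auto simp: kappa_def)
 finally show "compensated j H w = jump_integral T j H T w + (LINT s:{0<..T}|lborel. H (s, w) * ?k s)" by simp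
 have b1: "\<bar>LINT s:{0<..T}|lborel. H (s, w) * ?k s\<bar> <= K * real CARD('m) * T"
 proof -
  have "norm (LINT s:{0<..T}|lborel. H (s, w) * ?k s) <= (LINT s:{0<..T}|lborel. norm (H (s, w) * ?k s))"
   by (rule set_integral_norm_bound[OF i0])
  also have "... <= (LINT s:{0<..T}|lborel. K * real CARD('m))"
  proof (rule set_integral_mono[OF set_integrable_norm[OF i0]])
   show "set_integrable lborel {0<..T} (%s. K * real CARD('m))"
    by (rule set_integrable_bounded_lborel[where K="\<bar>K * real CARD('m)\<bar>"]) auto
   show "norm (H (s, w) * ?k s) <= K * real CARD('m)" if "s \<in> {0<..T}" for s
    unfolding norm_mult using K[OF that] kk[OF that] K0 by (intro mult_mono) auto
  qed
  also have "... = K * real CARD('m) * T" using T by (simp add: set_lebesgue_integral_def)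
  finally show ?thesis by simp
 qed
 have b2: "\<bar>\<Sum>r\<in>?J Int {0<..T}. H (r, w) * kappa j w r\<bar> <= K * real CARD('m) * N w"
 proof -
  have "\<bar>\<Sum>r\<in>?J Int {0<..T}. H (r, w) * kappa j w r\<bar> <= (\<Sum>r\<in>?J Int {0<..T}. K * real CARD('m))"
  proof (rule order_trans[OF sum_abs sum_mono])
   fix r assume "r \<in> ?J Int {0<..T}"
   then show "\<bar>H (r, w) * kappa j w r\<bar> <= K * real CARD('m)"
    unfolding abs_mult using K[of r] kappa_bound[OF w, of r j] K0 by (intro mult_mono) auto
  qed
  also have "... = K * real CARD('m) * card (?J Int {0<..T})" by simp
  also have "?J Int {0<..T} = ?J" using jumps_subset by blast
  finally show ?thesis unfolding Int_absorb2[OF jumps_subset] .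
 qed
 show "\<bar>compensated j H w\<bar> <= K * real CARD('m) * (T + N w)"
  unfolding c using b1 b2 by (simp add: distrib_left)
qed

lemma comp_measurable:
 assumes H: "H \<in> borel_measurable (predictable_sigma T)"
  and K: "!!s w. w \<in> path_space T ==> s \<in> {0<..T} ==> \<bar>H (s, w)\<bar> <= W w"
 shows "compensated j H \<in> borel_measurable P"
proof -
 have TT: "T \<in> {0..T}" using T by simp
 have "(%w. LINT s:{0<..T}|lborel. H (s, w) * (real CARD('m) * left_limit w s $ j - 1)) \<in> borel_measurable (F T)"
 proof (rule predictable_integral_adapted[OF T0 TT])
  have "(%x. H x * (real CARD('m) * (case x of (t, w) => left_limit w t $ j) - 1)) \<in> borel_measurable (predictable_sigma T)"
   by (intro borel_measurable_times H borel_measurable_diff Xm_predictable borel_measurable_const)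
  then show "(%(s, w). H (s, w) * (real CARD('m) * left_limit w s $ j - 1)) \<in> borel_measurable (predictable_sigma T)"
   by (simp add: case_prod_unfold)
 qed
 then have "(%w. jump_integral T j H T w + (LINT s:{0<..T}|lborel. H (s, w) * (real CARD('m) * left_limit w s $ j - 1))) \<in> borel_measurable P"
  by (intro borel_measurable_add F_measurable[OF jump_integral_adapted[OF T0 TT H] order_refl] F_measurable[of _ T]) auto
 then show ?thesis
  by (rule measurable_cong[THEN iffD2, rotated]) (use comp_eq[OF _ H K] in auto)
qed

text \<open>Growth in the number \<open>N\<close> of jumps is absorbed into a larger exponential base.\<close>

lemma moment_factor: "real CARD('m) * (T + N w) <= real CARD('m) * (T + 1) * 2 ^ N w"
proof -
 have "real n <= 2 ^ n" for n by (rule of_nat_less_two_power[THEN less_imp_le])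
 then have n: "real (N w) <= 2 ^ N w" .
 have "T <= T * 2 ^ N w" using T by simp
 have "T + N w <= T * 2 ^ N w + 2 ^ N w" by (rule add_mono[OF \<open>T <= T * 2 ^ N w\<close> n])
 then have "T + N w <= (T + 1) * 2 ^ N w" by (simp only: distrib_right mult_1)
 then show ?thesis by (simp add: mult.assoc)
qed

lemma comp_integrable_P:
 assumes H: "H \<in> borel_measurable (predictable_sigma T)" and C: "1 <= C"
  and K: "!!s w. w \<in> path_space T ==> s \<in> {0<..T} ==> \<bar>H (s, w)\<bar> <= K * C ^ N w"
 shows "integrable P (%w. K * real CARD('m) * (T + 1) * (2 * C) ^ N w)"
  and "w \<in> path_space T ==> \<bar>compensated j H w\<bar> <= K * real CARD('m) * (T + 1) * (2 * C) ^ N w"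
  and "integrable P (compensated j H)"
proof -
 show i: "integrable P (%w. K * real CARD('m) * (T + 1) * (2 * C) ^ N w)"
  using exp_moment[of "2 * C"] C by (intro integrable_mult_right) auto
 have b: "\<bar>compensated j H w\<bar> <= K * real CARD('m) * (T + 1) * (2 * C) ^ N w" if w: "w \<in> path_space T" for w
 proof -
  have K0: "0 <= K * C ^ N w" using order_trans[OF abs_ge_zero K[OF w, of T]] T by simp
  have "\<bar>compensated j H w\<bar> <= (K * C ^ N w) * (real CARD('m) * (T + N w))"
   using comp_bound[OF w H K[OF w]] by (simp only: mult.assoc)
  also have "... <= (K * C ^ N w) * (real CARD('m) * (T + 1) * 2 ^ N w)"
   by (rule mult_left_mono[OF moment_factor K0])
  finally show ?thesis by (simp add: power_mult_distrib algebra_simps)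
 qed
 then show "w \<in> path_space T ==> \<bar>compensated j H w\<bar> <= K * real CARD('m) * (T + 1) * (2 * C) ^ N w" .
 show "integrable P (compensated j H)"
 proof (rule bochner_bound[OF i comp_measurable[OF H K]], assumption, assumption, rule AE_I2)
  fix w assume "w \<in> space P"
  then have "w \<in> path_space T" by simp
  from b[OF this] show "norm (compensated j H w) <= norm (K * real CARD('m) * (T + 1) * (2 * C) ^ N w)"
   unfolding real_norm_def by (rule order_trans[OF _ abs_ge_self])
 qed
qed

lemma comp_lim:
 assumes H: "!!n. U n \<in> borel_measurable (predictable_sigma T)" and Hu: "u \<in> borel_measurable (predictable_sigma T)"
  and C: "1 <= C"
  and K: "!!n s w. w \<in> path_space T ==> s \<in> {0<..T} ==> \<bar>U n (s, w)\<bar> <= K * C ^ N w"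
  and lim: "!!x. x \<in> {0<..T} \<times> path_space T ==> (%n. U n x) \<longlonglongrightarrow> u x"
  and E: "!!n. expectation (compensated j (U n)) = 0"
 shows "expectation (compensated j u) = 0"
proof -
 have Ku: "\<bar>u (s, w)\<bar> <= K * C ^ N w" if "w \<in> path_space T" "s \<in> {0<..T}" for s w
  by (rule tendsto_upperbound[OF tendsto_rabs[OF lim[of "(s, w)"]]]) (use that K in auto)
 have "(%n. expectation (compensated j (U n))) \<longlonglongrightarrow> expectation (compensated j u)"
 proof (rule integral_dominated_convergence[where w="%w. K * real CARD('m) * (T + 1) * (2 * C) ^ N w"])
  show "compensated j u \<in> borel_measurable P" by (rule comp_measurable[OF Hu Ku])
  show "compensated j (U n) \<in> borel_measurable P" for n by (rule comp_measurable[OF H K])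
  show "integrable P (%w. K * real CARD('m) * (T + 1) * (2 * C) ^ N w)" by (rule comp_integrable_P(1)[OF Hu C Ku])
  show "AE w in P. norm (compensated j (U n) w) <= K * real CARD('m) * (T + 1) * (2 * C) ^ N w" for n
  proof (rule AE_I2)
   fix w assume "w \<in> space P"
   then have "w \<in> path_space T" by simp
   from comp_integrable_P(2)[OF H C K this]
   show "norm (compensated j (U n) w) <= K * real CARD('m) * (T + 1) * (2 * C) ^ N w" by simp
  qed
  show "AE w in P. (%n. compensated j (U n) w) \<longlonglongrightarrow> compensated j u w"
  proof (rule AE_I2)
   fix w assume "w \<in> space P"
   then have w: "w \<in> path_space T" by simp
   let ?one = "%x::real \<times> (real => real^'m). K * C ^ N w"
   have iu: "set_integrable (clock (jumps T w)) {0<..T} (%s. u (s, w) * kappa j w s)"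
    by (rule comp_integrable[OF w Hu Ku[OF w]])
   have iU: "set_integrable (clock (jumps T w)) {0<..T} (%s. U n (s, w) * kappa j w s)" for n
    by (rule comp_integrable[OF w H K[OF w]])
   have i1: "set_integrable (clock (jumps T w)) {0<..T} (%s. ?one (s, w) * kappa j w s)"
    by (rule comp_integrable[OF w, where K="\<bar>K * C ^ N w\<bar>"]) auto
   show "(%n. compensated j (U n) w) \<longlonglongrightarrow> compensated j u w"
    unfolding compensated_def set_lebesgue_integral_def
   proof (rule integral_dominated_convergence)
    show "integrable (clock (jumps T w)) (%s. \<bar>indicator {0<..T} s *\<^sub>R (?one (s, w) * kappa j w s)\<bar>)"
     using i1 unfolding set_integrable_def by (rule integrable_abs)
    show "(%s. indicator {0<..T} s *\<^sub>R (u (s, w) * kappa j w s)) \<in> borel_measurable (clock (jumps T w))"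
     using iu unfolding set_integrable_def by (rule borel_measurable_integrable)
    show "(%s. indicator {0<..T} s *\<^sub>R (U n (s, w) * kappa j w s)) \<in> borel_measurable (clock (jumps T w))" for n
     using iU unfolding set_integrable_def by (rule borel_measurable_integrable)
    show "AE s in clock (jumps T w). (%n. indicator {0<..T} s *\<^sub>R (U n (s, w) * kappa j w s)) \<longlonglongrightarrow> indicator {0<..T} s *\<^sub>R (u (s, w) * kappa j w s)"
    proof (rule AE_I2)
     fix s show "(%n. indicator {0<..T} s *\<^sub>R (U n (s, w) * kappa j w s)) \<longlonglongrightarrow> indicator {0<..T} s *\<^sub>R (u (s, w) * kappa j w s)"
      using lim[of "(s, w)"] w by (cases "s \<in> {0<..T}") (auto intro!: tendsto_mult_right)
    qed
    show "AE s in clock (jumps T w). norm (indicator {0<..T} s *\<^sub>R (U n (s, w) * kappa j w s)) <= \<bar>indicator {0<..T} s *\<^sub>R (?one (s, w) * kappa j w s)\<bar>" for n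
    proof (rule AE_I2)
     fix s show "norm (indicator {0<..T} s *\<^sub>R (U n (s, w) * kappa j w s)) <= \<bar>indicator {0<..T} s *\<^sub>R (?one (s, w) * kappa j w s)\<bar>"
     proof (cases "s \<in> {0<..T}")
      case True
      have "\<bar>U n (s, w)\<bar> * \<bar>kappa j w s\<bar> <= \<bar>K * C ^ N w\<bar> * \<bar>kappa j w s\<bar>"
       by (rule mult_right_mono[OF order_trans[OF K[OF w True] abs_ge_self] abs_ge_zero])
      then show ?thesis using True unfolding abs_mult[symmetric] by simp
     qed simp
    qed
   qed
  qed
 qed
 then show ?thesis using E by (simp add: LIMSEQ_const_iff)
qed

lemma comp_add:
 assumes w: "w \<in> path_space T" and u: "u \<in> borel_measurable (predictable_sigma T)" and v: "v \<in> borel_measurable (predictable_sigma T)"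
  and K: "!!s. s \<in> {0<..T} ==> \<bar>u (s, w)\<bar> <= K" and L: "!!s. s \<in> {0<..T} ==> \<bar>v (s, w)\<bar> <= L"
 shows "compensated j (%x. u x + v x) w = compensated j u w + compensated j v w"
  and "compensated j (%x. u x - v x) w = compensated j u w - compensated j v w"
proof -
 have iu: "set_integrable (clock (jumps T w)) {0<..T} (%s. u (s, w) * kappa j w s)"
  by (rule comp_integrable[OF w u K])
 have iv: "set_integrable (clock (jumps T w)) {0<..T} (%s. v (s, w) * kappa j w s)"
  by (rule comp_integrable[OF w v L])
 show "compensated j (%x. u x + v x) w = compensated j u w + compensated j v w"
  unfolding compensated_def distrib_right by (rule set_integral_add(2)[OF iu iv])
 show "compensated j (%x. u x - v x) w = compensated j u w - compensated j v w"
  unfolding compensated_def left_diff_distrib by (rule set_integral_diff(2)[OF iu iv])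
qed

text \<open>On a rectangle the jump integral telescopes to an increment of the path. With \<open>y\<close> the function
 \<open>u \<mapsto> E[Z X\<^sub>u]\<close>, known from the Markov property, the claim is \<open>y' = E Z - m y\<close> in integrated form.\<close>

lemma comp_rect:
 assumes ab: "0 <= a" "a < b" "b <= T" and B: "B \<in> sets (F a)"
 shows "expectation (compensated j (indicator ({a<..b} \<times> B))) = 0"
proof -
 let ?m = "real CARD('m)"
 have m: "0 < ?m" by simp
 let ?H = "indicator ({a<..b} \<times> B) :: real \<times> (real => real^'m) => real"
 have Hm: "?H \<in> borel_measurable (predictable_sigma T)"
  using predictable_Ioc[OF ab(1) less_imp_le[OF ab(2)] ab(3) B] by simp
 have TT: "T \<in> {0..T}" using T by simp
 let ?Z = "indicator B :: (real => real^'m) => real"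
 have Zm: "?Z \<in> borel_measurable (F a)" using B by simp
 have Z1: "\<bar>?Z w\<bar> <= 1" for w by (simp add: indicator_def)
 have ZP: "?Z \<in> borel_measurable P" using F_measurable[OF Zm] ab by simp
 define y where "y u = expectation (%w. ?Z w * w u $ j)" for u
 define \<beta> where "\<beta> = expectation ?Z"
 have y: "y u = exp (- ?m * (u - a)) * y a + enter_prob ?m (u - a) * \<beta>" if "u \<in> {a..b}" for u
  unfolding y_def \<beta>_def by (rule markov[OF ab(1) _ _ Zm Z1]) (use that ab in auto)
 have Xi: "integrable P (%w. ?Z w * w u $ j)" if "u \<in> {0..T}" for u
 proof (rule integrable_bounded[of _ 1])
  show "(%w. ?Z w * w u $ j) \<in> borel_measurable P" by (rule borel_measurable_times[OF ZP X_measurable[OF that]])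
  show "\<bar>?Z w * w u $ j\<bar> <= 1" if "w \<in> path_space T" for w
   using X_bounds[OF that \<open>u \<in> {0..T}\<close>, of j] by (auto simp: indicator_def)
 qed
 have Zi: "integrable P ?Z" by (rule integrable_bounded[OF ZP, of 1]) (rule Z1)
 define h where "h s w = ?H (s, w) * (?m * left_limit w s $ j - 1)" for s w
 have hm: "(%(s, w). h s w) \<in> borel_measurable (predictable_sigma T)"
 proof -
  have "(%x. ?H x * (?m * (case x of (t, w) => left_limit w t $ j) - 1)) \<in> borel_measurable (predictable_sigma T)"
   by (intro borel_measurable_times Hm borel_measurable_diff Xm_predictable borel_measurable_const)
  then show ?thesis by (simp add: case_prod_unfold h_def)
 qed
 have one: "integrable P (%w. 1)" by simp
 have mi: "set_integrable lborel {0<..T} (%s. ?m)" by (rule set_integrable_bounded_lborel[where K="?m"]) auto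
 have m1: "1 <= ?m" by (simp add: Suc_le_eq)
 have hb: "\<bar>h s w\<bar> <= ?m * 1" if "s \<in> {0<..T}" "w \<in> path_space T" for s w
  using Xm_bounds[OF that(2), of s j] that(1) m1 by (auto simp: h_def indicator_def)
 have he: "expectation (h s) = - exp (- ?m * (s - a)) * (\<beta> - ?m * y a)" if s: "s \<in> {a<..b}" for s
 proof -
  have s': "s \<in> {0..T}" using s ab by auto
  have "expectation (h s) = expectation (%w. ?m * (?Z w * w s $ j) - ?Z w)"
  proof (rule integral_cong_AE)
   show "h s \<in> borel_measurable P" by (rule predictable_at[OF hm]) (use s ab in auto)
   show "(%w. ?m * (?Z w * w s $ j) - ?Z w) \<in> borel_measurable P"
    using ZP X_measurable[OF s', of j] by measurable
   show "AE w in P. h s w = ?m * (?Z w * w s $ j) - ?Z w"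
    using AE_left_limit[OF s'] by (rule AE_mp) (use s in \<open>auto simp: h_def indicator_def\<close>)
  qed
  also have "... = ?m * y s - \<beta>" using Xi[OF s'] Zi by (simp add: y_def \<beta>_def)
  also have "y s = exp (- ?m * (s - a)) * y a + enter_prob ?m (s - a) * \<beta>" using s by (intro y) auto
  also have "?m * (exp (- ?m * (s - a)) * y a + enter_prob ?m (s - a) * \<beta>) - \<beta>
    = exp (- ?m * (s - a)) * (?m * y a) + (?m * enter_prob ?m (s - a)) * \<beta> - \<beta>" by (simp only: distrib_left mult.left_commute mult.assoc)
  also have "?m * enter_prob ?m (s - a) = 1 - exp (- ?m * (s - a))" using m by (simp add: enter_prob_def)
  finally show ?thesis by (simp only:) (simp add: left_diff_distrib right_diff_distrib)
 qed
 have "expectation (compensated j ?H) = expectation (%w. (?Z w * w b $ j - ?Z w * w a $ j) + (LINT s:{0<..T}|lborel. h s w))"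
 proof (rule bochner_cong[OF refl])
  fix w assume "w \<in> space P"
  then have w: "w \<in> path_space T" by simp
  have "compensated j ?H w = jump_integral T j ?H T w + (LINT s:{0<..T}|lborel. h s w)"
   unfolding h_def by (rule comp_eq[OF w Hm, of 1]) (simp add: indicator_def)
  also have "jump_integral T j ?H T w = ?Z w * (w (min T b) $ j - w (min T a) $ j)"
   by (rule jump_integral_rect[OF w TT ab(1) less_imp_le[OF ab(2)]])
  finally show "compensated j ?H w = (?Z w * w b $ j - ?Z w * w a $ j) + (LINT s:{0<..T}|lborel. h s w)"
   using ab by (simp add: right_diff_distrib min_absorb2)
 qed
 also have "... = y b - y a + expectation (%w. LINT s:{0<..T}|lborel. h s w)"
  using Xi[of a] Xi[of b] ab predictable_integrable_time[OF hm one mi TT hb] by (simp add: y_def)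
 also have "expectation (%w. LINT s:{0<..T}|lborel. h s w) = (LINT s:{0<..T}|lborel. expectation (h s))"
  by (rule predictable_fubini[OF hm one mi TT hb])
 also have "... = (LINT s:{a<..b}|lborel. exp (- ?m * (s - a)) * - (\<beta> - ?m * y a))"
  unfolding set_lebesgue_integral_def
 proof (rule bochner_cong[OF refl])
  fix s :: real
  show "indicator {0<..T} s *\<^sub>R expectation (h s) = indicator {a<..b} s *\<^sub>R (exp (- ?m * (s - a)) * - (\<beta> - ?m * y a))"
  proof (cases "s \<in> {a<..b}")
   case True
   then show ?thesis using he[OF True] ab by (simp add: right_diff_distrib)
  next
   case False
   then have "h s = (%w. 0)" by (auto simp: h_def indicator_def)
   then show ?thesis using False by simp
  qed
 qed
 also have "... = enter_prob ?m (b - a) * - (\<beta> - ?m * y a)"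
  unfolding set_integral_mult_left using set_integral_exp_decay[OF m less_imp_le[OF ab(2)]] by simp
 also have "y b = exp (- ?m * (b - a)) * y a + enter_prob ?m (b - a) * \<beta>" using ab by (intro y) auto
 finally show ?thesis using m by (simp add: enter_prob_def field_simps)
qed

text \<open>The complement is taken in \<open>(0,T]\<close> times the path space, which is itself a rectangle.\<close>

lemma comp_indicator:
 assumes A: "A \<in> sets (predictable_sigma T)"
 shows "expectation (compensated j (indicator A)) = 0"
 using T0 A
proof (induction rule: predictable_induct)
 case (zero B)
 have "compensated j (indicator ({0} \<times> B)) w = 0" for w
  unfolding compensated_def set_lebesgue_integral_def
  by (rule integral_eq_zero_AE) (auto simp: indicator_def)
 then show ?case by simp
next
 case (Ioc s t B)
 then show ?case by (intro comp_rect) auto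
next
 case (compl A)
 let ?I = "indicator ({0<..T} \<times> path_space T) :: real \<times> (real => real^'m) => real"
 have I0: "expectation (compensated j ?I) = 0" by (rule comp_rect[OF order_refl T order_refl path_space_sets])
 have Im: "?I \<in> borel_measurable (predictable_sigma T)"
  by (rule borel_measurable_indicator[OF predictable_Ioc[OF order_refl T0 order_refl path_space_sets]])
 have Am: "(indicator A :: _ => real) \<in> borel_measurable (predictable_sigma T)" using compl.hyps by simp
 have b: "\<bar>?I (s, w)\<bar> <= 1 * 1 ^ N w" "\<bar>indicator A (s, w) :: real\<bar> <= 1 * 1 ^ N w" for s w by (auto simp: indicator_def)
 have "expectation (compensated j (indicator ({0..T} \<times> path_space T - A))) = expectation (%w. compensated j ?I w - compensated j (indicator A) w)"
 proof (rule bochner_cong[OF refl])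
  fix w assume "w \<in> space P"
  then have w: "w \<in> path_space T" by simp
  have "compensated j (indicator ({0..T} \<times> path_space T - A)) w = compensated j (%x. ?I x - indicator A x) w"
   unfolding compensated_def by (rule set_lebesgue_integral_cong) (use w in \<open>auto simp: indicator_def\<close>)
  also have "... = compensated j ?I w - compensated j (indicator A) w"
   by (rule comp_add(2)[OF w Im Am, of 1 1]) (auto simp: indicator_def)
  finally show "compensated j (indicator ({0..T} \<times> path_space T - A)) w = compensated j ?I w - compensated j (indicator A) w" .
 qed
 also have "... = expectation (compensated j ?I) - expectation (compensated j (indicator A))"
  using comp_integrable_P(3)[OF Im order_refl b(1)] comp_integrable_P(3)[OF Am order_refl b(2)] by simp
 finally show ?case using I0 compl.IH by simp
next
 case (union A)
 have Am: "(indicator (A i) :: _ => real) \<in> borel_measurable (predictable_sigma T)" for i using union.hyps by auto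
 have Um: "(indicator (\<Union>i<n. A i) :: _ => real) \<in> borel_measurable (predictable_sigma T)" for n
  using union.hyps by (intro borel_measurable_indicator sets.finite_UN) auto
 have b: "\<bar>indicator S (s, w) :: real\<bar> <= 1 * 1 ^ N w" for s w and S :: "(real \<times> (real => real^'m)) set" by (auto simp: indicator_def)
 have E: "expectation (compensated j (indicator (\<Union>i<n. A i))) = 0" for n
 proof (induction n)
  case 0
  have "compensated j (indicator {}) = (%w. 0)" by (simp add: compensated_def fun_eq_iff set_lebesgue_integral_def)
  then have "expectation (compensated j (indicator {})) = 0" by (simp only: Bochner_Integration.integral_zero)
  then show ?case by (simp only: lessThan_0 image_empty Union_empty)
 next
  case (Suc n)
  have dj: "(\<Union>i<n. A i) Int A n = {}"
  proof -
   have "A i Int A n = {}" if "i < n" for i using disjoint_family_onD[OF union.hyps(1), of i n] that by simp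
   then show ?thesis by blast
  qed
  have e: "(indicator (\<Union>i<Suc n. A i) :: _ => real) = (%x. indicator (\<Union>i<n. A i) x + indicator (A n) x)"
   unfolding lessThan_Suc UN_insert Un_commute[of "A n"] indicator_add[OF dj, symmetric, abs_def] ..
  have "expectation (compensated j (indicator (\<Union>i<Suc n. A i))) = expectation (%w. compensated j (indicator (\<Union>i<n. A i)) w + compensated j (indicator (A n)) w)"
   unfolding e
  proof (rule bochner_cong[OF refl])
   fix w assume "w \<in> space P"
   then have w: "w \<in> path_space T" by simp
   show "compensated j (%x. indicator (\<Union>i<n. A i) x + indicator (A n) x) w = compensated j (indicator (\<Union>i<n. A i)) w + compensated j (indicator (A n)) w"
    by (rule comp_add(1)[OF w Um Am b b])
  qed
  also have "... = 0"
   using comp_integrable_P(3)[OF Um order_refl b] comp_integrable_P(3)[OF Am order_refl b] Suc.IH union.IH by simp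
  finally show ?case .
 qed
 show ?case
 proof (rule comp_lim[where U="%n. indicator (\<Union>i<n. A i)", OF Um _ order_refl b _ E])
  show "(indicator (\<Union>i. A i) :: _ => real) \<in> borel_measurable (predictable_sigma T)"
   using union.hyps by (intro borel_measurable_indicator sets.countable_UN) auto
  show "(%n. indicator (\<Union>i<n. A i) x :: real) \<longlonglongrightarrow> indicator (\<Union>i. A i) x" for x
   by (rule LIMSEQ_indicator_UN)
 qed
qed

text \<open>The bound \<open>K C\<^sup>N\<close> passes to the monotone approximations, so dominated convergence applies although
 the integrand is unbounded.\<close>

lemma comp_nonneg_zero:
 assumes H: "H \<in> borel_measurable (predictable_sigma T)" "!!x. 0 <= H x" and C: "1 <= C"
  and K: "!!s w. w \<in> path_space T ==> s \<in> {0<..T} ==> H (s, w) <= K * C ^ N w"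
 shows "expectation (compensated j H) = 0"
 using H K
proof (induction arbitrary: K rule: borel_measurable_induct_real)
 case (set A)
 then show ?case by (intro comp_indicator)
next
 case (mult u c)
 show ?case
 proof (cases "c = 0")
  case True
  then show ?thesis by (simp add: compensated_def set_lebesgue_integral_def)
 next
  case False
  then have c: "0 < c" using mult by simp
  have "expectation (compensated j u) = 0"
  proof (rule mult.IH)
   show "u (s, w) <= (K / c) * C ^ N w" if "w \<in> path_space T" "s \<in> {0<..T}" for s w
    using mult.prems[OF that] c by (simp add: field_simps)
  qed
  moreover have "compensated j (%x. c * u x) = (%w. c * compensated j u w)"
   by (simp add: compensated_def fun_eq_iff mult.assoc)
  ultimately show ?thesis by simp
 qed
next
 case (add u v)
 have ub: "u (s, w) <= K * C ^ N w" and vb: "v (s, w) <= K * C ^ N w" if "w \<in> path_space T" "s \<in> {0<..T}" for s w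
  using add.prems[OF that] add.hyps(2,4)[of "(s, w)"] by linarith+
 have u: "\<bar>u (s, w)\<bar> <= K * C ^ N w" and v: "\<bar>v (s, w)\<bar> <= K * C ^ N w" if "w \<in> path_space T" "s \<in> {0<..T}" for s w
  using ub[OF that] vb[OF that] add.hyps(2,4)[of "(s, w)"] by simp_all
 have "expectation (compensated j (%x. v x + u x)) = expectation (%w. compensated j v w + compensated j u w)"
  by (rule bochner_cong[OF refl], rule comp_add(1)[OF _ add.hyps(3) add.hyps(1) v u]) auto
 also have "... = expectation (compensated j v) + expectation (compensated j u)"
  using comp_integrable_P(3)[OF add.hyps(3) C v] comp_integrable_P(3)[OF add.hyps(1) C u] by simp
 also have "... = 0" using add.IH(1)[OF ub] add.IH(2)[OF vb] by simp
 finally show ?case .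
next
 case (seq U)
 have le: "U i (s, w) <= K * C ^ N w" if w: "w \<in> path_space T" "s \<in> {0<..T}" for i s w
 proof (rule order_trans[OF _ seq.prems[OF w]])
  have "incseq (%i. U i (s, w))" using seq.hyps(3) by (auto simp: incseq_def le_fun_def)
  moreover have "(%i. U i (s, w)) \<longlonglongrightarrow> H (s, w)" by (rule seq.hyps(4)) (use w T0 in auto)
  ultimately show "U i (s, w) <= H (s, w)" by (rule incseq_le)
 qed
 show ?case
 proof (rule comp_lim[OF seq.hyps(1) H(1) C])
  show "\<bar>U i (s, w)\<bar> <= K * C ^ N w" if "w \<in> path_space T" "s \<in> {0<..T}" for i s w
   using le[OF that] seq.hyps(2)[of i "(s, w)"] by simp
  show "(%i. U i x) \<longlonglongrightarrow> H x" if "x \<in> {0<..T} \<times> path_space T" for x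
   by (rule seq.hyps(4)) (use that T0 in auto)
  show "expectation (compensated j (U i)) = 0" for i by (rule seq.IH[OF le])
 qed
qed

lemma comp_zero:
 assumes H: "H \<in> borel_measurable (predictable_sigma T)" and C: "1 <= C"
  and K: "!!s w. w \<in> path_space T ==> s \<in> {0<..T} ==> \<bar>H (s, w)\<bar> <= K * C ^ N w"
 shows "expectation (compensated j H) = 0"
proof -
 define u where "u x = max 0 (H x)" for x
 define v where "v x = max 0 (- H x)" for x
 have m: "u \<in> borel_measurable (predictable_sigma T)" "v \<in> borel_measurable (predictable_sigma T)"
  using H by (auto simp: u_def[abs_def] v_def[abs_def])
 have nn: "0 <= u x" "0 <= v x" for x by (auto simp: u_def v_def)
 have u: "\<bar>u (s, w)\<bar> <= K * C ^ N w" and v: "\<bar>v (s, w)\<bar> <= K * C ^ N w" if "w \<in> path_space T" "s \<in> {0<..T}" for s w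
  using K[OF that] by (auto simp: u_def v_def)
 have e: "H = (%x. u x - v x)" by (auto simp: u_def v_def fun_eq_iff)
 have "expectation (compensated j H) = expectation (%w. compensated j u w - compensated j v w)"
  unfolding e by (rule bochner_cong[OF refl], rule comp_add(2)[OF _ m u v]) auto
 also have "... = expectation (compensated j u) - expectation (compensated j v)"
  using comp_integrable_P(3)[OF m(1) C u] comp_integrable_P(3)[OF m(2) C v] by simp
 also have "... = 0"
  using comp_nonneg_zero[OF m(1) nn(1) C order_trans[OF abs_ge_self u]] comp_nonneg_zero[OF m(2) nn(2) C order_trans[OF abs_ge_self v]] by simp
 finally show ?thesis .
qed

end

lemma left_limit_jump:
 assumes J: "finite J" and Y: "has_density (clock J) T \<eta> Y" and s: "s \<in> {0<..T}"
 shows "Y s = left_limit Y s + (if s \<in> J then \<eta> s else 0)"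
proof -
 have i: "set_integrable (clock J) A \<eta>" if "A <= {0<..T}" "A \<in> sets borel" for A
  by (rule has_density_subset[OF Y sets_clock that])
 have il: "set_integrable lborel {s} \<eta>"
  using i[of "{s}"] s by (simp add: set_integrable_clock[OF J])
 have z: "(LINT x:{s}|lborel. \<eta> x) = 0"
  unfolding set_lebesgue_integral_def
  by (rule integral_eq_zero_AE, rule AE_mp[OF AE_lborel_singleton[of s]]) (auto simp: indicator_def)
 have "Y s = Y 0 + (LINT x:{0<..s}|clock J. \<eta> x)" by (rule has_densityD(2)[OF Y]) (use s in auto)
 also have "{0<..s} = {0<..<s} Un {s}" using s by auto
 also have "(LINT x:{0<..<s} Un {s}|clock J. \<eta> x) = (LINT x:{0<..<s}|clock J. \<eta> x) + (LINT x:{s}|clock J. \<eta> x)"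
  by (rule set_integral_Un) (use s in \<open>auto intro!: i\<close>)
 also have "(LINT x:{s}|clock J. \<eta> x) = (\<Sum>x\<in>J Int {s}. \<eta> x)"
  using set_integral_clock[OF J _ il] z by simp
 also have "J Int {s} = (if s \<in> J then {s} else {})" by auto
 finally show ?thesis unfolding has_density_left_limit[OF Y sets_clock s] by simp
qed

lemma has_density_stop:
 assumes Y: "has_density M T \<eta> Y" and M: "sets M = sets borel" and u: "u \<in> {0..T}"
 shows "has_density M T (%s. indicator {..u} s * \<eta> s) (%t. Y (min t u))"
 unfolding has_density_def
proof (intro conjI ballI)
 have e: "indicator {0<..t} s *\<^sub>R (indicator {..u} s * \<eta> s) = indicator {0<..min t u} s *\<^sub>R \<eta> s" for s t
  by (auto simp: indicator_def)
 show "set_integrable M {0<..T} (%s. indicator {..u} s * \<eta> s)"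
  unfolding set_integrable_def e unfolding set_integrable_def[symmetric]
  by (rule has_density_subset[OF Y M]) auto
 show "Y (min t u) = Y (min 0 u) + (LINT s:{0<..t}|M. indicator {..u} s * \<eta> s)" if "t \<in> {0..T}" for t
  unfolding set_lebesgue_integral_def e unfolding set_lebesgue_integral_def[symmetric]
  using has_densityD(2)[OF Y, of "min t u"] that u by (simp add: min_le_iff_disj)
qed

context reference_chain begin

text \<open>Mean zero for a jump integral that charges each jump according to the state entered: the indicator
 \<open>1 - X\<^sub>j\<^sub>-\<close> keeps the entrances into \<open>j\<close> and discards the exits from it.\<close>

lemma entering_zero:
 fixes h :: "real => (real => real^'m) => 'm => real"
 assumes h: "!!j. (%(s, w). h s w j) \<in> borel_measurable (predictable_sigma T)" and C: "1 <= C"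
  and K: "!!s w j. w \<in> path_space T ==> s \<in> {0<..T} ==> \<bar>h s w j\<bar> <= K * C ^ N w" and t: "t \<in> {0..T}"
 defines "\<gamma> \<equiv> %w s. if s \<in> jumps T w then (\<Sum>j\<in>UNIV. w s $ j * h s w j)
    else - (\<Sum>j\<in>UNIV. (1 - left_limit w s $ j) * h s w j)"
 shows "w \<in> path_space T ==> set_integrable (clock (jumps T w)) {0<..t} (\<gamma> w)"
  and "integrable P (%w. LINT s:{0<..t}|clock (jumps T w). \<gamma> w s)"
  and "expectation (%w. LINT s:{0<..t}|clock (jumps T w). \<gamma> w s) = 0"
proof -
 define H where "H j x = indicator {0<..t} (fst x) * ((1 - left_limit (snd x) (fst x) $ j) * h (fst x) (snd x) j)" for j and x :: "real \<times> (real => real^'m)"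
 have H: "H j \<in> borel_measurable (predictable_sigma T)" for j
 proof -
  have "(%(s, w). indicator {0<..t} s :: real) \<in> borel_measurable (predictable_sigma T :: (real \<times> (real => real^'m)) measure)"
   by (rule predictable_time) (auto intro: measurable_restrict_space1)
  then show ?thesis
   using h[of j] Xm_predictable[of j] unfolding H_def case_prod_unfold by measurable
 qed
 have HK: "\<bar>H j (s, w)\<bar> <= K * C ^ N w" if "w \<in> path_space T" "s \<in> {0<..T}" for j s w
  using K[OF that, of j] Xm_bounds[OF that(1), of s j] that(2) order_trans[OF abs_ge_zero K[OF that, of j]]
  by (auto simp: H_def indicator_def)
 have pt: "(\<Sum>j\<in>UNIV. indicator {0<..T} s *\<^sub>R (H j (s, w) * kappa j w s)) = indicator {0<..t} s *\<^sub>R \<gamma> w s"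
  if w: "w \<in> path_space T" for w s
 proof (cases "s \<in> {0<..t}")
  case False
  then show ?thesis by (simp add: H_def)
 next
  case True
  then have s: "s \<in> {0<..T}" "s \<in> {0..T}" using t by auto
  show ?thesis
  proof (cases "s \<in> jumps T w")
   case J: True
   have "(\<Sum>j\<in>UNIV. H j (s, w) * kappa j w s) = (\<Sum>j\<in>UNIV. h s w j * ((1 - left_limit w s $ j) * (w s - left_limit w s) $ j))"
    using J True by (intro sum.cong) (auto simp: H_def kappa_def)
   also have "... = (\<Sum>j\<in>UNIV. h s w j * w s $ j)"
    unfolding entering_eq[OF w s(2)] by (rule entering_sum[OF w J])
   finally show ?thesis using J True s by (simp add: \<gamma>_def mult.commute)
  next
   case J: False
   have "H j (s, w) * kappa j w s = - ((1 - left_limit w s $ j) * h s w j)" for j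
    using J True Xm_bounds[OF w s(2), of j] by (auto simp: H_def kappa_def)
   then show ?thesis using J True s by (simp add: \<gamma>_def sum_negf)
  qed
 qed
 have ci: "set_integrable (clock (jumps T w)) {0<..T} (%s. H j (s, w) * kappa j w s)" if w: "w \<in> path_space T" for j w
  by (rule comp_integrable[OF w H HK[OF w]])
 show "set_integrable (clock (jumps T w)) {0<..t} (\<gamma> w)" if w: "w \<in> path_space T" for w
  using ci[OF w] unfolding set_integrable_def pt[OF w, symmetric] by (intro Bochner_Integration.integrable_sum)
 have e: "(LINT s:{0<..t}|clock (jumps T w). \<gamma> w s) = (\<Sum>j\<in>UNIV. compensated j (H j) w)" if w: "w \<in> path_space T" for w
  unfolding compensated_def set_lebesgue_integral_def pt[OF w, symmetric]
  by (rule Bochner_Integration.integral_sum) (rule ci[OF w, unfolded set_integrable_def])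
 have ip: "integrable P (compensated j (H j))" for j by (rule comp_integrable_P(3)[OF H C HK])
 have "integrable P (%w. \<Sum>j\<in>UNIV. compensated j (H j) w)" using ip by (intro Bochner_Integration.integrable_sum)
 then show "integrable P (%w. LINT s:{0<..t}|clock (jumps T w). \<gamma> w s)"
  by (rule Bochner_Integration.integrable_cong[THEN iffD2, OF refl, rotated]) (simp add: e)
 have "expectation (%w. LINT s:{0<..t}|clock (jumps T w). \<gamma> w s) = expectation (%w. \<Sum>j\<in>UNIV. compensated j (H j) w)"
  by (rule bochner_cong) (simp_all add: e)
 also have "... = 0" using ip comp_zero[OF H C HK] by simp
 finally show "expectation (%w. LINT s:{0<..t}|clock (jumps T w). \<gamma> w s) = 0" .
qed

lemma initial_law: "expectation (%w. w 0 $ i) = p0 $ i"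
proof -
 have "expectation (%w. w 0 $ i) = expectation (indicat_real {w \<in> space P. w 0 = unit_state i})"
 proof (rule bochner_cong[OF refl])
  fix w assume w: "w \<in> space P"
  obtain k where k: "w 0 = axis k 1" using path_in_state_space[of w T 0] w T by (auto elim: state_cases)
  show "w 0 $ i = indicat_real {w \<in> space P. w 0 = unit_state i} w"
   using w by (auto simp: k axis_nth axis_eq_axis)
 qed
 also have "... = measure P {w \<in> space P. w 0 = unit_state i}" by simp (simp add: Int_absorb2 subset_iff)
 also have "... = p0 $ i" using ref unfolding reference_measure_def by blast
 finally show ?thesis .
qed

end

section \<open>Change of intensity\<close>

text \<open>\<open>lam s w j\<close> is the intensity of jumping to \<open>j\<close>. At the current state it is minus the total exit rate in the
 applications, so positivity is asked of the other states only.\<close>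

locale controlled_chain = reference_chain T p0 P
 for T :: real and p0 :: "real^'m::finite" and P :: "(real => real^'m) measure" +
 fixes lam :: "real => (real => real^'m) => 'm => real" and c :: real
 assumes lam: "!!j. (%(s, w). lam s w j) \<in> borel_measurable (predictable_sigma T)"
  and c: "1 <= c"
  and lam_le: "!!s w j. s \<in> {0<..T} ==> w \<in> path_space T ==> \<bar>lam s w j\<bar> <= c"
  and lam_pos: "!!s w j. s \<in> {0<..T} ==> w \<in> path_space T ==> left_limit w s $ j = 0 ==> 0 < lam s w j"
begin

abbreviation drift :: "(real => real^'m) => real => real" where
 "drift w \<equiv> exit_drift (%s j. lam s w j) w"

abbreviation factor :: "(real => real^'m) => real => real" where
 "factor w \<equiv> jump_factor (%s j. lam s w j) w"

definition lik :: "real => (real => real^'m) => real" where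
 "lik t w = jump_exp (jumps T w) (drift w) (factor w) t"

definition lik_left :: "real => (real => real^'m) => real" where
 "lik_left s w = left_limit (%u. lik u w) s"

definition lik_const :: real where "lik_const = exp (real CARD('m) * (c + 1) * T)"

lemma drift_predictable: "(%(s, w). drift w s) \<in> borel_measurable (predictable_sigma T)"
proof -
 have [measurable]: "(%x. lam (fst x) (snd x) j) \<in> borel_measurable (predictable_sigma T)"
  "(%x. left_limit (snd x) (fst x) $ j) \<in> borel_measurable (predictable_sigma T)" for j
  using lam[of j] Xm_predictable[of j] by (simp_all add: case_prod_unfold)
 show ?thesis unfolding exit_drift_def case_prod_unfold by measurable
qed

lemma drift_bound:
 assumes "s \<in> {0<..T}" "w \<in> path_space T"
 shows "\<bar>drift w s\<bar> <= real CARD('m) * (c + 1)"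
proof -
 have "\<bar>drift w s\<bar> <= (\<Sum>j\<in>UNIV. \<bar>(1 - left_limit w s $ j) * (lam s w j - 1)\<bar>)"
  unfolding exit_drift_def abs_minus_cancel by (rule sum_abs)
 also have "... <= (\<Sum>j\<in>(UNIV::'m set). c + 1)"
 proof (rule sum_mono)
  fix j
  show "\<bar>(1 - left_limit w s $ j) * (lam s w j - 1)\<bar> <= c + 1"
   using Xm_bounds[OF assms(2), of s j] assms(1) lam_le[OF assms, of j] c by auto
 qed
 finally show ?thesis by simp
qed

lemma drift_integrable:
 assumes w: "w \<in> path_space T" shows "set_integrable lborel {0<..T} (drift w)"
 by (rule set_integrable_bounded_lborel[OF predictable_section_borel[OF T0 w drift_predictable] drift_bound[OF _ w]])

lemma factor_jump:
 assumes w: "w \<in> path_space T" and r: "r \<in> jumps T w"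
 obtains i k where "left_limit w r = axis i 1" "w r = axis k 1" "i ~= k" "factor w r = lam r w k" "0 < lam r w k" "lam r w k <= c"
proof -
 have r': "r \<in> {0<..T}" "r \<in> {0..T}" using r jumps_subset[of T w] by auto
 obtain i where i: "left_limit w r = axis i 1" using path_left_limit_state[OF w r'(2)] by (rule state_cases)
 obtain k where k: "w r = axis k 1" using path_in_state_space[OF w r'(2)] by (rule state_cases)
 have ik: "i ~= k" using r i k by (auto simp: jumps_def)
 have "factor w r = lam r w k" by (simp add: jump_factor_def k axis_nth if_mult_zero)
 moreover have "0 < lam r w k" by (rule lam_pos[OF r'(1) w]) (use ik in \<open>simp add: i axis_nth\<close>)
 moreover have "lam r w k <= c" using lam_le[OF r'(1) w, of k] by simp
 ultimately show ?thesis using that i k ik by blast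
qed

lemma factor_bounds:
 assumes "w \<in> path_space T" "r \<in> jumps T w"
 shows "0 < factor w r" "factor w r <= c" "factor w r ~= 0"
 by (rule factor_jump[OF assms], simp)+

lemma lik_0 [simp]: "lik 0 w = 1" by (simp add: lik_def)

lemma lik_pos: assumes w: "w \<in> path_space T" shows "0 < lik t w"
 unfolding lik_def by (rule jump_exp_pos) (rule factor_bounds(1)[OF w])

lemma lik_bound:
 assumes w: "w \<in> path_space T" and t: "t \<in> {0..T}"
 shows "lik t w <= lik_const * c ^ N w"
 unfolding lik_def jump_exp_def lik_const_def
proof (rule mult_mono)
 have i: "set_integrable lborel {0<..t} (drift w)" by (rule set_integrable_subset[OF drift_integrable[OF w]]) (use t in auto)
 have "(LINT s:{0<..t}|lborel. drift w s) <= (LINT s:{0<..t}|lborel. real CARD('m) * (c + 1))"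
 proof (rule set_integral_mono[OF i])
  show "set_integrable lborel {0<..t} (%s. real CARD('m) * (c + 1))"
   by (rule set_integrable_bounded_lborel[where K="\<bar>real CARD('m) * (c + 1)\<bar>"]) auto
  show "drift w s <= real CARD('m) * (c + 1)" if "s \<in> {0<..t}" for s
   using drift_bound[OF _ w, of s] that t by auto
 qed
 also have "... = real CARD('m) * (c + 1) * t" using t by (simp add: set_lebesgue_integral_def)
 also have "... <= real CARD('m) * (c + 1) * T" using t c by (intro mult_left_mono) auto
 finally show "exp (LINT s:{0<..t}|lborel. drift w s) <= exp (real CARD('m) * (c + 1) * T)" by simp
 have p: "0 < factor w r & factor w r <= c" if "r \<in> jumps T w" for r
  using factor_bounds[OF w that] by simp
 have "prod (factor w) (jumps T w Int {0<..t}) <= (\<Prod>r\<in>jumps T w Int {0<..t}. c)"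
  using p by (intro prod_mono) (auto intro: less_imp_le)
 also have "... = c ^ card (jumps T w Int {0<..t})" by simp
 also have "... <= c ^ N w" using c finite_jumps[OF w] by (intro power_increasing card_mono) auto
 finally show "prod (factor w) (jumps T w Int {0<..t}) <= c ^ N w" .
 show "0 <= prod (factor w) (jumps T w Int {0<..t})" using p by (intro prod_nonneg) (auto intro: less_imp_le)
qed simp

text \<open>The product over the jumps is the exponential of a sum of jump integrals.\<close>

lemma lik_adapted:
 assumes t: "t \<in> {0..T}" shows "lik t \<in> borel_measurable (F t)"
proof -
 define H where "H j x = (1 - left_limit (snd x) (fst x) $ j) * ln (lam (fst x) (snd x) j)" for j and x :: "real \<times> (real => real^'m)"
 have H: "H j \<in> borel_measurable (predictable_sigma T)" for j
  using lam[of j] Xm_predictable[of j] unfolding H_def case_prod_unfold by measurable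
 have "(%w. exp (LINT s:{0<..t}|lborel. drift w s) * exp (\<Sum>j\<in>UNIV. jump_integral T j (H j) t w)) \<in> borel_measurable (F t)"
  by (intro borel_measurable_times measurable_compose[OF _ borel_measurable_exp] borel_measurable_sum
   jump_integral_adapted[OF T0 t H] predictable_integral_adapted[OF T0 t drift_predictable])
 also have "?this \<longleftrightarrow> ?thesis"
 proof (rule measurable_cong)
  fix w assume "w \<in> space (F t)"
  then have w: "w \<in> path_space T" by simp
  have "(\<Sum>j\<in>UNIV. jump_integral T j (H j) t w) = (\<Sum>r\<in>jumps T w Int {0<..t}. \<Sum>j\<in>UNIV. H j (r, w) * (w r - left_limit w r) $ j)"
   unfolding jump_integral_def by (rule sum.swap)
  also have "... = (\<Sum>r\<in>jumps T w Int {0<..t}. ln (factor w r))"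
  proof (intro sum.cong refl)
   fix r assume "r \<in> jumps T w Int {0<..t}"
   then have r: "r \<in> jumps T w" by simp
   obtain i k where ik: "left_limit w r = axis i 1" "w r = axis k 1" "i ~= k" "factor w r = lam r w k"
    by (rule factor_jump[OF w r])
   have "H j (r, w) * (w r - left_limit w r) $ j = (if j = k then ln (lam r w k) else 0)" for j
    using ik(3) by (simp add: H_def ik(1,2) axis_nth)
   then show "(\<Sum>j\<in>UNIV. H j (r, w) * (w r - left_limit w r) $ j) = ln (factor w r)" by (simp add: ik(4))
  qed
  finally have "exp (\<Sum>j\<in>UNIV. jump_integral T j (H j) t w) = (\<Prod>r\<in>jumps T w Int {0<..t}. exp (ln (factor w r)))"
   using finite_jumps[OF w] by (simp add: exp_sum)
  also have "... = (\<Prod>r\<in>jumps T w Int {0<..t}. factor w r)"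
  proof (intro prod.cong refl)
   fix r assume "r \<in> jumps T w Int {0<..t}"
   then have "0 < factor w r" by (intro factor_bounds(1)[OF w]) simp
   then show "exp (ln (factor w r)) = factor w r" by simp
  qed
  finally show "exp (LINT s:{0<..t}|lborel. drift w s) * exp (\<Sum>j\<in>UNIV. jump_integral T j (H j) t w) = lik t w"
   by (simp add: lik_def jump_exp_def)
 qed
 finally show ?thesis .
qed

lemma lik_measurable: "t \<in> {0..T} ==> lik t \<in> borel_measurable P"
 by (rule F_measurable[OF lik_adapted]) auto

lemma
 assumes w: "w \<in> path_space T"
 shows lik_density: "has_density (clock (jumps T w)) T (%s. lik_left s w * (if s \<in> jumps T w then factor w s - 1 else drift w s)) (%t. lik t w)"
  and lik_left_eq: "s \<in> {0<..T} ==> s \<notin> jumps T w ==> lik_left s w = lik s w"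
proof -
 have ne: "factor w r ~= 0" if "r \<in> jumps T w" for r by (rule factor_bounds(3)[OF w that])
 show "has_density (clock (jumps T w)) T (%s. lik_left s w * (if s \<in> jumps T w then factor w s - 1 else drift w s)) (%t. lik t w)"
  unfolding lik_left_def lik_def by (rule has_density_jump_exp[OF finite_jumps[OF w] drift_integrable[OF w] T0 ne])
 show "s \<in> {0<..T} ==> s \<notin> jumps T w ==> lik_left s w = lik s w"
  using left_limit_jump_exp[OF finite_jumps[OF w] drift_integrable[OF w] T0 ne] by (simp add: lik_left_def lik_def)
qed

lemma lik_left_bound:
 assumes w: "w \<in> path_space T" and s: "s \<in> {0..T}"
 shows "\<bar>lik_left s w\<bar> <= lik_const * c ^ N w"
 unfolding lik_left_def
 by (rule left_limit_bounded[OF has_density_cadlag[OF lik_density[OF w] sets_clock] _ s])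
   (use lik_bound[OF w] lik_pos[OF w] in \<open>auto simp: abs_of_pos\<close>)

lemma lik_left_nonneg:
 assumes w: "w \<in> path_space T" and s: "s \<in> {0<..T}"
 shows "0 <= lik_left s w"
proof -
 have ne: "factor w r ~= 0" if "r \<in> jumps T w" for r by (rule factor_bounds(3)[OF w that])
 have p: "s \<in> jumps T w ==> 0 < factor w s" by (rule factor_bounds(1)[OF w])
 show ?thesis
  using left_limit_jump_exp[OF finite_jumps[OF w] drift_integrable[OF w] T0 ne s] lik_pos[OF w, of s] p
  by (auto simp: lik_left_def lik_def intro: less_imp_le divide_nonneg_nonneg)
qed

lemma lik_left_predictable: "(%(s, w). lik_left s w) \<in> borel_measurable (predictable_sigma T)"
 unfolding lik_left_def
 by (rule predictable_left_limit[OF T0 lik_adapted]) (auto intro!: exI has_density_at_left[OF lik_density sets_clock])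

end

context controlled_chain begin

text \<open>The controlled generator applied to \<open>wt\<close> at the current state: \<open>\<Sum>\<^sub>j lam\<^sub>j (wt\<^sub>j - wt\<^sub>i)\<close> in state \<open>i\<close>.\<close>

definition gen :: "(real => (real => real^'m) => 'm => real) => real => (real => real^'m) => real" where
 "gen wt s w = (\<Sum>j\<in>UNIV. (1 - left_limit w s $ j) * lam s w j * (wt s w j - (\<Sum>k\<in>UNIV. wt s w k * left_limit w s $ k)))"

lemma sum_axis: "(\<Sum>k\<in>UNIV. f k * axis i (1::real) $ k) = f (i::'m)"
 by (simp add: axis_nth if_mult_zero)

lemma sum_axis': "(\<Sum>k\<in>UNIV. axis i (1::real) $ k * f k) = f (i::'m)"
 by (simp add: axis_nth if_mult_zero)

lemma sum_split:
 fixes a l x :: "'m => real"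
 shows "(\<Sum>j\<in>UNIV. a j * (D * ((l j - 1) * v + l j * x j)))
  = D * ((\<Sum>j\<in>UNIV. a j * l j * x j) - - (\<Sum>j\<in>UNIV. a j * (l j - 1)) * v)"
 by (simp add: sum_distrib_left sum_distrib_right sum.distrib[symmetric] algebra_simps)

text \<open>Likelihood \<open>D\<close> times value \<open>V\<close>. At a jump from \<open>i\<close> to \<open>k\<close> the product rule gives
 \<open>D\<^sub>- ((lam\<^sub>k - 1) V\<^sub>- + lam\<^sub>k (wt\<^sub>k - wt\<^sub>i))\<close>; call this \<open>h\<^sub>k\<close>. Subtracting the compensator of \<open>h\<close> cancels the drift of \<open>D\<close>,
 which was chosen for this purpose, and leaves \<open>D\<^sub>- (f + gen wt)\<close>.\<close>

lemma
 fixes V f :: "real => (real => real^'m) => real" and wt :: "real => (real => real^'m) => 'm => real"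
 assumes V: "!!w. w \<in> path_space T ==> has_density (clock (jumps T w)) T
   (%s. if s \<in> jumps T w then \<Sum>j\<in>UNIV. wt s w j * (w s - left_limit w s) $ j else f s w) (%t. V t w)"
  and V_ad: "!!t. t \<in> {0..T} ==> V t \<in> borel_measurable (F t)"
  and V_bd: "!!t w. t \<in> {0..T} ==> w \<in> path_space T ==> \<bar>V t w\<bar> <= K"
  and w: "!!j. (%(s, w). wt s w j) \<in> borel_measurable (predictable_sigma T)"
  and w_bd: "!!s w j. s \<in> {0<..T} ==> w \<in> path_space T ==> \<bar>wt s w j\<bar> <= K"
  and t: "t \<in> {0..T}"
 shows verification_integrable: "integrable P (%w. lik t w * V t w)"
  and verification: "expectation (%w. lik t w * V t w)
   = expectation (V 0) + expectation (%w. LINT s:{0<..t}|lborel. lik_left s w * (f s w + gen wt s w))"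
proof -
 define Vm where "Vm s w = left_limit (%t. V t w) s" for s w
 have Vm: "(%(s, w). Vm s w) \<in> borel_measurable (predictable_sigma T)"
  unfolding Vm_def
  by (rule predictable_left_limit[OF T0 V_ad]) (auto intro!: exI has_density_at_left[OF V sets_clock])
 have Vm_bd: "\<bar>Vm s w\<bar> <= K" if "s \<in> {0<..T}" "w \<in> path_space T" for s w
  unfolding Vm_def
  by (rule left_limit_bounded[OF has_density_cadlag[OF V[OF that(2)] sets_clock] V_bd]) (use that in auto)
 define h where "h s w j = lik_left s w * ((lam s w j - 1) * Vm s w + lam s w j * (wt s w j - (\<Sum>k\<in>UNIV. wt s w k * left_limit w s $ k)))" for s w j
 have h: "(%(s, w). h s w j) \<in> borel_measurable (predictable_sigma T)" for j
 proof -
  have [measurable]: "(%x. lam (fst x) (snd x) j) \<in> borel_measurable (predictable_sigma T)"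
   "(%x. left_limit (snd x) (fst x) $ j) \<in> borel_measurable (predictable_sigma T)"
   "(%x. wt (fst x) (snd x) j) \<in> borel_measurable (predictable_sigma T)"
   "(%x. Vm (fst x) (snd x)) \<in> borel_measurable (predictable_sigma T)"
   "(%x. lik_left (fst x) (snd x)) \<in> borel_measurable (predictable_sigma T)" for j
   using lam[of j] Xm_predictable[of j] w[of j] Vm lik_left_predictable by (simp_all add: case_prod_unfold)
  show ?thesis unfolding h_def case_prod_unfold by measurable
 qed
 define L where "L = (c + 1) * K + c * (K + K)"
 have h_bd: "\<bar>h s w j\<bar> <= (lik_const * L) * c ^ N w" if wp: "w \<in> path_space T" and s: "s \<in> {0<..T}" for s w j
 proof -
  have s': "s \<in> {0..T}" using s by auto
  obtain i where i: "left_limit w s = axis i 1" using path_left_limit_state[OF wp s'] by (rule state_cases)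
  have K0: "0 <= K" using order_trans[OF abs_ge_zero V_bd[OF t wp]] .
  have "\<bar>(lam s w j - 1) * Vm s w + lam s w j * (wt s w j - wt s w i)\<bar> <= L"
   unfolding L_def
  proof (rule order_trans[OF abs_triangle_ineq add_mono])
   show "\<bar>(lam s w j - 1) * Vm s w\<bar> <= (c + 1) * K"
    unfolding abs_mult using lam_le[OF s wp, of j] Vm_bd[OF s wp] K0 c by (intro mult_mono) auto
   show "\<bar>lam s w j * (wt s w j - wt s w i)\<bar> <= c * (K + K)"
    unfolding abs_mult using lam_le[OF s wp, of j] w_bd[OF s wp, of i] w_bd[OF s wp, of j] K0 c by (intro mult_mono) auto
  qed
  then have "\<bar>h s w j\<bar> <= (lik_const * c ^ N w) * L"
   unfolding h_def i sum_axis abs_mult using lik_left_bound[OF wp s'] c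
   by (intro mult_mono) (auto simp: lik_const_def)
  then show ?thesis by (simp add: mult.commute mult.left_commute)
 qed
 let ?\<gamma> = "%w s. if s \<in> jumps T w then (\<Sum>j\<in>UNIV. w s $ j * h s w j) else - (\<Sum>j\<in>UNIV. (1 - left_limit w s $ j) * h s w j)"
 let ?k = "%w s. lik_left s w * (f s w + gen wt s w)"
 define G where "G w = (LINT s:{0<..t}|clock (jumps T w). ?\<gamma> w s)" for w
 have Gi: "integrable P G" and GE: "expectation G = 0"
  unfolding G_def[abs_def] by (rule entering_zero(2,3)[OF h c h_bd t], assumption+)+
 have path: "set_integrable lborel {0<..t} (?k w) & lik t w * V t w = V 0 w + G w + (LINT s:{0<..t}|lborel. ?k w s)"
  if wp: "w \<in> path_space T" for w
 proof -
  let ?J = "jumps T w"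
  note J = finite_jumps[OF wp]
  let ?\<rho> = "%s. (lik_left s w * (if s \<in> ?J then factor w s - 1 else drift w s)) * V s w
   + left_limit (%t. lik t w) s * (if s \<in> ?J then \<Sum>j\<in>UNIV. wt s w j * (w s - left_limit w s) $ j else f s w)"
  have d: "has_density (clock ?J) T ?\<rho> (%t. lik t w * V t w)"
   by (rule has_density_mult[OF sigma_finite_clock[OF J] sets_clock T0 lik_density[OF wp] V[OF wp]])
  have pt: "?\<rho> s = ?\<gamma> w s + (if s \<in> ?J then 0 else ?k w s)" if s: "s \<in> {0<..T}" for s
  proof -
   have s': "s \<in> {0..T}" using s by auto
   note Vs = left_limit_jump[OF J V[OF wp] s, folded Vm_def]
   show ?thesis
   proof (cases "s \<in> ?J")
    case True
    obtain i k where ik: "left_limit w s = axis i 1" "w s = axis k 1" "factor w s = lam s w k"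
     by (rule factor_jump[OF wp True])
    have jump: "(\<Sum>j\<in>UNIV. wt s w j * (w s - left_limit w s) $ j) = wt s w k - wt s w i"
     by (simp add: ik right_diff_distrib sum_subtractf sum_axis)
    have "V s w = Vm s w + (wt s w k - wt s w i)" using Vs True unfolding jump by simp
    moreover have "(\<Sum>j\<in>UNIV. w s $ j * h s w j) = lik_left s w * ((lam s w k - 1) * Vm s w + lam s w k * (wt s w k - wt s w i))"
     unfolding ik(2) sum_axis' unfolding h_def ik(1) sum_axis ..
    ultimately show ?thesis
     using True by (simp only: if_True jump ik(3) lik_left_def[symmetric]) (simp add: algebra_simps)
   next
    case False
    have "V s w = Vm s w" using Vs False by simp
    moreover have "(\<Sum>j\<in>UNIV. (1 - left_limit w s $ j) * h s w j) = lik_left s w * (gen wt s w - drift w s * Vm s w)"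
     unfolding h_def gen_def exit_drift_def by (rule sum_split)
    ultimately show ?thesis
     using False by (simp only: if_False lik_left_def[symmetric]) (simp add: algebra_simps)
   qed
  qed
  have g: "set_integrable (clock ?J) {0<..t} (?\<gamma> w)" by (rule entering_zero(1)[OF h c h_bd t wp])
  have r: "set_integrable (clock ?J) {0<..t} ?\<rho>"
   by (rule has_density_subset[OF d sets_clock]) (use t in auto)
  have e: "(if s \<in> ?J then 0 else ?k w s) = ?\<rho> s - ?\<gamma> w s" if "s \<in> {0<..t}" for s
   using pt[of s] that t by simp
  have i1: "set_integrable (clock ?J) {0<..t} (%s. if s \<in> ?J then 0 else ?k w s)"
   by (rule set_integrable_cong[THEN iffD2, OF refl refl e set_integral_diff(1)[OF r g]])
  then have i2: "set_integrable lborel {0<..t} (%s. if s \<in> ?J then 0 else ?k w s)"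
   by (simp add: set_integrable_clock[OF J])
  have i3: "set_integrable lborel {0<..t} (?k w)"
   by (rule set_integral_finite_difference(1)[OF J, THEN iffD1, OF _ i2]) simp
  have "(LINT s:{0<..t}|clock ?J. (if s \<in> ?J then 0 else ?k w s)) = (LINT s:{0<..t}|lborel. (if s \<in> ?J then 0 else ?k w s))"
   by (subst set_integral_clock[OF J _ i2]) simp_all
  also have "... = (LINT s:{0<..t}|lborel. ?k w s)" by (rule set_integral_finite_difference(2)[OF J]) simp
  finally have k: "(LINT s:{0<..t}|clock ?J. (if s \<in> ?J then 0 else ?k w s)) = (LINT s:{0<..t}|lborel. ?k w s)" .
  have "lik t w * V t w = V 0 w + (LINT s:{0<..t}|clock ?J. ?\<rho> s)"
   using has_densityD(2)[OF d t] by simp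
  also have "(LINT s:{0<..t}|clock ?J. ?\<rho> s) = (LINT s:{0<..t}|clock ?J. ?\<gamma> w s + (if s \<in> ?J then 0 else ?k w s))"
   by (rule set_lebesgue_integral_cong) (use pt t in auto)
  also have "... = G w + (LINT s:{0<..t}|lborel. ?k w s)"
   unfolding set_integral_add(2)[OF g i1] k G_def ..
  finally show ?thesis using i3 by simp
 qed
 have V0m: "V 0 \<in> borel_measurable P" and Vtm: "V t \<in> borel_measurable P"
  using V_ad[of 0] V_ad[OF t] t T by (auto intro: F_measurable)
 have V0i: "integrable P (V 0)" by (rule integrable_bounded[OF V0m V_bd]) (use T in auto)
 show i1: "integrable P (%w. lik t w * V t w)"
 proof (rule bochner_bound)
  show "integrable P (%w. (lik_const * K) * c ^ N w)" using exp_moment[OF c] by simp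
  show "(%w. lik t w * V t w) \<in> borel_measurable P" by (intro borel_measurable_times lik_measurable t Vtm)
  show "AE w in P. norm (lik t w * V t w) <= norm ((lik_const * K) * c ^ N w)"
  proof (rule AE_I2)
   fix w assume "w \<in> space P"
   then have wp: "w \<in> path_space T" by simp
   have "\<bar>lik t w * V t w\<bar> <= (lik_const * c ^ N w) * K"
    unfolding abs_mult using lik_bound[OF wp t] lik_pos[OF wp, of t] V_bd[OF t wp] by (intro mult_mono) auto
   also have "... <= \<bar>(lik_const * K) * c ^ N w\<bar>" by (simp add: mult.commute mult.left_commute)
   finally show "norm (lik t w * V t w) <= norm ((lik_const * K) * c ^ N w)" by simp
  qed
 qed
 have eq: "(LINT s:{0<..t}|lborel. ?k w s) = lik t w * V t w - V 0 w - G w" if "w \<in> path_space T" for w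
  using path[OF that] by simp
 have "integrable P (%w. lik t w * V t w - V 0 w - G w)" using i1 V0i Gi by simp
 then have i2: "integrable P (%w. LINT s:{0<..t}|lborel. ?k w s)"
  by (rule Bochner_Integration.integrable_cong[THEN iffD2, OF refl, rotated]) (simp add: eq)
 have "expectation (%w. LINT s:{0<..t}|lborel. ?k w s) = expectation (%w. lik t w * V t w - V 0 w - G w)"
  by (rule bochner_cong) (simp_all add: eq)
 also have "... = expectation (%w. lik t w * V t w) - expectation (V 0)" using i1 V0i Gi GE by simp
 finally show "expectation (%w. lik t w * V t w) = expectation (V 0) + expectation (%w. LINT s:{0<..t}|lborel. ?k w s)" by simp
qed

lemma expectation_lik:
 assumes t: "t \<in> {0..T}"
 shows "integrable P (lik t)" "expectation (lik t) = 1"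
proof -
 have d: "has_density (clock (jumps T w)) T
   (%s. if s \<in> jumps T w then \<Sum>j\<in>UNIV. 0 * (w s - left_limit w s) $ j else 0) (%t. 1)" for w :: "real => real^'m"
 proof -
  have "(%s. if s \<in> jumps T w then \<Sum>j\<in>UNIV. 0 * (w s - left_limit w s) $ j else 0) = (%s. 0)" by auto
  then show ?thesis by (simp add: has_density_def set_integrable_def set_lebesgue_integral_def)
 qed
 note v = verification_integrable[where V="%t w. 1" and wt="%s w j. 0" and f="%s w. 0" and K=1, OF d _ _ _ _ t]
  verification[where V="%t w. 1" and wt="%s w j. 0" and f="%s w. 0" and K=1, OF d _ _ _ _ t]
 show "integrable P (lik t)" using v(1) by simp
 show "expectation (lik t) = 1" using v(2) by (simp add: gen_def set_lebesgue_integral_def prob_path)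
qed

text \<open>Stopping \<open>X\<^sub>i\<close> at time \<open>s0\<close> shows that its mean there does not depend on the horizon \<open>t\<close> of the
 likelihood; this replaces the martingale property of the likelihood.\<close>

lemma marginal:
 assumes s0: "s0 \<in> {0..T}" and t: "t \<in> {s0..T}"
 shows "integrable P (%w. lik t w * w s0 $ i)"
  and "expectation (%w. lik t w * w s0 $ i) = p0 $ i + expectation (%w. LINT s:{0<..s0}|lborel. lik_left s w * gen (%s w j. if j = i then 1 else 0) s w)"
proof -
 define wt where "wt s w j = (if j = i then indicator {..s0} s else (0::real))" for s j and w :: "real => real^'m"
 define V where "V t w = w (min t s0) $ i" for t and w :: "real => real^'m"
 have t': "t \<in> {0..T}" using s0 t by auto
 have d: "has_density (clock (jumps T w)) T
   (%s. if s \<in> jumps T w then \<Sum>j\<in>UNIV. wt s w j * (w s - left_limit w s) $ j else 0) (%t. V t w)"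
  if wp: "w \<in> path_space T" for w
  unfolding V_def
 proof (rule has_density_cong[OF has_density_stop[OF has_density_path[OF wp] sets_clock s0] sets_clock _ refl T0])
  show "indicator {..s0} s * (if s \<in> jumps T w then (w s - left_limit w s) $ i else 0)
   = (if s \<in> jumps T w then \<Sum>j\<in>UNIV. wt s w j * (w s - left_limit w s) $ j else 0)" for s
   by (simp add: wt_def if_mult_zero)
 qed
 have V_ad: "V u \<in> borel_measurable (F u)" if "u \<in> {0..T}" for u
  unfolding V_def[abs_def] by (rule measurable_coordinate_nth) (use that s0 in auto)
 have V_bd: "\<bar>V u w\<bar> <= 1" if "u \<in> {0..T}" "w \<in> path_space T" for u w
 proof -
  have "min u s0 \<in> {0..T}" using that s0 by auto
  from X_bounds[OF that(2) this, of i] show ?thesis by (auto simp: V_def)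
 qed
 have wm: "(%(s, w). wt s w j) \<in> borel_measurable (predictable_sigma T)" for j
  unfolding wt_def by (rule predictable_time) (auto intro!: measurable_restrict_space1)
 have w_bd: "\<bar>wt s w j\<bar> <= 1" for s w j by (simp add: wt_def indicator_def)
 have m: "min t s0 = s0" using t by auto
 note v = verification_integrable[OF d V_ad V_bd wm w_bd t'] verification[OF d V_ad V_bd wm w_bd t']
 show "integrable P (%w. lik t w * w s0 $ i)" using v(1) by (simp add: V_def m)
 have V0: "V 0 = (%w. w 0 $ i)" using s0 by (simp add: V_def fun_eq_iff min_absorb1)
 have "(LINT s:{0<..t}|lborel. lik_left s w * (0 + gen wt s w))
   = (LINT s:{0<..s0}|lborel. lik_left s w * gen (%s w j. if j = i then 1 else 0) s w)" for w
  unfolding set_lebesgue_integral_def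
 proof (rule bochner_cong[OF refl])
  fix s :: real
  show "indicator {0<..t} s *\<^sub>R (lik_left s w * (0 + gen wt s w)) = indicator {0<..s0} s *\<^sub>R (lik_left s w * gen (%s w j. if j = i then 1 else 0) s w)"
  proof (cases "s <= s0")
   case True
   then have "wt s = (%w j. if j = i then 1 else 0)" by (auto simp: wt_def fun_eq_iff)
   then have "gen wt s w = gen (%s w j. if j = i then 1 else 0) s w" unfolding gen_def by (simp only:)
   then show ?thesis using t True by (auto simp: indicator_def)
  next
   case False
   then have "wt s = (%w j. 0)" by (auto simp: wt_def fun_eq_iff)
   then have "gen wt s w = 0" by (simp add: gen_def)
   then show ?thesis using False by simp
  qed
 qed
 then show "expectation (%w. lik t w * w s0 $ i) = p0 $ i + expectation (%w. LINT s:{0<..s0}|lborel. lik_left s w * gen (%s w j. if j = i then 1 else 0) s w)"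
  using v(2) initial_law[of i] by (simp only: V_def m V0)
qed

text \<open>For a feedback intensity the drift of \<open>X\<^sub>i\<close> is linear in \<open>X\<close> with deterministic coefficients, so taking
 expectations closes the equation for the marginal laws.\<close>

lemma kolmogorov:
 assumes r: "!!s w j. s \<in> {0<..T} ==> w \<in> path_space T ==> lam s w j = (\<Sum>k\<in>UNIV. left_limit w s $ k * r s k j)"
  and r0: "!!s k. s \<in> {0<..T} ==> (\<Sum>j\<in>UNIV. r s k j) = 0"
  and t: "t \<in> {0..T}"
 defines "\<mu> \<equiv> %t i. expectation (%w. lik T w * w t $ i)"
 shows "set_integrable lborel {0<..t} (%s. \<Sum>k\<in>UNIV. \<mu> s k * r s k i)"
  and "\<mu> t i = p0 $ i + (LINT s:{0<..t}|lborel. \<Sum>k\<in>UNIV. \<mu> s k * r s k i)"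
proof -
 let ?w = "%(s::real) (w::real => real^'m) j. if j = i then 1 else (0::real)"
 define K where "K s w = lik_left s w * gen ?w s w" for s w
 have ge: "gen ?w s w = (\<Sum>k\<in>UNIV. left_limit w s $ k * r s k i)" if s: "s \<in> {0<..T}" and wp: "w \<in> path_space T" for s w
 proof -
  have s': "s \<in> {0..T}" using s by auto
  obtain a where a: "left_limit w s = axis a 1" using path_left_limit_state[OF wp s'] by (rule state_cases)
  have l: "lam s w j = r s a j" for j unfolding r[OF s wp] a by (rule sum_axis')
  have aj: "(1 - axis a (1::real) $ j) * r s a j = r s a j - (if j = a then r s a j else 0)" for j :: 'm by (simp add: axis_nth)
  have "gen ?w s w = (\<Sum>j\<in>UNIV. ((1 - axis a (1::real) $ j) * r s a j) * ((if j = i then 1 else 0) - (if a = i then 1 else 0)))"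
   unfolding gen_def a sum_axis l ..
  also have "... = r s a i"
  proof (cases "a = i")
   case True
   have "(\<Sum>j\<in>UNIV. ((1 - axis a (1::real) $ j) * r s a j) * ((if j = i then 1 else 0) - (if a = i then 1 else 0)))
     = (\<Sum>j\<in>UNIV. (if j = i then r s a i else 0) - r s a j)"
    by (rule sum.cong) (auto simp: True axis_nth)
   also have "... = r s a i" by (simp add: sum_subtractf r0[OF s])
   finally show ?thesis .
  next
   case False
   then show ?thesis by (simp add: axis_nth if_mult_zero)
  qed
  also have "... = (\<Sum>k\<in>UNIV. left_limit w s $ k * r s k i)" unfolding a by (rule sum_axis'[symmetric])
  finally show ?thesis .
 qed
 have Km: "(%(s, w). K s w) \<in> borel_measurable (predictable_sigma T)"
 proof -
  have [measurable]: "(%x. lam (fst x) (snd x) j) \<in> borel_measurable (predictable_sigma T)"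
   "(%x. left_limit (snd x) (fst x) $ j) \<in> borel_measurable (predictable_sigma T)"
   "(%x. lik_left (fst x) (snd x)) \<in> borel_measurable (predictable_sigma T)" for j
   using lam[of j] Xm_predictable[of j] lik_left_predictable by (simp_all add: case_prod_unfold)
  show ?thesis unfolding K_def gen_def case_prod_unfold by measurable
 qed
 have Kb: "\<bar>K s w\<bar> <= c * (lik_const * c ^ N w)" if s: "s \<in> {0<..T}" and wp: "w \<in> path_space T" for s w
 proof -
  have s': "s \<in> {0..T}" using s by auto
  obtain a where a: "left_limit w s = axis a 1" using path_left_limit_state[OF wp s'] by (rule state_cases)
  have "gen ?w s w = lam s w i" unfolding ge[OF s wp] r[OF s wp] ..
  then have "\<bar>K s w\<bar> = \<bar>lam s w i\<bar> * \<bar>lik_left s w\<bar>" by (simp add: K_def abs_mult)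
  also have "... <= c * (lik_const * c ^ N w)"
   using lam_le[OF s wp, of i] lik_left_bound[OF wp s'] c by (intro mult_mono) auto
  finally show ?thesis .
 qed
 have Wi: "integrable P (%w. lik_const * c ^ N w)" using exp_moment[OF c] by simp
 have ci: "set_integrable lborel {0<..T} (%s. c)" by (rule set_integrable_bounded_lborel[where K="\<bar>c\<bar>"]) auto
 have KE: "expectation (K s) = (\<Sum>k\<in>UNIV. \<mu> s k * r s k i)" if s: "s \<in> {0<..T}" for s
 proof -
  have s': "s \<in> {0..T}" using s by auto
  have ii: "integrable P (%w. lik s w * w s $ k)" for k by (rule marginal(1)[OF s']) (use s in auto)
  have "expectation (K s) = expectation (%w. \<Sum>k\<in>UNIV. lik s w * w s $ k * r s k i)"
  proof (rule integral_cong_AE)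
   show "K s \<in> borel_measurable P" by (rule predictable_at[OF Km s])
   show "(%w. \<Sum>k\<in>UNIV. lik s w * w s $ k * r s k i) \<in> borel_measurable P"
    using ii by (intro borel_measurable_sum borel_measurable_times borel_measurable_const borel_measurable_integrable)
   show "AE w in P. K s w = (\<Sum>k\<in>UNIV. lik s w * w s $ k * r s k i)"
    using AE_left_limit[OF s'] AE_space
   proof eventually_elim
    fix w assume l: "left_limit w s = w s" and "w \<in> space P"
    then have wp: "w \<in> path_space T" by simp
    have nj: "s \<notin> jumps T w" using l by (simp add: jumps_def)
    then show "K s w = (\<Sum>k\<in>UNIV. lik s w * w s $ k * r s k i)"
     unfolding K_def ge[OF s wp] lik_left_eq[OF wp s nj] l by (simp add: sum_distrib_left mult.assoc)
   qed
  qed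
  also have "... = (\<Sum>k\<in>UNIV. expectation (%w. lik s w * w s $ k) * r s k i)" using ii by simp
  also have "... = (\<Sum>k\<in>UNIV. \<mu> s k * r s k i)"
   unfolding \<mu>_def using marginal(2)[OF s', of s] marginal(2)[OF s', of T] s by simp
  finally show ?thesis .
 qed
 have e: "indicator {0<..t} s *\<^sub>R expectation (K s) = indicator {0<..t} s *\<^sub>R (\<Sum>k\<in>UNIV. \<mu> s k * r s k i)" for s
  using KE[of s] t by (cases "s \<in> {0<..t}") auto
 show "set_integrable lborel {0<..t} (%s. \<Sum>k\<in>UNIV. \<mu> s k * r s k i)"
  using predictable_fubini_integrable[OF Km Wi ci t Kb] unfolding set_integrable_def e .
 have "\<mu> t i = p0 $ i + expectation (%w. LINT s:{0<..t}|lborel. K s w)"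
  unfolding \<mu>_def K_def by (rule marginal(2)[OF t]) (use t in auto)
 also have "expectation (%w. LINT s:{0<..t}|lborel. K s w) = (LINT s:{0<..t}|lborel. expectation (K s))"
  by (rule predictable_fubini[OF Km Wi ci t Kb])
 also have "... = (LINT s:{0<..t}|lborel. \<Sum>k\<in>UNIV. \<mu> s k * r s k i)"
  unfolding set_lebesgue_integral_def e ..
 finally show "\<mu> t i = p0 $ i + (LINT s:{0<..t}|lborel. \<Sum>k\<in>UNIV. \<mu> s k * r s k i)" .
qed

text \<open>Verification for \<open>V\<^sub>t = u\<^sub>t(X\<^sub>t) + \<integral>\<^sub>0\<^sup>t l ds\<close>, whose terminal value is the cost when \<open>u\<^sub>T = g\<close>.\<close>

lemma cost_identity:
 fixes u u' :: "'m => real => real" and l :: "real => (real => real^'m) => real"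
 assumes u: "!!k. has_density lborel T (u' k) (u k)"
  and l: "(%(s, w). l s w) \<in> borel_measurable (predictable_sigma T)"
  and l_bd: "!!s w. s \<in> {0<..T} ==> w \<in> path_space T ==> \<bar>l s w\<bar> <= \<phi> s" and \<phi>: "set_integrable lborel {0<..T} \<phi>"
 defines "k \<equiv> %s w. lik_left s w * (((\<Sum>k\<in>UNIV. u' k s * w s $ k) + l s w) + gen (%s w j. u j s) s w)"
 shows "expectation (%w. lik T w * ((\<Sum>k\<in>UNIV. u k T * w T $ k) + (LINT s:{0<..T}|lborel. l s w)))
   = (\<Sum>k\<in>UNIV. u k 0 * p0 $ k) + expectation (%w. LINT s:{0<..T}|lborel. k s w)"
proof -
 have TT: "T \<in> {0..T}" using T by simp
 define V where "V t w = (\<Sum>k\<in>UNIV. u k t * w t $ k) + (LINT s:{0<..t}|lborel. l s w)" for t and w :: "real => real^'m"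
 have li: "set_integrable lborel {0<..T} (%s. l s w)" if wp: "w \<in> path_space T" for w
  unfolding set_integrable_def
 proof (rule bochner_bound)
  show "integrable lborel (%s. indicator {0<..T} s *\<^sub>R \<phi> s)" using \<phi> by (simp add: set_integrable_def)
  show "(%s. indicator {0<..T} s *\<^sub>R l s w) \<in> borel_measurable lborel" using predictable_section_borel[OF T0 wp l] by simp
  show "AE s in lborel. norm (indicator {0<..T} s *\<^sub>R l s w) <= norm (indicator {0<..T} s *\<^sub>R \<phi> s)"
  proof (rule AE_I2)
   fix s show "norm (indicator {0<..T} s *\<^sub>R l s w) <= norm (indicator {0<..T} s *\<^sub>R \<phi> s)"
    using l_bd[OF _ wp, of s] by (cases "s \<in> {0<..T}") auto
  qed
 qed
 have d: "has_density (clock (jumps T w)) T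
   (%s. if s \<in> jumps T w then \<Sum>j\<in>UNIV. u j s * (w s - left_limit w s) $ j else (\<Sum>k\<in>UNIV. u' k s * w s $ k) + l s w) (%t. V t w)"
  if wp: "w \<in> path_space T" for w
 proof -
  let ?J = "jumps T w"
  note J = finite_jumps[OF wp]
  have one: "has_density (clock ?J) T (%s. if s \<in> ?J then u k s * (w s - left_limit w s) $ k else u' k s * w s $ k) (%t. u k t * w t $ k)" for k
  proof -
   have "has_density (clock ?J) T (%s. if s \<in> ?J then 0 else u' k s) (u k)"
    by (rule has_density_clockI[OF J has_densityD(1)[OF u]])
      (simp only: sum.neutral_const add_0_right, rule has_densityD(2)[OF u])
   note dm = has_density_mult[OF sigma_finite_clock[OF J] sets_clock T0 this has_density_path[OF wp, of k]]
   show ?thesis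
   proof (rule has_density_cong[OF dm sets_clock _ refl T0])
    fix s assume s: "s \<in> {0<..T}"
    show "(if s \<in> ?J then 0 else u' k s) * w s $ k + left_limit (u k) s * (if s \<in> ?J then (w s - left_limit w s) $ k else 0)
     = (if s \<in> ?J then u k s * (w s - left_limit w s) $ k else u' k s * w s $ k)"
     using left_limit_lborel[OF u s] by simp
   qed
  qed
  have two: "has_density (clock ?J) T (%s. if s \<in> ?J then 0 else l s w) (%t. LINT s:{0<..t}|lborel. l s w)"
   by (rule has_density_clockI[OF J li[OF wp]]) (simp add: set_lebesgue_integral_def)
  have i1: "set_integrable (clock ?J) {0<..t} (%s. if s \<in> ?J then u k s * (w s - left_limit w s) $ k else u' k s * w s $ k)" if "t \<in> {0..T}" for k t
   by (rule has_density_subset[OF one sets_clock]) (use that in auto)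
  have i2: "set_integrable (clock ?J) {0<..t} (%s. if s \<in> ?J then 0 else l s w)" if "t \<in> {0..T}" for t
   by (rule has_density_subset[OF two sets_clock]) (use that in auto)
  have e: "(if s \<in> ?J then \<Sum>j\<in>UNIV. u j s * (w s - left_limit w s) $ j else (\<Sum>k\<in>UNIV. u' k s * w s $ k) + l s w)
    = (\<Sum>k\<in>UNIV. if s \<in> ?J then u k s * (w s - left_limit w s) $ k else u' k s * w s $ k) + (if s \<in> ?J then 0 else l s w)" for s
   by simp
  have i3: "set_integrable (clock ?J) {0<..t} (%s. \<Sum>k\<in>UNIV. if s \<in> ?J then u k s * (w s - left_limit w s) $ k else u' k s * w s $ k)" if "t \<in> {0..T}" for t
   using i1[OF that] unfolding set_integrable_def scaleR_sum_right by (intro Bochner_Integration.integrable_sum)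
  have s3: "(LINT s:{0<..t}|clock ?J. \<Sum>k\<in>UNIV. if s \<in> ?J then u k s * (w s - left_limit w s) $ k else u' k s * w s $ k)
   = (\<Sum>k\<in>UNIV. LINT s:{0<..t}|clock ?J. if s \<in> ?J then u k s * (w s - left_limit w s) $ k else u' k s * w s $ k)" if "t \<in> {0..T}" for t
   unfolding set_lebesgue_integral_def scaleR_sum_right
   by (rule Bochner_Integration.integral_sum) (rule i1[OF that, unfolded set_integrable_def])
  show ?thesis
   unfolding has_density_def e
  proof (intro conjI ballI)
   show "set_integrable (clock ?J) {0<..T} (%s. (\<Sum>k\<in>UNIV. if s \<in> ?J then u k s * (w s - left_limit w s) $ k else u' k s * w s $ k) + (if s \<in> ?J then 0 else l s w))"
    by (rule set_integral_add(1)[OF i3[OF TT] i2[OF TT]])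
   fix t assume t: "t \<in> {0..T}"
   have z0: "(LINT s:{}|lborel. l s w) = 0" by (simp add: set_lebesgue_integral_def)
   have "V t w = (\<Sum>k\<in>UNIV. u k 0 * w 0 $ k + (LINT s:{0<..t}|clock ?J. if s \<in> ?J then u k s * (w s - left_limit w s) $ k else u' k s * w s $ k))
     + (LINT s:{0<..t}|clock ?J. if s \<in> ?J then 0 else l s w)"
    unfolding V_def by (subst has_densityD(2)[OF one t], subst has_densityD(2)[OF two t]) (simp add: z0)
   also have "... = V 0 w + (LINT s:{0<..t}|clock ?J. (\<Sum>k\<in>UNIV. if s \<in> ?J then u k s * (w s - left_limit w s) $ k else u' k s * w s $ k) + (if s \<in> ?J then 0 else l s w))"
    unfolding set_integral_add(2)[OF i3[OF t] i2[OF t]] s3[OF t] by (simp add: V_def sum.distrib z0)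
   finally show "V t w = V 0 w + (LINT s:{0<..t}|clock ?J. (\<Sum>k\<in>UNIV. if s \<in> ?J then u k s * (w s - left_limit w s) $ k else u' k s * w s $ k) + (if s \<in> ?J then 0 else l s w))" .
  qed
 qed
 obtain B where B: "\<bar>u k t\<bar> <= B k" if "t \<in> {0..T}" for k t
 proof -
  have "\<exists>b. \<forall>t\<in>{0..T}. \<bar>u k t\<bar> <= b" for k
   by (rule cadlag_bounded[OF has_density_cadlag[OF u[of k]] T0]) (simp, blast)
  then show ?thesis using that by metis
 qed
 define K where "K = (\<Sum>k\<in>UNIV. \<bar>B k\<bar>) + \<bar>LINT s:{0<..T}|lborel. \<phi> s\<bar>"
 have uK: "\<bar>u k t\<bar> <= (\<Sum>k\<in>UNIV. \<bar>B k\<bar>)" if "t \<in> {0..T}" for k t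
  using B[OF that, of k] member_le_sum[of k UNIV "%k. \<bar>B k\<bar>"] by simp
 have V_bd: "\<bar>V t w\<bar> <= K" if t: "t \<in> {0..T}" and wp: "w \<in> path_space T" for t w
 proof -
  obtain i where i: "w t = axis i 1" using path_in_state_space[OF wp t] by (rule state_cases)
  have it: "set_integrable lborel {0<..t} (%s. l s w)" by (rule set_integrable_subset[OF li[OF wp]]) (use t in auto)
  have "norm (LINT s:{0<..t}|lborel. l s w) <= (LINT s:{0<..t}|lborel. norm (l s w))" by (rule set_integral_norm_bound[OF it])
  also have "... <= (LINT s:{0<..T}|lborel. \<phi> s)"
   unfolding set_lebesgue_integral_def
  proof (rule integral_mono)
   show "integrable lborel (%s. indicator {0<..t} s *\<^sub>R norm (l s w))" using set_integrable_norm[OF it] by (simp add: set_integrable_def)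
   show "integrable lborel (%s. indicator {0<..T} s *\<^sub>R \<phi> s)" using \<phi> by (simp add: set_integrable_def)
   show "indicator {0<..t} s *\<^sub>R norm (l s w) <= indicator {0<..T} s *\<^sub>R \<phi> s" for s
    using l_bd[OF _ wp, of s] t by (auto simp: indicator_def)
  qed
  finally show ?thesis unfolding V_def K_def i sum_axis using uK[OF t, of i] by simp
 qed
 have V_ad: "V t \<in> borel_measurable (F t)" if t: "t \<in> {0..T}" for t
  unfolding V_def[abs_def]
  by (intro borel_measurable_add borel_measurable_sum borel_measurable_times borel_measurable_const
   predictable_integral_adapted[OF T0 t l] measurable_coordinate_nth) (use t in auto)
 have w: "(%(s, w). u j s) \<in> borel_measurable (predictable_sigma T :: (real \<times> (real => real^'m)) measure)" for j
 proof (rule predictable_time)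
  have m: "(%s. indicator {0<..T} s * left_limit (u j) s + indicator {0} s * u j 0) \<in> borel_measurable borel"
   by (intro borel_measurable_add borel_measurable_times borel_measurable_const has_density_left_limit_measurable[OF _ _ u])
    (auto intro: lborel.sigma_finite_measure_axioms)
  show "u j \<in> borel_measurable (restrict_space borel {0..T})"
   by (rule measurable_cong[THEN iffD2, OF _ measurable_restrict_space1[OF m]])
     (use left_limit_lborel[OF u] in \<open>auto simp: space_restrict_space indicator_def\<close>)
 qed
 have w_bd: "\<bar>u j s\<bar> <= K" if "s \<in> {0<..T}" "w \<in> path_space T" for s j and w :: "real => real^'m"
  using uK[of s j] that by (simp add: K_def)
 note a = d V_ad V_bd w w_bd TT
 have "expectation (V 0) = (\<Sum>k\<in>UNIV. u k 0 * p0 $ k)"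
 proof -
  have "integrable P (%w. w 0 $ k)" for k
  proof (rule integrable_bounded[OF X_measurable, of 0 k 1])
   have z: "0 \<in> {0..T}" using T by simp
   then show "0 \<in> {0..T}" .
   show "\<bar>w 0 $ k\<bar> <= 1" if "w \<in> path_space T" for w using X_bounds[OF that z, of k] by auto
  qed
  then have "expectation (%w. \<Sum>k\<in>UNIV. u k 0 * w 0 $ k) = (\<Sum>k\<in>UNIV. u k 0 * p0 $ k)"
   by (simp add: initial_law)
  then show ?thesis by (simp add: V_def[abs_def] set_lebesgue_integral_def)
 qed
 then show "expectation (%w. lik T w * ((\<Sum>k\<in>UNIV. u k T * w T $ k) + (LINT s:{0<..T}|lborel. l s w)))
   = (\<Sum>k\<in>UNIV. u k 0 * p0 $ k) + expectation (%w. LINT s:{0<..T}|lborel. k s w)"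
  using verification[OF a] by (simp only: V_def[of T] k_def)
qed

end

section \<open>Caratheodory functions and differential equations\<close>

text \<open>A function that is measurable in its first argument and continuous in its second may be
 composed with a measurable second argument: approximate the latter by countably valued functions.\<close>

lemma caratheodory_measurable:
 fixes h :: "'w => 'd::{metric_space, second_countable_topology} => 'e::metric_space"
 assumes meas: "!!d. d \<in> S ==> (%x. h x d) \<in> borel_measurable M"
  and cont: "!!x. x \<in> space M ==> continuous_on S (h x)"
  and y: "y \<in> borel_measurable M" and yS: "!!x. x \<in> space M ==> y x \<in> S"
 shows "(%x. h x (y x)) \<in> borel_measurable M"
proof (cases "S = {}")
 case True
 then have "space M = {}" using yS by auto
 then show ?thesis by (simp add: measurable_def)
next
 case False
 obtain D where D: "countable D" "D <= S" "S <= closure D" using separable by blast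
 have Dne: "D ~= {}" using False D(3) by auto
 define e where "e = from_nat_into D"
 have eD: "e i \<in> S" for i using from_nat_into[OF Dne] D(2) by (auto simp: e_def)
 define k where "k n x = (LEAST i. dist (e i) (y x) < 1 / real (Suc n))" for n x
 have k: "dist (e (k n x)) (y x) < 1 / real (Suc n)" if "x \<in> space M" for n x
  unfolding k_def
 proof (rule LeastI_ex)
  have "y x \<in> closure D" using yS[OF that] D(3) by auto
  then obtain d where "d \<in> D" "dist d (y x) < 1 / real (Suc n)"
   unfolding closure_approachable by (metis of_nat_0_less_iff zero_less_Suc zero_less_divide_1_iff)
  then show "\<exists>i. dist (e i) (y x) < 1 / real (Suc n)"
   using from_nat_into_surj[OF D(1)] by (auto simp: e_def)
 qed
 have km: "k n \<in> measurable M (count_space UNIV)" for n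
  unfolding k_def[abs_def]
 proof (rule measurable_Least)
  fix i
  have "(%x. dist (e i) (y x)) \<in> borel_measurable M" using y by simp
  then show "Measurable.pred M (%x. dist (e i) (y x) < 1 / real (Suc n))" by measurable
 qed
 show ?thesis
 proof (rule borel_measurable_LIMSEQ_metric)
  show "(%x. h x (e (k n x))) \<in> borel_measurable M" for n
   by (rule measurable_compose_countable[OF meas[OF eD] km])
  fix x assume x: "x \<in> space M"
  have "(%n. e (k n x)) \<longlonglongrightarrow> y x"
  proof (rule metric_tendsto_imp_tendsto[of "%n. 1 / real (Suc n)" 0])
   show "(%n. 1 / real (Suc n)) \<longlonglongrightarrow> 0" by (rule LIMSEQ_Suc[OF lim_1_over_n])
   show "eventually (%n. dist (e (k n x)) (y x) <= dist (1 / real (Suc n)) 0) sequentially"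
    using k[OF x] by (auto simp: dist_real_def less_imp_le)
  qed
  then show "(%n. h x (e (k n x))) \<longlonglongrightarrow> h x (y x)"
   by (rule continuous_on_tendsto_compose[OF cont[OF x] _ yS[OF x]]) (simp add: eD)
 qed
qed

lemma set_integral_exp_real:
 fixes K :: real assumes c: "0 <= c"
 shows "set_integrable lborel {0..c} (%s. K * exp (K * s))" "(LINT s:{0..c}|lborel. K * exp (K * s)) = exp (K * c) - 1"
proof -
 have cont: "continuous_on {0..c} (%s. K * exp (K * s))" by (intro continuous_intros)
 show i: "set_integrable lborel {0..c} (%s. K * exp (K * s))"
  by (rule borel_integrable_atLeastAtMost'[OF cont])
 have "((%s. K * exp (K * s)) has_integral (exp (K * c) - exp (K * 0))) {0..c}"
  by (rule fundamental_theorem_of_calculus[OF c])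
    (auto intro!: derivative_eq_intros simp flip: has_real_derivative_iff_has_vector_derivative)
 then show "(LINT s:{0..c}|lborel. K * exp (K * s)) = exp (K * c) - 1"
  unfolding set_borel_integral_eq_integral(2)[OF i] by (simp only: integral_unique) simp
qed

lemma gronwall:
 fixes w :: "real => real"
 assumes w: "continuous_on {0..T} w" and C: "0 <= C"
  and le: "!!t. t \<in> {0..T} ==> w t <= a + C * (LINT s:{0..t}|lborel. w s)" and t: "t \<in> {0..T}"
 shows "w t <= a * exp (C * t)"
proof -
 have "continuous_on {0..T} (%t. w t * exp (- (C * t)))" using w by (intro continuous_intros)
 then obtain u where u: "u \<in> {0..T}" "!!s. s \<in> {0..T} ==> w s * exp (- (C * s)) <= w u * exp (- (C * u))"
  using continuous_attains_sup[of "{0..T}" "%t. w t * exp (- (C * t))"] t by auto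
 define M where "M = w u * exp (- (C * u))"
 have wM: "w s <= M * exp (C * s)" if "s \<in> {0..T}" for s
 proof -
  have "w s * exp (- (C * s)) * exp (C * s) <= M * exp (C * s)"
   using u(2)[OF that] by (intro mult_right_mono) (auto simp: M_def)
  then show ?thesis by (simp add: mult.assoc exp_add[symmetric])
 qed
 have wi: "set_integrable lborel {0..u} w"
  by (rule borel_integrable_atLeastAtMost'[OF continuous_on_subset[OF w]]) (use u in auto)
 have "C * (LINT s:{0..u}|lborel. w s) = (LINT s:{0..u}|lborel. C * w s)" by simp
 also have "... <= (LINT s:{0..u}|lborel. M * (C * exp (C * s)))"
 proof (rule set_integral_mono)
  show "set_integrable lborel {0..u} (%s. C * w s)" using wi by simp
  show "set_integrable lborel {0..u} (%s. M * (C * exp (C * s)))"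
   using set_integral_exp_real(1)[of u C] u by (intro set_integrable_mult_right) auto
  fix s assume "s \<in> {0..u}"
  then have "C * w s <= C * (M * exp (C * s))" using wM[of s] C u by (intro mult_left_mono) auto
  then show "C * w s <= M * (C * exp (C * s))" by (simp add: algebra_simps)
 qed
 also have "... = M * (exp (C * u) - 1)" using set_integral_exp_real(2)[of u C] u by simp
 finally have "w u <= a + M * (exp (C * u) - 1)" using le[OF u(1)] by linarith
 moreover have "w u = M * exp (C * u)" by (simp add: M_def mult.assoc exp_add[symmetric])
 ultimately have "M <= a" by (simp add: algebra_simps)
 then have "M * exp (C * t) <= a * exp (C * t)" by (intro mult_right_mono) auto
 then show ?thesis using wM[OF t] by linarith
qed

text \<open>Global Lipschitz equations with integrable bound: after the substitution \<open>x t = exp (2 K t) y t\<close>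
 the integral operator contracts the supremum norm by one half, which also gives the Lipschitz
 dependence on the initial value.\<close>

lemma ode_flow:
 fixes b :: "real => 'a::euclidean_space => 'a"
 assumes T: "0 <= T" and K: "0 < K"
  and meas: "!!x. (%s. b s x) \<in> borel_measurable (restrict_space borel {0..T})"
  and lip: "!!s x y. s \<in> {0..T} ==> norm (b s x - b s y) <= K * norm (x - y)"
  and bd: "!!s x. s \<in> {0..T} ==> norm (b s x) <= \<phi> s" and \<phi>: "set_integrable lborel {0..T} \<phi>"
 obtains X where "!!x. continuous_on {0..T} (X x)"
  "!!x. set_integrable lborel {0..T} (%s. b s (X x s))"
  "!!x t. t \<in> {0..T} ==> X x t = x + (LINT s:{0..t}|lborel. b s (X x s))"
  "!!x y t. t \<in> {0..T} ==> norm (X x t - X y t) <= 2 * exp (2 * K * T) * norm (x - y)"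
proof -
 define c where "c t = max 0 (min T t)" for t
 have c: "c t \<in> {0..T}" for t using T by (auto simp: c_def)
 have cc: "continuous_on UNIV c" unfolding c_def by (intro continuous_intros)
 have bint: "set_integrable lborel {0..T} (%s. b s (y s))" if y: "continuous_on {0..T} y" for y
  unfolding set_integrable_def
 proof (rule bochner_bound)
  show "integrable lborel (%s. indicator {0..T} s *\<^sub>R \<phi> s)" using \<phi> by (simp add: set_integrable_def)
  have "(%s. b s (y s)) \<in> borel_measurable (restrict_space borel {0..T})"
  proof (rule caratheodory_measurable[where S=UNIV and h=b and y=y])
   show "continuous_on UNIV (b s)" if "s \<in> space (restrict_space borel {0..T})" for s
   proof (rule continuous_onI)
    fix x e :: 'a and \<epsilon> :: real assume "0 < \<epsilon>"
    have s: "s \<in> {0..T}" using that by (simp add: space_restrict_space)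
    show "\<exists>d>0. \<forall>x'\<in>UNIV. dist x' x < d \<longrightarrow> dist (b s x') (b s x) <= \<epsilon>"
    proof (intro exI[of _ "\<epsilon> / K"] conjI ballI impI)
     fix x' assume "dist x' x < \<epsilon> / K"
     then have "K * norm (x' - x) <= \<epsilon>" using K by (simp add: dist_norm field_simps)
     then show "dist (b s x') (b s x) <= \<epsilon>" using lip[OF s, of x' x] by (simp add: dist_norm)
    qed (use K \<open>0 < \<epsilon>\<close> in simp)
   qed
   show "y \<in> borel_measurable (restrict_space borel {0..T})"
    by (rule borel_measurable_continuous_on_restrict[OF y])
  qed (use meas in auto)
  then show "(%s. indicator {0..T} s *\<^sub>R b s (y s)) \<in> borel_measurable lborel"
   by (subst (asm) borel_measurable_restrict_space_iff) auto
  show "AE s in lborel. norm (indicator {0..T} s *\<^sub>R b s (y s)) <= norm (indicator {0..T} s *\<^sub>R \<phi> s)"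
   using bd by (intro AE_I2) (auto simp: indicator_def intro: order_trans[OF _ abs_ge_self])
 qed
 have icont: "continuous_on {0..T} (%t. LINT s:{0..t}|lborel. f s)" if f: "set_integrable lborel {0..T} f" for f :: "real => 'a"
 proof -
  have "continuous_on {0..T} (%t. integral {0..t} f)"
   using set_borel_integral_eq_integral(1)[OF f] by (rule indefinite_integral_continuous_1)
  moreover have "integral {0..t} f = (LINT s:{0..t}|lborel. f s)" if "t \<in> {0..T}" for t
   using that by (intro set_borel_integral_eq_integral(2)[symmetric] set_integrable_subset[OF f]) auto
  ultimately show ?thesis by (rule continuous_on_eq)
 qed
 define \<Phi>f where "\<Phi>f x y t = exp (- (2 * K * c t)) *\<^sub>R (x + (LINT s:{0..c t}|lborel. b s (exp (2 * K * s) *\<^sub>R apply_bcontfun y s)))"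
  for x :: 'a and y :: "real \<Rightarrow>\<^sub>C 'a" and t
 define \<Phi> where "\<Phi> x y = Bcontfun (\<Phi>f x y)" for x y
 have yc: "continuous_on S (%s. exp (2 * K * s) *\<^sub>R apply_bcontfun y s)" for S and y :: "real \<Rightarrow>\<^sub>C 'a"
  by (intro continuous_intros continuous_on_apply_bcontfun)
 note yint = bint[OF yc]
 have \<Phi>f: "\<Phi>f x y \<in> bcontfun" for x y
 proof -
  let ?g = "%t. exp (- (2 * K * t)) *\<^sub>R (x + (LINT s:{0..t}|lborel. b s (exp (2 * K * s) *\<^sub>R apply_bcontfun y s)))"
  have g: "continuous_on {0..T} ?g" by (intro continuous_intros icont[OF yint])
  have e: "\<Phi>f x y = ?g \<circ> c" by (auto simp: \<Phi>f_def)
  have 1: "continuous_on UNIV (\<Phi>f x y)"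
   unfolding e by (rule continuous_on_compose[OF cc continuous_on_subset[OF g]]) (use c in auto)
  have "bounded (?g ` {0..T})" by (intro compact_imp_bounded compact_continuous_image g) simp
  then obtain B where B: "\<forall>v\<in>?g ` {0..T}. norm v <= B" unfolding bounded_iff by blast
  have 2: "norm (\<Phi>f x y t) <= B" for t
   unfolding e o_def by (rule B[rule_format]) (use c[of t] in blast)
  show ?thesis by (rule bcontfun_normI[OF 1 2])
 qed
 have \<Phi>_app: "apply_bcontfun (\<Phi> x y) t = \<Phi>f x y t" for x y t
  unfolding \<Phi>_def using \<Phi>f by (simp add: Bcontfun_inverse)
 have contr: "dist (\<Phi> x y) (\<Phi> x z) <= 1/2 * dist y z" for x y z
 proof (rule dist_bound)
  fix t
  let ?d = "dist y z"
  let ?E = "%s. exp (2 * K * s)"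
  have ii: "set_integrable lborel {0..c t} (%s. b s (?E s *\<^sub>R apply_bcontfun y s))" for y
   using c[of t] by (intro set_integrable_subset[OF yint]) auto
  let ?D = "%s. b s (?E s *\<^sub>R apply_bcontfun y s) - b s (?E s *\<^sub>R apply_bcontfun z s)"
  have Di: "set_integrable lborel {0..c t} ?D" by (intro set_integral_diff(1) ii)
  have "norm (LINT s:{0..c t}|lborel. ?D s) <= (LINT s:{0..c t}|lborel. norm (?D s))"
   by (rule set_integral_norm_bound[OF Di])
  also have "... <= (LINT s:{0..c t}|lborel. ?d / 2 * (2 * K * exp (2 * K * s)))"
  proof (rule set_integral_mono)
   show "set_integrable lborel {0..c t} (%s. norm (?D s))" by (rule set_integrable_norm[OF Di])
   show "set_integrable lborel {0..c t} (%s. ?d / 2 * (2 * K * exp (2 * K * s)))"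
    using set_integral_exp_real(1)[of "c t" "2 * K"] c[of t] by (intro set_integrable_mult_right) auto
   fix s assume "s \<in> {0..c t}"
   then have s: "s \<in> {0..T}" using c[of t] by auto
   have "norm (?D s) <= K * norm (?E s *\<^sub>R apply_bcontfun y s - ?E s *\<^sub>R apply_bcontfun z s)" by (rule lip[OF s])
   also have "... = K * (?E s * dist (apply_bcontfun y s) (apply_bcontfun z s))"
    by (simp add: dist_norm scaleR_diff_right[symmetric])
   also have "... <= K * (?E s * ?d)" using K by (intro mult_left_mono dist_bounded) auto
   finally show "norm (?D s) <= ?d / 2 * (2 * K * exp (2 * K * s))" by (simp add: algebra_simps)
  qed
  also have "... = ?d / 2 * (exp (2 * K * c t) - 1)"
   using set_integral_exp_real(2)[of "c t" "2 * K"] c[of t] by simp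
  finally have n: "norm (LINT s:{0..c t}|lborel. ?D s) <= ?d / 2 * (exp (2 * K * c t) - 1)" .
  have "dist (\<Phi>f x y t) (\<Phi>f x z t) = exp (- (2 * K * c t)) * norm (LINT s:{0..c t}|lborel. ?D s)"
   unfolding set_integral_diff(2)[OF ii ii] by (simp add: \<Phi>f_def dist_norm scaleR_diff_right[symmetric])
  also have "... <= exp (- (2 * K * c t)) * (?d / 2 * (exp (2 * K * c t) - 1))"
   by (intro mult_left_mono n) simp
  also have "... = ?d / 2 * (1 - exp (- (2 * K * c t)))"
   by (simp add: algebra_simps exp_minus)
  also have "... <= ?d / 2 * 1" by (intro mult_left_mono) auto
  finally show "dist (apply_bcontfun (\<Phi> x y) t) (apply_bcontfun (\<Phi> x z) t) <= 1/2 * dist y z"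
   by (simp add: \<Phi>_app)
 qed
 have "\<exists>!y. \<Phi> x y = y" for x
  by (rule banach_fix_type[of "1/2"]) (use contr in auto)
 then have "\<forall>x. \<exists>y. \<Phi> x y = y" by (intro allI ex1_implies_ex)
 then obtain Y where Y: "!!x. \<Phi> x (Y x) = Y x" using choice[of "%x y. \<Phi> x y = y"] by blast
 define X where "X x t = exp (2 * K * t) *\<^sub>R apply_bcontfun (Y x) t" for x t
 show ?thesis
 proof
  show Xc: "continuous_on {0..T} (X x)" for x unfolding X_def by (rule yc)
  show "set_integrable lborel {0..T} (%s. b s (X x s))" for x by (rule bint[OF Xc])
  show "X x t = x + (LINT s:{0..t}|lborel. b s (X x s))" if t: "t \<in> {0..T}" for x t
  proof -
   have ct: "c t = t" using t by (auto simp: c_def)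
   have "apply_bcontfun (Y x) t = \<Phi>f x (Y x) t" using Y[of x] \<Phi>_app[of x "Y x" t] by simp
   then have "X x t = exp (2 * K * t) *\<^sub>R \<Phi>f x (Y x) t" by (simp add: X_def)
   also have "... = x + (LINT s:{0..t}|lborel. b s (X x s))"
    unfolding \<Phi>f_def ct X_def by (simp add: exp_minus)
   finally show ?thesis .
  qed
  show "norm (X x t - X y t) <= 2 * exp (2 * K * T) * norm (x - y)" if t: "t \<in> {0..T}" for x y t
  proof -
   have "dist (\<Phi> x (Y x)) (\<Phi> y (Y x)) <= norm (x - y)"
   proof (rule dist_bound)
    fix t
    have "dist (\<Phi>f x (Y x) t) (\<Phi>f y (Y x) t) = exp (- (2 * K * c t)) * norm (x - y)"
     by (simp add: \<Phi>f_def dist_norm scaleR_diff_right[symmetric])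
    also have "... <= 1 * norm (x - y)" using c[of t] K by (intro mult_right_mono) auto
    finally show "dist (apply_bcontfun (\<Phi> x (Y x)) t) (apply_bcontfun (\<Phi> y (Y x)) t) <= norm (x - y)"
     by (simp add: \<Phi>_app)
   qed
   moreover have "dist (Y x) (Y y) <= dist (\<Phi> x (Y x)) (\<Phi> y (Y x)) + dist (\<Phi> y (Y x)) (\<Phi> y (Y y))"
    using dist_triangle[of "\<Phi> x (Y x)" "\<Phi> y (Y y)" "\<Phi> y (Y x)"] Y by simp
   moreover have "dist (\<Phi> y (Y x)) (\<Phi> y (Y y)) <= 1/2 * dist (Y x) (Y y)" by (rule contr)
   ultimately have d: "dist (Y x) (Y y) <= 2 * norm (x - y)" by simp
   have "norm (X x t - X y t) = exp (2 * K * t) * dist (apply_bcontfun (Y x) t) (apply_bcontfun (Y y) t)"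
    by (simp add: X_def dist_norm scaleR_diff_right[symmetric])
   also have "... <= exp (2 * K * T) * dist (Y x) (Y y)"
    using t K by (intro mult_mono dist_bounded) auto
   also have "... <= exp (2 * K * T) * (2 * norm (x - y))" by (intro mult_left_mono d) simp
   finally show ?thesis by (simp add: algebra_simps)
  qed
 qed
qed

text \<open>Forward-backward systems by shooting: the missing initial value is a fixed point of a bounded
 continuous map of a Euclidean space.\<close>

lemma forward_backward_ode:
 fixes b :: "real => 'a::euclidean_space \<times> 'b::euclidean_space => 'a \<times> 'b" and G :: "'a => 'b"
 assumes T: "0 <= T" and K: "0 < K"
  and meas: "!!x. (%s. b s x) \<in> borel_measurable (restrict_space borel {0..T})"
  and lip: "!!s x y. s \<in> {0..T} ==> norm (b s x - b s y) <= K * norm (x - y)"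
  and bd: "!!s x. s \<in> {0..T} ==> norm (b s x) <= \<phi> s" and \<phi>: "set_integrable lborel {0..T} \<phi>"
  and G: "continuous_on UNIV G" "!!p. norm (G p) <= B"
 obtains x where "continuous_on {0..T} x" "fst (x 0) = p0" "snd (x T) = G (fst (x T))"
  "set_integrable lborel {0..T} (%s. b s (x s))"
  "!!t. t \<in> {0..T} ==> x t = x 0 + (LINT s:{0..t}|lborel. b s (x s))"
proof -
 obtain X where Xc: "!!x. continuous_on {0..T} (X x)"
  and Xi: "!!x. set_integrable lborel {0..T} (%s. b s (X x s))"
  and Xe: "!!x t. t \<in> {0..T} ==> X x t = x + (LINT s:{0..t}|lborel. b s (X x s))"
  and Xl: "!!x y t. t \<in> {0..T} ==> norm (X x t - X y t) <= 2 * exp (2 * K * T) * norm (x - y)"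
  using ode_flow[OF T K meas lip bd \<phi>] by blast
 define \<Psi> where "\<Psi> u = G (fst (X (p0, u) T)) - (snd (X (p0, u) T) - u)" for u
 define R where "R = B + (LINT s:{0..T}|lborel. \<phi> s)"
 have TT: "T \<in> {0..T}" using T by simp
 have "continuous_on UNIV (%x. X x T)"
 proof (rule continuous_onI)
  fix x :: "'a \<times> 'b" and \<epsilon> :: real assume e: "0 < \<epsilon>"
  let ?L = "2 * exp (2 * K * T)"
  show "\<exists>d>0. \<forall>x'\<in>UNIV. dist x' x < d \<longrightarrow> dist (X x' T) (X x T) <= \<epsilon>"
  proof (intro exI[of _ "\<epsilon> / ?L"] conjI ballI impI)
   fix x' assume "dist x' x < \<epsilon> / ?L"
   then have "?L * norm (x' - x) <= \<epsilon>" by (simp add: dist_norm field_simps)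
   then show "dist (X x' T) (X x T) <= \<epsilon>" using Xl[OF TT, of x' x] by (simp add: dist_norm)
  qed (use e in simp)
 qed
 then have XT: "continuous_on UNIV (%u. X (p0, u) T)"
  by (rule continuous_on_compose2) (auto intro!: continuous_intros)
 have \<Psi>c: "continuous_on UNIV \<Psi>"
  unfolding \<Psi>_def by (intro continuous_intros continuous_on_compose2[OF G(1)] XT) auto
 have \<Psi>R: "norm (\<Psi> u) <= R" for u
 proof -
  have "norm (X (p0, u) T - (p0, u)) <= (LINT s:{0..T}|lborel. norm (b s (X (p0, u) s)))"
   using set_integral_norm_bound[OF Xi, of "(p0, u)"] Xe[OF TT, of "(p0, u)"] by simp
  also have "... <= (LINT s:{0..T}|lborel. \<phi> s)"
   by (rule set_integral_mono[OF set_integrable_norm[OF Xi] \<phi> bd])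
  finally have "norm (snd (X (p0, u) T) - u) <= (LINT s:{0..T}|lborel. \<phi> s)"
   using norm_snd_le[of "snd (X (p0, u) T - (p0, u))" "fst (X (p0, u) T - (p0, u))"]
   by (simp only: prod.collapse) (simp add: snd_diff)
  then show ?thesis
   unfolding \<Psi>_def R_def using norm_triangle_ineq4[of "G (fst (X (p0, u) T))" "snd (X (p0, u) T) - u"] G(2)[of "fst (X (p0, u) T)"]
   by linarith
 qed
 have R0: "0 <= R" using order_trans[OF norm_ge_zero \<Psi>R] .
 have "\<exists>u. \<Psi> u = u"
 proof (rule brouwer[of "cball 0 R" \<Psi>])
  show "\<Psi> \<in> cball 0 R \<rightarrow> cball 0 R" using \<Psi>R by simp
  show "continuous_on (cball 0 R) \<Psi>" by (rule continuous_on_subset[OF \<Psi>c]) simp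
  show "cball 0 R ~= {}" using R0 by simp
  show "\<exists>u. \<Psi> u = u" if "\<Psi> x = x" for x using that by blast
 qed simp_all
 then obtain u where u: "\<Psi> u = u" by blast
 show ?thesis
 proof (rule that[of "X (p0, u)"])
  have "(LINT s:{0}|lborel. b s (X (p0, u) s)) = 0"
   unfolding set_lebesgue_integral_def
   by (rule integral_eq_zero_AE, rule AE_mp[OF AE_lborel_singleton[of 0]]) (auto simp: indicator_def)
  then have X0: "X (p0, u) 0 = (p0, u)" using Xe[of 0 "(p0, u)"] T by simp
  show "fst (X (p0, u) 0) = p0" using X0 by simp
  show "snd (X (p0, u) T) = G (fst (X (p0, u) T))" using u by (simp add: \<Psi>_def algebra_simps)
  fix t
  show "X (p0, u) t = X (p0, u) 0 + (LINT s:{0..t}|lborel. b s (X (p0, u) s))" if "t \<in> {0..T}"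
   unfolding X0 by (rule Xe[OF that])
 qed (rule Xc Xi)+
qed

section \<open>Finite mixtures of actions\<close>

text \<open>In a Markovian feedback equilibrium the law of the control is a mixture of \<open>m\<close> point masses.\<close>

definition mixture :: "(real^'l::finite) set => real^'m::finite => (real^'l)^'m => (real^'l) measure" where
 "mixture A p b = distr (point_measure UNIV (%i. ennreal (p $ i))) (restrict_space borel A) (%i. b $ i)"

lemma prob_space_point_measure_simplex:
 fixes w :: "'i::finite => real"
 assumes "!!i. 0 <= w i" "(\<Sum>i\<in>UNIV. w i) = 1"
 shows "prob_space (point_measure UNIV (%i. ennreal (w i)))"
proof
 have "emeasure (point_measure UNIV (%i. ennreal (w i))) UNIV = (\<Sum>i\<in>UNIV. ennreal (w i))"
  by (subst emeasure_point_measure_finite) auto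
 also have "... = 1" using assms by (simp add: sum_ennreal)
 finally show "emeasure (point_measure UNIV (%i. ennreal (w i))) (space (point_measure UNIV (%i. ennreal (w i)))) = 1"
  by (simp add: space_point_measure)
qed

lemma prob_simplexD: "p \<in> prob_simplex ==> 0 <= p $ i" "p \<in> prob_simplex ==> (\<Sum>i\<in>UNIV. p $ i) = 1"
 by (auto simp: prob_simplex_def)

lemma measurable_point_restrict:
 assumes "!!i. b $ i \<in> A"
 shows "(%i. b $ i) \<in> measurable (point_measure UNIV w) (restrict_space borel A)"
 using assms by (intro measurable_restrict_space2) (auto simp: measurable_point_measure_eq1)

lemma mixture_prob:
 assumes p: "p \<in> prob_simplex" and b: "!!i. b $ i \<in> A"
 shows "mixture A p b \<in> prob_measures A"
 unfolding prob_measures_def mixture_def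
 using prob_space.prob_space_distr[OF prob_space_point_measure_simplex measurable_point_restrict[OF b]]
  prob_simplexD[OF p] by auto

lemma emeasure_mixture:
 assumes b: "!!i. b $ i \<in> A" and p: "!!i. 0 <= p $ i" and S: "S \<in> sets (restrict_space borel A)"
 shows "emeasure (mixture A p b) S = ennreal (\<Sum>i\<in>UNIV. p $ i * indicator S (b $ i))"
proof -
 have "emeasure (mixture A p b) S = (\<Sum>i\<in>(%i. b $ i) -` S. ennreal (p $ i))"
  unfolding mixture_def using S measurable_point_restrict[OF b]
  by (subst emeasure_distr) (auto simp: space_point_measure emeasure_point_measure_finite)
 also have "... = ennreal (\<Sum>i\<in>(%i. b $ i) -` S. p $ i)" using p by (simp add: sum_ennreal)
 also have "(\<Sum>i\<in>(%i. b $ i) -` S. p $ i) = (\<Sum>i\<in>UNIV. p $ i * indicator S (b $ i))"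
  by (rule sum.mono_neutral_cong_left) (auto simp: indicator_def)
 finally show ?thesis .
qed

text \<open>Keep the common mass in place and move the rest independently.\<close>

lemma wasserstein_mixture:
 fixes A :: "(real^'l::finite) set" and p p' :: "real^'m::finite"
 assumes p: "p \<in> prob_simplex" "p' \<in> prob_simplex" and b: "!!i. b $ i \<in> A" "!!i. b' $ i \<in> A"
  and D: "!!x y. x \<in> A ==> y \<in> A ==> dist x y <= D"
 shows "wasserstein1 A (mixture A p b) (mixture A p' b')
  <= (\<Sum>i\<in>UNIV. dist (b $ i) (b' $ i)) + D * (\<Sum>i\<in>UNIV. \<bar>p $ i - p' $ i\<bar>)"
proof -
 define k where "k i = min (p $ i) (p' $ i)" for i
 define r where "r i = p $ i - k i" for i
 define r' where "r' i = p' $ i - k i" for i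
 define R where "R = (\<Sum>i\<in>UNIV. r i)"
 have R': "R = (\<Sum>i\<in>UNIV. r' i)"
  using prob_simplexD(2)[OF p(1)] prob_simplexD(2)[OF p(2)] by (simp add: R_def r_def r'_def sum_subtractf)
 have nn: "0 <= k i" "0 <= r i" "0 <= r' i" for i
  using prob_simplexD(1)[OF p(1)] prob_simplexD(1)[OF p(2)] by (auto simp: k_def r_def r'_def)
 have R0: "0 <= R" using nn by (auto simp: R_def intro: sum_nonneg)
 have rR: "r i * R / R = r i" "r' i * R / R = r' i" for i
 proof -
  have "r i = 0 & r' i = 0" if "R = 0"
   using that nn sum_nonneg_eq_0_iff[of UNIV r] sum_nonneg_eq_0_iff[of UNIV r'] R' by (auto simp: R_def)
  then show "r i * R / R = r i" "r' i * R / R = r' i" by auto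
 qed
 define w where "w = (%(i, j). (if i = j then k i else 0) + r i * r' j / R)"
 have w0: "0 <= w x" for x using nn R0 by (auto simp: w_def split: prod.split)
 have row: "(\<Sum>j\<in>UNIV. w (i, j)) = p $ i" for i
 proof -
  have "(\<Sum>j\<in>UNIV. w (i, j)) = k i + r i * R / R"
   by (simp add: w_def sum.distrib R' sum_distrib_left sum_divide_distrib)
  then show ?thesis unfolding rR by (simp add: r_def)
 qed
 have col: "(\<Sum>i\<in>UNIV. w (i, j)) = p' $ j" for j
 proof -
  have "(\<Sum>i\<in>UNIV. w (i, j)) = k j + r' j * R / R"
   by (simp add: w_def sum.distrib R_def sum_distrib_left sum_divide_distrib mult.commute)
  then show ?thesis unfolding rR by (simp add: r'_def)
 qed
 have U: "(UNIV :: ('m \<times> 'm) set) = UNIV \<times> UNIV" by simp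
 have sum_w: "(\<Sum>x\<in>UNIV. w x * h x) = (\<Sum>i\<in>UNIV. \<Sum>j\<in>UNIV. w (i, j) * h (i, j))" for h :: "'m \<times> 'm => real"
  unfolding U by (subst sum.cartesian_product) (simp add: case_prod_unfold)
 have w1: "(\<Sum>x\<in>UNIV. w x) = 1"
  using sum_w[of "%_. 1"] prob_simplexD(2)[OF p(1)] by (simp add: row)
 let ?PM = "point_measure UNIV (%x. ennreal (w x))"
 let ?A = "restrict_space borel A :: (real^'l) measure"
 define f where "f = (%(i, j). (b $ i, b' $ j))"
 have fm: "f \<in> measurable ?PM (?A \<Otimes>\<^sub>M ?A)"
  using b by (auto simp: measurable_point_measure_eq1 f_def space_pair_measure space_restrict_space)
 define \<pi> where "\<pi> = distr ?PM (?A \<Otimes>\<^sub>M ?A) f"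
 have marg: "distr \<pi> ?A g = mixture A q c"
  if g: "g \<in> measurable (?A \<Otimes>\<^sub>M ?A) ?A" and q: "!!i. 0 <= q $ i" and c: "!!i. c $ i \<in> A"
   and e: "!!S. (\<Sum>x\<in>UNIV. w x * indicator S (g (f x))) = (\<Sum>i\<in>UNIV. q $ i * indicator S (c $ i) :: real)"
  for g and q :: "real^'m" and c
 proof (rule measure_eqI)
  show "sets (distr \<pi> ?A g) = sets (mixture A q c)" by (simp add: mixture_def)
  fix S assume "S \<in> sets (distr \<pi> ?A g)"
  then have S: "S \<in> sets ?A" by simp
  have gf: "g \<circ> f \<in> measurable ?PM ?A" by (rule measurable_comp[OF fm g])
  have "emeasure (distr \<pi> ?A g) S = (\<Sum>x\<in>(g \<circ> f) -` S. ennreal (w x))"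
   unfolding \<pi>_def distr_distr[OF g fm] using S gf
   by (subst emeasure_distr) (auto simp: space_point_measure emeasure_point_measure_finite)
  also have "... = ennreal (\<Sum>x\<in>(g \<circ> f) -` S. w x)" using w0 by (simp add: sum_ennreal)
  also have "(\<Sum>x\<in>(g \<circ> f) -` S. w x) = (\<Sum>x\<in>UNIV. w x * indicator S (g (f x)))"
   by (rule sum.mono_neutral_cong_left) (auto simp: indicator_def)
  finally show "emeasure (distr \<pi> ?A g) S = emeasure (mixture A q c) S"
   by (simp add: e emeasure_mixture[OF c q S])
 qed
 have "\<pi> \<in> couplings A (mixture A p b) (mixture A p' b')"
  unfolding couplings_def
 proof (intro CollectI conjI)
  show "sets \<pi> = sets (?A \<Otimes>\<^sub>M ?A)" by (simp add: \<pi>_def)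
  show "prob_space \<pi>"
   unfolding \<pi>_def by (rule prob_space.prob_space_distr[OF prob_space_point_measure_simplex[OF w0 w1] fm])
  show "distr \<pi> ?A fst = mixture A p b"
  proof (rule marg)
   show "(\<Sum>x\<in>UNIV. w x * indicator S (fst (f x))) = (\<Sum>i\<in>UNIV. p $ i * indicator S (b $ i) :: real)" for S
    unfolding sum_w by (simp add: f_def sum_distrib_right[symmetric] row)
  qed (use b prob_simplexD(1)[OF p(1)] in auto)
  show "distr \<pi> ?A snd = mixture A p' b'"
  proof (rule marg)
   show "(\<Sum>x\<in>UNIV. w x * indicator S (snd (f x))) = (\<Sum>i\<in>UNIV. p' $ i * indicator S (b' $ i) :: real)" for S
    unfolding sum_w by (subst sum.swap) (simp add: f_def sum_distrib_right[symmetric] col)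
  qed (use b prob_simplexD(1)[OF p(2)] in auto)
 qed
 then have "wasserstein1 A (mixture A p b) (mixture A p' b') <= (LINT xy|\<pi>. dist (fst xy) (snd xy))"
  unfolding wasserstein1_def
  by (intro cINF_lower bdd_belowI[of _ 0]) (auto intro!: bochner_nonneg)
 also have "(LINT xy|\<pi>. dist (fst xy) (snd xy)) = (LINT x|?PM. dist (fst (f x)) (snd (f x)))"
 proof -
  have 1: "fst \<in> borel_measurable (?A \<Otimes>\<^sub>M ?A)" "snd \<in> borel_measurable (?A \<Otimes>\<^sub>M ?A)"
   using measurable_compose[OF measurable_fst, of "%x. x" ?A borel ?A] measurable_compose[OF measurable_snd, of "%x. x" ?A borel ?A]
   by (auto simp: measurable_restrict_space1)
  then have "(%xy. dist (fst xy) (snd xy)) \<in> borel_measurable (?A \<Otimes>\<^sub>M ?A)" by (rule borel_measurable_dist)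
  then show ?thesis unfolding \<pi>_def by (rule integral_distr[OF fm])
 qed
 also have "... = (\<Sum>x\<in>UNIV. w x * dist (fst (f x)) (snd (f x)))"
  using w0 by (subst lebesgue_integral_point_measure_finite) auto
 also have "... = (\<Sum>i\<in>UNIV. \<Sum>j\<in>UNIV. (if j = i then k i * dist (b $ i) (b' $ i) else 0) + r i * r' j / R * dist (b $ i) (b' $ j))"
  unfolding sum_w by (intro sum.cong) (auto simp: w_def f_def distrib_right)
 also have "... <= (\<Sum>i\<in>UNIV. \<Sum>j\<in>UNIV. (if j = i then dist (b $ i) (b' $ i) else 0) + r i * r' j / R * D)"
 proof (intro sum_mono add_mono)
  fix i j
  have "k i <= 1"
   using member_le_sum[of i UNIV "($) p"] prob_simplexD[OF p(1)] by (auto simp: k_def min_le_iff_disj)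
  then show "(if j = i then k i * dist (b $ i) (b' $ i) else 0) <= (if j = i then dist (b $ i) (b' $ i) else 0)"
   using nn(1)[of i] by (auto intro: mult_left_le_one_le)
  show "r i * r' j / R * dist (b $ i) (b' $ j) <= r i * r' j / R * D"
   using nn R0 D[OF b(1) b(2), of i j] by (intro mult_left_mono) auto
 qed
 also have "... = (\<Sum>i\<in>UNIV. dist (b $ i) (b' $ i)) + D * R"
 proof -
  have "(\<Sum>j\<in>UNIV. r i * r' j / R * D) = r i * R / R * D" for i
   by (simp add: R' sum_distrib_left sum_distrib_right sum_divide_distrib)
  then have e: "(\<Sum>j\<in>UNIV. r i * r' j / R * D) = D * r i" for i unfolding rR by (simp only: mult.commute)
  show ?thesis unfolding sum.distrib e unfolding R_def sum_distrib_left[symmetric] by simp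
 qed
 also have "D * R <= D * (\<Sum>i\<in>UNIV. \<bar>p $ i - p' $ i\<bar>)"
 proof (rule mult_left_mono)
  show "R <= (\<Sum>i\<in>UNIV. \<bar>p $ i - p' $ i\<bar>)" unfolding R_def r_def k_def by (intro sum_mono) auto
  show "0 <= D" using order_trans[OF zero_le_dist D[OF b(1) b(1)]] .
 qed
 finally show ?thesis by simp
qed

definition mixture_params :: "(real^'l::finite) set => ((real^'m::finite) \<times> ((real^'l)^'m)) set" where
 "mixture_params A = {(p, b). p \<in> prob_simplex & (\<forall>i. b $ i \<in> A)}"

lemma mixture_dist:
 fixes A :: "(real^'l::finite) set" and x y :: "(real^'m::finite) \<times> ((real^'l)^'m)"
 assumes x: "x \<in> mixture_params A" and y: "y \<in> mixture_params A"
  and D: "!!x y. x \<in> A ==> y \<in> A ==> dist x y <= D"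
 shows "wasserstein1 A (mixture A (fst x) (snd x)) (mixture A (fst y) (snd y)) <= real CARD('m) * (1 + D) * dist x y"
proof -
 have p: "fst x \<in> prob_simplex" "fst y \<in> prob_simplex" and b: "snd x $ i \<in> A" "snd y $ i \<in> A" for i
  using x y by (auto simp: mixture_params_def)
 have d1: "dist (snd x $ i) (snd y $ i) <= dist x y" for i
  using dist_vec_nth_le[of "snd x" i "snd y"] dist_snd_le[of x y] by linarith
 have d2: "\<bar>fst x $ i - fst y $ i\<bar> <= dist x y" for i
  using dist_vec_nth_le[of "fst x" i "fst y"] dist_fst_le[of x y] by (simp add: dist_real_def)
 have D0: "0 <= D" using order_trans[OF zero_le_dist D[OF b(1) b(1)]] .
 have "wasserstein1 A (mixture A (fst x) (snd x)) (mixture A (fst y) (snd y))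
   <= (\<Sum>i\<in>UNIV. dist (snd x $ i) (snd y $ i)) + D * (\<Sum>i\<in>UNIV. \<bar>fst x $ i - fst y $ i\<bar>)"
  by (rule wasserstein_mixture[OF p b D])
 also have "... <= (\<Sum>i\<in>(UNIV::'m set). dist x y) + D * (\<Sum>i\<in>(UNIV::'m set). dist x y)"
  by (intro add_mono sum_mono mult_left_mono d1 d2 D0)
 finally show ?thesis by (simp add: algebra_simps)
qed

text \<open>By the Lipschitz estimate, Wasserstein-open sets pull back to relatively open sets of parameters.\<close>

lemma mixture_measurable:
 fixes A :: "(real^'l::finite) set" and x :: "'w => (real^'m::finite) \<times> ((real^'l)^'m)"
 assumes x: "x \<in> borel_measurable M" and xS: "!!s. s \<in> space M ==> x s \<in> mixture_params A"
  and A: "bounded A"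
 shows "(%s. mixture A (fst (x s)) (snd (x s))) \<in> measurable M (wasserstein_borel A)"
 unfolding wasserstein_borel_def
proof (rule measurable_measure_of)
 obtain D0 where D0: "!!x y. x \<in> A ==> y \<in> A ==> dist x y <= D0"
  using A unfolding bounded_two_points by blast
 define D where "D = max 0 D0"
 have D: "dist x y <= D" if "x \<in> A" "y \<in> A" for x y using D0[OF that] by (simp add: D_def)
 define L where "L = real CARD('m) * (1 + D)"
 have L: "L > 0" by (auto simp: L_def D_def intro!: mult_pos_pos)
 let ?mix = "%y::(real^'m) \<times> ((real^'l)^'m). mixture A (fst y) (snd y)"
 have mixp: "?mix y \<in> prob_measures A" if "y \<in> mixture_params A" for y :: "(real^'m) \<times> ((real^'l)^'m)"
  using that by (auto simp: mixture_params_def intro!: mixture_prob)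
 show "{U. wasserstein_open A U} <= Pow (prob_measures A)" by (auto simp: wasserstein_open_def)
 show "(%s. ?mix (x s)) \<in> space M \<rightarrow> prob_measures A" using xS mixp by auto
 fix U assume "U \<in> {U. wasserstein_open A U}"
 then have U: "wasserstein_open A U" by simp
 define V where "V = {y \<in> mixture_params A. ?mix y \<in> U}"
 have "openin (top_of_set (mixture_params A)) V"
  unfolding openin_contains_ball
 proof (intro conjI ballI)
  show "V <= mixture_params A" by (auto simp: V_def)
  fix y assume y: "y \<in> V"
  then obtain r where r: "r > 0" "!!\<nu>. \<nu> \<in> prob_measures A ==> wasserstein1 A (?mix y) \<nu> < r ==> \<nu> \<in> U"
   using U unfolding wasserstein_open_def V_def by blast
  show "\<exists>e>0. ball y e Int mixture_params A <= V"
  proof (intro exI[of _ "r / L"] conjI subsetI)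
   fix z assume z: "z \<in> ball y (r / L) Int mixture_params A"
   then have "wasserstein1 A (?mix y) (?mix z) <= L * dist y z"
    unfolding L_def using y by (intro mixture_dist D) (auto simp: V_def)
   also have "... < r" using z L by (simp add: pos_less_divide_eq mult.commute)
   finally have "?mix z \<in> U" using r(2) mixp z by blast
   then show "z \<in> V" using z by (simp add: V_def)
  qed (use r L in simp)
 qed
 then obtain W where W: "open W" "V = mixture_params A Int W" unfolding openin_open by blast
 have "?mix (x s) \<in> U \<longleftrightarrow> x s \<in> W" if "s \<in> space M" for s
  using xS[OF that] W(2) unfolding V_def by blast
 then have "(%s. ?mix (x s)) -` U Int space M = x -` W Int space M" by blast
 also have "... \<in> sets M" using x W(1) by (intro measurable_sets) auto
 finally show "(%s. ?mix (x s)) -` U Int space M \<in> sets M" .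
qed

section \<open>The coupled system\<close>

text \<open>Lipschitz in the state, uniformly over the time interval: the notion that is stable under the
 operations from which the vector field is built.\<close>

definition uniformly_lipschitz :: "real => (real => 'a::real_normed_vector => 'b::real_normed_vector) => bool" where
 "uniformly_lipschitz T h \<longleftrightarrow> (\<exists>K. \<forall>t\<in>{0..T}. \<forall>x y. norm (h t x - h t y) <= K * norm (x - y))"

lemma uniformly_lipschitzI:
 "(!!t x y. t \<in> {0..T} ==> norm (h t x - h t y) <= K * norm (x - y)) ==> uniformly_lipschitz T h"
 unfolding uniformly_lipschitz_def by blast

lemma uniformly_lipschitzE:
 assumes "uniformly_lipschitz T h"
 obtains K where "0 < K" "!!t x y. t \<in> {0..T} ==> norm (h t x - h t y) <= K * norm (x - y)"
proof -
 obtain K where K: "!!t x y. t \<in> {0..T} ==> norm (h t x - h t y) <= K * norm (x - y)"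
  using assms unfolding uniformly_lipschitz_def by blast
 show ?thesis
 proof (rule that[of "\<bar>K\<bar> + 1"])
  fix t x y assume "t \<in> {0..T}"
  from K[OF this, of x y] show "norm (h t x - h t y) <= (\<bar>K\<bar> + 1) * norm (x - y)"
   by (rule order_trans) (auto intro!: mult_right_mono)
 qed simp
qed

lemma uniformly_lipschitz_add:
 assumes "uniformly_lipschitz T h" "uniformly_lipschitz T k"
 shows "uniformly_lipschitz T (%t x. h t x + k t x)"
proof -
 obtain K where "0 < K" and K: "!!t x y. t \<in> {0..T} ==> norm (h t x - h t y) <= K * norm (x - y)" by (rule uniformly_lipschitzE[OF assms(1)]) blast
 obtain L where "0 < L" and L: "!!t x y. t \<in> {0..T} ==> norm (k t x - k t y) <= L * norm (x - y)" by (rule uniformly_lipschitzE[OF assms(2)]) blast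
 show ?thesis
 proof (rule uniformly_lipschitzI)
  fix t x y assume t: "t \<in> {0..T}"
  have "norm (h t x + k t x - (h t y + k t y)) <= norm (h t x - h t y) + norm (k t x - k t y)"
   using norm_triangle_ineq[of "h t x - h t y" "k t x - k t y"] by (simp add: algebra_simps)
  also have "... <= (K + L) * norm (x - y)" using add_mono[OF K[OF t] L[OF t]] by (simp add: distrib_right)
  finally show "norm (h t x + k t x - (h t y + k t y)) <= (K + L) * norm (x - y)" .
 qed
qed

lemma uniformly_lipschitz_minus: "uniformly_lipschitz T h ==> uniformly_lipschitz T (%t x. - h t x)"
 unfolding uniformly_lipschitz_def by (simp add: norm_minus_commute)

lemma uniformly_lipschitz_const: "uniformly_lipschitz T (%t x. c t)"
 by (rule uniformly_lipschitzI[of _ _ 0]) simp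

lemma uniformly_lipschitz_sum:
 assumes "finite I" "!!i. i \<in> I ==> uniformly_lipschitz T (h i)"
 shows "uniformly_lipschitz T (%t x. \<Sum>i\<in>I. h i t x)"
 using assms by (induction I rule: finite_induct) (auto intro!: uniformly_lipschitz_const uniformly_lipschitz_add)

lemma uniformly_lipschitz_mult:
 fixes h k :: "real => 'a::real_normed_vector => real"
 assumes "uniformly_lipschitz T h" "uniformly_lipschitz T k"
  and hB: "!!t x. t \<in> {0..T} ==> \<bar>h t x\<bar> <= B" and kB: "!!t x. t \<in> {0..T} ==> \<bar>k t x\<bar> <= B"
 shows "uniformly_lipschitz T (%t x. h t x * k t x)"
proof -
 obtain K where "0 < K" and K: "!!t x y. t \<in> {0..T} ==> norm (h t x - h t y) <= K * norm (x - y)" by (rule uniformly_lipschitzE[OF assms(1)]) blast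
 obtain L where "0 < L" and L: "!!t x y. t \<in> {0..T} ==> norm (k t x - k t y) <= L * norm (x - y)" by (rule uniformly_lipschitzE[OF assms(2)]) blast
 show ?thesis
 proof (rule uniformly_lipschitzI)
  fix t x y assume t: "t \<in> {0..T}"
  have B0: "0 <= B" using order_trans[OF abs_ge_zero hB[OF t]] .
  have "\<bar>h t x * k t x - h t y * k t y\<bar> = \<bar>h t x * (k t x - k t y) + (h t x - h t y) * k t y\<bar>" by (simp add: algebra_simps)
  also have "... <= \<bar>h t x\<bar> * \<bar>k t x - k t y\<bar> + \<bar>h t x - h t y\<bar> * \<bar>k t y\<bar>"
   unfolding abs_mult[symmetric] by (rule abs_triangle_ineq)
  also have "... <= B * (L * norm (x - y)) + (K * norm (x - y)) * B"
   using K[OF t, of x y] L[OF t, of x y] hB[OF t, of x] kB[OF t, of y] B0 order_trans[OF norm_ge_zero K[OF t, of x y]]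
   by (intro add_mono mult_mono) auto
  finally show "norm (h t x * k t x - h t y * k t y) <= (B * L + K * B) * norm (x - y)" by (simp add: algebra_simps)
 qed
qed

lemma uniformly_lipschitz_vec:
 fixes h :: "'i::finite => real => 'a::real_normed_vector => 'b::real_normed_vector"
 assumes "!!i. uniformly_lipschitz T (h i)"
 shows "uniformly_lipschitz T (%t x. \<chi> i. h i t x)"
proof -
 have "\<forall>i. \<exists>K. \<forall>t\<in>{0..T}. \<forall>x y. norm (h i t x - h i t y) <= K * norm (x - y)"
  using assms unfolding uniformly_lipschitz_def by blast
 then obtain K where K: "!!i t x y. t \<in> {0..T} ==> norm (h i t x - h i t y) <= K i * norm (x - y)" by metis
 show ?thesis
 proof (rule uniformly_lipschitzI)
  fix t x y assume t: "t \<in> {0..T}"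
  have "norm ((\<chi> i. h i t x) - (\<chi> i. h i t y)) <= (\<Sum>i\<in>UNIV. norm (h i t x - h i t y))"
   unfolding norm_vec_def by (rule order_trans[OF L2_set_le_sum]) auto
  also have "... <= (\<Sum>i\<in>UNIV. K i) * norm (x - y)" unfolding sum_distrib_right by (intro sum_mono K t)
  finally show "norm ((\<chi> i. h i t x) - (\<chi> i. h i t y)) <= (\<Sum>i\<in>UNIV. K i) * norm (x - y)" .
 qed
qed

lemma uniformly_lipschitz_Pair:
 assumes "uniformly_lipschitz T h" "uniformly_lipschitz T k"
 shows "uniformly_lipschitz T (%t x. (h t x, k t x))"
proof -
 obtain K where "0 < K" and K: "!!t x y. t \<in> {0..T} ==> norm (h t x - h t y) <= K * norm (x - y)" by (rule uniformly_lipschitzE[OF assms(1)]) blast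
 obtain L where "0 < L" and L: "!!t x y. t \<in> {0..T} ==> norm (k t x - k t y) <= L * norm (x - y)" by (rule uniformly_lipschitzE[OF assms(2)]) blast
 show ?thesis
 proof (rule uniformly_lipschitzI)
  fix t x y assume t: "t \<in> {0..T}"
  have "norm ((h t x, k t x) - (h t y, k t y)) <= norm (h t x - h t y) + norm (k t x - k t y)"
   using norm_Pair_le[of "h t x - h t y" "k t x - k t y"] by simp
  also have "... <= (K + L) * norm (x - y)" using add_mono[OF K[OF t] L[OF t]] by (simp add: distrib_right)
  finally show "norm ((h t x, k t x) - (h t y, k t y)) <= (K + L) * norm (x - y)" .
 qed
qed

text \<open>In the vector field the inner map lands in \<open>S\<close> because of the projections; the outer one is Lipschitz only there.\<close>

lemma uniformly_lipschitz_compose: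
 assumes "uniformly_lipschitz T y" "!!t x. t \<in> {0..T} ==> y t x \<in> S"
  and "!!t a b. t \<in> {0..T} ==> a \<in> S ==> b \<in> S ==> norm (h t a - h t b) <= L * norm (a - b)"
 shows "uniformly_lipschitz T (%t x. h t (y t x))"
proof -
 obtain K where "0 < K" and K: "!!t x y'. t \<in> {0..T} ==> norm (y t x - y t y') <= K * norm (x - y')" by (rule uniformly_lipschitzE[OF assms(1)]) blast
 show ?thesis
 proof (rule uniformly_lipschitzI)
  fix t x z assume t: "t \<in> {0..T}"
  have "norm (h t (y t x) - h t (y t z)) <= L * norm (y t x - y t z)" by (rule assms(3)[OF t assms(2)[OF t] assms(2)[OF t]])
  also have "... <= \<bar>L\<bar> * norm (y t x - y t z)" by (rule mult_right_mono) auto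
  also have "... <= \<bar>L\<bar> * (K * norm (x - z))" by (rule mult_left_mono[OF K[OF t]]) simp
  finally show "norm (h t (y t x) - h t (y t z)) <= (\<bar>L\<bar> * K) * norm (x - z)" by simp
 qed
qed

lemma borel_measurable_vec_lambda:
 fixes h :: "'i::finite => 'w => 'b::euclidean_space"
 assumes "!!i. h i \<in> borel_measurable M"
 shows "(%x. \<chi> i. h i x) \<in> borel_measurable M"
proof -
 have "(%x. \<chi> i. h i x) = (%x. \<Sum>i\<in>UNIV. axis i (h i x))"
  by (auto simp: fun_eq_iff vec_eq_iff axis_def if_distrib cong: if_cong)
 moreover have "(%x. axis i (h i x)) \<in> borel_measurable M" for i
 proof (rule measurable_compose[OF assms])
  have "continuous_on UNIV (%v::'b. if j = i then v else 0)" for j by (cases "j = i") simp_all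
  then have "continuous_on UNIV (%v::'b. \<chi> j. if j = i then v else 0)" by (rule continuous_on_vec_lambda)
  then show "(axis i :: 'b => 'b^'i) \<in> borel_measurable borel"
   unfolding axis_def[abs_def] by (rule borel_measurable_continuous_onI)
 qed
 ultimately show ?thesis by (simp add: borel_measurable_sum)
qed

lemma state_seminorm_le:
 fixes z :: "real^'m::finite"
 shows "state_seminorm i z <= 2 * real CARD('m) * norm z"
proof -
 have "state_seminorm i z <= (\<Sum>j\<in>UNIV - {i}. \<bar>z $ j - z $ i\<bar>)"
  unfolding state_seminorm_def L2_set_def[symmetric] by (rule L2_set_le_sum) simp
 also have "... <= (\<Sum>j\<in>UNIV - {i}. 2 * norm z)"
 proof (rule sum_mono)
  fix j
  show "\<bar>z $ j - z $ i\<bar> <= 2 * norm z" using component_le_norm_cart[of z j] component_le_norm_cart[of z i] by linarith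
 qed
 also have "... <= (\<Sum>j\<in>(UNIV :: 'm set). 2 * norm z)" by (rule sum_mono2) auto
 finally show ?thesis by (simp add: mult.commute mult.left_commute)
qed

lemma prob_simplex_compact: "compact (prob_simplex :: (real^'m::finite) set)"
proof (rule compact_eq_bounded_closed[THEN iffD2], intro conjI)
 have "norm p <= 1" if "p \<in> prob_simplex" for p :: "real^'m"
  using norm_le_l1_cart[of p] prob_simplexD[OF that] by (simp add: abs_of_nonneg)
 then show "bounded (prob_simplex :: (real^'m) set)" by (auto intro!: boundedI)
 have "prob_simplex = (\<Inter>i. {p :: real^'m. 0 <= p $ i}) Int {p. (\<Sum>i\<in>UNIV. p $ i) = 1}"
  by (auto simp: prob_simplex_def)
 also have "closed ..."
  by (intro closed_Int closed_INT ballI closed_Collect_le closed_Collect_eq continuous_intros)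
 finally show "closed (prob_simplex :: (real^'m) set)" .
qed

lemma prob_simplex_convex: "convex (prob_simplex :: (real^'m::finite) set)"
 unfolding convex_def prob_simplex_def
 by (auto simp: sum.distrib sum_distrib_left[symmetric])

lemma prob_simplex_nonempty: "axis i 1 \<in> (prob_simplex :: (real^'m::finite) set)"
 by (auto simp: prob_simplex_def axis_nth)

definition to_simplex :: "real^'m::finite => real^'m" where "to_simplex = closest_point prob_simplex"

definition to_ball :: "real => real^'m::finite => real^'m" where "to_ball R = closest_point (cball 0 R)"

lemma to_simplex_in [simp]: "to_simplex p \<in> prob_simplex"
 unfolding to_simplex_def
 using prob_simplex_nonempty by (intro closest_point_in_set compact_imp_closed prob_simplex_compact) auto

lemma to_simplex_lipschitz: "norm (to_simplex p - to_simplex p') <= norm (p - p')"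
 using closest_point_lipschitz[of prob_simplex p p'] prob_simplex_nonempty
 unfolding to_simplex_def dist_norm
 by (auto intro: compact_imp_closed prob_simplex_compact prob_simplex_convex)

lemma to_simplex_self: "p \<in> prob_simplex ==> to_simplex p = p"
 unfolding to_simplex_def by (rule closest_point_self)

lemma to_ball_lipschitz: "0 <= R ==> norm (to_ball R u - to_ball R u') <= norm (u - u')"
 using closest_point_lipschitz[of "cball 0 R" u u'] unfolding to_ball_def dist_norm by auto

lemma to_ball_self: "norm u <= R ==> to_ball R u = u"
 unfolding to_ball_def by (rule closest_point_self) simp

lemma to_ball_norm:
 fixes u :: "real^'m::finite"
 assumes "0 <= R" shows "norm (to_ball R u) <= R" "norm (to_ball R u) <= norm u"
proof -
 have "to_ball R u \<in> cball 0 R" unfolding to_ball_def using assms by (intro closest_point_in_set) auto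
 then show "norm (to_ball R u) <= R" by simp
 show "norm (to_ball R u) <= norm u" using to_ball_lipschitz[OF assms, of u 0] to_ball_self[of "0 :: real^'m" R] assms by simp
qed

lemma prob_simplex_le: "p \<in> prob_simplex ==> \<bar>p $ i\<bar> <= 1"
 using member_le_sum[of i UNIV "($) p"] prob_simplexD[of p] by auto

lemma gronwall_backward:
 fixes w :: "real => real"
 assumes w: "continuous_on {0..T} w" and C: "0 <= C"
  and le: "!!t. t \<in> {0..T} ==> w t <= a + C * (LINT s:{t..T}|lborel. w s)" and t: "t \<in> {0..T}"
 shows "w t <= a * exp (C * (T - t))"
proof -
 have "w (T - (T - t)) <= a * exp (C * (T - t))"
 proof (rule gronwall[where w="%s. w (T - s)" and T=T])
  show "continuous_on {0..T} (%s. w (T - s))"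
   by (rule continuous_on_compose2[OF w]) (auto intro!: continuous_intros)
  fix r assume r: "r \<in> {0..T}"
  have "(LINT s:{T - r..T}|lborel. w s) = (\<integral>s. indicator {T - r..T} (T + (-1) * s) * w (T + (-1) * s) \<partial>lborel)"
   unfolding set_lebesgue_integral_def by (subst lborel_integral_real_affine[where c="-1" and t=T]) auto
  also have "... = (LINT s:{0..r}|lborel. w (T - s))"
   unfolding set_lebesgue_integral_def
   by (rule bochner_cong[OF refl]) (auto simp: indicator_def)
  finally show "w (T - r) <= a + C * (LINT s:{0..r}|lborel. w (T - s))" using le[of "T - r"] r by simp
 qed (use t C in auto)
 then show ?thesis by simp
qed

lemma set_integral_Icc_Ioc:
 fixes h :: "real => 'a::euclidean_space"
 shows "set_integrable lborel {a..b} h \<longleftrightarrow> set_integrable lborel {a<..b} h"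
  and "set_integrable lborel {a..b} h ==> (LINT s:{a..b}|lborel. h s) = (LINT s:{a<..b}|lborel. h s)"
proof -
 have m: "(%s. indicator {a<..b} s *\<^sub>R h s) \<in> borel_measurable lborel \<longleftrightarrow> (%s. indicator {a..b} s *\<^sub>R h s) \<in> borel_measurable lborel" (is "?l \<longleftrightarrow> ?r")
 proof
  assume l: ?l
  have "(%s. indicator {a<..b} s *\<^sub>R h s + indicator {x. x = a & a <= b} s *\<^sub>R h a) \<in> borel_measurable lborel"
   by (intro borel_measurable_add l borel_measurable_scaleR borel_measurable_indicator borel_measurable_const) (simp add: Collect_conj_eq)
  also have "(%s. indicator {a<..b} s *\<^sub>R h s + indicator {x. x = a & a <= b} s *\<^sub>R h a) = (%s. indicator {a..b} s *\<^sub>R h s)"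
   by (auto simp: fun_eq_iff indicator_def)
  finally show ?r .
 next
  assume r: ?r
  have "(%s. indicator {a<..b} s *\<^sub>R (indicator {a..b} s *\<^sub>R h s)) \<in> borel_measurable lborel"
   by (intro borel_measurable_scaleR r borel_measurable_indicator) simp
  also have "(%s. indicator {a<..b} s *\<^sub>R (indicator {a..b} s *\<^sub>R h s)) = (%s. indicator {a<..b} s *\<^sub>R h s)"
   by (auto simp: fun_eq_iff indicator_def)
  finally show ?l .
 qed
 have ae: "AE s in lborel. indicator {a..b} s *\<^sub>R h s = indicator {a<..b} s *\<^sub>R h s"
  by (rule AE_mp[OF AE_lborel_singleton[of a]]) (auto simp: indicator_def)
 show "set_integrable lborel {a..b} h \<longleftrightarrow> set_integrable lborel {a<..b} h"
  unfolding set_integrable_def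
 proof
  assume i: "integrable lborel (%s. indicator {a..b} s *\<^sub>R h s)"
  have r: ?r by (rule borel_measurable_integrable[OF i])
  show "integrable lborel (%s. indicator {a<..b} s *\<^sub>R h s)"
   by (rule integrable_cong_AE[THEN iffD1, OF r m[THEN iffD2, OF r] ae i])
 next
  assume i: "integrable lborel (%s. indicator {a<..b} s *\<^sub>R h s)"
  have l: ?l by (rule borel_measurable_integrable[OF i])
  show "integrable lborel (%s. indicator {a..b} s *\<^sub>R h s)"
   by (rule integrable_cong_AE[THEN iffD2, OF m[THEN iffD1, OF l] l ae i])
 qed
 show "(LINT s:{a..b}|lborel. h s) = (LINT s:{a<..b}|lborel. h s)" if "set_integrable lborel {a..b} h"
 proof -
  have r: ?r using that unfolding set_integrable_def by (rule borel_measurable_integrable)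
  show ?thesis
   unfolding set_lebesgue_integral_def by (rule integral_cong_AE[OF r m[THEN iffD2, OF r] ae])
 qed
qed

lemma has_density_component:
 fixes x b :: "real => 'a::euclidean_space"
 assumes h: "bounded_linear h" and b: "set_integrable lborel {0..T} b"
  and x: "!!t. t \<in> {0..T} ==> x t = x 0 + (LINT s:{0..t}|lborel. b s)"
 shows "has_density lborel T (%s. h (b s)) (%t. h (x t))"
 unfolding has_density_def
proof (intro conjI ballI)
 have hb: "indicator S s *\<^sub>R h (b s) = h (indicator S s *\<^sub>R b s)" for S :: "real set" and s
  by (simp add: linear_scale[OF bounded_linear.linear[OF h]])
 have i: "set_integrable lborel {0..t} b" if "t \<in> {0..T}" for t
  by (rule set_integrable_subset[OF b]) (use that in auto)
 have hi: "set_integrable lborel {0..t} (%s. h (b s))" if "t \<in> {0..T}" for t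
  using integrable_bounded_linear[OF h i[OF that, unfolded set_integrable_def]] by (simp only: set_integrable_def hb)
 have hT: "set_integrable lborel {0..T} (%s. h (b s))"
  using integrable_bounded_linear[OF h b[unfolded set_integrable_def]] by (simp only: set_integrable_def hb)
 then show "set_integrable lborel {0<..T} (%s. h (b s))" by (simp only: set_integral_Icc_Ioc(1))
 fix t assume t: "t \<in> {0..T}"
 have "h (x t) = h (x 0) + h (LINT s:{0..t}|lborel. b s)"
  by (subst x[OF t]) (rule linear_add[OF bounded_linear.linear[OF h]])
 also have "h (LINT s:{0..t}|lborel. b s) = (LINT s:{0..t}|lborel. h (b s))"
  unfolding set_lebesgue_integral_def hb
  by (rule integral_bounded_linear[OF h i[OF t, unfolded set_integrable_def], symmetric])
 also have "... = (LINT s:{0<..t}|lborel. h (b s))" by (rule set_integral_Icc_Ioc(2)[OF hi[OF t]])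
 finally show "h (x t) = h (x 0) + (LINT s:{0<..t}|lborel. h (b s))" .
qed

text \<open>The data with all constants made explicit and with the minimizer of the Hamiltonian as a parameter.\<close>

locale mean_field_game =
 fixes T :: real and A :: "(real^'l::finite) set" and q :: "('m::finite, 'l) rate_function"
  and f :: "('m, 'l) running_cost" and g :: "'m terminal_cost"
  and ahat :: "'m => real => real^'m => real^'m => real^'l" and Cq C C1 C2 :: real
 assumes T: "0 < T" and A: "compact A" "A ~= {}" and constants: "0 < Cq" "0 < C" "0 < C1" "0 <= C2"
  and q_sum: "!!t i a p \<nu>. t \<in> {0..T} ==> a \<in> A ==> p \<in> prob_simplex ==> \<nu> \<in> prob_measures A ==> (\<Sum>j\<in>UNIV. q t i j a p \<nu>) = 0"
  and q_pos: "!!t i j a p \<nu>. t \<in> {0..T} ==> a \<in> A ==> p \<in> prob_simplex ==> \<nu> \<in> prob_measures A ==> i ~= j ==> 0 < q t i j a p \<nu>"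
  and q_le: "!!t i j a p \<nu>. t \<in> {0..T} ==> a \<in> A ==> p \<in> prob_simplex ==> \<nu> \<in> prob_measures A ==> \<bar>q t i j a p \<nu>\<bar> <= Cq"
  and q_lip: "!!t i j a a' p p' \<nu> \<nu>'. t \<in> {0..T} ==> a \<in> A ==> a' \<in> A ==> p \<in> prob_simplex ==> p' \<in> prob_simplex
   ==> \<nu> \<in> prob_measures A ==> \<nu>' \<in> prob_measures A
   ==> \<bar>q t i j a p \<nu> - q t i j a' p' \<nu>'\<bar> <= C * (norm (a - a') + norm (p - p') + wasserstein1 A \<nu> \<nu>')"
  and q_meas: "!!i j a p \<nu>. a \<in> A ==> p \<in> prob_simplex ==> \<nu> \<in> prob_measures A ==> (%t. q t i j a p \<nu>) \<in> borel_measurable (restrict_space borel {0..T})"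
  and f_lip: "!!t i a a' p p' \<nu> \<nu>'. t \<in> {0..T} ==> a \<in> A ==> a' \<in> A ==> p \<in> prob_simplex ==> p' \<in> prob_simplex
   ==> \<nu> \<in> prob_measures A ==> \<nu>' \<in> prob_measures A
   ==> \<bar>f t (unit_state i) a p \<nu> - f t (unit_state i) a' p' \<nu>'\<bar> <= C * (norm (a - a') + norm (p - p') + wasserstein1 A \<nu> \<nu>')"
  and f_int: "!!i a p \<nu>. a \<in> A ==> p \<in> prob_simplex ==> \<nu> \<in> prob_measures A ==> set_integrable lborel {0..T} (%t. f t (unit_state i) a p \<nu>)"
  and g_lip: "!!i p p'. p \<in> prob_simplex ==> p' \<in> prob_simplex ==> \<bar>g (unit_state i) p - g (unit_state i) p'\<bar> <= C * norm (p - p')"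
  and ahat_min: "!!t i z p \<nu>. t \<in> {0..T} ==> p \<in> prob_simplex ==> \<nu> \<in> prob_measures A
   ==> is_arg_min (%b. hamiltonian q f i t z b p \<nu>) (%b. b \<in> A) (ahat i t z p)"
  and ahat_meas: "!!i. (%(t, z, p). ahat i t z p) \<in> borel_measurable (restrict_space borel ({0..T} \<times> UNIV \<times> prob_simplex))"
  and ahat_lip: "!!t i z z' p p'. t \<in> {0..T} ==> p \<in> prob_simplex ==> p' \<in> prob_simplex
   ==> norm (ahat i t z p - ahat i t z' p') <= C1 * state_seminorm i (z - z') + (C1 + C2 * state_seminorm i z) * norm (p - p')"
begin

text \<open>The triples of an own action, a law of the state, and a vector of actions, one for each state. They
 stand for the arguments \<open>(\<alpha>, p, \<nu>)\<close> with \<open>\<nu>\<close> a mixture of \<open>m\<close> point masses; in these coordinates the data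
 are Lipschitz functions on a subset of a Euclidean space.\<close>

definition params :: "((real^'l) \<times> ((real^'m) \<times> ((real^'l)^'m))) set" where
 "params = A \<times> mixture_params A"

definition rate :: "real => 'm => 'm => (real^'l) \<times> ((real^'m) \<times> ((real^'l)^'m)) => real" where
 "rate t i j x = q t i j (fst x) (fst (snd x)) (mixture A (fst (snd x)) (snd (snd x)))"

definition run :: "real => 'm => (real^'l) \<times> ((real^'m) \<times> ((real^'l)^'m)) => real" where
 "run t i x = f t (unit_state i) (fst x) (fst (snd x)) (mixture A (fst (snd x)) (snd (snd x)))"

lemma paramsD:
 assumes "x \<in> params"
 shows "fst x \<in> A" "fst (snd x) \<in> prob_simplex" "snd (snd x) $ i \<in> A" "snd x \<in> mixture_params A"
  "mixture A (fst (snd x)) (snd (snd x)) \<in> prob_measures A"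
 using assms by (auto simp: params_def mixture_params_def intro!: mixture_prob)

lemma paramsI: "a \<in> A ==> p \<in> prob_simplex ==> (!!i. b $ i \<in> A) ==> (a, (p, b)) \<in> params"
 by (auto simp: params_def mixture_params_def)

lemma params_lipschitz:
 obtains L where "0 < L"
  "!!h x y. x \<in> params ==> y \<in> params ==>
   (!!a a' p p' \<nu> \<nu>'. a \<in> A ==> a' \<in> A ==> p \<in> prob_simplex ==> p' \<in> prob_simplex
   ==> \<nu> \<in> prob_measures A ==> \<nu>' \<in> prob_measures A
   ==> \<bar>h a p \<nu> - h a' p' \<nu>'\<bar> <= C * (norm (a - a') + norm (p - p') + wasserstein1 A \<nu> \<nu>'))
   ==> norm (h (fst x) (fst (snd x)) (mixture A (fst (snd x)) (snd (snd x)))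
     - h (fst y) (fst (snd y)) (mixture A (fst (snd y)) (snd (snd y))) :: real) <= L * norm (x - y)"
proof -
 obtain D0 where D0: "!!x y. x \<in> A ==> y \<in> A ==> dist x y <= D0"
  using compact_imp_bounded[OF A(1)] unfolding bounded_two_points by blast
 define D where "D = max 0 D0"
 have D: "dist x y <= D" if "x \<in> A" "y \<in> A" for x y using D0[OF that] by (simp add: D_def)
 have D_nn: "0 <= D" by (simp add: D_def)
 let ?W = "real CARD('m) * (1 + D)"
 have W0: "0 <= ?W" using D_nn by simp
 show ?thesis
 proof (rule that[of "C * (2 + ?W)"])
  show "0 < C * (2 + ?W)" using constants(2) W0 by (intro mult_pos_pos) linarith+
  fix h :: "real^'l => real^'m => (real^'l) measure => real" and x y
  assume x: "x \<in> params" and y: "y \<in> params"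
   and h: "!!a a' p p' \<nu> \<nu>'. a \<in> A ==> a' \<in> A ==> p \<in> prob_simplex ==> p' \<in> prob_simplex
   ==> \<nu> \<in> prob_measures A ==> \<nu>' \<in> prob_measures A
   ==> \<bar>h a p \<nu> - h a' p' \<nu>'\<bar> <= C * (norm (a - a') + norm (p - p') + wasserstein1 A \<nu> \<nu>')"
  have s: "dist (snd x) (snd y) <= dist x y" by (rule dist_snd_le)
  have "norm (fst x - fst y) <= norm (x - y)" using dist_fst_le[of x y] by (simp add: dist_norm)
  moreover have "norm (fst (snd x) - fst (snd y)) <= norm (x - y)"
   using dist_fst_le[of "snd x" "snd y"] s by (simp add: dist_norm)
  moreover have "wasserstein1 A (mixture A (fst (snd x)) (snd (snd x))) (mixture A (fst (snd y)) (snd (snd y))) <= ?W * norm (x - y)"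
   unfolding dist_norm[symmetric]
   by (rule order_trans[OF mixture_dist[OF paramsD(4)[OF x] paramsD(4)[OF y] D] mult_left_mono[OF s W0]])
  ultimately have "norm (fst x - fst y) + norm (fst (snd x) - fst (snd y)) + wasserstein1 A (mixture A (fst (snd x)) (snd (snd x))) (mixture A (fst (snd y)) (snd (snd y)))
    <= (2 + ?W) * norm (x - y)" by (simp only: distrib_right)
  then have "C * (norm (fst x - fst y) + norm (fst (snd x) - fst (snd y)) + wasserstein1 A (mixture A (fst (snd x)) (snd (snd x))) (mixture A (fst (snd y)) (snd (snd y))))
    <= C * ((2 + ?W) * norm (x - y))" using constants(2) by (intro mult_left_mono) auto
  with h[OF paramsD(1)[OF x] paramsD(1)[OF y] paramsD(2)[OF x] paramsD(2)[OF y] paramsD(5)[OF x] paramsD(5)[OF y]]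
  show "norm (h (fst x) (fst (snd x)) (mixture A (fst (snd x)) (snd (snd x)))
     - h (fst y) (fst (snd y)) (mixture A (fst (snd y)) (snd (snd y)))) <= C * (2 + ?W) * norm (x - y)"
   by (simp only: real_norm_def mult.assoc)
 qed
qed

lemma rate_run_lipschitz:
 obtains L where "0 < L"
  "!!t i j x y. t \<in> {0..T} ==> x \<in> params ==> y \<in> params ==> norm (rate t i j x - rate t i j y) <= L * norm (x - y)"
  "!!t i x y. t \<in> {0..T} ==> x \<in> params ==> y \<in> params ==> norm (run t i x - run t i y) <= L * norm (x - y)"
proof -
 obtain L where L: "0 < L" and
  h: "!!h x y. x \<in> params ==> y \<in> params ==>
   (!!a a' p p' \<nu> \<nu>'. a \<in> A ==> a' \<in> A ==> p \<in> prob_simplex ==> p' \<in> prob_simplex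
   ==> \<nu> \<in> prob_measures A ==> \<nu>' \<in> prob_measures A
   ==> \<bar>h a p \<nu> - h a' p' \<nu>'\<bar> <= C * (norm (a - a') + norm (p - p') + wasserstein1 A \<nu> \<nu>'))
   ==> norm (h (fst x) (fst (snd x)) (mixture A (fst (snd x)) (snd (snd x)))
     - h (fst y) (fst (snd y)) (mixture A (fst (snd y)) (snd (snd y))) :: real) <= L * norm (x - y)"
  by (rule params_lipschitz) blast
 show ?thesis
 proof (rule that[OF L])
  fix t i j x y assume t: "t \<in> {0..T}" and x: "x \<in> params" and y: "y \<in> params"
  show "norm (rate t i j x - rate t i j y) <= L * norm (x - y)"
   unfolding rate_def by (rule h[OF x y, of "q t i j"]) (rule q_lip[OF t])
  show "norm (run t i x - run t i y) <= L * norm (x - y)"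
   unfolding run_def by (rule h[OF x y, of "f t (unit_state i)"]) (rule f_lip[OF t])
 qed
qed

lemma rate_bound: "t \<in> {0..T} ==> x \<in> params ==> \<bar>rate t i j x\<bar> <= Cq"
 unfolding rate_def by (rule q_le) (auto dest: paramsD)

lemma rate_sum: "t \<in> {0..T} ==> x \<in> params ==> (\<Sum>j\<in>UNIV. rate t i j x) = 0"
 unfolding rate_def by (rule q_sum) (auto dest: paramsD)

lemma rate_pos: "t \<in> {0..T} ==> x \<in> params ==> i ~= j ==> 0 < rate t i j x"
 unfolding rate_def by (rule q_pos) (auto dest: paramsD)

lemma
 assumes \<tau>: "\<tau> \<in> measurable M (restrict_space borel {0..T})" and y: "y \<in> borel_measurable M"
  and yS: "!!x. x \<in> space M ==> y x \<in> params"
 shows rate_measurable: "(%x. rate (\<tau> x) i j (y x)) \<in> borel_measurable M"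
  and run_measurable: "(%x. run (\<tau> x) i (y x)) \<in> borel_measurable M"
proof -
 have \<tau>T: "\<tau> x \<in> {0..T}" if "x \<in> space M" for x
  using measurable_space[OF \<tau> that] by (simp add: space_restrict_space)
 obtain L where L: "0 < L" and
  lq: "!!t i j x y. t \<in> {0..T} ==> x \<in> params ==> y \<in> params ==> norm (rate t i j x - rate t i j y) <= L * norm (x - y)" and
  lf: "!!t i x y. t \<in> {0..T} ==> x \<in> params ==> y \<in> params ==> norm (run t i x - run t i y) <= L * norm (x - y)"
  by (rule rate_run_lipschitz) blast
 have cont: "continuous_on params h" if "!!x y. x \<in> params ==> y \<in> params ==> norm (h x - h y) <= L * norm (x - y)"
  for h :: "_ => real"
  by (rule lipschitz_on_continuous_on[of L], rule lipschitz_onI) (use that L in \<open>auto simp: dist_norm\<close>)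
 show "(%x. rate (\<tau> x) i j (y x)) \<in> borel_measurable M"
 proof (rule caratheodory_measurable[OF _ _ y yS, where h="%x. rate (\<tau> x) i j"])
  show "(%x. rate (\<tau> x) i j d) \<in> borel_measurable M" if "d \<in> params" for d
   unfolding rate_def by (rule measurable_compose[OF \<tau> q_meas]) (use paramsD[OF that] in auto)
  show "continuous_on params (rate (\<tau> x) i j)" if "x \<in> space M" for x
   by (rule cont[OF lq[OF \<tau>T[OF that]]])
 qed
 show "(%x. run (\<tau> x) i (y x)) \<in> borel_measurable M"
 proof (rule caratheodory_measurable[OF _ _ y yS, where h="%x. run (\<tau> x) i"])
  show "(%x. run (\<tau> x) i d) \<in> borel_measurable M" if d: "d \<in> params" for d
  proof -
   have "(%t. run t i d) \<in> borel_measurable (restrict_space borel {0..T})"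
    using borel_measurable_integrable[OF f_int[OF paramsD(1)[OF d] paramsD(2)[OF d] paramsD(5)[OF d], of i, unfolded set_integrable_def]]
    by (subst borel_measurable_restrict_space_iff) (simp_all add: run_def)
   from measurable_compose[OF \<tau> this] show ?thesis .
  qed
  show "continuous_on params (run (\<tau> x) i)" if "x \<in> space M" for x
   by (rule cont[OF lf[OF \<tau>T[OF that]]])
 qed
qed

lemma params_bounded:
 obtains B where "0 < B" "!!x. x \<in> params ==> norm x <= B"
proof -
 obtain a where a: "0 < a" "!!x. x \<in> A ==> norm x <= a" using compact_imp_bounded[OF A(1)] unfolding bounded_pos by blast
 show ?thesis
 proof (rule that[of "a + (1 + real CARD('m) * a)"])
  show "0 < a + (1 + real CARD('m) * a)" using a(1) by (simp add: add_pos_nonneg)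
  fix x assume x: "x \<in> params"
  have "norm x <= norm (fst x) + norm (snd x)" using norm_Pair_le[of "fst x" "snd x"] by simp
  also have "norm (snd x) <= norm (fst (snd x)) + norm (snd (snd x))" using norm_Pair_le[of "fst (snd x)" "snd (snd x)"] by simp
  also have "norm (snd (snd x)) <= (\<Sum>i\<in>UNIV. norm (snd (snd x) $ i))" unfolding norm_vec_def by (rule L2_set_le_sum) simp
  also have "... <= (\<Sum>i\<in>(UNIV :: 'm set). a)" by (rule sum_mono) (rule a(2)[OF paramsD(3)[OF x]])
  also have "norm (fst (snd x)) <= 1"
   using norm_le_l1_cart[of "fst (snd x)"] prob_simplexD[OF paramsD(2)[OF x]] by (simp add: abs_of_nonneg)
  also have "norm (fst x) <= a" by (rule a(2)[OF paramsD(1)[OF x]])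
  finally show "norm x <= a + (1 + real CARD('m) * a)" by simp
 qed
qed

lemma params_nonempty: obtains x where "x \<in> params"
proof -
 obtain a where "a \<in> A" using A(2) by blast
 then have "(a, (axis undefined 1, \<chi> i. a)) \<in> params" by (intro paramsI prob_simplex_nonempty) auto
 then show ?thesis by (rule that)
qed

text \<open>A Lipschitz function on a bounded set is dominated by its value at one point plus a constant.\<close>

lemma run_bound:
 obtains \<phi> where "set_integrable lborel {0..T} \<phi>" "!!t i x. t \<in> {0..T} ==> x \<in> params ==> \<bar>run t i x\<bar> <= \<phi> t"
proof -
 obtain x0 where x0: "x0 \<in> params" by (rule params_nonempty)
 obtain B where B: "0 < B" "!!x. x \<in> params ==> norm x <= B" by (rule params_bounded) blast
 obtain L where L: "0 < L" and
  lf: "!!t i x y. t \<in> {0..T} ==> x \<in> params ==> y \<in> params ==> norm (run t i x - run t i y) <= L * norm (x - y)"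
  by (rule rate_run_lipschitz) blast
 show ?thesis
 proof (rule that[of "%t. (\<Sum>i\<in>UNIV. \<bar>run t i x0\<bar>) + L * (B + B)"])
  have "set_integrable lborel {0..T} (%t. \<bar>run t i x0\<bar>)" for i
   unfolding run_def using set_integrable_norm[OF f_int[OF paramsD(1)[OF x0] paramsD(2)[OF x0] paramsD(5)[OF x0], of i]] by simp
  then have "set_integrable lborel {0..T} (%t. \<Sum>i\<in>UNIV. \<bar>run t i x0\<bar>)"
   unfolding set_integrable_def scaleR_sum_right by (intro Bochner_Integration.integrable_sum)
  moreover have "set_integrable lborel {0..T} (%t. L * (B + B))"
   unfolding set_integral_Icc_Ioc(1) by (rule set_integrable_bounded_lborel[where K="\<bar>L * (B + B)\<bar>"]) auto
  ultimately show "set_integrable lborel {0..T} (%t. (\<Sum>i\<in>UNIV. \<bar>run t i x0\<bar>) + L * (B + B))" by (rule set_integral_add(1))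
  fix t i x assume t: "t \<in> {0..T}" and x: "x \<in> params"
  have "norm (x - x0) <= B + B" using norm_triangle_ineq4[of x x0] B(2)[OF x] B(2)[OF x0] by linarith
  then have "L * norm (x - x0) <= L * (B + B)" using L by (intro mult_left_mono) auto
  moreover have "\<bar>run t i x - run t i x0\<bar> <= L * norm (x - x0)" using lf[OF t x x0, of i] by simp
  moreover have "\<bar>run t i x0\<bar> <= (\<Sum>i\<in>UNIV. \<bar>run t i x0\<bar>)" by (rule member_le_sum[of i UNIV "%i. \<bar>run t i x0\<bar>"]) auto
  ultimately show "\<bar>run t i x\<bar> <= (\<Sum>i\<in>UNIV. \<bar>run t i x0\<bar>) + L * (B + B)" by linarith
 qed
qed

lemma ahat_in: "t \<in> {0..T} ==> p \<in> prob_simplex ==> ahat i t z p \<in> A"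
proof -
 assume t: "t \<in> {0..T}" and p: "p \<in> prob_simplex"
 obtain x0 where x0: "x0 \<in> params" by (rule params_nonempty)
 show ?thesis using ahat_min[OF t p paramsD(5)[OF x0], of i z] by (simp add: is_arg_min_def)
qed

text \<open>The parameters seen by state \<open>i\<close> when all states use the optimal feedback.\<close>

definition feedback :: "'m => real => real^'m => real^'m => (real^'l) \<times> ((real^'m) \<times> ((real^'l)^'m))" where
 "feedback i t z p = (ahat i t z p, (p, \<chi> k. ahat k t z p))"

lemma feedback_in: "t \<in> {0..T} ==> p \<in> prob_simplex ==> feedback i t z p \<in> params"
 unfolding feedback_def by (intro paramsI) (auto intro: ahat_in)

text \<open>The Kolmogorov equation for the first component, the Hamilton-Jacobi equation for the second. As
 the rows of the rates sum to zero, \<open>\<Sum>\<^sub>j z\<^sub>j q\<^sub>i\<^sub>j\<close> is \<open>\<Sum>\<^sub>j (z\<^sub>j - z\<^sub>i) q\<^sub>i\<^sub>j\<close>. The projections make the field bounded and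
 globally Lipschitz, since the minimizer is Lipschitz only on bounded sets of \<open>z\<close>.\<close>

definition field :: "real => real => (real^'m) \<times> (real^'m) => (real^'m) \<times> (real^'m)" where
 "field R t x = (let p = to_simplex (fst x); z = to_ball R (snd x) in
   (\<chi> i. \<Sum>j\<in>UNIV. p $ j * rate t j i (feedback j t z p),
   \<chi> i. - (run t i (feedback i t z p) + (\<Sum>j\<in>UNIV. z $ j * rate t i j (feedback i t z p)))))"

lemma ahat_uniformly_lipschitz:
 assumes R: "0 <= R"
 shows "uniformly_lipschitz T (%t x. ahat i t (to_ball R (snd x)) (to_simplex (fst x)))"
proof (rule uniformly_lipschitzI)
 fix t and x y :: "(real^'m) \<times> (real^'m)" assume t: "t \<in> {0..T}"
 let ?m = "2 * real CARD('m)"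
 have n1: "norm (to_simplex (fst x) - to_simplex (fst y)) <= norm (x - y)"
  using to_simplex_lipschitz[of "fst x" "fst y"] dist_fst_le[of x y] by (simp add: dist_norm)
 have n2: "norm (to_ball R (snd x) - to_ball R (snd y)) <= norm (x - y)"
  using to_ball_lipschitz[OF R, of "snd x" "snd y"] dist_snd_le[of x y] by (simp add: dist_norm)
 have s1: "state_seminorm i (to_ball R (snd x) - to_ball R (snd y)) <= ?m * norm (x - y)"
  by (rule order_trans[OF state_seminorm_le mult_left_mono[OF n2]]) simp
 have s2: "state_seminorm i (to_ball R (snd x)) <= ?m * R"
  by (rule order_trans[OF state_seminorm_le mult_left_mono[OF to_ball_norm(1)[OF R]]]) simp
 have "norm (ahat i t (to_ball R (snd x)) (to_simplex (fst x)) - ahat i t (to_ball R (snd y)) (to_simplex (fst y)))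
   <= C1 * state_seminorm i (to_ball R (snd x) - to_ball R (snd y)) + (C1 + C2 * state_seminorm i (to_ball R (snd x))) * norm (to_simplex (fst x) - to_simplex (fst y))"
  by (rule ahat_lip[OF t to_simplex_in to_simplex_in])
 also have "... <= C1 * (?m * norm (x - y)) + (C1 + C2 * (?m * R)) * norm (x - y)"
  using s1 s2 n1 constants R by (intro add_mono mult_mono mult_left_mono) (auto simp: state_seminorm_def intro!: add_nonneg_nonneg mult_nonneg_nonneg sum_nonneg)
 finally show "norm (ahat i t (to_ball R (snd x)) (to_simplex (fst x)) - ahat i t (to_ball R (snd y)) (to_simplex (fst y)))
   <= (C1 * ?m + (C1 + C2 * (?m * R))) * norm (x - y)" by (simp add: algebra_simps)
qed

lemma to_simplex_uniformly_lipschitz: "uniformly_lipschitz T (%t x. to_simplex (fst (x :: (real^'m) \<times> (real^'m))))"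
proof (rule uniformly_lipschitzI[of _ _ 1])
 fix x y :: "(real^'m) \<times> (real^'m)"
 show "norm (to_simplex (fst x) - to_simplex (fst y)) <= 1 * norm (x - y)"
  using to_simplex_lipschitz[of "fst x" "fst y"] dist_fst_le[of x y] by (simp only: dist_norm mult_1)
qed

lemma uniformly_lipschitz_nth:
 fixes h :: "real => 'a::real_normed_vector => real^'i::finite"
 assumes "uniformly_lipschitz T h" shows "uniformly_lipschitz T (%t x. h t x $ i)"
proof -
 obtain K where "0 < K" and K: "!!t x y. t \<in> {0..T} ==> norm (h t x - h t y) <= K * norm (x - y)" by (rule uniformly_lipschitzE[OF assms]) blast
 show ?thesis
 proof (rule uniformly_lipschitzI)
  fix t x y assume t: "t \<in> {0..T}"
  show "norm (h t x $ i - h t y $ i) <= K * norm (x - y)"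
   using component_le_norm_cart[of "h t x - h t y" i] K[OF t, of x y] by simp
 qed
qed

lemma field_lipschitz:
 assumes R: "0 <= R" shows "uniformly_lipschitz T (field R)"
proof -
 obtain L where L: "0 < L" and
  lq: "!!t i j x y. t \<in> {0..T} ==> x \<in> params ==> y \<in> params ==> norm (rate t i j x - rate t i j y) <= L * norm (x - y)" and
  lf: "!!t i x y. t \<in> {0..T} ==> x \<in> params ==> y \<in> params ==> norm (run t i x - run t i y) <= L * norm (x - y)"
  by (rule rate_run_lipschitz) blast
 have fb: "uniformly_lipschitz T (%t x. feedback i t (to_ball R (snd x)) (to_simplex (fst x)))" for i
  unfolding feedback_def
  by (intro uniformly_lipschitz_Pair uniformly_lipschitz_vec ahat_uniformly_lipschitz R to_simplex_uniformly_lipschitz)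
 have rt: "uniformly_lipschitz T (%t x. rate t i j (feedback i t (to_ball R (snd x)) (to_simplex (fst x))))" for i j
  by (rule uniformly_lipschitz_compose[OF fb _ lq]) (auto intro: feedback_in)
 have rn: "uniformly_lipschitz T (%t x. run t i (feedback i t (to_ball R (snd x)) (to_simplex (fst x))))" for i
  by (rule uniformly_lipschitz_compose[OF fb _ lf]) (auto intro: feedback_in)
 have zl: "uniformly_lipschitz T (%t x. to_ball R (snd (x :: (real^'m) \<times> (real^'m))))"
 proof (rule uniformly_lipschitzI[of _ _ 1])
  fix x y :: "(real^'m) \<times> (real^'m)"
  show "norm (to_ball R (snd x) - to_ball R (snd y)) <= 1 * norm (x - y)"
   using to_ball_lipschitz[OF R, of "snd x" "snd y"] dist_snd_le[of x y] by (simp only: dist_norm mult_1)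
 qed
 let ?B = "max Cq (max 1 R)"
 have b1: "\<bar>to_simplex p $ j\<bar> <= ?B" for p :: "real^'m" and j using prob_simplex_le[OF to_simplex_in, of p j] by simp
 have b2: "\<bar>to_ball R z $ j\<bar> <= ?B" for z :: "real^'m" and j
  using component_le_norm_cart[of "to_ball R z" j] to_ball_norm(1)[OF R, of z] by simp
 have b3: "\<bar>rate t i j (feedback k t z (to_simplex p))\<bar> <= ?B" if "t \<in> {0..T}" for t i j k z p
  using rate_bound[OF that feedback_in[OF that to_simplex_in], of i j k z p] by simp
 show ?thesis
  unfolding field_def[abs_def] Let_def
  by (intro uniformly_lipschitz_Pair uniformly_lipschitz_vec uniformly_lipschitz_sum uniformly_lipschitz_minus uniformly_lipschitz_add
    uniformly_lipschitz_mult[where B="?B"] rt rn uniformly_lipschitz_nth[OF zl] uniformly_lipschitz_nth[OF to_simplex_uniformly_lipschitz] b1 b2 b3)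
   auto
qed

lemma ahat_path_measurable:
 assumes \<tau>: "\<tau> \<in> measurable M (restrict_space borel {0..T})" and z: "z \<in> borel_measurable M" and p: "p \<in> borel_measurable M"
  and pS: "!!x. x \<in> space M ==> p x \<in> prob_simplex"
 shows "(%x. ahat i (\<tau> x) (z x) (p x)) \<in> borel_measurable M"
proof -
 have "\<tau> \<in> borel_measurable M" "!!x. x \<in> space M ==> \<tau> x \<in> {0..T}"
  using \<tau> by (auto simp: measurable_restrict_space2_iff)
 then have "(%x. (\<tau> x, z x, p x)) \<in> measurable M (restrict_space borel ({0..T} \<times> UNIV \<times> prob_simplex))"
  using z p pS by (intro measurable_restrict_space2 borel_measurable_Pair) auto
 from measurable_compose[OF this ahat_meas] show ?thesis by simp
qed

lemma feedback_measurable: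
 assumes "\<tau> \<in> measurable M (restrict_space borel {0..T})" "z \<in> borel_measurable M" "p \<in> borel_measurable M"
  and "!!x. x \<in> space M ==> p x \<in> prob_simplex"
 shows "(%x. feedback i (\<tau> x) (z x) (p x)) \<in> borel_measurable M"
 unfolding feedback_def
 by (intro borel_measurable_Pair borel_measurable_vec_lambda ahat_path_measurable assms)

lemma field_measurable:
 "(%t. field R t x) \<in> borel_measurable (restrict_space borel {0..T})"
proof -
 have id: "(%t. t) \<in> measurable (restrict_space borel {0..T}) (restrict_space borel {0..T})" by simp
 have fb: "(%t. feedback i t z (to_simplex p)) \<in> borel_measurable (restrict_space borel {0..T})" for i z p
  by (rule feedback_measurable[OF id]) auto
 have sp: "feedback i t z (to_simplex p) \<in> params" if "t \<in> space (restrict_space borel {0..T})" for i t z p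
  using that by (intro feedback_in) (auto simp: space_restrict_space)
 show ?thesis
  unfolding field_def Let_def
  by (intro borel_measurable_Pair borel_measurable_vec_lambda borel_measurable_sum borel_measurable_times borel_measurable_const
   borel_measurable_uminus borel_measurable_add rate_measurable[OF id fb sp] run_measurable[OF id fb sp])
qed

end

context mean_field_game begin

text \<open>The radius \<open>R\<close> must bound the solution that it helps to define. This is not circular, because
 \<open>norm (to_ball R z) <= norm z\<close> for every \<open>R\<close>, so the Gronwall bound for the second component does not see \<open>R\<close>.\<close>

lemma exists_solution:
 obtains p u :: "real => real^'m" where "continuous_on {0..T} p" "continuous_on {0..T} u" "p 0 = p0"
  "!!i. u T $ i = g (unit_state i) (to_simplex (p T))"
  "!!i. has_density lborel T (%s. \<Sum>j\<in>UNIV. to_simplex (p s) $ j * rate s j i (feedback j s (u s) (to_simplex (p s)))) (%t. p t $ i)"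
  "!!i. has_density lborel T (%s. - (run s i (feedback i s (u s) (to_simplex (p s)))
    + (\<Sum>j\<in>UNIV. u s $ j * rate s i j (feedback i s (u s) (to_simplex (p s)))))) (%t. u t $ i)"
proof -
 let ?m = "real CARD('m)"
 obtain \<phi> where \<phi>: "set_integrable lborel {0..T} \<phi>" "!!t i x. t \<in> {0..T} ==> x \<in> params ==> \<bar>run t i x\<bar> <= \<phi> t"
  by (rule run_bound) blast
 obtain x0 where x0: "x0 \<in> params" by (rule params_nonempty)
 have \<phi>0: "0 <= \<phi> t" if "t \<in> {0..T}" for t using order_trans[OF abs_ge_zero \<phi>(2)[OF that x0]] .
 define p00 where "p00 = (axis undefined 1 :: real^'m)"
 have p00: "p00 \<in> prob_simplex" unfolding p00_def by (rule prob_simplex_nonempty)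
 define Bg where "Bg = (\<Sum>i\<in>(UNIV :: 'm set). \<bar>g (unit_state i) p00\<bar> + C * 2)"
 define G where "G p = (\<chi> i. g (unit_state i) (to_simplex p))" for p :: "real^'m"
 have n1: "norm p <= 1" if "p \<in> prob_simplex" for p :: "real^'m"
  using norm_le_l1_cart[of p] prob_simplexD[OF that] by (simp add: abs_of_nonneg)
 have GB: "norm (G p) <= Bg" for p
 proof -
  have "norm (G p) <= (\<Sum>i\<in>UNIV. \<bar>G p $ i\<bar>)" by (rule norm_le_l1_cart)
  also have "... <= Bg"
   unfolding Bg_def
  proof (rule sum_mono)
   fix i
   have "norm (to_simplex p - p00) <= 2"
    using norm_triangle_ineq4[of "to_simplex p" p00] n1[OF to_simplex_in, of p] n1[OF p00] by linarith
   then have "C * norm (to_simplex p - p00) <= C * 2" using constants(2) by (intro mult_left_mono) auto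
   then show "\<bar>G p $ i\<bar> <= \<bar>g (unit_state i) p00\<bar> + C * 2"
    using g_lip[OF to_simplex_in p00, of i p] by (simp add: G_def)
  qed
  finally show ?thesis .
 qed
 have Gc: "continuous_on UNIV G"
  unfolding G_def
 proof (rule continuous_on_vec_lambda)
  fix i
  show "continuous_on UNIV (%p. g (unit_state i) (to_simplex p))"
  proof (rule lipschitz_on_continuous_on[of C], rule lipschitz_onI)
   fix p p' :: "real^'m"
   have "\<bar>g (unit_state i) (to_simplex p) - g (unit_state i) (to_simplex p')\<bar> <= C * norm (to_simplex p - to_simplex p')"
    by (rule g_lip) auto
   also have "... <= C * norm (p - p')" using constants(2) to_simplex_lipschitz by (intro mult_left_mono) auto
   finally show "dist (g (unit_state i) (to_simplex p)) (g (unit_state i) (to_simplex p')) <= C * dist p p'"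
    by (simp add: dist_norm)
  qed (use constants in auto)
 qed
 define Cu where "Cu = ?m * ?m * Cq"
 have Cu0: "0 <= Cu" using constants by (simp add: Cu_def)
 define \<phi>m where "\<phi>m t = ?m * \<phi> t" for t
 have \<phi>mi: "set_integrable lborel {0..T} \<phi>m" unfolding \<phi>m_def using \<phi>(1) by (intro set_integrable_mult_right) auto
 define a where "a = Bg + (LINT s:{0..T}|lborel. \<phi>m s)"
 define R where "R = a * exp (Cu * T)"
 have a0: "0 <= a"
  unfolding a_def set_lebesgue_integral_def
  using order_trans[OF norm_ge_zero GB] \<phi>0 by (intro add_nonneg_nonneg bochner_nonneg) (auto simp: \<phi>m_def indicator_def)
 have R0: "0 <= R" using a0 by (simp add: R_def)
 have snd_bd: "norm (snd (field R t x)) <= \<phi>m t + Cu * norm (to_ball R (snd x))" if t: "t \<in> {0..T}" for t x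
 proof -
  let ?z = "to_ball R (snd x)"
  let ?fb = "%i. feedback i t ?z (to_simplex (fst x))"
  have fb: "?fb i \<in> params" for i by (rule feedback_in[OF t to_simplex_in])
  have "norm (snd (field R t x)) <= (\<Sum>i\<in>UNIV. \<bar>snd (field R t x) $ i\<bar>)" by (rule norm_le_l1_cart)
  also have "... <= (\<Sum>i\<in>(UNIV :: 'm set). \<phi> t + ?m * (norm ?z * Cq))"
  proof (rule sum_mono)
   fix i
   have "\<bar>\<Sum>j\<in>UNIV. ?z $ j * rate t i j (?fb i)\<bar> <= (\<Sum>j\<in>(UNIV :: 'm set). norm ?z * Cq)"
   proof (rule order_trans[OF sum_abs sum_mono])
    fix j show "\<bar>?z $ j * rate t i j (?fb i)\<bar> <= norm ?z * Cq"
     unfolding abs_mult by (intro mult_mono component_le_norm_cart rate_bound[OF t fb]) auto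
   qed
   then show "\<bar>snd (field R t x) $ i\<bar> <= \<phi> t + ?m * (norm ?z * Cq)"
    using \<phi>(2)[OF t fb[of i], of i] unfolding field_def Let_def by simp
  qed
  also have "... = \<phi>m t + Cu * norm ?z" by (simp add: \<phi>m_def Cu_def algebra_simps)
  finally show ?thesis .
 qed
 have fst_bd: "norm (fst (field R t x)) <= ?m * (?m * Cq)" if t: "t \<in> {0..T}" for t x
 proof -
  let ?fb = "%i. feedback i t (to_ball R (snd x)) (to_simplex (fst x))"
  have fb: "?fb i \<in> params" for i by (rule feedback_in[OF t to_simplex_in])
  have "norm (fst (field R t x)) <= (\<Sum>i\<in>UNIV. \<bar>fst (field R t x) $ i\<bar>)" by (rule norm_le_l1_cart)
  also have "... <= (\<Sum>i\<in>(UNIV :: 'm set). \<Sum>j\<in>(UNIV :: 'm set). Cq)"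
  proof (rule sum_mono)
   fix i
   have "\<bar>\<Sum>j\<in>UNIV. to_simplex (fst x) $ j * rate t j i (?fb j)\<bar> <= (\<Sum>j\<in>(UNIV :: 'm set). 1 * Cq)"
   proof (rule order_trans[OF sum_abs sum_mono])
    fix j show "\<bar>to_simplex (fst x) $ j * rate t j i (?fb j)\<bar> <= 1 * Cq"
     unfolding abs_mult by (intro mult_mono prob_simplex_le rate_bound[OF t fb] to_simplex_in) auto
   qed
   then show "\<bar>fst (field R t x) $ i\<bar> <= (\<Sum>j\<in>(UNIV :: 'm set). Cq)" unfolding field_def Let_def by simp
  qed
  finally show ?thesis by simp
 qed
 define \<Phi> where "\<Phi> t = \<phi>m t + (?m * (?m * Cq) + Cu * R)" for t
 have \<Phi>i: "set_integrable lborel {0..T} \<Phi>"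
  unfolding \<Phi>_def
 proof (rule set_integral_add(1)[OF \<phi>mi])
  show "set_integrable lborel {0..T} (%t. ?m * (?m * Cq) + Cu * R)"
   unfolding set_integral_Icc_Ioc(1) by (rule set_integrable_bounded_lborel[where K="\<bar>?m * (?m * Cq) + Cu * R\<bar>"]) auto
 qed
 have \<Phi>b: "norm (field R t x) <= \<Phi> t" if t: "t \<in> {0..T}" for t x
 proof -
  have "norm (field R t x) <= norm (fst (field R t x)) + norm (snd (field R t x))"
   using norm_Pair_le[of "fst (field R t x)" "snd (field R t x)"] by simp
  moreover have "Cu * norm (to_ball R (snd x)) <= Cu * R" using Cu0 to_ball_norm(1)[OF R0] by (intro mult_left_mono)
  ultimately show ?thesis using fst_bd[OF t, of x] snd_bd[OF t, of x] unfolding \<Phi>_def by linarith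
 qed
 obtain K where K: "0 < K" "!!t x y. t \<in> {0..T} ==> norm (field R t x - field R t y) <= K * norm (x - y)"
  by (rule uniformly_lipschitzE[OF field_lipschitz[OF R0]]) blast
 obtain x where xc: "continuous_on {0..T} x" and x00: "fst (x 0) = p0" and xT: "snd (x T) = G (fst (x T))"
  and xi: "set_integrable lborel {0..T} (%s. field R s (x s))"
  and xe: "!!t. t \<in> {0..T} ==> x t = x 0 + (LINT s:{0..t}|lborel. field R s (x s))"
  by (rule forward_backward_ode[OF less_imp_le[OF T] K(1) field_measurable K(2) \<Phi>b \<Phi>i Gc GB, of p0]) blast+
 have TT: "T \<in> {0..T}" using T by simp
 have uc: "continuous_on {0..T} (%t. snd (x t))" using xc by (intro continuous_intros)
 have pc: "continuous_on {0..T} (%t. fst (x t))" using xc by (intro continuous_intros)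
 have u_le: "norm (snd (x t)) <= R" if t: "t \<in> {0..T}" for t
 proof -
  have "norm (snd (x t)) <= a * exp (Cu * (T - t))"
  proof (rule gronwall_backward[OF _ Cu0 _ t])
   show "continuous_on {0..T} (%t. norm (snd (x t)))" by (rule continuous_on_norm[OF uc])
   fix t assume t: "t \<in> {0..T}"
   have i1: "set_integrable lborel {0..t} (%s. field R s (x s))" and i2: "set_integrable lborel {t<..T} (%s. field R s (x s))"
    by (rule set_integrable_subset[OF xi], use t in auto)+
   have U: "{0..T} = {0..t} Un {t<..T}" using t by auto
   have "(LINT s:{0..T}|lborel. field R s (x s)) = (LINT s:{0..t}|lborel. field R s (x s)) + (LINT s:{t<..T}|lborel. field R s (x s))"
    unfolding U by (rule set_integral_Un[OF _ i1 i2]) auto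
   note split = this
   have aux: "a = c + (d + e) ==> b = c + d ==> b = a - e" for a b c d e :: "(real^'m) \<times> (real^'m)" by simp
   have xx: "x t = x T - (LINT s:{t<..T}|lborel. field R s (x s))"
    by (rule aux[OF xe[OF TT, unfolded split] xe[OF t]])
   have sn: "snd (LINT s:{t<..T}|lborel. field R s (x s)) = (LINT s:{t<..T}|lborel. snd (field R s (x s)))"
    using integral_bounded_linear[OF bounded_linear_snd i2[unfolded set_integrable_def]]
    by (simp add: set_lebesgue_integral_def)
   have si: "set_integrable lborel {t<..T} (%s. snd (field R s (x s)))"
    using integrable_bounded_linear[OF bounded_linear_snd i2[unfolded set_integrable_def]]
    by (simp add: set_integrable_def)
   have wi: "set_integrable lborel {t<..T} (%s. norm (snd (x s)))"
   proof -
    have "set_integrable lborel {0..T} (%s. norm (snd (x s)))"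
     by (rule borel_integrable_atLeastAtMost'[OF continuous_on_norm[OF uc]])
    then show ?thesis by (rule set_integrable_subset) (use t in auto)
   qed
   have fi: "set_integrable lborel {t<..T} \<phi>m" by (rule set_integrable_subset[OF \<phi>mi]) (use t in auto)
   have "norm (LINT s:{t<..T}|lborel. snd (field R s (x s))) <= (LINT s:{t<..T}|lborel. norm (snd (field R s (x s))))"
    by (rule set_integral_norm_bound[OF si])
   also have "... <= (LINT s:{t<..T}|lborel. \<phi>m s + Cu * norm (snd (x s)))"
   proof (rule set_integral_mono[OF set_integrable_norm[OF si]])
    show "set_integrable lborel {t<..T} (%s. \<phi>m s + Cu * norm (snd (x s)))"
     by (intro set_integral_add(1) fi set_integrable_mult_right) (use wi in auto)
    fix s assume "s \<in> {t<..T}"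
    then have s: "s \<in> {0..T}" using t by auto
    have "Cu * norm (to_ball R (snd (x s))) <= Cu * norm (snd (x s))" by (rule mult_left_mono[OF to_ball_norm(2)[OF R0] Cu0])
    then show "norm (snd (field R s (x s))) <= \<phi>m s + Cu * norm (snd (x s))" using snd_bd[OF s, of "x s"] by linarith
   qed
   also have "... = (LINT s:{t<..T}|lborel. \<phi>m s) + Cu * (LINT s:{t<..T}|lborel. norm (snd (x s)))"
    using set_integral_add(2)[OF fi set_integrable_mult_right[of Cu, OF wi]] by simp
   also have "(LINT s:{t<..T}|lborel. \<phi>m s) <= (LINT s:{0..T}|lborel. \<phi>m s)"
    unfolding set_lebesgue_integral_def
    by (rule integral_mono[OF fi[unfolded set_integrable_def] \<phi>mi[unfolded set_integrable_def]])
      (use t \<phi>0 in \<open>auto simp: indicator_def \<phi>m_def\<close>)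
   also have "(LINT s:{t<..T}|lborel. norm (snd (x s))) = (LINT s:{t..T}|lborel. norm (snd (x s)))"
    by (rule set_integral_Icc_Ioc(2)[symmetric]) (use wi in \<open>simp add: set_integral_Icc_Ioc(1)\<close>)
   finally have "norm (LINT s:{t<..T}|lborel. snd (field R s (x s))) <= (LINT s:{0..T}|lborel. \<phi>m s) + Cu * (LINT s:{t..T}|lborel. norm (snd (x s)))"
    by simp
   moreover have "norm (snd (x t)) <= norm (snd (x T)) + norm (LINT s:{t<..T}|lborel. snd (field R s (x s)))"
    unfolding xx sn[symmetric] snd_diff by (rule norm_triangle_ineq4)
   moreover have "norm (snd (x T)) <= Bg" unfolding xT by (rule GB)
   ultimately show "norm (snd (x t)) <= a + Cu * (LINT s:{t..T}|lborel. norm (snd (x s)))" unfolding a_def by linarith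
  qed
  also have "... <= R" unfolding R_def using a0 Cu0 t by (intro mult_left_mono) (auto intro: mult_left_mono)
  finally show ?thesis .
 qed
 have d: "has_density lborel T (%s. h (field R s (x s))) (%t. h (x t))" if "bounded_linear h" for h :: "_ => real"
  by (rule has_density_component[OF that xi xe])
 have T0: "0 <= T" using T by simp
 have fe: "field R s (x s) = (\<chi> i. \<Sum>j\<in>UNIV. to_simplex (fst (x s)) $ j * rate s j i (feedback j s (snd (x s)) (to_simplex (fst (x s)))),
   \<chi> i. - (run s i (feedback i s (snd (x s)) (to_simplex (fst (x s)))) + (\<Sum>j\<in>UNIV. snd (x s) $ j * rate s i j (feedback i s (snd (x s)) (to_simplex (fst (x s)))))))"
  if "s \<in> {0<..T}" for s
  unfolding field_def Let_def using to_ball_self[OF u_le[of s]] that by simp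
 show ?thesis
 proof (rule that[OF pc uc x00])
  show "snd (x T) $ i = g (unit_state i) (to_simplex (fst (x T)))" for i by (simp add: xT G_def)
  fix i
  have b1: "bounded_linear (%y :: (real^'m) \<times> (real^'m). fst y $ i)"
   by (rule bounded_linear_compose[OF bounded_linear_vec_nth bounded_linear_fst])
  have b2: "bounded_linear (%y :: (real^'m) \<times> (real^'m). snd y $ i)"
   by (rule bounded_linear_compose[OF bounded_linear_vec_nth bounded_linear_snd])
  show "has_density lborel T (%s. \<Sum>j\<in>UNIV. to_simplex (fst (x s)) $ j * rate s j i (feedback j s (snd (x s)) (to_simplex (fst (x s))))) (%t. fst (x t) $ i)"
   by (rule has_density_cong[OF d[OF b1] _ _ refl T0]) (simp_all add: fe)
  show "has_density lborel T (%s. - (run s i (feedback i s (snd (x s)) (to_simplex (fst (x s))))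
    + (\<Sum>j\<in>UNIV. snd (x s) $ j * rate s i j (feedback i s (snd (x s)) (to_simplex (fst (x s))))))) (%t. snd (x t) $ i)"
   by (rule has_density_cong[OF d[OF b2] _ _ refl T0]) (simp_all add: fe)
 qed
qed

end

text \<open>A flow of laws \<open>p\<close> and of feedback actions \<open>v\<close> is given; a single player deviates from it.\<close>

locale game_flow = mean_field_game T A q f g ahat Cq C C1 C2 + chain: reference_chain T p0 P
 for T :: real and A :: "(real^'l::finite) set" and q :: "('m::finite, 'l) rate_function"
  and f :: "('m, 'l) running_cost" and g :: "'m terminal_cost"
  and ahat :: "'m => real => real^'m => real^'m => real^'l" and Cq C C1 C2 :: real
  and p0 :: "real^'m" and P :: "(real => real^'m) measure" +
 fixes p :: "real => real^'m" and v :: "real => (real^'l)^'m"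
 assumes p_meas: "p \<in> borel_measurable (restrict_space borel {0..T})"
  and v_meas: "v \<in> borel_measurable (restrict_space borel {0..T})"
  and p_simplex: "!!t. t \<in> {0..T} ==> p t \<in> prob_simplex"
  and v_in: "!!t i. t \<in> {0..T} ==> v t $ i \<in> A"
begin

definition nu :: "real => (real^'l) measure" where "nu t = mixture A (p t) (v t)"

definition lam :: "('m, 'l) control => real => (real => real^'m) => 'm => real" where
 "lam \<beta> s w j = intensity (%s i j. q s i j (\<beta> s w) (p s) (nu s)) w s j"

definition ell :: "('m, 'l) control => real => (real => real^'m) => real" where
 "ell \<beta> s w = (\<Sum>i\<in>UNIV. left_limit w s $ i * run s i (\<beta> s w, (p s, v s)))"

lemma rate_eq: "q s i j a (p s) (nu s) = rate s i j (a, (p s, v s))"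
 by (simp add: rate_def nu_def)

lemma run_eq: "f s (unit_state i) a (p s) (nu s) = run s i (a, (p s, v s))"
 by (simp add: run_def nu_def)

lemma control_in: "\<beta> \<in> controls T A ==> s \<in> {0..T} ==> w \<in> path_space T ==> \<beta> s w \<in> A"
 unfolding controls_def using measurable_space[of "%(t, w). \<beta> t w" "predictable_sigma T" "restrict_space borel A" "(s, w)"] T
 by (auto simp: space_restrict_space)

lemma control_params: "\<beta> \<in> controls T A ==> s \<in> {0..T} ==> w \<in> path_space T ==> (\<beta> s w, (p s, v s)) \<in> params"
 by (intro paramsI control_in p_simplex v_in)

lemma
 fixes \<beta> :: "('m, 'l) control"
 assumes \<beta>: "\<beta> \<in> controls T A"
 shows rate_predictable: "(%(s, w). rate s i j (\<beta> s w, (p s, v s))) \<in> borel_measurable (predictable_sigma T)"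
  and run_predictable: "(%(s, w). run s i (\<beta> s w, (p s, v s))) \<in> borel_measurable (predictable_sigma T)"
proof -
 let ?M = "predictable_sigma T :: (real \<times> (real => real^'m)) measure"
 have id: "(%t. t) \<in> measurable (restrict_space borel {0..T}) (restrict_space borel {0..T})" by simp
 have t: "(%x. fst x) \<in> measurable ?M (restrict_space borel {0..T})"
  using chain.predictable_time[OF id] by (simp add: case_prod_unfold)
 have b: "(%x. \<beta> (fst x) (snd x)) \<in> borel_measurable ?M"
 proof -
  have "(%(t, w). \<beta> t w) \<in> measurable ?M (restrict_space borel A)" using \<beta> by (simp add: controls_def)
  then show ?thesis by (simp add: measurable_restrict_space2_iff case_prod_unfold)
 qed
 have y: "(%x. (\<beta> (fst x) (snd x), (p (fst x), v (fst x)))) \<in> borel_measurable ?M"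
  using chain.predictable_time[OF p_meas] chain.predictable_time[OF v_meas] b
  by (intro borel_measurable_Pair) (simp_all add: case_prod_unfold)
 have yS: "(\<beta> (fst x) (snd x), (p (fst x), v (fst x))) \<in> params" if "x \<in> space ?M" for x
  using that T by (intro control_params[OF \<beta>]) auto
 show "(%(s, w). rate s i j (\<beta> s w, (p s, v s))) \<in> borel_measurable ?M"
  using rate_measurable[OF t y yS] by (simp add: case_prod_unfold)
 show "(%(s, w). run s i (\<beta> s w, (p s, v s))) \<in> borel_measurable ?M"
  using run_measurable[OF t y yS] by (simp add: case_prod_unfold)
qed

lemma lam_eq: "lam \<beta> s w j = (\<Sum>i\<in>UNIV. left_limit w s $ i * rate s i j (\<beta> s w, (p s, v s)))"
 by (simp add: lam_def intensity_def rate_eq)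

lemma lam_axis: "left_limit w s = axis i 1 ==> lam \<beta> s w j = rate s i j (\<beta> s w, (p s, v s))"
 unfolding lam_def by (simp add: intensity_axis rate_eq)

lemma lam_controlled:
 assumes \<beta>: "\<beta> \<in> controls T A"
 shows "controlled_chain T p0 P (lam \<beta>) (max 1 Cq)"
proof
 show "(%(s, w). lam \<beta> s w j) \<in> borel_measurable (predictable_sigma T)" for j
 proof -
  have "(%x. \<Sum>i\<in>UNIV. left_limit (snd x) (fst x) $ i * rate (fst x) i j (\<beta> (fst x) (snd x), (p (fst x), v (fst x)))) \<in> borel_measurable (predictable_sigma T)"
   using rate_predictable[OF \<beta>] chain.Xm_predictable
   by (intro borel_measurable_sum borel_measurable_times) (simp_all add: case_prod_unfold)
  then show ?thesis by (simp add: lam_eq case_prod_unfold)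
 qed
 show "1 <= max 1 Cq" by simp
 fix s and w :: "real => real^'m" and j assume s: "s \<in> {0<..T}" and w: "w \<in> path_space T"
 have s': "s \<in> {0..T}" using s by auto
 obtain i where i: "left_limit w s = axis i 1" using path_left_limit_state[OF w s'] by (rule state_cases)
 show "\<bar>lam \<beta> s w j\<bar> <= max 1 Cq"
  unfolding lam_axis[OF i] using rate_bound[OF s' control_params[OF \<beta> s' w], of i j] by simp
 show "0 < lam \<beta> s w j" if "left_limit w s $ j = 0"
  unfolding lam_axis[OF i]
  by (rule rate_pos[OF s' control_params[OF \<beta> s' w]]) (use that in \<open>auto simp: i axis_nth\<close>)
qed

lemma controlled_measure_eq:
 assumes \<beta>: "\<beta> \<in> controls T A"
 shows "controlled_measure T P q \<beta> p nu = density P (%w. ennreal (controlled_chain.lik T (lam \<beta>) T w))"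
proof -
 interpret X: controlled_chain T p0 P "lam \<beta>" "max 1 Cq" by (rule lam_controlled[OF \<beta>])
 have eta: "(%s j. lam \<beta> s w j) = intensity (%s i j. q s i j (\<beta> s w) (p s) (nu s)) w" for w
  by (simp add: fun_eq_iff lam_def)
 have e: "doleans_dade (L_process q \<beta> p nu w) T = X.lik T w" if w: "w \<in> path_space T" for w
  unfolding X.lik_def eta
 proof (rule doleans_dade_L_process[OF w T])
  show "(%s. indicator {0<..T} s * q s i j (\<beta> s w) (p s) (nu s)) \<in> borel_measurable borel" for i j
   unfolding rate_eq by (rule predictable_section_borel[OF chain.T0 w rate_predictable[OF \<beta>]])
  fix i j s assume "s \<in> {0<..T}"
  then have s: "s \<in> {0..T}" by auto
  note pr = control_params[OF \<beta> s w]
  show "\<bar>q s i j (\<beta> s w) (p s) (nu s)\<bar> <= Cq" unfolding rate_eq by (rule rate_bound[OF s pr])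
  show "(\<Sum>j\<in>UNIV. q s i j (\<beta> s w) (p s) (nu s)) = 0" unfolding rate_eq by (rule rate_sum[OF s pr])
  show "i ~= j ==> 0 < q s i j (\<beta> s w) (p s) (nu s)" unfolding rate_eq by (rule rate_pos[OF s pr])
 qed
 show ?thesis
  unfolding controlled_measure_def
 proof (rule density_cong)
  have m: "(%w. ennreal (X.lik T w)) \<in> borel_measurable P"
   using X.lik_measurable[of T] T by (intro measurable_compose[OF _ measurable_ennreal]) auto
  then show "(%w. ennreal (X.lik T w)) \<in> borel_measurable P" .
  show "(%w. ennreal (doleans_dade (L_process q \<beta> p nu w) T)) \<in> borel_measurable P"
   by (rule measurable_cong[THEN iffD2, OF _ m]) (simp add: e)
  show "AE w in P. ennreal (doleans_dade (L_process q \<beta> p nu w) T) = ennreal (X.lik T w)"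
   by (rule AE_I2) (simp add: e)
 qed
qed

lemma ell_predictable:
 assumes \<beta>: "\<beta> \<in> controls T A" shows "(%(s, w). ell \<beta> s w) \<in> borel_measurable (predictable_sigma T)"
proof -
 have "(%x. \<Sum>i\<in>UNIV. left_limit (snd x) (fst x) $ i * run (fst x) i (\<beta> (fst x) (snd x), (p (fst x), v (fst x)))) \<in> borel_measurable (predictable_sigma T)"
  using run_predictable[OF \<beta>] chain.Xm_predictable
  by (intro borel_measurable_sum borel_measurable_times) (simp_all add: case_prod_unfold)
 then show ?thesis by (simp add: ell_def case_prod_unfold)
qed

lemma ell_axis: "left_limit w s = axis i 1 ==> ell \<beta> s w = run s i (\<beta> s w, (p s, v s))"
 unfolding ell_def by (simp add: axis_nth if_mult_zero)

text \<open>The running cost sees \<open>X\<^sub>t\<close> but the predictable version \<open>ell\<close> sees \<open>X\<^sub>t\<^sub>-\<close>; they differ at jumps and at zero only.\<close>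

lemma running_cost_path:
 assumes w: "w \<in> path_space T"
 shows "(LINT t:{0..T}|lborel. f t (w t) (\<beta> t w) (p t) (nu t)) = (LINT s:{0<..T}|lborel. ell \<beta> s w)"
proof -
 have "(LINT t:{0..T}|lborel. f t (w t) (\<beta> t w) (p t) (nu t)) = (LINT t:{0..T}|lborel. indicator {0<..T} t * ell \<beta> t w)"
 proof (rule set_integral_finite_difference(2)[of "insert 0 (jumps T w)"])
  show "finite (insert 0 (jumps T w))" using finite_jumps[OF w] by simp
  fix s assume s: "s \<in> {0..T}" "s \<notin> insert 0 (jumps T w)"
  then have s': "s \<in> {0<..T}" by auto
  obtain i where i: "left_limit w s = axis i 1" using path_left_limit_state[OF w s(1)] by (rule state_cases)
  have "w s = axis i 1" using s s' i by (auto simp: jumps_def)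
  then show "f s (w s) (\<beta> s w) (p s) (nu s) = indicator {0<..T} s * ell \<beta> s w"
   using s' by (simp add: ell_axis[OF i] run_eq)
 qed
 also have "... = (LINT s:{0<..T}|lborel. ell \<beta> s w)"
  unfolding set_lebesgue_integral_def by (rule bochner_cong[OF refl]) (auto simp: indicator_def)
 finally show ?thesis .
qed

lemma cost_eq:
 assumes \<beta>: "\<beta> \<in> controls T A"
 shows "cost T P q f g \<beta> p nu = (LINT w|P. controlled_chain.lik T (lam \<beta>) T w *
  ((\<Sum>k\<in>UNIV. g (unit_state k) (p T) * w T $ k) + (LINT s:{0<..T}|lborel. ell \<beta> s w)))"
proof -
 interpret X: controlled_chain T p0 P "lam \<beta>" "max 1 Cq" by (rule lam_controlled[OF \<beta>])
 have TT: "T \<in> {0..T}" using T by simp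
 let ?c = "%w. (\<Sum>k\<in>UNIV. g (unit_state k) (p T) * w T $ k) + (LINT s:{0<..T}|lborel. ell \<beta> s w)"
 have e: "(LINT t:{0..T}|lborel. f t (w t) (\<beta> t w) (p t) (nu t)) + g (w T) (p T) = ?c w" if w: "w \<in> path_space T" for w
 proof -
  obtain i where i: "w T = axis i 1" using path_in_state_space[OF w TT] by (rule state_cases)
  show ?thesis unfolding running_cost_path[OF w] by (simp add: i axis_nth if_mult_zero)
 qed
 have "(%w. LINT s:{0<..T}|lborel. ell \<beta> s w) \<in> borel_measurable P"
  by (rule chain.F_measurable[OF predictable_integral_adapted[OF chain.T0 TT ell_predictable[OF \<beta>]] order_refl])
 moreover have "(%w. \<Sum>k\<in>UNIV. g (unit_state k) (p T) * w T $ k) \<in> borel_measurable P"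
  by (rule borel_measurable_sum, rule borel_measurable_times[OF borel_measurable_const chain.X_measurable[OF TT]])
 ultimately have cm: "?c \<in> borel_measurable P" by (rule borel_measurable_add[rotated])
 have "cost T P q f g \<beta> p nu = (LINT w|density P (%w. ennreal (X.lik T w)). ?c w)"
  unfolding cost_def controlled_measure_eq[OF \<beta>]
  by (rule bochner_cong[OF refl]) (simp add: e)
 also have "... = (LINT w|P. X.lik T w *\<^sub>R ?c w)"
  by (rule integral_density[OF cm X.lik_measurable[OF TT]]) (auto intro!: AE_I2 less_imp_le X.lik_pos)
 finally show ?thesis by simp
qed

end

section \<open>The equilibrium\<close>

lemma has_density_lborel_continuous:
 assumes Y: "has_density lborel T \<eta> Y" shows "continuous_on {0..T} Y"
proof -
 have i: "set_integrable lborel {0..T} \<eta>" using has_densityD(1)[OF Y] by (simp only: set_integral_Icc_Ioc(1))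
 have "continuous_on {0..T} (%t. integral {0..t} \<eta>)"
  using set_borel_integral_eq_integral(1)[OF i] by (rule indefinite_integral_continuous_1)
 then have "continuous_on {0..T} (%t. Y 0 + integral {0..t} \<eta>)" by (intro continuous_intros)
 also have "?this \<longleftrightarrow> ?thesis"
 proof (rule continuous_on_cong[OF refl])
  fix t assume t: "t \<in> {0..T}"
  have it: "set_integrable lborel {0..t} \<eta>" by (rule set_integrable_subset[OF i]) (use t in auto)
  have "Y t = Y 0 + (LINT s:{0<..t}|lborel. \<eta> s)" by (rule has_densityD(2)[OF Y t])
  also have "(LINT s:{0<..t}|lborel. \<eta> s) = integral {0..t} \<eta>"
   unfolding set_integral_Icc_Ioc(2)[OF it, symmetric] by (rule set_borel_integral_eq_integral(2)[OF it])
  finally show "Y 0 + integral {0..t} \<eta> = Y t" by simp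
 qed
 finally show ?thesis .
qed

text \<open>Every player uses the feedback action of the current state along a solution \<open>(p, u)\<close> of the coupled
 system. A deviation costs at least as much, because its drift in \<open>cost_identity\<close> is a Hamiltonian minus
 its minimum; for the feedback this drift vanishes.\<close>

lemma (in mean_field_game) equilibrium:
 fixes p0 :: "real^'m" and P :: "(real => real^'m) measure"
 assumes ch: "reference_chain T p0 P" and p0: "p0 \<in> prob_simplex"
 shows "\<exists>\<alpha> p \<nu>.
   \<alpha> \<in> controls T A &
   p \<in> restrict_space borel {0..T} \<rightarrow>\<^sub>M restrict_space borel prob_simplex &
   \<nu> \<in> restrict_space borel {0..T} \<rightarrow>\<^sub>M wasserstein_borel A &
   (\<forall>\<beta>\<in>controls T A. cost T P q f g \<alpha> p \<nu> <= cost T P q f g \<beta> p \<nu>) &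
   (\<forall>t\<in>{0..T}.
     p t = (\<chi> i. measure (controlled_measure T P q \<alpha> p \<nu>)
           {w \<in> path_space T. w t = unit_state i}) &
     \<nu> t = distr (controlled_measure T P q \<alpha> p \<nu>) (restrict_space borel A) (\<alpha> t))"
proof -
 interpret chain: reference_chain T p0 P by (rule ch)
 have TT: "T \<in> {0..T}" using T by simp
 obtain p u :: "real => real^'m" where pc: "continuous_on {0..T} p" and uc: "continuous_on {0..T} u" and p_0: "p 0 = p0"
  and uT: "!!i. u T $ i = g (unit_state i) (to_simplex (p T))"
  and pd: "!!i. has_density lborel T (%s. \<Sum>j\<in>UNIV. to_simplex (p s) $ j * rate s j i (feedback j s (u s) (to_simplex (p s)))) (%t. p t $ i)"
  and ud: "!!i. has_density lborel T (%s. - (run s i (feedback i s (u s) (to_simplex (p s)))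
    + (\<Sum>j\<in>UNIV. u s $ j * rate s i j (feedback i s (u s) (to_simplex (p s)))))) (%t. u t $ i)"
  by (rule exists_solution[of p0]) blast
 define Pt where "Pt t = to_simplex (p t)" for t
 define v where "v t = (\<chi> k. ahat k t (u t) (Pt t))" for t
 have PtS: "Pt t \<in> prob_simplex" for t by (simp add: Pt_def)
 have um: "u \<in> borel_measurable (restrict_space borel {0..T})" by (rule borel_measurable_continuous_on_restrict[OF uc])
 have "continuous_on UNIV (to_simplex :: real^'m => real^'m)"
  by (rule lipschitz_on_continuous_on[of 1], rule lipschitz_onI) (simp_all add: dist_norm to_simplex_lipschitz)
 then have "continuous_on {0..T} Pt" unfolding Pt_def by (rule continuous_on_compose2[OF _ pc]) simp
 then have Pm: "Pt \<in> borel_measurable (restrict_space borel {0..T})" by (rule borel_measurable_continuous_on_restrict)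
 have id: "(%t. t) \<in> measurable (restrict_space borel {0..T}) (restrict_space borel {0..T})" by simp
 have vm: "v \<in> borel_measurable (restrict_space borel {0..T})"
  unfolding v_def by (intro borel_measurable_vec_lambda ahat_path_measurable[OF id um Pm PtS])
 have vA: "v t $ i \<in> A" if "t \<in> {0..T}" for t i unfolding v_def using ahat_in[OF that PtS] by simp
 interpret G: game_flow T A q f g ahat Cq C C1 C2 p0 P Pt v
  by (intro game_flow.intro mean_field_game_axioms ch game_flow_axioms.intro Pm vm PtS vA)
 have fb: "feedback i s (u s) (Pt s) = (v s $ i, (Pt s, v s))" for i s by (simp add: feedback_def v_def)
 note pd' = pd[folded Pt_def, unfolded fb] and ud' = ud[folded Pt_def, unfolded fb]
 define \<alpha> where "\<alpha> t w = (\<Sum>i\<in>UNIV. left_limit w t $ i *\<^sub>R v t $ i)" for t and w :: "real => real^'m"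
 have \<alpha>_axis: "\<alpha> t w = v t $ i" if "left_limit w t = axis i 1" for t i w
  unfolding \<alpha>_def that axis_nth by (simp add: if_distrib[of "%c. c *\<^sub>R _"] cong: if_cong)
 have \<alpha>A: "\<alpha> t w \<in> A" if t: "t \<in> {0..T}" and w: "w \<in> path_space T" for t w
 proof -
  obtain i where i: "left_limit w t = axis i 1" using path_left_limit_state[OF w t] by (rule state_cases)
  show ?thesis unfolding \<alpha>_axis[OF i] by (rule vA[OF t])
 qed
 have nthm: "(%y::(real^'l)^'m. y $ i) \<in> borel_measurable borel" for i
  by (intro borel_measurable_continuous_onI continuous_intros)
 have \<alpha>c: "\<alpha> \<in> controls T A"
  unfolding controls_def
 proof (intro CollectI measurable_restrict_space2)
  show "(%(t, w). \<alpha> t w) \<in> space (predictable_sigma T) \<rightarrow> A" using \<alpha>A chain.T0 by auto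
  have "(%x. v (fst x) $ i) \<in> borel_measurable (predictable_sigma T :: (real \<times> (real => real^'m)) measure)" for i
   using measurable_compose[OF chain.predictable_time[OF vm] nthm, of i] by (simp add: case_prod_unfold)
  then have "(%x. \<Sum>i\<in>UNIV. left_limit (snd x) (fst x) $ i *\<^sub>R v (fst x) $ i) \<in> borel_measurable (predictable_sigma T :: (real \<times> (real => real^'m)) measure)"
   using chain.Xm_predictable by (intro borel_measurable_sum borel_measurable_scaleR) (simp_all add: case_prod_unfold)
  then show "(%(t, w). \<alpha> t w) \<in> borel_measurable (predictable_sigma T)" by (simp add: \<alpha>_def case_prod_unfold)
 qed
 interpret X: controlled_chain T p0 P "G.lam \<alpha>" "max 1 Cq" by (rule G.lam_controlled[OF \<alpha>c])
 (* Both p and the law mu of the controlled chain follow the rates r; the projection in the equation for p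
   is 1-Lipschitz and fixes mu, so Gronwall forces p = mu. *)
 define r where "r s k j = rate s k j (v s $ k, (Pt s, v s))" for s k j
 have prm: "(v s $ k, (Pt s, v s)) \<in> params" if "s \<in> {0..T}" for s k by (intro paramsI vA that PtS)
 define \<mu> where "\<mu> t i = chain.expectation (%w. X.lik T w * w t $ i)" for t i
 have lr: "G.lam \<alpha> s w j = (\<Sum>k\<in>UNIV. left_limit w s $ k * r s k j)" if s: "s \<in> {0<..T}" and w: "w \<in> path_space T" for s w j
 proof -
  have s': "s \<in> {0..T}" using s by auto
  obtain i where i: "left_limit w s = axis i 1" using path_left_limit_state[OF w s'] by (rule state_cases)
  show ?thesis unfolding G.lam_axis[OF i] \<alpha>_axis[OF i] unfolding i by (simp add: r_def axis_nth if_mult_zero)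
 qed
 have r0: "(\<Sum>j\<in>UNIV. r s k j) = 0" if "s \<in> {0<..T}" for s k
  unfolding r_def by (rule rate_sum[OF _ prm]) (use that in auto)
 have kol: "set_integrable lborel {0<..t} (%s. \<Sum>k\<in>UNIV. \<mu> s k * r s k i)"
  "\<mu> t i = p0 $ i + (LINT s:{0<..t}|lborel. \<Sum>k\<in>UNIV. \<mu> s k * r s k i)" if t: "t \<in> {0..T}" for t i
  unfolding \<mu>_def by (rule X.kolmogorov(1)[OF lr r0 t], assumption+) (rule X.kolmogorov(2)[OF lr r0 t], assumption+)
 have \<mu>i: "integrable P (%w. X.lik T w * w t $ i)" if "t \<in> {0..T}" for t i
  by (rule X.marginal(1)[OF that]) (use that in auto)
 have \<mu>S: "(\<chi> i. \<mu> t i) \<in> prob_simplex" if t: "t \<in> {0..T}" for t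
  unfolding prob_simplex_def
 proof (intro CollectI conjI allI)
  fix i
  show "0 <= (\<chi> i. \<mu> t i) $ i"
   unfolding \<mu>_def vec_lambda_beta
  proof (rule Bochner_Integration.integral_nonneg_AE, rule AE_I2)
   fix w assume "w \<in> space P"
   then have w: "w \<in> path_space T" by simp
   show "0 <= X.lik T w * w t $ i" using chain.X_bounds[OF w t, of i] X.lik_pos[OF w, of T] by auto
  qed
  have "(\<Sum>i\<in>UNIV. \<mu> t i) = chain.expectation (%w. \<Sum>i\<in>UNIV. X.lik T w * w t $ i)"
   unfolding \<mu>_def using \<mu>i[OF t] by simp
  also have "... = chain.expectation (X.lik T)"
  proof (rule bochner_cong[OF refl])
   fix w assume "w \<in> space P"
   then have w: "w \<in> path_space T" by simp
   obtain i where i: "w t = axis i 1" using path_in_state_space[OF w t] by (rule state_cases)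
   show "(\<Sum>i\<in>UNIV. X.lik T w * w t $ i) = X.lik T w" unfolding i by (rule X.sum_axis)
  qed
  finally show "(\<Sum>i\<in>UNIV. (\<chi> i. \<mu> t i) $ i) = 1" using X.expectation_lik(2)[OF TT] by simp
 qed
 have \<mu>0: "\<mu> 0 i = p0 $ i" for i using kol(2)[of 0 i] T by (simp add: set_lebesgue_integral_def)
 have \<mu>d: "has_density lborel T (%s. \<Sum>k\<in>UNIV. \<mu> s k * r s k i) (%t. \<mu> t i)" for i
  unfolding has_density_def using kol(1)[OF TT, of i] kol(2)[of _ i] unfolding \<mu>0 by blast
 have \<mu>c: "continuous_on {0..T} (%t. \<chi> i. \<mu> t i)"
  by (rule continuous_on_vec_lambda) (rule has_density_lborel_continuous[OF \<mu>d])
 define wt where "wt t = norm (p t - (\<chi> i. \<mu> t i))" for t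
 have wc: "continuous_on {0..T} wt" unfolding wt_def by (intro continuous_intros pc \<mu>c)
 let ?m = "real CARD('m)"
 have wz: "wt t <= 0 * exp (?m * ?m * Cq * t)" if t: "t \<in> {0..T}" for t
 proof (rule gronwall[OF wc _ _ t])
  show "0 <= ?m * ?m * Cq" using constants by simp
  fix t assume t: "t \<in> {0..T}"
  have wi: "set_integrable lborel {0..t} wt"
   by (rule set_integrable_subset[OF borel_integrable_atLeastAtMost'[OF wc]]) (use t in auto)
  have wi': "set_integrable lborel {0<..t} (%s. ?m * Cq * wt s)"
   by (rule set_integrable_mult_right) (use wi in \<open>simp add: set_integral_Icc_Ioc(1)\<close>)
  have comp: "\<bar>(p t - (\<chi> i. \<mu> t i)) $ i\<bar> <= ?m * Cq * (LINT s:{0..t}|lborel. wt s)" for i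
  proof -
   have i1: "set_integrable lborel {0<..t} (%s. \<Sum>j\<in>UNIV. Pt s $ j * rate s j i (v s $ j, (Pt s, v s)))"
    by (rule set_integrable_subset[OF has_densityD(1)[OF pd']]) (use t in auto)
   have i2: "set_integrable lborel {0<..t} (%s. \<Sum>k\<in>UNIV. \<mu> s k * r s k i)" by (rule kol(1)[OF t])
   have i3: "set_integrable lborel {0<..t} (%s. (\<Sum>j\<in>UNIV. Pt s $ j * rate s j i (v s $ j, (Pt s, v s))) - (\<Sum>k\<in>UNIV. \<mu> s k * r s k i))"
    by (rule set_integral_diff(1)[OF i1 i2])
   have "(p t - (\<chi> i. \<mu> t i)) $ i = (LINT s:{0<..t}|lborel. (\<Sum>j\<in>UNIV. Pt s $ j * rate s j i (v s $ j, (Pt s, v s))) - (\<Sum>k\<in>UNIV. \<mu> s k * r s k i))"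
    unfolding set_integral_diff(2)[OF i1 i2] using has_densityD(2)[OF pd' t, of i] kol(2)[OF t, of i] p_0 by simp
   then have "\<bar>(p t - (\<chi> i. \<mu> t i)) $ i\<bar> <= (LINT s:{0<..t}|lborel. norm ((\<Sum>j\<in>UNIV. Pt s $ j * rate s j i (v s $ j, (Pt s, v s))) - (\<Sum>k\<in>UNIV. \<mu> s k * r s k i)))"
    using set_integral_norm_bound[OF i3] by simp
   also have "... <= (LINT s:{0<..t}|lborel. ?m * Cq * wt s)"
   proof (rule set_integral_mono[OF set_integrable_norm[OF i3] wi'])
    fix s assume "s \<in> {0<..t}"
    then have s: "s \<in> {0..T}" using t by auto
    have "(\<Sum>j\<in>UNIV. Pt s $ j * rate s j i (v s $ j, (Pt s, v s))) - (\<Sum>k\<in>UNIV. \<mu> s k * r s k i) = (\<Sum>j\<in>UNIV. (Pt s - (\<chi> i. \<mu> s i)) $ j * r s j i)"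
     by (simp add: r_def sum_subtractf left_diff_distrib)
    also have "norm ... <= (\<Sum>j\<in>(UNIV :: 'm set). wt s * Cq)"
    proof (unfold real_norm_def, rule order_trans[OF sum_abs sum_mono])
     fix j
     have "\<bar>(Pt s - (\<chi> i. \<mu> s i)) $ j\<bar> <= norm (to_simplex (p s) - to_simplex (\<chi> i. \<mu> s i))"
      unfolding to_simplex_self[OF \<mu>S[OF s]] Pt_def by (rule component_le_norm_cart)
     also have "... <= wt s" unfolding wt_def by (rule to_simplex_lipschitz)
     finally show "\<bar>(Pt s - (\<chi> i. \<mu> s i)) $ j * r s j i\<bar> <= wt s * Cq"
      unfolding abs_mult r_def by (intro mult_mono rate_bound[OF s prm[OF s]]) (auto simp: wt_def)
    qed
    finally show "norm ((\<Sum>j\<in>UNIV. Pt s $ j * rate s j i (v s $ j, (Pt s, v s))) - (\<Sum>k\<in>UNIV. \<mu> s k * r s k i)) <= ?m * Cq * wt s"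
     by (simp add: mult.commute mult.left_commute)
   qed
   also have "... = ?m * Cq * (LINT s:{0..t}|lborel. wt s)"
    unfolding set_integral_Icc_Ioc(2)[OF wi] by (rule set_integral_mult_right)
   finally show ?thesis .
  qed
  have "wt t <= (\<Sum>i\<in>UNIV. \<bar>(p t - (\<chi> i. \<mu> t i)) $ i\<bar>)" unfolding wt_def by (rule norm_le_l1_cart)
  also have "... <= (\<Sum>i\<in>(UNIV :: 'm set). ?m * Cq * (LINT s:{0..t}|lborel. wt s))" by (rule sum_mono) (rule comp)
  finally show "wt t <= 0 + ?m * ?m * Cq * (LINT s:{0..t}|lborel. wt s)" by (simp add: mult.assoc)
 qed
 have p\<mu>: "p t = (\<chi> i. \<mu> t i)" if "t \<in> {0..T}" for t using wz[OF that] by (simp add: wt_def)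
 have P\<mu>: "Pt t = (\<chi> i. \<mu> t i)" if t: "t \<in> {0..T}" for t
  unfolding Pt_def p\<mu>[OF t] by (rule to_simplex_self[OF \<mu>S[OF t]])
 (* The rows of the rates sum to zero, so up to a term without the action the Hamiltonian is linear in z. *)
 have ham: "hamiltonian q f i s z a (Pt s) (G.nu s)
   = run s i (a, (Pt s, v s)) + (\<Sum>j\<in>UNIV. z $ j * rate s i j (a, (Pt s, v s))) - (\<Sum>j\<in>UNIV - {i}. z $ j - z $ i)"
  if a: "a \<in> A" and s: "s \<in> {0..T}" for i s z a
 proof -
  have pr: "(a, (Pt s, v s)) \<in> params" by (intro paramsI a PtS vA s)
  have "(\<Sum>j\<in>UNIV - {i}. (z $ j - z $ i) * (rate s i j (a, (Pt s, v s)) - 1))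
   = (\<Sum>j\<in>UNIV - {i}. (z $ j - z $ i) * rate s i j (a, (Pt s, v s))) - (\<Sum>j\<in>UNIV - {i}. z $ j - z $ i)"
   by (simp add: right_diff_distrib sum_subtractf)
  also have "(\<Sum>j\<in>UNIV - {i}. (z $ j - z $ i) * rate s i j (a, (Pt s, v s))) = (\<Sum>j\<in>UNIV. (z $ j - z $ i) * rate s i j (a, (Pt s, v s)))"
   by (rule sum.mono_neutral_left) auto
  also have "... = (\<Sum>j\<in>UNIV. z $ j * rate s i j (a, (Pt s, v s))) - z $ i * (\<Sum>j\<in>UNIV. rate s i j (a, (Pt s, v s)))"
   by (simp add: left_diff_distrib sum_subtractf sum_distrib_left)
  finally show ?thesis unfolding hamiltonian_def G.rate_eq G.run_eq rate_sum[OF s pr] by simp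
 qed
 obtain \<phi> where \<phi>: "set_integrable lborel {0..T} \<phi>" "!!t i x. t \<in> {0..T} ==> x \<in> params ==> \<bar>run t i x\<bar> <= \<phi> t"
  by (rule run_bound) blast
 have \<phi>': "set_integrable lborel {0<..T} \<phi>" using \<phi>(1) by (simp only: set_integral_Icc_Ioc(1))
 let ?c0 = "\<Sum>k\<in>UNIV. u 0 $ k * p0 $ k"
 have opt: "?c0 <= cost T P q f g \<beta> Pt G.nu"
  and eq: "(!!s w. s \<in> {0<..T} ==> w \<in> path_space T ==> \<beta> s w = \<alpha> s w) ==> cost T P q f g \<beta> Pt G.nu = ?c0"
  if \<beta>: "\<beta> \<in> controls T A" for \<beta>
 proof -
  interpret Y: controlled_chain T p0 P "G.lam \<beta>" "max 1 Cq" by (rule G.lam_controlled[OF \<beta>])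
  let ?u' = "%i s. - (run s i (v s $ i, (Pt s, v s)) + (\<Sum>j\<in>UNIV. u s $ j * rate s i j (v s $ i, (Pt s, v s))))"
  define k where "k s w = Y.lik_left s w * (((\<Sum>k\<in>UNIV. ?u' k s * w s $ k) + G.ell \<beta> s w) + Y.gen (%s w j. u s $ j) s w)" for s w
  have lb: "\<bar>G.ell \<beta> s w\<bar> <= \<phi> s" if s: "s \<in> {0<..T}" and w: "w \<in> path_space T" for s w
  proof -
   have s': "s \<in> {0..T}" using s by auto
   obtain i where i: "left_limit w s = axis i 1" using path_left_limit_state[OF w s'] by (rule state_cases)
   show ?thesis unfolding G.ell_axis[OF i] by (rule \<phi>(2)[OF s' G.control_params[OF \<beta> s' w]])
  qed
  have kv: "k s w = Y.lik_left s w * (hamiltonian q f i s (u s) (\<beta> s w) (Pt s) (G.nu s) - hamiltonian q f i s (u s) (v s $ i) (Pt s) (G.nu s))"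
   if s: "s \<in> {0<..T}" and w: "w \<in> path_space T" and nj: "s \<notin> jumps T w" and i: "left_limit w s = axis i 1" for s w i
  proof -
   have s': "s \<in> {0..T}" using s by auto
   have ws: "w s = axis i 1" using s nj i by (auto simp: jumps_def)
   let ?y = "(\<beta> s w, (Pt s, v s))"
   have "Y.gen (%s w j. u s $ j) s w = (\<Sum>j\<in>UNIV. u s $ j * rate s i j ?y - u s $ i * rate s i j ?y)"
    unfolding Y.gen_def i Y.sum_axis G.lam_axis[OF i] by (intro sum.cong refl) (auto simp: axis_nth algebra_simps)
   also have "... = (\<Sum>j\<in>UNIV. u s $ j * rate s i j ?y)"
    using rate_sum[OF s' G.control_params[OF \<beta> s' w], of i] by (simp add: sum_subtractf sum_distrib_left[symmetric])
   finally have gen: "Y.gen (%s w j. u s $ j) s w = (\<Sum>j\<in>UNIV. u s $ j * rate s i j ?y)" .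
   show ?thesis
    unfolding k_def ws Y.sum_axis gen G.ell_axis[OF i] ham[OF G.control_in[OF \<beta> s' w] s'] ham[OF vA[OF s'] s'] by simp
  qed
  have c: "cost T P q f g \<beta> Pt G.nu = ?c0 + chain.expectation (%w. LINT s:{0<..T}|lborel. k s w)"
   unfolding G.cost_eq[OF \<beta>] k_def
   using Y.cost_identity[where u="%k t. u t $ k", OF ud' G.ell_predictable[OF \<beta>] lb \<phi>'] uT by (simp add: Pt_def)
  have kp: "0 <= (LINT s:{0<..T}|lborel. k s w)" if w: "w \<in> path_space T" for w
  proof -
   have "(LINT s:{0<..T}|lborel. k s w) = (LINT s:{0<..T}|lborel. (if s \<in> jumps T w then 0 else k s w))"
    by (rule set_integral_finite_difference(2)[OF finite_jumps[OF w]]) simp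
   also have "0 <= ..."
    unfolding set_lebesgue_integral_def
   proof (rule bochner_nonneg)
    fix s
    show "0 <= indicator {0<..T} s *\<^sub>R (if s \<in> jumps T w then 0 else k s w)"
    proof (cases "s \<in> {0<..T} & s \<notin> jumps T w")
     case True
     then have s: "s \<in> {0<..T}" "s \<in> {0..T}" by auto
     obtain i where i: "left_limit w s = axis i 1" using path_left_limit_state[OF w s(2)] by (rule state_cases)
     have nuP: "G.nu s \<in> prob_measures A" unfolding G.nu_def by (rule mixture_prob[OF PtS vA[OF s(2)]])
     have vi: "v s $ i = ahat i s (u s) (Pt s)" by (simp add: v_def)
     have "hamiltonian q f i s (u s) (v s $ i) (Pt s) (G.nu s) <= hamiltonian q f i s (u s) (\<beta> s w) (Pt s) (G.nu s)"
      using ahat_min[OF s(2) PtS nuP, of i "u s"] G.control_in[OF \<beta> s(2) w] unfolding is_arg_min_def vi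
      by (meson not_le)
     then have "0 <= k s w" using kv[OF s(1) w _ i] True Y.lik_left_nonneg[OF w s(1)] by simp
     then show ?thesis using True by simp
    qed auto
   qed
   finally show ?thesis .
  qed
  show "?c0 <= cost T P q f g \<beta> Pt G.nu"
  proof -
   have "0 <= chain.expectation (%w. LINT s:{0<..T}|lborel. k s w)"
    by (rule Bochner_Integration.integral_nonneg_AE, rule AE_I2) (simp add: kp)
   then show ?thesis unfolding c by simp
  qed
  assume \<beta>\<alpha>: "!!s w. s \<in> {0<..T} ==> w \<in> path_space T ==> \<beta> s w = \<alpha> s w"
  have "(LINT s:{0<..T}|lborel. k s w) = 0" if w: "w \<in> path_space T" for w
  proof -
   have "(LINT s:{0<..T}|lborel. k s w) = (LINT s:{0<..T}|lborel. indicator (jumps T w) s * k s w)"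
    unfolding set_lebesgue_integral_def
   proof (rule bochner_cong[OF refl])
    fix s :: real
    show "indicator {0<..T} s *\<^sub>R k s w = indicator {0<..T} s *\<^sub>R (indicator (jumps T w) s * k s w)"
    proof (cases "s \<in> {0<..T} & s \<notin> jumps T w")
     case True
     then have s: "s \<in> {0<..T}" "s \<in> {0..T}" by auto
     obtain i where i: "left_limit w s = axis i 1" using path_left_limit_state[OF w s(2)] by (rule state_cases)
     have "k s w = 0" using kv[OF s(1) w _ i] True \<beta>\<alpha>[OF s(1) w] \<alpha>_axis[OF i] by simp
     then show ?thesis by simp
    qed (auto simp: indicator_def)
   qed
   also have "... = (LINT s:{0<..T}|lborel. 0)"
    by (rule set_integral_finite_difference(2)[OF finite_jumps[OF w]]) simp
   finally show ?thesis by (simp add: set_lebesgue_integral_def)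
  qed
  then have "chain.expectation (%w. LINT s:{0<..T}|lborel. k s w) = chain.expectation (%w. 0)"
   by (intro bochner_cong) auto
  then show "cost T P q f g \<beta> Pt G.nu = ?c0" unfolding c by simp
 qed
 let ?Q = "controlled_measure T P q \<alpha> Pt G.nu"
 have likm: "X.lik T \<in> borel_measurable P" by (rule X.lik_measurable[OF TT])
 have ens: "ennreal (max 0 x) = ennreal x" for x by (cases "0 <= x") (auto simp: ennreal_neg)
 have Q: "?Q = density P (%w. ennreal (max 0 (X.lik T w)))" unfolding ens by (rule G.controlled_measure_eq[OF \<alpha>c])
 have liki: "integrable P (%w. max 0 (X.lik T w))" using X.expectation_lik(1)[OF TT] by simp
 have emQ: "emeasure ?Q S = ennreal (chain.expectation (%w. indicator S w * X.lik T w))" if S: "S \<in> sets P" for S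
 proof -
  have "emeasure ?Q S = ennreal (LINT w:S|P. max 0 (X.lik T w))" unfolding Q by (rule measure_density_real[OF liki _ S]) simp
  also have "(LINT w:S|P. max 0 (X.lik T w)) = chain.expectation (%w. indicator S w * X.lik T w)"
   unfolding set_lebesgue_integral_def
   by (rule bochner_cong[OF refl]) (use X.lik_pos[of _ T] in \<open>simp add: less_imp_le\<close>)
  finally show ?thesis .
 qed
 have law_X: "measure ?Q {w \<in> path_space T. w t = unit_state i} = \<mu> t i" if t: "t \<in> {0..T}" for t i
 proof -
  have st: "w t = unit_state i \<longleftrightarrow> w t $ i = 1" if w: "w \<in> path_space T" for w i
  proof -
   obtain k where k: "w t = axis k 1" using path_in_state_space[OF w t] by (rule state_cases)
   show ?thesis by (auto simp: k axis_nth axis_eq_axis)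
  qed
  have S: "{w \<in> path_space T. w t = unit_state i} = (%w. w t $ i) -` {1} Int space P" using st by auto
  have Sm: "{w \<in> path_space T. w t = unit_state i} \<in> sets P"
   unfolding S by (rule measurable_sets[OF chain.X_measurable[OF t]]) simp
  have "chain.expectation (%w. indicator {w \<in> path_space T. w t = unit_state i} w * X.lik T w) = \<mu> t i"
   unfolding \<mu>_def
  proof (rule bochner_cong[OF refl])
   fix w assume "w \<in> space P"
   then have w: "w \<in> path_space T" by simp
   show "indicator {w \<in> path_space T. w t = unit_state i} w * X.lik T w = X.lik T w * w t $ i"
    using chain.X_bounds[OF w t, of i] st[OF w, of i] w by (auto simp: indicator_def)
  qed
  moreover have "0 <= \<mu> t i" using \<mu>S[OF t] by (simp add: prob_simplex_def)
  ultimately show ?thesis unfolding measure_def emQ[OF Sm] by simp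
 qed
 have law_\<alpha>: "G.nu t = distr ?Q (restrict_space borel A) (\<alpha> t)" if t: "t \<in> {0..T}" for t
 proof (rule measure_eqI)
  show "sets (G.nu t) = sets (distr ?Q (restrict_space borel A) (\<alpha> t))" by (simp add: G.nu_def mixture_def)
  fix S assume "S \<in> sets (G.nu t)"
  then have S: "S \<in> sets (restrict_space borel A)" by (simp add: G.nu_def mixture_def)
  have lm: "(%w. left_limit w t $ i) \<in> borel_measurable P" for i
  proof (cases "t = 0")
   case True then show ?thesis using chain.X_measurable[OF t] by simp
  next
   case False then show ?thesis using t by (intro chain.predictable_at[OF chain.Xm_predictable]) auto
  qed
  have am: "\<alpha> t \<in> measurable P (restrict_space borel A)"
  proof (rule measurable_restrict_space2)
   show "\<alpha> t \<in> space P \<rightarrow> A" using \<alpha>A[OF t] by auto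
   show "\<alpha> t \<in> borel_measurable P" unfolding \<alpha>_def[abs_def] by (intro borel_measurable_sum borel_measurable_scaleR lm) simp
  qed
  then have amQ: "\<alpha> t \<in> measurable ?Q (restrict_space borel A)" by (simp add: controlled_measure_def)
  have "emeasure (distr ?Q (restrict_space borel A) (\<alpha> t)) S = emeasure ?Q (\<alpha> t -` S Int space P)"
   using emeasure_distr[OF amQ S] by (simp add: controlled_measure_def)
  also have "... = ennreal (chain.expectation (%w. indicator (\<alpha> t -` S Int space P) w * X.lik T w))"
   by (rule emQ[OF measurable_sets[OF am S]])
  also have "chain.expectation (%w. indicator (\<alpha> t -` S Int space P) w * X.lik T w)
    = chain.expectation (%w. \<Sum>i\<in>UNIV. (X.lik T w * w t $ i) * indicator S (v t $ i))"
  proof (rule integral_cong_AE)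
   show "(%w. indicator (\<alpha> t -` S Int space P) w * X.lik T w) \<in> borel_measurable P"
    by (intro borel_measurable_times borel_measurable_indicator measurable_sets[OF am S] likm)
   show "(%w. \<Sum>i\<in>UNIV. (X.lik T w * w t $ i) * indicator S (v t $ i)) \<in> borel_measurable P"
    by (intro borel_measurable_sum borel_measurable_times likm chain.X_measurable[OF t] borel_measurable_const)
   show "AE w in P. indicator (\<alpha> t -` S Int space P) w * X.lik T w = (\<Sum>i\<in>UNIV. (X.lik T w * w t $ i) * indicator S (v t $ i))"
    using chain.AE_left_limit[OF t] AE_space
   proof eventually_elim
    fix w assume l: "left_limit w t = w t" and sp: "w \<in> space P"
    then have w: "w \<in> path_space T" by simp
    obtain i where i: "left_limit w t = axis i 1" using path_left_limit_state[OF w t] by (rule state_cases)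
    show "indicator (\<alpha> t -` S Int space P) w * X.lik T w = (\<Sum>i\<in>UNIV. (X.lik T w * w t $ i) * indicator S (v t $ i))"
     unfolding l[symmetric] i using sp by (simp add: axis_nth if_mult_zero \<alpha>_axis[OF i] indicator_def)
   qed
  qed
  also have "... = (\<Sum>i\<in>UNIV. Pt t $ i * indicator S (v t $ i))"
   using \<mu>i[OF t] by (simp add: P\<mu>[OF t] \<mu>_def)
  also have "ennreal ... = emeasure (G.nu t) S"
   unfolding G.nu_def by (rule emeasure_mixture[OF vA[OF t] prob_simplexD(1)[OF PtS] S, symmetric])
  finally show "emeasure (G.nu t) S = emeasure (distr ?Q (restrict_space borel A) (\<alpha> t)) S" by simp
 qed
 show ?thesis
 proof (intro exI conjI ballI)
  show "\<alpha> \<in> controls T A" by (rule \<alpha>c)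
  show "Pt \<in> restrict_space borel {0..T} \<rightarrow>\<^sub>M restrict_space borel prob_simplex"
   using Pm PtS by (intro measurable_restrict_space2) auto
  have "(%t. mixture A (fst (Pt t, v t)) (snd (Pt t, v t))) \<in> measurable (restrict_space borel {0..T}) (wasserstein_borel A)"
  proof (rule mixture_measurable[OF borel_measurable_Pair[OF Pm vm] _ compact_imp_bounded[OF A(1)]])
   fix t assume "t \<in> space (restrict_space borel {0..T})"
   then have "t \<in> {0..T}" by (simp add: space_restrict_space)
   then show "(Pt t, v t) \<in> mixture_params A" using PtS vA by (auto simp: mixture_params_def)
  qed
  then show "G.nu \<in> restrict_space borel {0..T} \<rightarrow>\<^sub>M wasserstein_borel A" by (simp add: G.nu_def[abs_def])
  show "cost T P q f g \<alpha> Pt G.nu <= cost T P q f g \<beta> Pt G.nu" if "\<beta> \<in> controls T A" for \<beta>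
   using eq[OF \<alpha>c refl] opt[OF that] by simp
  show "Pt t = (\<chi> i. measure ?Q {w \<in> path_space T. w t = unit_state i})" if "t \<in> {0..T}" for t
   by (simp add: law_X[OF that] P\<mu>[OF that])
  show "G.nu t = distr ?Q (restrict_space borel A) (\<alpha> t)" if "t \<in> {0..T}" for t by (rule law_\<alpha>[OF that])
 qed
qed

theorem theorem4p1:
  fixes T :: real
    and A :: "(real^'l::finite) set"
    and p0 :: "real^'m::finite"
    and P :: "(real \<Rightarrow> real^'m) measure"
    and q :: "('m, 'l) rate_function"
    and f :: "('m, 'l) running_cost"
    and g :: "'m terminal_cost"
  assumes "0 < T"
    and "compact A" and "A \<noteq> {}"
    and "p0 \<in> prob_simplex"
    and "reference_measure T p0 P"
    and "well_posed_data T A q f"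
    and "assumption_A T A q"
    and "assumption_B T A f g"
    and "assumption_C T A q f"
  shows "\<exists>\<alpha> p \<nu>.
      \<alpha> \<in> controls T A \<and>
      p \<in> restrict_space borel {0..T} \<rightarrow>\<^sub>M restrict_space borel prob_simplex \<and>
      \<nu> \<in> restrict_space borel {0..T} \<rightarrow>\<^sub>M wasserstein_borel A \<and>
      (\<forall>\<beta>\<in>controls T A. cost T P q f g \<alpha> p \<nu> \<le> cost T P q f g \<beta> p \<nu>) \<and>
      (\<forall>t\<in>{0..T}.
         p t = (\<chi> i. measure (controlled_measure T P q \<alpha> p \<nu>)
                      {\<omega> \<in> path_space T. \<omega> t = unit_state i}) \<and>
         \<nu> t = distr (controlled_measure T P q \<alpha> p \<nu>) (restrict_space borel A) (\<alpha> t))"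
proof -
 note A = assms(7)[unfolded assumption_A_def]
 have qs: "(\<Sum>j\<in>UNIV. q t i j a p \<nu>) = 0"
  if "t \<in> {0..T}" "a \<in> A" "p \<in> prob_simplex" "\<nu> \<in> prob_measures A" for t i a p \<nu>
  using A[THEN conjunct1, rule_format, OF that] by blast
 from A[THEN conjunct2, THEN conjunct1] obtain Clow Cup where Cb: "0 < Clow" "0 < Cup"
  and qb: "\<forall>t\<in>{0..T}. \<forall>a\<in>A. \<forall>p\<in>prob_simplex. \<forall>\<nu>\<in>prob_measures A. \<forall>i j.
    i ~= j \<longrightarrow> Clow < q t i j a p \<nu> & q t i j a p \<nu> < Cup"
  by (elim exE conjE) (rule that)
 from A[THEN conjunct2, THEN conjunct2] obtain Cq where Cq0: "0 < Cq"
  and ql: "\<forall>t\<in>{0..T}. \<forall>i j. \<forall>a\<in>A. \<forall>a'\<in>A. \<forall>p\<in>prob_simplex. \<forall>p'\<in>prob_simplex.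
    \<forall>\<nu>\<in>prob_measures A. \<forall>\<nu>'\<in>prob_measures A.
    \<bar>q t i j a p \<nu> - q t i j a' p' \<nu>'\<bar>
     <= Cq * (norm (a - a') + norm (p - p') + wasserstein1 A \<nu> \<nu>')"
  by (elim exE conjE) (rule that)
 note Clow = Cb Cq0
 from assms(8)[unfolded assumption_B_def] obtain Cf where Cf: "0 < Cf"
  and fl: "\<forall>t\<in>{0..T}. \<forall>i. \<forall>a\<in>A. \<forall>a'\<in>A. \<forall>p\<in>prob_simplex. \<forall>p'\<in>prob_simplex.
     \<forall>\<nu>\<in>prob_measures A. \<forall>\<nu>'\<in>prob_measures A.
     \<bar>f t (unit_state i) a p \<nu> - f t (unit_state i) a' p' \<nu>'\<bar>
      <= Cf * (norm (a - a') + norm (p - p') + wasserstein1 A \<nu> \<nu>')"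
  and gl: "\<forall>i. \<forall>p\<in>prob_simplex. \<forall>p'\<in>prob_simplex.
     \<bar>g (unit_state i) p - g (unit_state i) p'\<bar> <= Cf * norm (p - p')"
  by (elim exE conjE) (rule that)
 from assms(9)[unfolded assumption_C_def] obtain ahat :: "'m => real => real^'m => real^'m => real^'l" and C1 C2 where
  am: "\<forall>t\<in>{0..T}. \<forall>i z. \<forall>p\<in>prob_simplex. \<forall>\<nu>\<in>prob_measures A. \<forall>a.
     is_arg_min (%b. hamiltonian q f i t z b p \<nu>) (%b. b \<in> A) a \<longleftrightarrow> a = ahat i t z p"
  and ab: "\<forall>i. (%(t, z, p). ahat i t z p)
       \<in> borel_measurable (restrict_space borel ({0..T} \<times> UNIV \<times> prob_simplex))"
  and C12: "0 < C1" "0 <= C2"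
  and al: "\<forall>t\<in>{0..T}. \<forall>i z z'. \<forall>p\<in>prob_simplex. \<forall>p'\<in>prob_simplex.
     norm (ahat i t z p - ahat i t z' p')
      <= C1 * state_seminorm i (z - z') + (C1 + C2 * state_seminorm i z) * norm (p - p')"
  by (elim exE conjE) (rule that)
 have up: "c * x <= max Cq Cf * x" if "0 <= x" "c <= max Cq Cf" for c x :: real using that by (intro mult_right_mono) auto
 have w0: "0 <= norm (a - a') + norm (p - p') + wasserstein1 A \<nu> \<nu>'"
  if "Cq * (norm (a - a') + norm (p - p') + wasserstein1 A \<nu> \<nu>') \<ge> 0" for a a' :: "real^'l" and p p' :: "real^'m" and \<nu> \<nu>'
  using that Clow(3) by (simp add: zero_le_mult_iff)
 interpret mean_field_game T A q f g ahat "real CARD('m) * Cup" "max Cq Cf" C1 C2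
 proof
  show "0 < T" "compact A" "A ~= {}" using assms by auto
  show "0 < real CARD('m) * Cup" "0 < max Cq Cf" "0 < C1" "0 <= C2" using Clow Cf C12 by auto
  show "is_arg_min (%b. hamiltonian q f i t z b p \<nu>) (%b. b \<in> A) (ahat i t z p)"
   if "t \<in> {0..T}" "p \<in> prob_simplex" "\<nu> \<in> prob_measures A" for t i z p \<nu> using am[rule_format, OF that] by simp
  show "(%(t, z, p). ahat i t z p) \<in> borel_measurable (restrict_space borel ({0..T} \<times> UNIV \<times> prob_simplex))" for i using ab by (rule spec)
  show "norm (ahat i t z p - ahat i t z' p') <= C1 * state_seminorm i (z - z') + (C1 + C2 * state_seminorm i z) * norm (p - p')"
   if "t \<in> {0..T}" "p \<in> prob_simplex" "p' \<in> prob_simplex" for t i z z' p p' by (rule al[rule_format, OF that])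
  show "\<bar>g (unit_state i) p - g (unit_state i) p'\<bar> <= max Cq Cf * norm (p - p')"
   if "p \<in> prob_simplex" "p' \<in> prob_simplex" for i p p' by (rule order_trans[OF gl[rule_format, OF that] up]) auto
  fix t i j a and p :: "real^'m" and \<nu> assume a: "a \<in> A" "p \<in> prob_simplex" "\<nu> \<in> prob_measures A"
  show "(%t. q t i j a p \<nu>) \<in> borel_measurable (restrict_space borel {0..T})"
   "set_integrable lborel {0..T} (%t. f t (unit_state i) a p \<nu>)"
   using assms(6) a unfolding well_posed_data_def by blast+
  assume t: "t \<in> {0..T}"
  show sum0: "(\<Sum>j\<in>UNIV. q t i j a p \<nu>) = 0" by (rule qs[OF t a])
  show "0 < q t i j a p \<nu>" if "i ~= j" using qb[rule_format, OF t a that] Clow by linarith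
  show "\<bar>q t i j a p \<nu>\<bar> <= real CARD('m) * Cup"
  proof (cases "i = j")
   case False
   then have "\<bar>q t i j a p \<nu>\<bar> <= 1 * Cup" using qb[rule_format, OF t a False] Clow by simp
   also have "... <= real CARD('m) * Cup" using Clow by (intro mult_right_mono) (auto simp: Suc_le_eq)
   finally show ?thesis .
  next
   case True
   have "q t i i a p \<nu> = - (\<Sum>j\<in>UNIV - {i}. q t i j a p \<nu>)" using sum0 by (simp add: sum.remove[of UNIV i])
   then have "\<bar>q t i i a p \<nu>\<bar> <= (\<Sum>j\<in>UNIV - {i}. \<bar>q t i j a p \<nu>\<bar>)" by (simp add: sum_abs)
   also have "... <= (\<Sum>j\<in>UNIV - {i}. Cup)"
   proof (rule sum_mono)
    fix j assume "j \<in> UNIV - {i}"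
    then have "i ~= j" by auto
    from qb[rule_format, OF t a this] show "\<bar>q t i j a p \<nu>\<bar> <= Cup" using Clow by linarith
   qed
   also have "... <= (\<Sum>j\<in>(UNIV :: 'm set). Cup)" using Clow by (intro sum_mono2) auto
   finally show ?thesis using True by simp
  qed
  fix a' and p' :: "real^'m" and \<nu>' assume a': "a' \<in> A" "p' \<in> prob_simplex" "\<nu>' \<in> prob_measures A"
  note l1 = ql[rule_format, OF t a(1) a'(1) a(2) a'(2) a(3) a'(3)] and l2 = fl[rule_format, OF t a(1) a'(1) a(2) a'(2) a(3) a'(3)]
  have nn: "0 <= norm (a - a') + norm (p - p') + wasserstein1 A \<nu> \<nu>'" by (rule w0[OF order_trans[OF abs_ge_zero l1]])
  show "\<bar>q t i j a p \<nu> - q t i j a' p' \<nu>'\<bar> <= max Cq Cf * (norm (a - a') + norm (p - p') + wasserstein1 A \<nu> \<nu>')"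
   by (rule order_trans[OF l1 up[OF nn]]) simp
  show "\<bar>f t (unit_state i) a p \<nu> - f t (unit_state i) a' p' \<nu>'\<bar> <= max Cq Cf * (norm (a - a') + norm (p - p') + wasserstein1 A \<nu> \<nu>')"
   by (rule order_trans[OF l2 up[OF nn]]) simp
 qed
 show ?thesis
 proof (rule equilibrium[OF _ assms(4)])
  show "reference_chain T p0 P" using assms(1,5) by unfold_locales
 qed
qed

end
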